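(* Let $\mathbf{C}$ be a Bass--Serre category. Suppose $G\in\mathrm{Grp}(\mathbf{C})$ acts on a connected graph $X\in\mathrm{Graph}(\mathbf{C})$ such that the quotient map $q\colon X\to G\backslash X$ has a section $s$ in $\mathrm{Graph}(\mathbf{C})$. Let $\pi=\pi_1(s^*G_X)$ be the fundamental group of the associated graph of groups $s^*G_X$, let $T=T(s^*G_X)$ be its standard graph, and let $\varphi\colon\pi\to G$ and $\Phi\colon T\to X$ be the canonical maps. Then the following are equivalent. (i) The map $\Phi\colon T\to X$ has a section in $\mathrm{Graph}(\mathbf{C})$. (ii) The map $\Phi\colon T\to X$ is an isomorphism in $\mathrm{Graph}(\mathbf{C})$. (iii) The map $\varphi\colon\pi\to G$ is an isomorphism in $\mathbf{C}$ (and hence in $\mathrm{Grp}(\mathbf{C})$).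
   Context: Basic notation. For a category $\mathbf{C}$ with finite limits (terminal object $*$), $\mathrm{Grp}(\mathbf{C})$ is the category of group objects in $\mathbf{C}$, with structure maps $m_G,i_G,e_G$. $\mathrm{Graph}(\mathbf{C})$ is the category of internal directed graphs $X=(d_0,d_1\colon EX\rightrightarrows VX)$, i.e. functors from the parallel-pair category to $\mathbf{C}$; limits and colimits are computed on $E$ and $V$ separately. An object $C$ of $\mathbf{C}$ is also regarded as the constant graph $(C\rightrightarrows C)$, so $C\times X=(C\times EX\rightrightarrows C\times VX)$. A $G$-object is an object $X$ with a left action $a\colon G\times X\to X$; a $G$-graph ("$G$ acts on the graph $X$") is a graph with $G$-actions on $EX$ and $VX$ for which $d_0,d_1$ are equivariant, so there is an action map $a\colon G\times X\to X$ in $\mathrm{Graph}(\mathbf{C})$. The quotient $q\colon X\to G\backslash X$ is the coequaliser of $a,\mathrm{pr}_X\colon G\times X\rightrightarrows X$. The stabiliser $G_X$ is the equaliser of $a,\mathrm{pr}_X\colon G\times X\rightrightarrows X$; with its map to $X$ it is a group object in the slice category over $X$, with multiplication induced by $m_G$. A graph $X$ is connected if the coequaliser $\mathrm{Comp}(X)$ of $d_0,d_1\colon EX\rightrightarrows VX$ is $*$. Graphs of groups. A graph of groups over $Q\in\mathrm{Graph}(\mathbf{C})$ is an object $\mathcal{G}$ of $\mathrm{Grp}(\mathrm{Graph}(\mathbf{C})_{/Q})$. Let $\Delta\colon\mathrm{Grp}(\mathbf{C})\to\mathrm{Grp}(\mathrm{Graph}(\mathbf{C})_{/Q})$, $H\mapsto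 H\times Q$. When $\Delta$ has a left adjoint $\operatorname{colim}$ (this is so in a Bass--Serre category), the fundamental group of $\mathcal{G}$ is $\pi=\pi_1(\mathcal{G})=\operatorname{colim}\mathcal{G}$, with unit $\mathcal{G}\to\Delta(\pi)=\pi\times Q$. The standard graph $T=T(\mathcal{G})$ is the coequaliser in $\mathrm{Graph}(\mathbf{C})$ of the two maps $\pi\times\mathcal{G}\rightrightarrows\pi\times Q$ given by $\mathrm{id}_\pi\times(\mathcal{G}\to Q)$ and by $\pi\times\mathcal{G}\to\pi\times\Delta(\pi)=\pi\times\pi\times Q\xrightarrow{m_\pi\times\mathrm{id}_Q}\pi\times Q$. Graph of groups of an action. If $X$ is a $G$-graph whose quotient map $q$ has a section $s\colon G\backslash X\to X$ in $\mathrm{Graph}(\mathbf{C})$, the associated graph of groups is the pullback $s^*G_X\in\mathrm{Grp}(\mathrm{Graph}(\mathbf{C})_{/(G\backslash X)})$ of $G_X\to X$ along $s$. With $\pi=\pi_1(s^*G_X)$, the canonical homomorphism $\varphi\colon\pi\to G$ is the adjoint of $s^*G_X\to G_X\to G\times X\xrightarrow{\mathrm{id}\times q}G\times(G\backslash X)=\Delta(G)$. The canonical map $\Phi\colon T\to X$ is induced, via the coequaliser defining $T$, by $\pi\times(G\backslash X)\xrightarrow{\varphi\times\mathrm{id}}G\times(G\backslash X)\xrightarrow{\mathrm{id}_G\times s}G\times X\xrightarrow{a}X$. Action Barr-exactness. In a regular category $\mathbf{D}$, if $H\in\mathrm{Grp}(\mathbf{D})$ acts on $Y$, then the image $R\hookrightarrow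 Y\times Y$ in the (regular epi)-mono factorisation of $(a,\mathrm{pr}_Y)\colon H\times Y\to Y\times Y$ is a congruence (internal equivalence relation) on $Y$. A regular category $\mathbf{D}$ is action Barr-exact if every such congruence is effective (has a coequaliser and is the kernel pair of it). $\mathbf{C}$ is locally action Barr-exact if every slice $\mathbf{C}_{/Y}$ is action Barr-exact. Bass--Serre category. A category $\mathbf{C}$ is Bass--Serre if: (1) $\mathbf{C}$ is locally action Barr-exact, has a terminal object, and has coequalisers, which are preserved by $C\times(-)$ for every $C\in\mathbf{C}$; (2) $\mathrm{Grp}(\mathbf{C})$ has coequalisers and $\mathbf{C}$-internal coproducts, i.e. for each $C\in\mathbf{C}$ the functor $\mathrm{Grp}(\mathbf{C})\to\mathrm{Grp}(\mathbf{C}_{/C})$, $K\mapsto K\times C$, has a left adjoint $\operatorname{colim}_{C^\delta}$; moreover for every $C$ and $H\in\mathrm{Grp}(\mathbf{C}_{/C})$, $H$ generates $\operatorname{colim}_{C^\delta}H$, meaning that $(\operatorname{colim}_{C^\delta}H)\times H\rightrightarrows\operatorname{colim}_{C^\delta}H\to *$ is a coequaliser in $\mathbf{C}$, where the two maps are the projection and the map (canonical map $H\to\operatorname{colim}_{C^\delta}H$ on the second factor, followed by multiplication). *)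

theory Defs
  imports Main
begin

section \<open>Categories\<close>

text \<open>
  Hom-sets are indexed by source and target and need not be disjoint. Thus slice categories and
  categories of group objects have the arrows of the ambient category as their arrows.
  An arrow is always to be read together with its source and target, so notions such as
  ``isomorphism'' take these as arguments.
\<close>

record ('o, 'a) cat =
  Obj :: "'o set"
  Hom :: "'o \<Rightarrow> 'o \<Rightarrow> 'a set"
  Comp :: "'a \<Rightarrow> 'a \<Rightarrow> 'a"  (infixr "\<cdot>\<index>" 70)
  Id :: "'o \<Rightarrow> 'a"

definition category :: "('o, 'a) cat \<Rightarrow> bool" where
  "category C \<longleftrightarrow>
     (\<forall>A B f. f \<in> Hom C A B \<longrightarrow> A \<in> Obj C \<and> B \<in> Obj C) \<and>
     (\<forall>A \<in> Obj C. Id C A \<in> Hom C A A) \<and>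
     (\<forall>A B D f g. f \<in> Hom C A B \<and> g \<in> Hom C B D \<longrightarrow> g \<cdot>\<^bsub>C\<^esub> f \<in> Hom C A D) \<and>
     (\<forall>A B f. f \<in> Hom C A B \<longrightarrow> f \<cdot>\<^bsub>C\<^esub> Id C A = f \<and> Id C B \<cdot>\<^bsub>C\<^esub> f = f) \<and>
     (\<forall>A B D E f g h. f \<in> Hom C A B \<and> g \<in> Hom C B D \<and> h \<in> Hom C D E \<longrightarrow>
        (h \<cdot>\<^bsub>C\<^esub> g) \<cdot>\<^bsub>C\<^esub> f = h \<cdot>\<^bsub>C\<^esub> (g \<cdot>\<^bsub>C\<^esub> f))"

definition is_iso :: "('o, 'a) cat \<Rightarrow> 'o \<Rightarrow> 'o \<Rightarrow> 'a \<Rightarrow> bool" where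
  "is_iso C A B f \<longleftrightarrow>
     f \<in> Hom C A B \<and> (\<exists>g \<in> Hom C B A. g \<cdot>\<^bsub>C\<^esub> f = Id C A \<and> f \<cdot>\<^bsub>C\<^esub> g = Id C B)"

definition is_mono :: "('o, 'a) cat \<Rightarrow> 'o \<Rightarrow> 'o \<Rightarrow> 'a \<Rightarrow> bool" where
  "is_mono C A B f \<longleftrightarrow>
     f \<in> Hom C A B \<and>
     (\<forall>Z. \<forall>x \<in> Hom C Z A. \<forall>y \<in> Hom C Z A. f \<cdot>\<^bsub>C\<^esub> x = f \<cdot>\<^bsub>C\<^esub> y \<longrightarrow> x = y)"

definition is_section :: "('o, 'a) cat \<Rightarrow> 'o \<Rightarrow> 'o \<Rightarrow> 'a \<Rightarrow> 'a \<Rightarrow> bool" where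
  "is_section C A B f s \<longleftrightarrow> f \<in> Hom C A B \<and> s \<in> Hom C B A \<and> f \<cdot>\<^bsub>C\<^esub> s = Id C B"

subsection \<open>Limits and colimits\<close>

definition is_terminal :: "('o, 'a) cat \<Rightarrow> 'o \<Rightarrow> bool" where
  "is_terminal C T \<longleftrightarrow> T \<in> Obj C \<and> (\<forall>A \<in> Obj C. \<exists>!f. f \<in> Hom C A T)"

definition is_product :: "('o, 'a) cat \<Rightarrow> 'o \<Rightarrow> 'o \<Rightarrow> 'o \<Rightarrow> 'a \<Rightarrow> 'a \<Rightarrow> bool" where
  "is_product C A B P p q \<longleftrightarrow>
     p \<in> Hom C P A \<and> q \<in> Hom C P B \<and>
     (\<forall>Z. \<forall>f \<in> Hom C Z A. \<forall>g \<in> Hom C Z B.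
        \<exists>!u. u \<in> Hom C Z P \<and> p \<cdot>\<^bsub>C\<^esub> u = f \<and> q \<cdot>\<^bsub>C\<^esub> u = g)"

definition is_pullback ::
  "('o, 'a) cat \<Rightarrow> 'o \<Rightarrow> 'o \<Rightarrow> 'o \<Rightarrow> 'a \<Rightarrow> 'a \<Rightarrow> 'o \<Rightarrow> 'a \<Rightarrow> 'a \<Rightarrow> bool" where
  "is_pullback C A B D f g P p q \<longleftrightarrow>
     f \<in> Hom C A D \<and> g \<in> Hom C B D \<and>
     p \<in> Hom C P A \<and> q \<in> Hom C P B \<and> f \<cdot>\<^bsub>C\<^esub> p = g \<cdot>\<^bsub>C\<^esub> q \<and>
     (\<forall>Z. \<forall>x \<in> Hom C Z A. \<forall>y \<in> Hom C Z B. f \<cdot>\<^bsub>C\<^esub> x = g \<cdot>\<^bsub>C\<^esub> y \<longrightarrow>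
        (\<exists>!u. u \<in> Hom C Z P \<and> p \<cdot>\<^bsub>C\<^esub> u = x \<and> q \<cdot>\<^bsub>C\<^esub> u = y))"

definition is_equaliser ::
  "('o, 'a) cat \<Rightarrow> 'o \<Rightarrow> 'o \<Rightarrow> 'a \<Rightarrow> 'a \<Rightarrow> 'o \<Rightarrow> 'a \<Rightarrow> bool" where
  "is_equaliser C A B f g E e \<longleftrightarrow>
     f \<in> Hom C A B \<and> g \<in> Hom C A B \<and> e \<in> Hom C E A \<and> f \<cdot>\<^bsub>C\<^esub> e = g \<cdot>\<^bsub>C\<^esub> e \<and>
     (\<forall>Z. \<forall>x \<in> Hom C Z A. f \<cdot>\<^bsub>C\<^esub> x = g \<cdot>\<^bsub>C\<^esub> x \<longrightarrow>
        (\<exists>!u. u \<in> Hom C Z E \<and> e \<cdot>\<^bsub>C\<^esub> u = x))"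

definition is_coequaliser ::
  "('o, 'a) cat \<Rightarrow> 'o \<Rightarrow> 'o \<Rightarrow> 'a \<Rightarrow> 'a \<Rightarrow> 'o \<Rightarrow> 'a \<Rightarrow> bool" where
  "is_coequaliser C A B f g Q q \<longleftrightarrow>
     f \<in> Hom C A B \<and> g \<in> Hom C A B \<and> q \<in> Hom C B Q \<and> q \<cdot>\<^bsub>C\<^esub> f = q \<cdot>\<^bsub>C\<^esub> g \<and>
     (\<forall>Z. \<forall>x \<in> Hom C B Z. x \<cdot>\<^bsub>C\<^esub> f = x \<cdot>\<^bsub>C\<^esub> g \<longrightarrow>
        (\<exists>!u. u \<in> Hom C Q Z \<and> u \<cdot>\<^bsub>C\<^esub> q = x))"

definition has_finite_limits :: "('o, 'a) cat \<Rightarrow> bool" where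
  "has_finite_limits C \<longleftrightarrow>
     (\<exists>T. is_terminal C T) \<and>
     (\<forall>A \<in> Obj C. \<forall>B \<in> Obj C. \<exists>P p q. is_product C A B P p q) \<and>
     (\<forall>A B. \<forall>f \<in> Hom C A B. \<forall>g \<in> Hom C A B. \<exists>E e. is_equaliser C A B f g E e)"

definition has_coequalisers :: "('o, 'a) cat \<Rightarrow> bool" where
  "has_coequalisers C \<longleftrightarrow>
     (\<forall>A B. \<forall>f \<in> Hom C A B. \<forall>g \<in> Hom C A B. \<exists>Q q. is_coequaliser C A B f g Q q)"

text \<open>Chosen representatives of the universal constructions, meaningful whenever these exist.\<close>

definition term_obj :: "('o, 'a) cat \<Rightarrow> 'o" where
  "term_obj C = (SOME T. is_terminal C T)"

definition bang :: "('o, 'a) cat \<Rightarrow> 'o \<Rightarrow> 'a" where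
  "bang C A = (THE f. f \<in> Hom C A (term_obj C))"

definition product :: "('o, 'a) cat \<Rightarrow> 'o \<Rightarrow> 'o \<Rightarrow> 'o \<times> 'a \<times> 'a" where
  "product C A B = (SOME (P, p, q). is_product C A B P p q)"

definition Prod :: "('o, 'a) cat \<Rightarrow> 'o \<Rightarrow> 'o \<Rightarrow> 'o" where
  "Prod C A B = fst (product C A B)"

definition pr1 :: "('o, 'a) cat \<Rightarrow> 'o \<Rightarrow> 'o \<Rightarrow> 'a" where
  "pr1 C A B = fst (snd (product C A B))"

definition pr2 :: "('o, 'a) cat \<Rightarrow> 'o \<Rightarrow> 'o \<Rightarrow> 'a" where
  "pr2 C A B = snd (snd (product C A B))"

definition pullback ::
  "('o, 'a) cat \<Rightarrow> 'o \<Rightarrow> 'o \<Rightarrow> 'o \<Rightarrow> 'a \<Rightarrow> 'a \<Rightarrow> 'o \<times> 'a \<times> 'a" where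
  "pullback C A B D f g = (SOME (P, p, q). is_pullback C A B D f g P p q)"

definition equaliser :: "('o, 'a) cat \<Rightarrow> 'o \<Rightarrow> 'o \<Rightarrow> 'a \<Rightarrow> 'a \<Rightarrow> 'o \<times> 'a" where
  "equaliser C A B f g = (SOME (E, e). is_equaliser C A B f g E e)"

definition coequaliser :: "('o, 'a) cat \<Rightarrow> 'o \<Rightarrow> 'o \<Rightarrow> 'a \<Rightarrow> 'a \<Rightarrow> 'o \<times> 'a" where
  "coequaliser C A B f g = (SOME (Q, q). is_coequaliser C A B f g Q q)"

text \<open>
  \<open>tuple C Z P p q f g\<close> is the map \<open>Z \<rightarrow> P\<close> with components \<open>f\<close> and \<open>g\<close>, for \<open>(P, p, q)\<close> a
  product or pullback cone; \<open>factor C Z B i f\<close> is the factorisation \<open>Z \<rightarrow> B\<close> of \<open>f\<close> through the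
  monomorphism \<open>i\<close>; \<open>cofactor C Q Z q f\<close> is the factorisation \<open>Q \<rightarrow> Z\<close> of \<open>f\<close> through the
  epimorphism \<open>q\<close>.
\<close>

definition tuple ::
  "('o, 'a) cat \<Rightarrow> 'o \<Rightarrow> 'o \<Rightarrow> 'a \<Rightarrow> 'a \<Rightarrow> 'a \<Rightarrow> 'a \<Rightarrow> 'a" where
  "tuple C Z P p q f g = (THE u. u \<in> Hom C Z P \<and> p \<cdot>\<^bsub>C\<^esub> u = f \<and> q \<cdot>\<^bsub>C\<^esub> u = g)"

definition factor :: "('o, 'a) cat \<Rightarrow> 'o \<Rightarrow> 'o \<Rightarrow> 'a \<Rightarrow> 'a \<Rightarrow> 'a" where
  "factor C Z B i f = (THE u. u \<in> Hom C Z B \<and> i \<cdot>\<^bsub>C\<^esub> u = f)"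

definition cofactor :: "('o, 'a) cat \<Rightarrow> 'o \<Rightarrow> 'o \<Rightarrow> 'a \<Rightarrow> 'a \<Rightarrow> 'a" where
  "cofactor C Q Z q f = (THE u. u \<in> Hom C Q Z \<and> u \<cdot>\<^bsub>C\<^esub> q = f)"

definition pair :: "('o, 'a) cat \<Rightarrow> 'o \<Rightarrow> 'o \<Rightarrow> 'o \<Rightarrow> 'a \<Rightarrow> 'a \<Rightarrow> 'a" where
  "pair C Z A B f g = tuple C Z (Prod C A B) (pr1 C A B) (pr2 C A B) f g"

text \<open>\<open>pmap C A B A' B' f g\<close> is \<open>f \<times> g : A \<times> B \<rightarrow> A' \<times> B'\<close>.\<close>

definition pmap ::
  "('o, 'a) cat \<Rightarrow> 'o \<Rightarrow> 'o \<Rightarrow> 'o \<Rightarrow> 'o \<Rightarrow> 'a \<Rightarrow> 'a \<Rightarrow> 'a" where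
  "pmap C A B A' B' f g =
     pair C (Prod C A B) A' B' (f \<cdot>\<^bsub>C\<^esub> pr1 C A B) (g \<cdot>\<^bsub>C\<^esub> pr2 C A B)"

subsection \<open>Slice categories\<close>

definition slice :: "('o, 'a) cat \<Rightarrow> 'o \<Rightarrow> ('o \<times> 'a, 'a) cat" where
  "slice C Y =
     \<lparr> Obj = {(A, f). f \<in> Hom C A Y},
       Hom = (\<lambda>(A, f) (B, g). {h \<in> Hom C A B. f \<in> Hom C A Y \<and> g \<in> Hom C B Y \<and> g \<cdot>\<^bsub>C\<^esub> h = f}),
       Comp = Comp C,
       Id = (\<lambda>(A, f). Id C A) \<rparr>"

subsection \<open>Adjunctions\<close>

text \<open>
  \<open>L\<close> is the object part of a left adjoint, with unit \<open>\<eta>\<close>, of the functor \<open>D \<rightarrow> E\<close> which is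
  \<open>F\<close> on objects and sends \<open>h : x \<rightarrow> y\<close> to \<open>Fm x y h\<close>.
\<close>

definition is_left_adjoint ::
  "('d, 'da) cat \<Rightarrow> ('e, 'ea) cat \<Rightarrow> ('d \<Rightarrow> 'e) \<Rightarrow> ('d \<Rightarrow> 'd \<Rightarrow> 'da \<Rightarrow> 'ea) \<Rightarrow>
   ('e \<Rightarrow> 'd) \<Rightarrow> ('e \<Rightarrow> 'ea) \<Rightarrow> bool" where
  "is_left_adjoint D E F Fm L \<eta> \<longleftrightarrow>
     (\<forall>x \<in> Obj E. L x \<in> Obj D \<and> \<eta> x \<in> Hom E x (F (L x)) \<and>
        (\<forall>y \<in> Obj D. \<forall>g \<in> Hom E x (F y).
           \<exists>!h. h \<in> Hom D (L x) y \<and> Fm (L x) y h \<cdot>\<^bsub>E\<^esub> \<eta> x = g))"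

section \<open>Group objects and actions\<close>

record ('o, 'a) grp =
  gob :: 'o
  gmul :: 'a
  ginv :: 'a
  gunit :: 'a

text \<open>\<open>gop C Z K x y\<close> is the product \<open>m\<^sub>K \<circ> (x, y)\<close> of two generalised elements \<open>x, y : Z \<rightarrow> K\<close>.\<close>

definition gop :: "('o, 'a) cat \<Rightarrow> 'o \<Rightarrow> ('o, 'a) grp \<Rightarrow> 'a \<Rightarrow> 'a \<Rightarrow> 'a" where
  "gop C Z K x y = gmul K \<cdot>\<^bsub>C\<^esub> pair C Z (gob K) (gob K) x y"

definition group_object :: "('o, 'a) cat \<Rightarrow> ('o, 'a) grp \<Rightarrow> bool" where
  "group_object C K \<longleftrightarrow>
     (let G = gob K; GG = Prod C G G; W = Prod C GG G;
          x = pr1 C G G \<cdot>\<^bsub>C\<^esub> pr1 C GG G; y = pr2 C G G \<cdot>\<^bsub>C\<^esub> pr1 C GG G; z = pr2 C GG G;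
          one = gunit K \<cdot>\<^bsub>C\<^esub> bang C G
      in G \<in> Obj C \<and> gmul K \<in> Hom C GG G \<and> ginv K \<in> Hom C G G \<and>
         gunit K \<in> Hom C (term_obj C) G \<and>
         gop C W K (gop C W K x y) z = gop C W K x (gop C W K y z) \<and>
         gop C G K one (Id C G) = Id C G \<and> gop C G K (Id C G) one = Id C G \<and>
         gop C G K (ginv K) (Id C G) = one \<and> gop C G K (Id C G) (ginv K) = one)"

definition Grp :: "('o, 'a) cat \<Rightarrow> (('o, 'a) grp, 'a) cat" where
  "Grp C =
     \<lparr> Obj = {K. group_object C K},
       Hom = (\<lambda>K L. {f \<in> Hom C (gob K) (gob L). group_object C K \<and> group_object C L \<and>
                f \<cdot>\<^bsub>C\<^esub> gmul K =
                gmul L \<cdot>\<^bsub>C\<^esub> pmap C (gob K) (gob K) (gob L) (gob L) f f}),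
       Comp = Comp C,
       Id = (\<lambda>K. Id C (gob K)) \<rparr>"

definition left_action :: "('o, 'a) cat \<Rightarrow> ('o, 'a) grp \<Rightarrow> 'o \<Rightarrow> 'a \<Rightarrow> bool" where
  "left_action C K Y a \<longleftrightarrow>
     (let G = gob K; GG = Prod C G G; W = Prod C GG Y;
          g = pr1 C G G \<cdot>\<^bsub>C\<^esub> pr1 C GG Y; h = pr2 C G G \<cdot>\<^bsub>C\<^esub> pr1 C GG Y; y = pr2 C GG Y
      in Y \<in> Obj C \<and> a \<in> Hom C (Prod C G Y) Y \<and>
         a \<cdot>\<^bsub>C\<^esub> pair C Y G Y (gunit K \<cdot>\<^bsub>C\<^esub> bang C Y) (Id C Y) = Id C Y \<and>
         a \<cdot>\<^bsub>C\<^esub> pair C W G Y (gop C W K g h) y =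
         a \<cdot>\<^bsub>C\<^esub> pair C W G Y g (a \<cdot>\<^bsub>C\<^esub> pair C W G Y h y))"

text \<open>
  For a product cone \<open>(P, p, q)\<close> of \<open>gob K\<close> and \<open>Q\<close>: the group object \<open>q : P \<rightarrow> Q\<close> of the
  slice over \<open>Q\<close>, with operations those of \<open>K\<close> in the first component.
\<close>

definition family_group ::
  "('o, 'a) cat \<Rightarrow> ('o, 'a) grp \<Rightarrow> 'o \<Rightarrow> 'o \<Rightarrow> 'a \<Rightarrow> 'a \<Rightarrow> ('o \<times> 'a, 'a) grp" where
  "family_group D K Q P p q =
     (let D' = slice D Q;
          (S, s) = Prod D' (P, q) (P, q); r1 = pr1 D' (P, q) (P, q); r2 = pr2 D' (P, q) (P, q);
          (U, u) = term_obj D'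
      in \<lparr> gob = (P, q),
           gmul = tuple D S P p q (gop D S K (p \<cdot>\<^bsub>D\<^esub> r1) (p \<cdot>\<^bsub>D\<^esub> r2)) s,
           ginv = tuple D P P p q (ginv K \<cdot>\<^bsub>D\<^esub> p) q,
           gunit = tuple D U P p q (gunit K \<cdot>\<^bsub>D\<^esub> bang D U) u \<rparr>)"

text \<open>The functor \<open>K \<mapsto> K \<times> A\<close> from groups in \<open>C\<close> to groups in the slice of \<open>C\<close> over \<open>A\<close>.\<close>

definition times_group ::
  "('o, 'a) cat \<Rightarrow> 'o \<Rightarrow> ('o, 'a) grp \<Rightarrow> ('o \<times> 'a, 'a) grp" where
  "times_group C A K =
     family_group C K A (Prod C (gob K) A) (pr1 C (gob K) A) (pr2 C (gob K) A)"

definition times_group_map ::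
  "('o, 'a) cat \<Rightarrow> 'o \<Rightarrow> ('o, 'a) grp \<Rightarrow> ('o, 'a) grp \<Rightarrow> 'a \<Rightarrow> 'a" where
  "times_group_map C A K L f = pmap C (gob K) A (gob L) A f (Id C A)"

text \<open>The group structure induced from \<open>H\<close> on a subobject \<open>i : B \<rightarrow> gob H\<close>.\<close>

definition subgroup_object ::
  "('o, 'a) cat \<Rightarrow> ('o, 'a) grp \<Rightarrow> 'o \<Rightarrow> 'a \<Rightarrow> ('o, 'a) grp" where
  "subgroup_object D H B i =
     (let BB = Prod D B B
      in \<lparr> gob = B,
           gmul = factor D BB B i (gop D BB H (i \<cdot>\<^bsub>D\<^esub> pr1 D B B) (i \<cdot>\<^bsub>D\<^esub> pr2 D B B)),
           ginv = factor D B B i (ginv H \<cdot>\<^bsub>D\<^esub> i),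
           gunit = factor D (term_obj D) B i (gunit H) \<rparr>)"

text \<open>
  For \<open>s : Y \<rightarrow> X\<close> and a group object \<open>K\<close>, \<open>k : B \<rightarrow> X\<close>, of the slice over \<open>X\<close>: the projections
  \<open>t : P \<rightarrow> B\<close> and \<open>p : P \<rightarrow> Y\<close> of the pullback, and the group object \<open>s\<^sup>*K\<close>, namely \<open>p : P \<rightarrow> Y\<close>
  in the slice over \<open>Y\<close>.
\<close>

definition pullback_cone ::
  "('o, 'a) cat \<Rightarrow> 'o \<Rightarrow> 'o \<Rightarrow> 'a \<Rightarrow> ('o \<times> 'a, 'a) grp \<Rightarrow> 'o \<times> 'a \<times> 'a" where
  "pullback_cone D Y X s K = pullback D (fst (gob K)) Y X (snd (gob K)) s"

definition pullback_group ::
  "('o, 'a) cat \<Rightarrow> 'o \<Rightarrow> 'o \<Rightarrow> 'a \<Rightarrow> ('o \<times> 'a, 'a) grp \<Rightarrow> ('o \<times> 'a, 'a) grp" where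
  "pullback_group D Y X s K =
     (let (P, t, p) = pullback_cone D Y X s K; DX = slice D X; DY = slice D Y;
          (S, v) = Prod DY (P, p) (P, p);
          r1 = pr1 DY (P, p) (P, p); r2 = pr2 DY (P, p) (P, p);
          (U, u) = term_obj DY
      in \<lparr> gob = (P, p),
           gmul = tuple D S P t p
                    (gop DX (S, s \<cdot>\<^bsub>D\<^esub> v) K (t \<cdot>\<^bsub>D\<^esub> r1) (t \<cdot>\<^bsub>D\<^esub> r2)) v,
           ginv = tuple D P P t p (ginv K \<cdot>\<^bsub>D\<^esub> t) p,
           gunit = tuple D U P t p (gunit K \<cdot>\<^bsub>D\<^esub> bang DX (U, s \<cdot>\<^bsub>D\<^esub> u)) u \<rparr>)"

section \<open>Bass--Serre categories\<close>

definition regular_epi :: "('o, 'a) cat \<Rightarrow> 'o \<Rightarrow> 'o \<Rightarrow> 'a \<Rightarrow> bool" where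
  "regular_epi C B Q q \<longleftrightarrow> (\<exists>A f g. is_coequaliser C A B f g Q q)"

definition regular_category :: "('o, 'a) cat \<Rightarrow> bool" where
  "regular_category C \<longleftrightarrow>
     category C \<and> has_finite_limits C \<and>
     (\<forall>A B f R r0 r1. is_pullback C A A B f f R r0 r1 \<longrightarrow>
        (\<exists>Q q. is_coequaliser C R A r0 r1 Q q)) \<and>
     (\<forall>A B D f g P p q. is_pullback C A B D f g P p q \<and> regular_epi C A D f \<longrightarrow>
        regular_epi C P B q)"

text \<open>
  Below, \<open>i \<circ> e\<close> is the (regular epi)-mono factorisation of \<open>(a, pr\<^sub>Y) : H \<times> Y \<rightarrow> Y \<times> Y\<close>;
  the congruence \<open>R\<close> is effective if it is the kernel pair of its coequaliser.
\<close>

definition action_Barr_exact :: "('o, 'a) cat \<Rightarrow> bool" where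
  "action_Barr_exact D \<longleftrightarrow>
     regular_category D \<and>
     (\<forall>H Y a R e i.
        group_object D H \<and> left_action D H Y a \<and>
        regular_epi D (Prod D (gob H) Y) R e \<and> is_mono D R (Prod D Y Y) i \<and>
        i \<cdot>\<^bsub>D\<^esub> e = pair D (Prod D (gob H) Y) Y Y a (pr2 D (gob H) Y) \<longrightarrow>
        (\<exists>Q q. is_coequaliser D R Y (pr1 D Y Y \<cdot>\<^bsub>D\<^esub> i) (pr2 D Y Y \<cdot>\<^bsub>D\<^esub> i) Q q \<and>
               is_pullback D Y Y Q q q R (pr1 D Y Y \<cdot>\<^bsub>D\<^esub> i) (pr2 D Y Y \<cdot>\<^bsub>D\<^esub> i)))"

definition locally_action_Barr_exact :: "('o, 'a) cat \<Rightarrow> bool" where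
  "locally_action_Barr_exact C \<longleftrightarrow> (\<forall>Y \<in> Obj C. action_Barr_exact (slice C Y))"

definition products_preserve_coequalisers :: "('o, 'a) cat \<Rightarrow> bool" where
  "products_preserve_coequalisers C \<longleftrightarrow>
     (\<forall>D \<in> Obj C. \<forall>A B f g Q q. is_coequaliser C A B f g Q q \<longrightarrow>
        is_coequaliser C (Prod C D A) (Prod C D B)
          (pmap C D A D B (Id C D) f) (pmap C D A D B (Id C D) g)
          (Prod C D Q) (pmap C D B D Q (Id C D) q))"

text \<open>For \<open>c : B \<rightarrow> gob K\<close>: the two maps \<open>K \<times> B \<rightarrow> K\<close>, \<open>(k, b) \<mapsto> k\<close> and \<open>(k, b) \<mapsto> k c(b)\<close>,
  have coequaliser \<open>K \<rightarrow> *\<close>.\<close>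

definition generates :: "('o, 'a) cat \<Rightarrow> 'o \<Rightarrow> ('o, 'a) grp \<Rightarrow> 'a \<Rightarrow> bool" where
  "generates C B K c \<longleftrightarrow>
     (let KB = Prod C (gob K) B; p = pr1 C (gob K) B; q = pr2 C (gob K) B
      in is_coequaliser C KB (gob K) p (gop C KB K p (c \<cdot>\<^bsub>C\<^esub> q)) (term_obj C) (bang C (gob K)))"

definition Bass_Serre :: "('o, 'a) cat \<Rightarrow> bool" where
  "Bass_Serre C \<longleftrightarrow>
     category C \<and> locally_action_Barr_exact C \<and> (\<exists>T. is_terminal C T) \<and>
     has_coequalisers C \<and> products_preserve_coequalisers C \<and>
     has_coequalisers (Grp C) \<and>
     (\<forall>A \<in> Obj C. \<exists>L \<eta>.
        is_left_adjoint (Grp C) (Grp (slice C A)) (times_group C A) (times_group_map C A) L \<eta> \<and>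
        (\<forall>H \<in> Obj (Grp (slice C A)).
           generates C (fst (gob H)) (L H) (pr1 C (gob (L H)) A \<cdot>\<^bsub>C\<^esub> \<eta> H)))"

section \<open>Internal graphs\<close>

record ('o, 'a) graph =
  edges :: 'o
  verts :: 'o
  d0 :: 'a
  d1 :: 'a

definition Graph :: "('o, 'a) cat \<Rightarrow> (('o, 'a) graph, 'a \<times> 'a) cat" where
  "Graph C =
     (let gr = (\<lambda>X. d0 X \<in> Hom C (edges X) (verts X) \<and> d1 X \<in> Hom C (edges X) (verts X))
      in \<lparr> Obj = {X. gr X},
           Hom = (\<lambda>X Y. {(fE, fV). gr X \<and> gr Y \<and>
                    fE \<in> Hom C (edges X) (edges Y) \<and> fV \<in> Hom C (verts X) (verts Y) \<and>
                    d0 Y \<cdot>\<^bsub>C\<^esub> fE = fV \<cdot>\<^bsub>C\<^esub> d0 X \<and> d1 Y \<cdot>\<^bsub>C\<^esub> fE = fV \<cdot>\<^bsub>C\<^esub> d1 X}),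
           Comp = (\<lambda>(gE, gV) (fE, fV). (gE \<cdot>\<^bsub>C\<^esub> fE, gV \<cdot>\<^bsub>C\<^esub> fV)),
           Id = (\<lambda>X. (Id C (edges X), Id C (verts X))) \<rparr>)"

definition connected :: "('o, 'a) cat \<Rightarrow> ('o, 'a) graph \<Rightarrow> bool" where
  "connected C X \<longleftrightarrow> is_terminal C (fst (coequaliser C (edges X) (verts X) (d0 X) (d1 X)))"

definition const_graph :: "('o, 'a) cat \<Rightarrow> 'o \<Rightarrow> ('o, 'a) graph" where
  "const_graph C A = \<lparr> edges = A, verts = A, d0 = Id C A, d1 = Id C A \<rparr>"

text \<open>The graph \<open>A \<times> X\<close>, a product of \<open>const_graph C A\<close> and \<open>X\<close>, and its projections.\<close>

definition times_graph :: "('o, 'a) cat \<Rightarrow> 'o \<Rightarrow> ('o, 'a) graph \<Rightarrow> ('o, 'a) graph" where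
  "times_graph C A X =
     \<lparr> edges = Prod C A (edges X), verts = Prod C A (verts X),
       d0 = pmap C A (edges X) A (verts X) (Id C A) (d0 X),
       d1 = pmap C A (edges X) A (verts X) (Id C A) (d1 X) \<rparr>"

definition times_pr1 :: "('o, 'a) cat \<Rightarrow> 'o \<Rightarrow> ('o, 'a) graph \<Rightarrow> 'a \<times> 'a" where
  "times_pr1 C A X = (pr1 C A (edges X), pr1 C A (verts X))"

definition times_pr2 :: "('o, 'a) cat \<Rightarrow> 'o \<Rightarrow> ('o, 'a) graph \<Rightarrow> 'a \<times> 'a" where
  "times_pr2 C A X = (pr2 C A (edges X), pr2 C A (verts X))"

definition times_map ::
  "('o, 'a) cat \<Rightarrow> 'o \<Rightarrow> ('o, 'a) graph \<Rightarrow> 'o \<Rightarrow> ('o, 'a) graph \<Rightarrow> 'a \<Rightarrow> 'a \<times> 'a \<Rightarrow> 'a \<times> 'a" where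
  "times_map C A X B Y f h =
     (pmap C A (edges X) B (edges Y) f (fst h), pmap C A (verts X) B (verts Y) f (snd h))"

subsection \<open>Group actions on graphs\<close>

text \<open>The action on the graph \<open>X\<close> is given by \<open>a = (a\<^sub>E, a\<^sub>V)\<close>; the last condition says that
  \<open>d0\<close> and \<open>d1\<close> are equivariant.\<close>

definition graph_action ::
  "('o, 'a) cat \<Rightarrow> ('o, 'a) grp \<Rightarrow> ('o, 'a) graph \<Rightarrow> 'a \<times> 'a \<Rightarrow> bool" where
  "graph_action C G X a \<longleftrightarrow>
     X \<in> Obj (Graph C) \<and>
     left_action C G (edges X) (fst a) \<and> left_action C G (verts X) (snd a) \<and>
     (\<forall>d \<in> {d0 X, d1 X}. d \<cdot>\<^bsub>C\<^esub> fst a =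
        snd a \<cdot>\<^bsub>C\<^esub> pmap C (gob G) (edges X) (gob G) (verts X) (Id C (gob G)) d)"

definition quotient ::
  "('o, 'a) cat \<Rightarrow> ('o, 'a) grp \<Rightarrow> ('o, 'a) graph \<Rightarrow> 'a \<times> 'a \<Rightarrow> ('o, 'a) graph \<times> ('a \<times> 'a)" where
  "quotient C G X a =
     coequaliser (Graph C) (times_graph C (gob G) X) X a (times_pr2 C (gob G) X)"

definition quotient_graph ::
  "('o, 'a) cat \<Rightarrow> ('o, 'a) grp \<Rightarrow> ('o, 'a) graph \<Rightarrow> 'a \<times> 'a \<Rightarrow> ('o, 'a) graph" where
  "quotient_graph C G X a = fst (quotient C G X a)"

definition quotient_map ::
  "('o, 'a) cat \<Rightarrow> ('o, 'a) grp \<Rightarrow> ('o, 'a) graph \<Rightarrow> 'a \<times> 'a \<Rightarrow> 'a \<times> 'a" where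
  "quotient_map C G X a = snd (quotient C G X a)"

section \<open>Graphs of groups\<close>

definition const_group ::
  "('o, 'a) cat \<Rightarrow> ('o, 'a) grp \<Rightarrow> (('o, 'a) graph, 'a \<times> 'a) grp" where
  "const_group C K =
     (let X = const_graph C (gob K);
          S = Prod (Graph C) X X; r1 = pr1 (Graph C) X X; r2 = pr2 (Graph C) X X;
          U = term_obj (Graph C)
      in \<lparr> gob = X,
           gmul = (gop C (edges S) K (fst r1) (fst r2), gop C (verts S) K (snd r1) (snd r2)),
           ginv = (ginv K, ginv K),
           gunit = (gunit K \<cdot>\<^bsub>C\<^esub> bang C (edges U), gunit K \<cdot>\<^bsub>C\<^esub> bang C (verts U)) \<rparr>)"

text \<open>The category of graphs of groups over \<open>Q\<close>, and the functor \<open>\<Delta>\<close>, \<open>K \<mapsto> K \<times> Q\<close>, into it.\<close>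

definition GoG ::
  "('o, 'a) cat \<Rightarrow> ('o, 'a) graph \<Rightarrow> ((('o, 'a) graph \<times> ('a \<times> 'a), 'a \<times> 'a) grp, 'a \<times> 'a) cat" where
  "GoG C Q = Grp (slice (Graph C) Q)"

definition Delta ::
  "('o, 'a) cat \<Rightarrow> ('o, 'a) graph \<Rightarrow> ('o, 'a) grp \<Rightarrow> (('o, 'a) graph \<times> ('a \<times> 'a), 'a \<times> 'a) grp" where
  "Delta C Q K =
     family_group (Graph C) (const_group C K) Q
       (times_graph C (gob K) Q) (times_pr1 C (gob K) Q) (times_pr2 C (gob K) Q)"

definition Delta_map ::
  "('o, 'a) cat \<Rightarrow> ('o, 'a) graph \<Rightarrow> ('o, 'a) grp \<Rightarrow> ('o, 'a) grp \<Rightarrow> 'a \<Rightarrow> 'a \<times> 'a" where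
  "Delta_map C Q K L f = times_map C (gob K) Q (gob L) Q f (Id (Graph C) Q)"

definition colim_Delta ::
  "('o, 'a) cat \<Rightarrow> ('o, 'a) graph \<Rightarrow>
   ((('o, 'a) graph \<times> ('a \<times> 'a), 'a \<times> 'a) grp \<Rightarrow> ('o, 'a) grp) \<times>
   ((('o, 'a) graph \<times> ('a \<times> 'a), 'a \<times> 'a) grp \<Rightarrow> 'a \<times> 'a)" where
  "colim_Delta C Q =
     (SOME (L, \<eta>). is_left_adjoint (Grp C) (GoG C Q) (Delta C Q) (Delta_map C Q) L \<eta>)"

definition pi1 ::
  "('o, 'a) cat \<Rightarrow> ('o, 'a) graph \<Rightarrow> (('o, 'a) graph \<times> ('a \<times> 'a), 'a \<times> 'a) grp \<Rightarrow> ('o, 'a) grp" where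
  "pi1 C Q \<G> = fst (colim_Delta C Q) \<G>"

definition pi1_unit ::
  "('o, 'a) cat \<Rightarrow> ('o, 'a) graph \<Rightarrow> (('o, 'a) graph \<times> ('a \<times> 'a), 'a \<times> 'a) grp \<Rightarrow> 'a \<times> 'a" where
  "pi1_unit C Q \<G> = snd (colim_Delta C Q) \<G>"

text \<open>\<open>mul_id C K A\<close> is \<open>m\<^sub>K \<times> id : K \<times> (K \<times> A) \<rightarrow> K \<times> A\<close>, up to the associativity of products.\<close>

definition mul_id :: "('o, 'a) cat \<Rightarrow> ('o, 'a) grp \<Rightarrow> 'o \<Rightarrow> 'a" where
  "mul_id C K A =
     (let KA = Prod C (gob K) A; W = Prod C (gob K) KA; r = pr2 C (gob K) KA
      in pair C W (gob K) A
           (gop C W K (pr1 C (gob K) KA) (pr1 C (gob K) A \<cdot>\<^bsub>C\<^esub> r)) (pr2 C (gob K) A \<cdot>\<^bsub>C\<^esub> r))"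

text \<open>The standard graph \<open>T(\<G>)\<close> together with the coequaliser map \<open>\<pi> \<times> Q \<rightarrow> T(\<G>)\<close>.\<close>

definition standard ::
  "('o, 'a) cat \<Rightarrow> ('o, 'a) graph \<Rightarrow> (('o, 'a) graph \<times> ('a \<times> 'a), 'a \<times> 'a) grp \<Rightarrow>
   ('o, 'a) graph \<times> ('a \<times> 'a)" where
  "standard C Q \<G> =
     (let \<pi> = pi1 C Q \<G>; P = gob \<pi>; (\<Gamma>, \<gamma>) = gob \<G>; PQ = times_graph C P Q
      in coequaliser (Graph C) (times_graph C P \<Gamma>) PQ
           (times_map C P \<Gamma> P Q (Id C P) \<gamma>)
           ((mul_id C \<pi> (edges Q), mul_id C \<pi> (verts Q)) \<cdot>\<^bsub>Graph C\<^esub>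
              times_map C P \<Gamma> P PQ (Id C P) (pi1_unit C Q \<G>)))"

definition standard_graph ::
  "('o, 'a) cat \<Rightarrow> ('o, 'a) graph \<Rightarrow> (('o, 'a) graph \<times> ('a \<times> 'a), 'a \<times> 'a) grp \<Rightarrow>
   ('o, 'a) graph" where
  "standard_graph C Q \<G> = fst (standard C Q \<G>)"

definition standard_proj ::
  "('o, 'a) cat \<Rightarrow> ('o, 'a) graph \<Rightarrow> (('o, 'a) graph \<times> ('a \<times> 'a), 'a \<times> 'a) grp \<Rightarrow> 'a \<times> 'a" where
  "standard_proj C Q \<G> = snd (standard C Q \<G>)"

subsection \<open>The graph of groups of an action\<close>

text \<open>The equaliser \<open>e : G\<^sub>X \<rightarrow> G \<times> X\<close> in graphs, and \<open>G\<^sub>X\<close> as a group object over \<open>X\<close>.\<close>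

definition stabiliser_eq ::
  "('o, 'a) cat \<Rightarrow> ('o, 'a) grp \<Rightarrow> ('o, 'a) graph \<Rightarrow> 'a \<times> 'a \<Rightarrow> ('o, 'a) graph \<times> ('a \<times> 'a)" where
  "stabiliser_eq C G X a =
     equaliser (Graph C) (times_graph C (gob G) X) X a (times_pr2 C (gob G) X)"

definition stabiliser ::
  "('o, 'a) cat \<Rightarrow> ('o, 'a) grp \<Rightarrow> ('o, 'a) graph \<Rightarrow> 'a \<times> 'a \<Rightarrow>
   (('o, 'a) graph \<times> ('a \<times> 'a), 'a \<times> 'a) grp" where
  "stabiliser C G X a =
     (let (S, e) = stabiliser_eq C G X a
      in subgroup_object (slice (Graph C) X) (Delta C X G)
           (S, times_pr2 C (gob G) X \<cdot>\<^bsub>Graph C\<^esub> e) e)"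

definition action_gog ::
  "('o, 'a) cat \<Rightarrow> ('o, 'a) grp \<Rightarrow> ('o, 'a) graph \<Rightarrow> 'a \<times> 'a \<Rightarrow> 'a \<times> 'a \<Rightarrow>
   (('o, 'a) graph \<times> ('a \<times> 'a), 'a \<times> 'a) grp" where
  "action_gog C G X a s =
     pullback_group (Graph C) (quotient_graph C G X a) X s (stabiliser C G X a)"

text \<open>The map \<open>s\<^sup>*G\<^sub>X \<rightarrow> G\<^sub>X \<rightarrow> G \<times> X \<rightarrow> G \<times> (G\X) = \<Delta>(G)\<close> and its adjoint \<open>\<phi> : \<pi> \<rightarrow> G\<close>.\<close>

definition gog_map ::
  "('o, 'a) cat \<Rightarrow> ('o, 'a) grp \<Rightarrow> ('o, 'a) graph \<Rightarrow> 'a \<times> 'a \<Rightarrow> 'a \<times> 'a \<Rightarrow> 'a \<times> 'a" where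
  "gog_map C G X a s =
     (let Q = quotient_graph C G X a;
          (P, t, p) = pullback_cone (Graph C) Q X s (stabiliser C G X a);
          (S, e) = stabiliser_eq C G X a
      in times_map C (gob G) X (gob G) Q (Id C (gob G)) (quotient_map C G X a)
           \<cdot>\<^bsub>Graph C\<^esub> e \<cdot>\<^bsub>Graph C\<^esub> t)"

definition canonical_hom ::
  "('o, 'a) cat \<Rightarrow> ('o, 'a) grp \<Rightarrow> ('o, 'a) graph \<Rightarrow> 'a \<times> 'a \<Rightarrow> 'a \<times> 'a \<Rightarrow> 'a" where
  "canonical_hom C G X a s =
     (let Q = quotient_graph C G X a; \<G> = action_gog C G X a s; \<pi> = pi1 C Q \<G>
      in (THE h. h \<in> Hom (Grp C) \<pi> G \<and>
            Delta_map C Q \<pi> G h \<cdot>\<^bsub>GoG C Q\<^esub> pi1_unit C Q \<G> = gog_map C G X a s))"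

definition canonical_map ::
  "('o, 'a) cat \<Rightarrow> ('o, 'a) grp \<Rightarrow> ('o, 'a) graph \<Rightarrow> 'a \<times> 'a \<Rightarrow> 'a \<times> 'a \<Rightarrow> 'a \<times> 'a" where
  "canonical_map C G X a s =
     (let Q = quotient_graph C G X a; \<G> = action_gog C G X a s; P = gob (pi1 C Q \<G>)
      in cofactor (Graph C) (standard_graph C Q \<G>) X (standard_proj C Q \<G>)
           (a \<cdot>\<^bsub>Graph C\<^esub>
            times_map C (gob G) Q (gob G) X (Id C (gob G)) s \<cdot>\<^bsub>Graph C\<^esub>
            times_map C P Q (gob G) Q (canonical_hom C G X a s) (Id (Graph C) Q)))"

end

theory Submission
  imports Defs
begin

text \<open>
  Let \<open>Q\<close> be the quotient of \<open>X\<close>. We argue with generalised elements, where an element exists locally if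
  it exists after composition with a regular epimorphism. By action exactness, every element \<open>x\<close> of
  \<open>X\<close> is locally of the form \<open>g s(q x)\<close>, and \<open>g\<close> is unique up to stabilisers; so \<open>X\<close> arises from \<open>G\<close> exactly
  as \<open>T\<close> arises from \<open>\<pi>\<close>, and \<open>\<Phi>\<close> is invertible if \<open>\<phi>\<close> is.

  Conversely, the stabilisers of \<open>s(y)\<close> lie in the image of \<open>\<phi>\<close>, so \<open>g s(y) \<mapsto> g \<phi>(\<pi>)\<close> is a map from \<open>X\<close> to
  the cosets of \<open>\<phi>(\<pi>)\<close>. As \<open>X\<close> is connected it is constant, and \<open>\<phi>\<close> is locally surjective. Given a section
  \<open>\<sigma>\<close> of \<open>\<Phi>\<close>, the elements \<open>\<sigma>(\<phi>(p) s(y))\<close> and \<open>[p, y]\<close> of \<open>T\<close> lie over the same element of \<open>X\<close>, so that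
  \<open>\<sigma>(\<phi>(p) s(y)) = [n p, y]\<close> for a unique \<open>n\<close> in the kernel of \<open>\<phi>\<close>. This \<open>n\<close> depends neither on \<open>y\<close>, as \<open>Q\<close>
  is connected, nor on \<open>p\<close>, as \<open>\<pi>\<close> is generated by the vertex groups. Since \<open>\<sigma>(\<phi>(p) s(y))\<close> does not change
  when \<open>p\<close> is multiplied by an element of the kernel, the kernel is trivial.
\<close>

section \<open>Categories with finite limits\<close>

text \<open>Three gaps have to be bridged. The standard graph is a quotient by groups that vary with
  the vertex, so deciding when two classes in \<open>T\<close> agree requires exactness in the slice
  over the vertices of \<open>Q\<close>; exactness for groups of \<open>C\<close> itself handles
  only \<open>X\<close> and cosets. The generation axiom speaks of the coproduct of the vertex
  groups, whereas \<open>\<pi>\<close> is a further coequaliser in \<open>Grp C\<close>, whose map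
  need not be surjective in \<open>C\<close> a priori; surjectivity is extracted from the universal
  property, by showing that the image subgroup is everything. Finally, a section of
  \<open>\<Phi>\<close> is not assumed equivariant, so \<open>n\<close> depends at the outset on
  both \<open>p\<close> and \<open>y\<close>, and it exists only locally. Its uniqueness makes it a
  map on \<open>\<pi> \<times> VQ\<close>, to which connectedness and generation apply. That the
  section is a map of graphs enters through its edge component: an edge has a single deviation,
  which serves both of its ends. Homomorphisms out of a graph of groups are encoded on vertices
  throughout, because a map to a constant graph is determined there.\<close>

lemma is_coequaliser_hom:
  assumes "is_coequaliser C A B f g Q q"
  shows "f \<in> Hom C A B" "g \<in> Hom C A B" "q \<in> Hom C B Q" "q \<cdot>\<^bsub>C\<^esub> f = q \<cdot>\<^bsub>C\<^esub> g"
  using assms by (auto simp: is_coequaliser_def)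

locale Cat =
  fixes C :: "('o, 'a) cat" (structure)
  assumes category: "category C"
begin

lemma Hom_Obj: assumes "f \<in> Hom C A B" shows "A \<in> Obj C" "B \<in> Obj C"
  using category assms unfolding category_def by blast+

lemma Id_in [simp]: "A \<in> Obj C \<Longrightarrow> Id C A \<in> Hom C A A"
  using category unfolding category_def by blast

lemma comp_in [intro]: "g \<in> Hom C B D \<Longrightarrow> f \<in> Hom C A B \<Longrightarrow> g \<cdot> f \<in> Hom C A D"
  using category unfolding category_def by blast

lemma comp_Id [simp]: "f \<in> Hom C A B \<Longrightarrow> f \<cdot> Id C A = f"
  using category unfolding category_def by blast

lemma Id_comp [simp]: "f \<in> Hom C A B \<Longrightarrow> Id C B \<cdot> f = f"
  using category unfolding category_def by blast

lemma comp_assoc: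
  "h \<in> Hom C D E \<Longrightarrow> f \<in> Hom C A B \<Longrightarrow> g \<in> Hom C B D \<Longrightarrow> (h \<cdot> g) \<cdot> f = h \<cdot> (g \<cdot> f)"
  using category unfolding category_def by blast

text \<open>Associativity holds only for typed arrows, so a known composite cannot simply be
  rewritten inside a longer one. This is the rewriting step used throughout, with the typing as
  premises.\<close>

lemma comp_reduce:
  assumes "g \<cdot> f = k" "f \<in> Hom C A B" "g \<in> Hom C B D" "x \<in> Hom C Z A"
  shows "g \<cdot> (f \<cdot> x) = k \<cdot> x"
  using comp_assoc[OF assms(3,4,2)] assms(1) by simp

lemma tuple_is_product:
  assumes "is_product C A B P p q" "f \<in> Hom C Z A" "g \<in> Hom C Z B"
  shows "tuple C Z P p q f g \<in> Hom C Z P" "p \<cdot> tuple C Z P p q f g = f"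
    "q \<cdot> tuple C Z P p q f g = g"
proof -
  have "\<exists>!u. u \<in> Hom C Z P \<and> p \<cdot> u = f \<and> q \<cdot> u = g"
    using assms unfolding is_product_def by blast
  from theI'[OF this] show "tuple C Z P p q f g \<in> Hom C Z P" "p \<cdot> tuple C Z P p q f g = f"
    "q \<cdot> tuple C Z P p q f g = g" unfolding tuple_def by auto
qed

lemma is_product_hom:
  assumes "is_product C A B P p q"
  shows "p \<in> Hom C P A" "q \<in> Hom C P B"
  using assms unfolding is_product_def by auto

lemma is_product_ext:
  assumes "is_product C A B P p q" "u \<in> Hom C Z P" "v \<in> Hom C Z P" "p \<cdot> u = p \<cdot> v" "q \<cdot> u = q \<cdot> v"
  shows "u = v"
proof -
  have "p \<cdot> u \<in> Hom C Z A" "q \<cdot> u \<in> Hom C Z B"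
    using assms is_product_hom by blast+
  then have "\<exists>!w. w \<in> Hom C Z P \<and> p \<cdot> w = p \<cdot> u \<and> q \<cdot> w = q \<cdot> u"
    using assms(1) unfolding is_product_def by blast
  then show ?thesis using assms by metis
qed

lemma tuple_is_pullback:
  assumes "is_pullback C A B D f g P p q" "x \<in> Hom C Z A" "y \<in> Hom C Z B" "f \<cdot> x = g \<cdot> y"
  shows "tuple C Z P p q x y \<in> Hom C Z P" "p \<cdot> tuple C Z P p q x y = x"
    "q \<cdot> tuple C Z P p q x y = y"
proof -
  have "\<exists>!u. u \<in> Hom C Z P \<and> p \<cdot> u = x \<and> q \<cdot> u = y"
    using assms unfolding is_pullback_def by blast
  from theI'[OF this] show "tuple C Z P p q x y \<in> Hom C Z P" "p \<cdot> tuple C Z P p q x y = x"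
    "q \<cdot> tuple C Z P p q x y = y" unfolding tuple_def by auto
qed

lemma is_pullback_hom:
  assumes "is_pullback C A B D f g P p q"
  shows "f \<in> Hom C A D" "g \<in> Hom C B D" "p \<in> Hom C P A" "q \<in> Hom C P B" "f \<cdot> p = g \<cdot> q"
  using assms unfolding is_pullback_def by auto

lemma is_pullback_ext:
  assumes "is_pullback C A B D f g P p q"
    and "u \<in> Hom C Z P" "v \<in> Hom C Z P" "p \<cdot> u = p \<cdot> v" "q \<cdot> u = q \<cdot> v"
  shows "u = v"
proof -
  note h = is_pullback_hom[OF assms(1)]
  have "p \<cdot> u \<in> Hom C Z A" "q \<cdot> u \<in> Hom C Z B" using h(3,4) assms(2) by blast+
  moreover have "f \<cdot> (p \<cdot> u) = g \<cdot> (q \<cdot> u)"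
    using comp_assoc[OF h(1) assms(2) h(3)] comp_assoc[OF h(2) assms(2) h(4)] h(5) by simp
  ultimately have "\<exists>!w. w \<in> Hom C Z P \<and> p \<cdot> w = p \<cdot> u \<and> q \<cdot> w = q \<cdot> u"
    using assms(1) unfolding is_pullback_def by blast
  then show ?thesis using assms by metis
qed

lemma is_equaliser_hom:
  assumes "is_equaliser C A B f g E e"
  shows "f \<in> Hom C A B" "g \<in> Hom C A B" "e \<in> Hom C E A" "f \<cdot> e = g \<cdot> e"
  using assms unfolding is_equaliser_def by auto

lemma is_equaliser_ext:
  assumes "is_equaliser C A B f g E e" "u \<in> Hom C Z E" "v \<in> Hom C Z E" "e \<cdot> u = e \<cdot> v"
  shows "u = v"
proof -
  note h = is_equaliser_hom[OF assms(1)]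
  have "e \<cdot> u \<in> Hom C Z A" using h(3) assms(2) by blast
  moreover have "f \<cdot> (e \<cdot> u) = g \<cdot> (e \<cdot> u)"
    using comp_assoc[OF h(1) assms(2) h(3)] comp_assoc[OF h(2) assms(2) h(3)] h(4) by simp
  ultimately have "\<exists>!w. w \<in> Hom C Z E \<and> e \<cdot> w = e \<cdot> u"
    using assms(1) unfolding is_equaliser_def by blast
  then show ?thesis using assms by metis
qed

lemma factor_is_equaliser:
  assumes "is_equaliser C A B f g E e" "x \<in> Hom C Z A" "f \<cdot> x = g \<cdot> x"
  shows "factor C Z E e x \<in> Hom C Z E" "e \<cdot> factor C Z E e x = x"
proof -
  have "\<exists>!u. u \<in> Hom C Z E \<and> e \<cdot> u = x" using assms unfolding is_equaliser_def by blast
  from theI'[OF this] show "factor C Z E e x \<in> Hom C Z E" "e \<cdot> factor C Z E e x = x"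
    unfolding factor_def by auto
qed

lemma is_equaliser_mono: "is_equaliser C A B f g E e \<Longrightarrow> is_mono C E A e"
  unfolding is_mono_def using is_equaliser_hom(3) by (blast intro: is_equaliser_ext)

lemma is_coequaliser_ext:
  assumes "is_coequaliser C A B f g Q q" "u \<in> Hom C Q Z" "v \<in> Hom C Q Z" "u \<cdot> q = v \<cdot> q"
  shows "u = v"
proof -
  note h = is_coequaliser_hom[OF assms(1)]
  have "u \<cdot> q \<in> Hom C B Z" using h(3) assms(2) by blast
  moreover have "(u \<cdot> q) \<cdot> f = (u \<cdot> q) \<cdot> g"
    using comp_assoc[OF assms(2) h(1) h(3)] comp_assoc[OF assms(2) h(2) h(3)] h(4) by simp
  ultimately have "\<exists>!w. w \<in> Hom C Q Z \<and> w \<cdot> q = u \<cdot> q"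
    using assms(1) unfolding is_coequaliser_def by blast
  then show ?thesis using assms by metis
qed

lemma is_coequaliser_factor:
  assumes "is_coequaliser C A B f g Q q" "x \<in> Hom C B Z" "x \<cdot> f = x \<cdot> g"
  obtains u where "u \<in> Hom C Q Z" "u \<cdot> q = x"
  using assms unfolding is_coequaliser_def by blast

lemma cofactor_is_coequaliser:
  assumes "is_coequaliser C A B f g Q q" "x \<in> Hom C B Z" "x \<cdot> f = x \<cdot> g"
  shows "cofactor C Q Z q x \<in> Hom C Q Z" "cofactor C Q Z q x \<cdot> q = x"
proof -
  have "\<exists>!u. u \<in> Hom C Q Z \<and> u \<cdot> q = x" using assms unfolding is_coequaliser_def by blast
  from theI'[OF this] show "cofactor C Q Z q x \<in> Hom C Q Z" "cofactor C Q Z q x \<cdot> q = x"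
    unfolding cofactor_def by auto
qed

lemma is_coequaliserI:
  assumes "f \<in> Hom C A B" "g \<in> Hom C A B" "q \<in> Hom C B Q" "q \<cdot> f = q \<cdot> g"
    and "\<And>Z x. x \<in> Hom C B Z \<Longrightarrow> x \<cdot> f = x \<cdot> g \<Longrightarrow> \<exists>u \<in> Hom C Q Z. u \<cdot> q = x"
    and "\<And>Z u v. u \<in> Hom C Q Z \<Longrightarrow> v \<in> Hom C Q Z \<Longrightarrow> u \<cdot> q = v \<cdot> q \<Longrightarrow> u = v"
  shows "is_coequaliser C A B f g Q q"
  unfolding is_coequaliser_def
proof (intro conjI allI ballI impI assms(1-4))
  fix Z x assume a: "x \<in> Hom C B Z" "x \<cdot> f = x \<cdot> g"
  obtain u where u: "u \<in> Hom C Q Z" "u \<cdot> q = x" using assms(5)[OF a] by blast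
  show "\<exists>!u. u \<in> Hom C Q Z \<and> u \<cdot> q = x"
    by (rule ex1I[of _ u]) (use u assms(6) in auto)
qed

lemma is_equaliserI:
  assumes "f \<in> Hom C A B" "g \<in> Hom C A B" "e \<in> Hom C E A" "f \<cdot> e = g \<cdot> e"
    and "\<And>Z x. x \<in> Hom C Z A \<Longrightarrow> f \<cdot> x = g \<cdot> x \<Longrightarrow> \<exists>u \<in> Hom C Z E. e \<cdot> u = x"
    and "\<And>Z u v. u \<in> Hom C Z E \<Longrightarrow> v \<in> Hom C Z E \<Longrightarrow> e \<cdot> u = e \<cdot> v \<Longrightarrow> u = v"
  shows "is_equaliser C A B f g E e"
  unfolding is_equaliser_def
proof (intro conjI allI ballI impI assms(1-4))
  fix Z x assume a: "x \<in> Hom C Z A" "f \<cdot> x = g \<cdot> x"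
  obtain u where u: "u \<in> Hom C Z E" "e \<cdot> u = x" using assms(5)[OF a] by blast
  show "\<exists>!u. u \<in> Hom C Z E \<and> e \<cdot> u = x"
    by (rule ex1I[of _ u]) (use u assms(6) in auto)
qed

lemma is_pullbackI:
  assumes "f \<in> Hom C A D" "g \<in> Hom C B D" "p \<in> Hom C P A" "q \<in> Hom C P B" "f \<cdot> p = g \<cdot> q"
    and "\<And>Z x y. x \<in> Hom C Z A \<Longrightarrow> y \<in> Hom C Z B \<Longrightarrow> f \<cdot> x = g \<cdot> y \<Longrightarrow>
           \<exists>u \<in> Hom C Z P. p \<cdot> u = x \<and> q \<cdot> u = y"
    and "\<And>Z u v. u \<in> Hom C Z P \<Longrightarrow> v \<in> Hom C Z P \<Longrightarrow> p \<cdot> u = p \<cdot> v \<Longrightarrow> q \<cdot> u = q \<cdot> v \<Longrightarrow> u = v"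
  shows "is_pullback C A B D f g P p q"
  unfolding is_pullback_def
proof (intro conjI allI ballI impI assms(1-5))
  fix Z x y assume a: "x \<in> Hom C Z A" "y \<in> Hom C Z B" "f \<cdot> x = g \<cdot> y"
  obtain u where u: "u \<in> Hom C Z P" "p \<cdot> u = x" "q \<cdot> u = y" using assms(6)[OF a] by blast
  show "\<exists>!u. u \<in> Hom C Z P \<and> p \<cdot> u = x \<and> q \<cdot> u = y"
    by (rule ex1I[of _ u]) (use u assms(7) in auto)
qed

lemma is_productI:
  assumes "p \<in> Hom C P A" "q \<in> Hom C P B"
    and "\<And>Z x y. x \<in> Hom C Z A \<Longrightarrow> y \<in> Hom C Z B \<Longrightarrow> \<exists>u \<in> Hom C Z P. p \<cdot> u = x \<and> q \<cdot> u = y"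
    and "\<And>Z u v. u \<in> Hom C Z P \<Longrightarrow> v \<in> Hom C Z P \<Longrightarrow> p \<cdot> u = p \<cdot> v \<Longrightarrow> q \<cdot> u = q \<cdot> v \<Longrightarrow> u = v"
  shows "is_product C A B P p q"
  unfolding is_product_def
proof (intro conjI allI ballI impI assms(1-2))
  fix Z x y assume a: "x \<in> Hom C Z A" "y \<in> Hom C Z B"
  obtain u where u: "u \<in> Hom C Z P" "p \<cdot> u = x" "q \<cdot> u = y" using assms(3)[OF a] by blast
  show "\<exists>!u. u \<in> Hom C Z P \<and> p \<cdot> u = x \<and> q \<cdot> u = y"
    by (rule ex1I[of _ u]) (use u assms(4) in auto)
qed

lemma coequaliser_exists:
  assumes "is_coequaliser C A B f g Q q"
  shows "is_coequaliser C A B f g (fst (coequaliser C A B f g)) (snd (coequaliser C A B f g))"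
proof -
  have "(\<lambda>(Q, q). is_coequaliser C A B f g Q q) (coequaliser C A B f g)"
    unfolding coequaliser_def by (rule someI[of _ "(Q, q)"]) (use assms in simp)
  then show ?thesis by (simp add: case_prod_unfold)
qed

lemma equaliser_exists:
  assumes "is_equaliser C A B f g Q q"
  shows "is_equaliser C A B f g (fst (equaliser C A B f g)) (snd (equaliser C A B f g))"
proof -
  have "(\<lambda>(Q, q). is_equaliser C A B f g Q q) (equaliser C A B f g)"
    unfolding equaliser_def by (rule someI[of _ "(Q, q)"]) (use assms in simp)
  then show ?thesis by (simp add: case_prod_unfold)
qed

lemma pullback_exists:
  assumes "is_pullback C A B D f g P p q"
  shows "is_pullback C A B D f g (fst (pullback C A B D f g)) (fst (snd (pullback C A B D f g)))
           (snd (snd (pullback C A B D f g)))"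
proof -
  have "(\<lambda>(P, p, q). is_pullback C A B D f g P p q) (pullback C A B D f g)"
    unfolding pullback_def by (rule someI[of _ "(P, p, q)"]) (use assms in simp)
  then show ?thesis by (simp add: case_prod_unfold)
qed

section \<open>Uniqueness of universal cones up to isomorphism, and transport along
  isomorphisms\<close>

lemma is_coequaliser_unique:
  assumes "is_coequaliser C A B f g Q q" "is_coequaliser C A B f g Q' q'"
  obtains u v where "u \<in> Hom C Q Q'" "v \<in> Hom C Q' Q" "u \<cdot> q = q'" "v \<cdot> q' = q"
    "v \<cdot> u = Id C Q" "u \<cdot> v = Id C Q'"
proof -
  note h = is_coequaliser_hom[OF assms(1)] and h' = is_coequaliser_hom[OF assms(2)]
  obtain u where u: "u \<in> Hom C Q Q'" "u \<cdot> q = q'"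
    using is_coequaliser_factor[OF assms(1)] h' by metis
  obtain v where v: "v \<in> Hom C Q' Q" "v \<cdot> q' = q"
    using is_coequaliser_factor[OF assms(2)] h by metis
  have "v \<cdot> u = Id C Q"
    by (rule is_coequaliser_ext[OF assms(1)])
       (use u v h Hom_Obj in \<open>auto simp: comp_assoc[of _ _ _ _ B] intro!: Id_in\<close>)
  moreover have "u \<cdot> v = Id C Q'"
    by (rule is_coequaliser_ext[OF assms(2)])
       (use u v h' Hom_Obj in \<open>auto simp: comp_assoc[of _ _ _ _ B] intro!: Id_in\<close>)
  ultimately show thesis using u v that by blast
qed

lemma is_pullback_unique:
  assumes "is_pullback C A B D f g P p q" "is_pullback C A B D f g P' p' q'"
  obtains u v where "u \<in> Hom C P P'" "v \<in> Hom C P' P" "p' \<cdot> u = p" "q' \<cdot> u = q"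
    "p \<cdot> v = p'" "q \<cdot> v = q'" "v \<cdot> u = Id C P" "u \<cdot> v = Id C P'"
proof -
  note h = is_pullback_hom[OF assms(1)] and h' = is_pullback_hom[OF assms(2)]
  define u where "u = tuple C P P' p' q' p q"
  define v where "v = tuple C P' P p q p' q'"
  have u: "u \<in> Hom C P P'" "p' \<cdot> u = p" "q' \<cdot> u = q"
    using tuple_is_pullback[OF assms(2) h(3,4,5)] by (auto simp: u_def)
  have v: "v \<in> Hom C P' P" "p \<cdot> v = p'" "q \<cdot> v = q'"
    using tuple_is_pullback[OF assms(1) h'(3,4,5)] by (auto simp: v_def)
  have "v \<cdot> u = Id C P"
  proof (rule is_pullback_ext[OF assms(1)])
    show "p \<cdot> (v \<cdot> u) = p \<cdot> Id C P" "q \<cdot> (v \<cdot> u) = q \<cdot> Id C P"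
      using u v h comp_assoc by (metis comp_Id)+
  qed (use u v h Hom_Obj in auto)
  moreover have "u \<cdot> v = Id C P'"
  proof (rule is_pullback_ext[OF assms(2)])
    show "p' \<cdot> (u \<cdot> v) = p' \<cdot> Id C P'" "q' \<cdot> (u \<cdot> v) = q' \<cdot> Id C P'"
      using u v h' comp_assoc by (metis comp_Id)+
  qed (use u v h' Hom_Obj in auto)
  ultimately show thesis using u v that by blast
qed

lemma is_equaliser_unique:
  assumes "is_equaliser C A B f g P p" "is_equaliser C A B f g P' p'"
  obtains u v where "u \<in> Hom C P P'" "v \<in> Hom C P' P" "p' \<cdot> u = p" "p \<cdot> v = p'"
    "v \<cdot> u = Id C P" "u \<cdot> v = Id C P'"
proof -
  note h = is_equaliser_hom[OF assms(1)] and h' = is_equaliser_hom[OF assms(2)]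
  define u where "u = factor C P P' p' p"
  define v where "v = factor C P' P p p'"
  have u: "u \<in> Hom C P P'" "p' \<cdot> u = p"
    using factor_is_equaliser[OF assms(2) h(3,4)] by (auto simp: u_def)
  have v: "v \<in> Hom C P' P" "p \<cdot> v = p'"
    using factor_is_equaliser[OF assms(1) h'(3,4)] by (auto simp: v_def)
  have "v \<cdot> u = Id C P"
  proof (rule is_equaliser_ext[OF assms(1)])
    show "p \<cdot> (v \<cdot> u) = p \<cdot> Id C P"
      using u v h comp_assoc by (metis comp_Id)
  qed (use u v h Hom_Obj in auto)
  moreover have "u \<cdot> v = Id C P'"
  proof (rule is_equaliser_ext[OF assms(2)])
    show "p' \<cdot> (u \<cdot> v) = p' \<cdot> Id C P'"
      using u v h' comp_assoc by (metis comp_Id)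
  qed (use u v h' Hom_Obj in auto)
  ultimately show thesis using u v that by blast
qed

text \<open>Used, like its analogues for pullbacks and equalisers, to pass from a cone built by hand
  to an arbitrary one, in particular to the one picked by choice.\<close>

lemma is_coequaliser_transport:
  assumes "is_coequaliser C A B f g Q q" "u \<in> Hom C Q Q'" "v \<in> Hom C Q' Q"
    "v \<cdot> u = Id C Q" "u \<cdot> v = Id C Q'"
  shows "is_coequaliser C A B f g Q' (u \<cdot> q)"
proof (rule is_coequaliserI)
  note h = is_coequaliser_hom[OF assms(1)]
  show "f \<in> Hom C A B" "g \<in> Hom C A B" "u \<cdot> q \<in> Hom C B Q'" using h assms by auto
  show "(u \<cdot> q) \<cdot> f = (u \<cdot> q) \<cdot> g"
    using comp_assoc[OF assms(2) h(1,3)] comp_assoc[OF assms(2) h(2,3)] h by simp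
  fix Z
  { fix x assume x: "x \<in> Hom C B Z" "x \<cdot> f = x \<cdot> g"
    obtain w where w: "w \<in> Hom C Q Z" "w \<cdot> q = x" using is_coequaliser_factor[OF assms(1) x] .
    have "(w \<cdot> v) \<cdot> (u \<cdot> q) = w \<cdot> (v \<cdot> (u \<cdot> q))"
      by (rule comp_assoc) (use w h assms in auto)
    also have "\<dots> = x" using comp_reduce[OF assms(4,2,3) h(3)] w h by simp
    finally show "\<exists>u' \<in> Hom C Q' Z. u' \<cdot> (u \<cdot> q) = x" using w assms by blast }
  { fix x y assume x: "x \<in> Hom C Q' Z" "y \<in> Hom C Q' Z" "x \<cdot> (u \<cdot> q) = y \<cdot> (u \<cdot> q)"
    have "x \<cdot> u = y \<cdot> u"
      by (rule is_coequaliser_ext[OF assms(1)]) (use x h assms comp_assoc in auto)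
    then have "(x \<cdot> u) \<cdot> v = (y \<cdot> u) \<cdot> v" by simp
    then show "x = y" using comp_assoc[OF x(1) assms(3,2)] comp_assoc[OF x(2) assms(3,2)] x assms(5)
      by simp }
qed

lemma is_pullback_transport:
  assumes "is_pullback C A B D f g P p q" "u \<in> Hom C P P'" "v \<in> Hom C P' P"
    "v \<cdot> u = Id C P" "u \<cdot> v = Id C P'"
  shows "is_pullback C A B D f g P' (p \<cdot> v) (q \<cdot> v)"
proof (rule is_pullbackI)
  note h = is_pullback_hom[OF assms(1)]
  show "f \<in> Hom C A D" "g \<in> Hom C B D" "p \<cdot> v \<in> Hom C P' A" "q \<cdot> v \<in> Hom C P' B"
    using h assms by auto
  show "f \<cdot> (p \<cdot> v) = g \<cdot> (q \<cdot> v)"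
    using comp_assoc[OF h(1) assms(3) h(3)] comp_assoc[OF h(2) assms(3) h(4)] h by simp
  fix Z
  { fix x y assume x: "x \<in> Hom C Z A" "y \<in> Hom C Z B" "f \<cdot> x = g \<cdot> y"
    define w where "w = tuple C Z P p q x y"
    have w: "w \<in> Hom C Z P" "p \<cdot> w = x" "q \<cdot> w = y"
      using tuple_is_pullback[OF assms(1) x] by (auto simp: w_def)
    have uw: "u \<cdot> w \<in> Hom C Z P'" using w assms by auto
    have "v \<cdot> (u \<cdot> w) = w" using comp_reduce[OF assms(4,2,3) w(1)] w by simp
    then have "(p \<cdot> v) \<cdot> (u \<cdot> w) = x" "(q \<cdot> v) \<cdot> (u \<cdot> w) = y"
      using comp_assoc[OF h(3) uw assms(3)] comp_assoc[OF h(4) uw assms(3)] w by simp_all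
    then show "\<exists>w \<in> Hom C Z P'. (p \<cdot> v) \<cdot> w = x \<and> (q \<cdot> v) \<cdot> w = y" using w assms by blast }
  { fix x y assume x: "x \<in> Hom C Z P'" "y \<in> Hom C Z P'"
      "(p \<cdot> v) \<cdot> x = (p \<cdot> v) \<cdot> y" "(q \<cdot> v) \<cdot> x = (q \<cdot> v) \<cdot> y"
    have "v \<cdot> x = v \<cdot> y"
      by (rule is_pullback_ext[OF assms(1)]) (use x h assms comp_assoc in auto)
    then have "u \<cdot> (v \<cdot> x) = u \<cdot> (v \<cdot> y)" by simp
    then show "x = y" using comp_reduce[OF assms(5,3,2) x(1)] comp_reduce[OF assms(5,3,2) x(2)] x
      by simp }
qed

lemma is_equaliser_transport:
  assumes "is_equaliser C A B f g P p" "u \<in> Hom C P P'" "v \<in> Hom C P' P"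
    "v \<cdot> u = Id C P" "u \<cdot> v = Id C P'"
  shows "is_equaliser C A B f g P' (p \<cdot> v)"
proof (rule is_equaliserI)
  note h = is_equaliser_hom[OF assms(1)]
  show "f \<in> Hom C A B" "g \<in> Hom C A B" "p \<cdot> v \<in> Hom C P' A"
    using h assms by auto
  show "f \<cdot> (p \<cdot> v) = g \<cdot> (p \<cdot> v)"
    using comp_assoc[OF h(1) assms(3) h(3)] comp_assoc[OF h(2) assms(3) h(3)] h by simp
  fix Z
  { fix x assume x: "x \<in> Hom C Z A" "f \<cdot> x = g \<cdot> x"
    define w where "w = factor C Z P p x"
    have w: "w \<in> Hom C Z P" "p \<cdot> w = x"
      using factor_is_equaliser[OF assms(1) x] by (auto simp: w_def)
    have uw: "u \<cdot> w \<in> Hom C Z P'" using w assms by auto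
    have "v \<cdot> (u \<cdot> w) = w" using comp_reduce[OF assms(4,2,3) w(1)] w by simp
    then have "(p \<cdot> v) \<cdot> (u \<cdot> w) = x" using comp_assoc[OF h(3) uw assms(3)] w by simp
    then show "\<exists>w \<in> Hom C Z P'. (p \<cdot> v) \<cdot> w = x" using w assms by blast }
  { fix x y assume x: "x \<in> Hom C Z P'" "y \<in> Hom C Z P'" "(p \<cdot> v) \<cdot> x = (p \<cdot> v) \<cdot> y"
    have "v \<cdot> x = v \<cdot> y"
      by (rule is_equaliser_ext[OF assms(1)]) (use x h assms comp_assoc in auto)
    then have "u \<cdot> (v \<cdot> x) = u \<cdot> (v \<cdot> y)" by simp
    then show "x = y" using comp_reduce[OF assms(5,3,2) x(1)] comp_reduce[OF assms(5,3,2) x(2)] x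
      by simp }
qed

end

locale Fin_Lim = Cat C for C :: "('o, 'a) cat" (structure) +
  assumes finite_limits: "has_finite_limits C"
begin

lemma term_is_terminal: "is_terminal C (term_obj C)"
  unfolding term_obj_def using finite_limits unfolding has_finite_limits_def by (metis someI_ex)

lemma term_Obj [simp]: "term_obj C \<in> Obj C"
  using term_is_terminal unfolding is_terminal_def by blast

lemma bang_in [simp]: "A \<in> Obj C \<Longrightarrow> bang C A \<in> Hom C A (term_obj C)"
  unfolding bang_def using term_is_terminal theI'[of "\<lambda>f. f \<in> Hom C A (term_obj C)"]
  unfolding is_terminal_def by blast

lemma bang_unique: "f \<in> Hom C A (term_obj C) \<Longrightarrow> g \<in> Hom C A (term_obj C) \<Longrightarrow> f = g"
  using term_is_terminal Hom_Obj(1)[of f A] unfolding is_terminal_def by blast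

lemma bang_comp [simp]: "f \<in> Hom C A B \<Longrightarrow> bang C B \<cdot> f = bang C A"
  by (rule bang_unique[of _ A]) (auto dest: Hom_Obj intro!: comp_in[OF bang_in])

lemma Prod_is_product:
  assumes "A \<in> Obj C" "B \<in> Obj C"
  shows "is_product C A B (Prod C A B) (pr1 C A B) (pr2 C A B)"
proof -
  obtain P p q where "is_product C A B P p q"
    using assms finite_limits unfolding has_finite_limits_def by blast
  then have "(\<lambda>(P, p, q). is_product C A B P p q) (product C A B)"
    unfolding product_def by (rule_tac someI[of _ "(P, p, q)"]) simp
  then show ?thesis unfolding Prod_def pr1_def pr2_def by (simp add: case_prod_unfold)
qed

lemma pr_in [simp]:
  assumes "A \<in> Obj C" "B \<in> Obj C"
  shows "pr1 C A B \<in> Hom C (Prod C A B) A" "pr2 C A B \<in> Hom C (Prod C A B) B"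
  using Prod_is_product[OF assms] is_product_hom by blast+

lemma comp_pr_in [intro]:
  assumes "A \<in> Obj C" "B \<in> Obj C" "u \<in> Hom C Z (Prod C A B)"
  shows "pr1 C A B \<cdot> u \<in> Hom C Z A" "pr2 C A B \<cdot> u \<in> Hom C Z B"
  using comp_in[OF pr_in(1) assms(3)] comp_in[OF pr_in(2) assms(3)] assms by auto

lemma pr_assoc:
  assumes "A \<in> Obj C" "B \<in> Obj C" "h \<in> Hom C Z' Z" "u \<in> Hom C Z (Prod C A B)"
  shows "(pr1 C A B \<cdot> u) \<cdot> h = pr1 C A B \<cdot> (u \<cdot> h)" "(pr2 C A B \<cdot> u) \<cdot> h = pr2 C A B \<cdot> (u \<cdot> h)"
  using comp_assoc[OF pr_in(1) assms(3,4)] comp_assoc[OF pr_in(2) assms(3,4)] assms by auto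

lemma Prod_Obj [simp]: "A \<in> Obj C \<Longrightarrow> B \<in> Obj C \<Longrightarrow> Prod C A B \<in> Obj C"
  using pr_in Hom_Obj by blast

lemma pair_in [intro]:
  assumes "f \<in> Hom C Z A" "g \<in> Hom C Z B"
  shows "pair C Z A B f g \<in> Hom C Z (Prod C A B)"
  unfolding pair_def
  using tuple_is_product(1)[OF Prod_is_product[OF Hom_Obj(2)[OF assms(1)] Hom_Obj(2)[OF assms(2)]] assms] .

lemma pr_pair [simp]:
  assumes "f \<in> Hom C Z A" "g \<in> Hom C Z B"
  shows "pr1 C A B \<cdot> pair C Z A B f g = f" "pr2 C A B \<cdot> pair C Z A B f g = g"
  unfolding pair_def
  using tuple_is_product(2,3)[OF Prod_is_product[OF Hom_Obj(2)[OF assms(1)] Hom_Obj(2)[OF assms(2)]] assms]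
  by auto

lemma pair_ext:
  assumes "u \<in> Hom C Z (Prod C A B)" "v \<in> Hom C Z (Prod C A B)" "A \<in> Obj C" "B \<in> Obj C"
    "pr1 C A B \<cdot> u = pr1 C A B \<cdot> v" "pr2 C A B \<cdot> u = pr2 C A B \<cdot> v"
  shows "u = v"
  using is_product_ext[OF Prod_is_product] assms by blast

lemma pair_comp:
  assumes "h \<in> Hom C Z' Z" "f \<in> Hom C Z A" "g \<in> Hom C Z B"
  shows "pair C Z A B f g \<cdot> h = pair C Z' A B (f \<cdot> h) (g \<cdot> h)"
proof -
  have o: "A \<in> Obj C" "B \<in> Obj C" using assms Hom_Obj by auto
  have *: "pair C Z A B f g \<in> Hom C Z (Prod C A B)" using assms by auto
  have **: "f \<cdot> h \<in> Hom C Z' A" "g \<cdot> h \<in> Hom C Z' B" using assms by auto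
  show ?thesis
  proof (rule pair_ext[OF _ _ o])
    show "pair C Z A B f g \<cdot> h \<in> Hom C Z' (Prod C A B)" using * assms by auto
    show "pair C Z' A B (f \<cdot> h) (g \<cdot> h) \<in> Hom C Z' (Prod C A B)" using ** by auto
    show "pr1 C A B \<cdot> (pair C Z A B f g \<cdot> h) = pr1 C A B \<cdot> pair C Z' A B (f \<cdot> h) (g \<cdot> h)"
      using comp_assoc[OF pr_in(1)[OF o] assms(1) *] assms ** by simp
    show "pr2 C A B \<cdot> (pair C Z A B f g \<cdot> h) = pr2 C A B \<cdot> pair C Z' A B (f \<cdot> h) (g \<cdot> h)"
      using comp_assoc[OF pr_in(2)[OF o] assms(1) *] assms ** by simp
  qed
qed

lemma pair_eta:
  assumes "u \<in> Hom C Z (Prod C A B)" "A \<in> Obj C" "B \<in> Obj C"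
  shows "pair C Z A B (pr1 C A B \<cdot> u) (pr2 C A B \<cdot> u) = u"
proof -
  have "pr1 C A B \<cdot> u \<in> Hom C Z A" "pr2 C A B \<cdot> u \<in> Hom C Z B" using assms pr_in by blast+
  then show ?thesis using assms by (rule_tac pair_ext[of _ Z A B]) auto
qed

lemma pair_pr [simp]:
  assumes "A \<in> Obj C" "B \<in> Obj C"
  shows "pair C (Prod C A B) A B (pr1 C A B) (pr2 C A B) = Id C (Prod C A B)"
  using pair_eta[OF Id_in, of A B] pr_in[OF assms] assms by simp

lemma pmap_in [intro]:
  assumes "f \<in> Hom C A A'" "g \<in> Hom C B B'"
  shows "pmap C A B A' B' f g \<in> Hom C (Prod C A B) (Prod C A' B')"
proof -
  have "A \<in> Obj C" "B \<in> Obj C" using assms Hom_Obj by auto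
  then show ?thesis unfolding pmap_def using assms pr_in by (blast intro: comp_in pair_in)
qed

lemma pmap_pair [simp]:
  assumes "f \<in> Hom C A A'" "g \<in> Hom C B B'" "x \<in> Hom C Z A" "y \<in> Hom C Z B"
  shows "pmap C A B A' B' f g \<cdot> pair C Z A B x y = pair C Z A' B' (f \<cdot> x) (g \<cdot> y)"
proof -
  have o: "A \<in> Obj C" "B \<in> Obj C" using assms Hom_Obj by auto
  have p: "pair C Z A B x y \<in> Hom C Z (Prod C A B)" using assms by auto
  have "f \<cdot> pr1 C A B \<in> Hom C (Prod C A B) A'" "g \<cdot> pr2 C A B \<in> Hom C (Prod C A B) B'"
    using assms o pr_in by blast+
  then show ?thesis unfolding pmap_def
    using assms pair_comp[OF p] comp_assoc[OF assms(1) p] comp_assoc[OF assms(2) p] o by simp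
qed

lemma pmap_eq:
  assumes "f \<in> Hom C A A'" "g \<in> Hom C B B'" "u \<in> Hom C Z (Prod C A B)"
  shows "pmap C A B A' B' f g \<cdot> u = pair C Z A' B' (f \<cdot> (pr1 C A B \<cdot> u)) (g \<cdot> (pr2 C A B \<cdot> u))"
proof -
  have o: "A \<in> Obj C" "B \<in> Obj C" using assms Hom_Obj by auto
  have "pr1 C A B \<cdot> u \<in> Hom C Z A" "pr2 C A B \<cdot> u \<in> Hom C Z B" using assms o pr_in by blast+
  then show ?thesis using pmap_pair[OF assms(1,2)] pair_eta[OF assms(3) o] by metis
qed

lemma pr_pmap [simp]:
  assumes "f \<in> Hom C A A'" "g \<in> Hom C B B'"
  shows "pr1 C A' B' \<cdot> pmap C A B A' B' f g = f \<cdot> pr1 C A B"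
    "pr2 C A' B' \<cdot> pmap C A B A' B' f g = g \<cdot> pr2 C A B"
proof -
  have o: "A \<in> Obj C" "B \<in> Obj C" using assms Hom_Obj by auto
  have "f \<cdot> pr1 C A B \<in> Hom C (Prod C A B) A'" "g \<cdot> pr2 C A B \<in> Hom C (Prod C A B) B'"
    using assms o pr_in by blast+
  then show "pr1 C A' B' \<cdot> pmap C A B A' B' f g = f \<cdot> pr1 C A B"
    "pr2 C A' B' \<cdot> pmap C A B A' B' f g = g \<cdot> pr2 C A B"
    unfolding pmap_def by auto
qed

lemma Id_comp2: "g \<in> Hom C B D \<Longrightarrow> f \<in> Hom C A B \<Longrightarrow> Id C D \<cdot> (g \<cdot> f) = g \<cdot> f"
  by (rule Id_comp) auto

lemma Id_comp_pr:
  assumes "A \<in> Obj C" "B \<in> Obj C" "u \<in> Hom C Z (Prod C A B)"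
  shows "Id C A \<cdot> (pr1 C A B \<cdot> u) = pr1 C A B \<cdot> u" "Id C B \<cdot> (pr2 C A B \<cdot> u) = pr2 C A B \<cdot> u"
  using comp_pr_in[OF assms] by auto

lemmas cat_simps = comp_in comp_assoc comp_pr_in pr_assoc pair_in pair_comp pmap_in Hom_Obj
  Id_comp2 Id_comp_pr

lemma ex_equaliser:
  assumes "f \<in> Hom C A B" "g \<in> Hom C A B"
  obtains E e where "is_equaliser C A B f g E e"
  using assms finite_limits unfolding has_finite_limits_def by blast

text \<open>The usual construction: the equaliser of the two composites from the product to
  \<open>D\<close>.\<close>

lemma ex_pullback:
  assumes "f \<in> Hom C A D" "g \<in> Hom C B D"
  obtains P p q where "is_pullback C A B D f g P p q"
proof -
  have [simp]: "A \<in> Obj C" "B \<in> Obj C" using assms Hom_Obj by auto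
  let ?p = "pr1 C A B" and ?q = "pr2 C A B"
  have pq: "?p \<in> Hom C (Prod C A B) A" "?q \<in> Hom C (Prod C A B) B" by auto
  obtain E e where e: "is_equaliser C (Prod C A B) D (f \<cdot> ?p) (g \<cdot> ?q) E e"
    using ex_equaliser comp_in[OF assms(1) pq(1)] comp_in[OF assms(2) pq(2)] by blast
  note h = is_equaliser_hom[OF e]
  have "is_pullback C A B D f g E (?p \<cdot> e) (?q \<cdot> e)"
  proof (rule is_pullbackI[OF assms])
    show "?p \<cdot> e \<in> Hom C E A" "?q \<cdot> e \<in> Hom C E B" using h pq by auto
    show "f \<cdot> (?p \<cdot> e) = g \<cdot> (?q \<cdot> e)"
      using comp_assoc[OF assms(1) h(3) pq(1)] comp_assoc[OF assms(2) h(3) pq(2)] h(4) by simp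
    fix Z
    { fix x y assume x: "x \<in> Hom C Z A" "y \<in> Hom C Z B" "f \<cdot> x = g \<cdot> y"
      have xy: "pair C Z A B x y \<in> Hom C Z (Prod C A B)" using x by auto
      have "(f \<cdot> ?p) \<cdot> pair C Z A B x y = (g \<cdot> ?q) \<cdot> pair C Z A B x y"
        using comp_assoc[OF assms(1) xy pq(1)] comp_assoc[OF assms(2) xy pq(2)] x by simp
      from factor_is_equaliser[OF e xy this] obtain u where "u \<in> Hom C Z E" "e \<cdot> u = pair C Z A B x y"
        by blast
      then have "(?p \<cdot> e) \<cdot> u = x \<and> (?q \<cdot> e) \<cdot> u = y"
        using comp_assoc[OF pq(1) _ h(3)] comp_assoc[OF pq(2) _ h(3)] x by simp
      then show "\<exists>u \<in> Hom C Z E. (?p \<cdot> e) \<cdot> u = x \<and> (?q \<cdot> e) \<cdot> u = y"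
        using \<open>u \<in> Hom C Z E\<close> by blast }
    { fix u v assume u: "u \<in> Hom C Z E" "v \<in> Hom C Z E"
        "(?p \<cdot> e) \<cdot> u = (?p \<cdot> e) \<cdot> v" "(?q \<cdot> e) \<cdot> u = (?q \<cdot> e) \<cdot> v"
      have "e \<cdot> u = e \<cdot> v"
        by (rule pair_ext[of _ Z A B]) (use u h comp_assoc[OF pq(1) _ h(3)] comp_assoc[OF pq(2) _ h(3)] in auto)
      then show "u = v" using is_equaliser_ext[OF e] u by blast }
  qed
  then show thesis using that by blast
qed

end

section \<open>Group objects\<close>

context Fin_Lim
begin

text \<open>The neutral element at stage \<open>Z\<close>, as a generalised element
  \<open>Z \<rightarrow> gob K\<close>.\<close>

abbreviation gone :: "'o \<Rightarrow> ('o, 'a) grp \<Rightarrow> 'a" where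
  "gone Z K \<equiv> gunit K \<cdot> bang C Z"

text \<open>Only the typing of the multiplication is assumed, because this is needed while the group
  axioms of a construction are still being checked.\<close>

lemma gop_in_of_mul:
  assumes "gmul K \<in> Hom C (Prod C (gob K) (gob K)) (gob K)" "x \<in> Hom C Z (gob K)" "y \<in> Hom C Z (gob K)"
  shows "gop C Z K x y \<in> Hom C Z (gob K)"
  unfolding gop_def using assms by (simp add: cat_simps)

lemma gop_comp_of_mul:
  assumes "gmul K \<in> Hom C (Prod C (gob K) (gob K)) (gob K)" "c \<in> Hom C Z' Z"
    "x \<in> Hom C Z (gob K)" "y \<in> Hom C Z (gob K)"
  shows "gop C Z K x y \<cdot> c = gop C Z' K (x \<cdot> c) (y \<cdot> c)"
  unfolding gop_def using assms by (simp add: cat_simps)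

lemma group_object_hom:
  assumes "group_object C K"
  shows "gob K \<in> Obj C" "gmul K \<in> Hom C (Prod C (gob K) (gob K)) (gob K)"
    "ginv K \<in> Hom C (gob K) (gob K)" "gunit K \<in> Hom C (term_obj C) (gob K)"
  using assms unfolding group_object_def Let_def by auto

lemma gop_in [intro]:
  assumes "group_object C K" "x \<in> Hom C Z (gob K)" "y \<in> Hom C Z (gob K)"
  shows "gop C Z K x y \<in> Hom C Z (gob K)"
  using gop_in_of_mul group_object_hom assms by blast

lemma gop_comp:
  assumes "group_object C K" "c \<in> Hom C Z' Z" "x \<in> Hom C Z (gob K)" "y \<in> Hom C Z (gob K)"
  shows "gop C Z K x y \<cdot> c = gop C Z' K (x \<cdot> c) (y \<cdot> c)"
  using gop_comp_of_mul[OF group_object_hom(2)] assms by blast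

lemma ginv_in [intro]:
  assumes "group_object C K" "x \<in> Hom C Z (gob K)"
  shows "ginv K \<cdot> x \<in> Hom C Z (gob K)"
  using assms group_object_hom by blast

lemma ginv_assoc:
  assumes "group_object C K" "c \<in> Hom C Z' Z" "x \<in> Hom C Z (gob K)"
  shows "(ginv K \<cdot> x) \<cdot> c = ginv K \<cdot> (x \<cdot> c)"
  using comp_assoc[OF group_object_hom(3)[OF assms(1)] assms(2,3)] .

lemma gone_in [intro]:
  assumes "group_object C K" "Z \<in> Obj C"
  shows "gone Z K \<in> Hom C Z (gob K)"
  using assms group_object_hom bang_in by blast

lemma gone_comp_of_unit:
  assumes "gunit K \<in> Hom C (term_obj C) (gob K)" "c \<in> Hom C Z' Z"
  shows "gone Z K \<cdot> c = gone Z' K"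
  using comp_assoc[OF assms bang_in] Hom_Obj[OF assms(2)] assms(2) by simp

lemma gone_comp:
  assumes "group_object C K" "c \<in> Hom C Z' Z"
  shows "gone Z K \<cdot> c = gone Z' K"
  using gone_comp_of_unit group_object_hom(4) assms by blast

text \<open>Yoneda: the diagrams in the definition are the identities for generic elements, namely
  the three projections of the triple product and the identity of \<open>gob K\<close>. All later
  constructions of groups are verified on elements through this rule.\<close>

lemma group_objectI:
  assumes "gob K \<in> Obj C" "gmul K \<in> Hom C (Prod C (gob K) (gob K)) (gob K)"
    "ginv K \<in> Hom C (gob K) (gob K)" "gunit K \<in> Hom C (term_obj C) (gob K)"
    and "\<And>Z x y z. x \<in> Hom C Z (gob K) \<Longrightarrow> y \<in> Hom C Z (gob K) \<Longrightarrow> z \<in> Hom C Z (gob K) \<Longrightarrow>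
           gop C Z K (gop C Z K x y) z = gop C Z K x (gop C Z K y z)"
    and "\<And>Z x. x \<in> Hom C Z (gob K) \<Longrightarrow> gop C Z K (gone Z K) x = x"
    and "\<And>Z x. x \<in> Hom C Z (gob K) \<Longrightarrow> gop C Z K x (gone Z K) = x"
    and "\<And>Z x. x \<in> Hom C Z (gob K) \<Longrightarrow> gop C Z K (ginv K \<cdot> x) x = gone Z K"
    and "\<And>Z x. x \<in> Hom C Z (gob K) \<Longrightarrow> gop C Z K x (ginv K \<cdot> x) = gone Z K"
  shows "group_object C K"
proof -
  let ?G = "gob K"
  have pr: "pr1 C ?G ?G \<in> Hom C (Prod C ?G ?G) ?G" "pr2 C ?G ?G \<in> Hom C (Prod C ?G ?G) ?G"
    "pr1 C (Prod C ?G ?G) ?G \<in> Hom C (Prod C (Prod C ?G ?G) ?G) (Prod C ?G ?G)"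
    "pr2 C (Prod C ?G ?G) ?G \<in> Hom C (Prod C (Prod C ?G ?G) ?G) ?G"
    using assms(1) by auto
  have i: "Id C ?G \<in> Hom C ?G ?G" using assms(1) by simp
  show ?thesis
    unfolding group_object_def Let_def
    using assms(1-4) assms(5)[OF comp_in[OF pr(1,3)] comp_in[OF pr(2,3)] pr(4)]
      assms(6-9)[OF i] by simp
qed

lemma gop_assoc:
  assumes K: "group_object C K" and x: "x \<in> Hom C Z (gob K)" "y \<in> Hom C Z (gob K)" "z \<in> Hom C Z (gob K)"
  shows "gop C Z K (gop C Z K x y) z = gop C Z K x (gop C Z K y z)"
proof -
  let ?G = "gob K" let ?GG = "Prod C ?G ?G" let ?W = "Prod C ?GG ?G"
  note h = group_object_hom[OF K]
  \<comment> \<open>The map to the triple product along which \<open>x\<close>, \<open>y\<close>,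
    \<open>z\<close> are restrictions of the generic elements.\<close>
  define w where "w = pair C Z ?GG ?G (pair C Z ?G ?G x y) z"
  have xy: "pair C Z ?G ?G x y \<in> Hom C Z ?GG" using x by auto
  have w: "w \<in> Hom C Z ?W" unfolding w_def using x xy by auto
  let ?x = "pr1 C ?G ?G \<cdot> pr1 C ?GG ?G" and ?y = "pr2 C ?G ?G \<cdot> pr1 C ?GG ?G" and ?z = "pr2 C ?GG ?G"
  have pr: "pr1 C ?G ?G \<in> Hom C ?GG ?G" "pr2 C ?G ?G \<in> Hom C ?GG ?G"
    "pr1 C ?GG ?G \<in> Hom C ?W ?GG" "?z \<in> Hom C ?W ?G" using h by auto
  have e: "?x \<cdot> w = x" "?y \<cdot> w = y" "?z \<cdot> w = z"
    using comp_assoc[OF pr(1) w pr(3)] comp_assoc[OF pr(2) w pr(3)] x xy by (simp_all add: w_def)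
  have i: "?x \<in> Hom C ?W ?G" "?y \<in> Hom C ?W ?G" using pr by auto
  note g = gop_in[OF K i] gop_in[OF K i(2) pr(4)]
  have "gop C ?W K (gop C ?W K ?x ?y) ?z = gop C ?W K ?x (gop C ?W K ?y ?z)"
    using K unfolding group_object_def Let_def by auto
  then have "gop C ?W K (gop C ?W K ?x ?y) ?z \<cdot> w = gop C ?W K ?x (gop C ?W K ?y ?z) \<cdot> w" by simp
  then show ?thesis
    using gop_comp[OF K w g(1) pr(4)] gop_comp[OF K w i] gop_comp[OF K w i(1) g(2)]
      gop_comp[OF K w i(2) pr(4)] e by simp
qed

lemma
  assumes K: "group_object C K" and x: "x \<in> Hom C Z (gob K)"
  shows gop_one_left: "gop C Z K (gone Z K) x = x"
    and gop_one_right: "gop C Z K x (gone Z K) = x"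
    and gop_inv_left: "gop C Z K (ginv K \<cdot> x) x = gone Z K"
    and gop_inv_right: "gop C Z K x (ginv K \<cdot> x) = gone Z K"
proof -
  let ?G = "gob K"
  note h = group_object_hom[OF K]
  have i: "Id C ?G \<in> Hom C ?G ?G" "gone ?G K \<in> Hom C ?G ?G" using h K by auto
  have "gop C ?G K (gone ?G K) (Id C ?G) \<cdot> x = Id C ?G \<cdot> x"
    "gop C ?G K (Id C ?G) (gone ?G K) \<cdot> x = Id C ?G \<cdot> x"
    "gop C ?G K (ginv K) (Id C ?G) \<cdot> x = gone ?G K \<cdot> x"
    "gop C ?G K (Id C ?G) (ginv K) \<cdot> x = gone ?G K \<cdot> x"
    using K unfolding group_object_def Let_def by auto
  then show "gop C Z K (gone Z K) x = x" "gop C Z K x (gone Z K) = x"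
    "gop C Z K (ginv K \<cdot> x) x = gone Z K" "gop C Z K x (ginv K \<cdot> x) = gone Z K"
    using gop_comp[OF K x] i h(3) gone_comp[OF K x] x by auto
qed

lemma gop_cancel_left:
  assumes K: "group_object C K" and x: "x \<in> Hom C Z (gob K)" "y \<in> Hom C Z (gob K)" "z \<in> Hom C Z (gob K)"
    and "gop C Z K x y = gop C Z K x z"
  shows "y = z"
proof -
  have i: "ginv K \<cdot> x \<in> Hom C Z (gob K)" using K x by auto
  have "gop C Z K (gop C Z K (ginv K \<cdot> x) x) y = gop C Z K (gop C Z K (ginv K \<cdot> x) x) z"
    using gop_assoc[OF K i x(1,2)] gop_assoc[OF K i x(1,3)] assms(5) by simp
  then show ?thesis using gop_inv_left[OF K x(1)] gop_one_left[OF K] x by simp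
qed

lemma gop_cancel_right:
  assumes K: "group_object C K" and x: "x \<in> Hom C Z (gob K)" "y \<in> Hom C Z (gob K)" "z \<in> Hom C Z (gob K)"
    and "gop C Z K y x = gop C Z K z x"
  shows "y = z"
proof -
  have i: "ginv K \<cdot> x \<in> Hom C Z (gob K)" using K x by auto
  have "gop C Z K y (gop C Z K x (ginv K \<cdot> x)) = gop C Z K z (gop C Z K x (ginv K \<cdot> x))"
    using gop_assoc[OF K x(2,1) i] gop_assoc[OF K x(3,1) i] assms(5) by simp
  then show ?thesis using gop_inv_right[OF K x(1)] gop_one_right[OF K] x by simp
qed

lemma ginv_unique:
  assumes K: "group_object C K" and x: "x \<in> Hom C Z (gob K)" "y \<in> Hom C Z (gob K)"
    and "gop C Z K y x = gone Z K"
  shows "y = ginv K \<cdot> x"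
  using gop_cancel_right[OF K x(1) x(2) ginv_in[OF K x(1)]] assms(4) gop_inv_left[OF K x(1)] by simp

lemma gop_inv_cancel:
  assumes K: "group_object C K" and x: "x \<in> Hom C Z (gob K)" "y \<in> Hom C Z (gob K)"
  shows "gop C Z K (ginv K \<cdot> x) (gop C Z K x y) = y" "gop C Z K x (gop C Z K (ginv K \<cdot> x) y) = y"
    "gop C Z K (gop C Z K y x) (ginv K \<cdot> x) = y" "gop C Z K (gop C Z K y (ginv K \<cdot> x)) x = y"
proof -
  have i: "ginv K \<cdot> x \<in> Hom C Z (gob K)" using K x by auto
  note a = gop_one_left[OF K] gop_one_right[OF K] gop_inv_left[OF K x(1)] gop_inv_right[OF K x(1)]
  show "gop C Z K (ginv K \<cdot> x) (gop C Z K x y) = y"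
    using gop_assoc[OF K i x] a x by simp
  show "gop C Z K x (gop C Z K (ginv K \<cdot> x) y) = y"
    using gop_assoc[OF K x(1) i x(2)] a x by simp
  show "gop C Z K (gop C Z K y x) (ginv K \<cdot> x) = y"
    using gop_assoc[OF K x(2,1) i] a x by simp
  show "gop C Z K (gop C Z K y (ginv K \<cdot> x)) x = y"
    using gop_assoc[OF K x(2) i x(1)] a x by simp
qed

lemma ginv_gop:
  assumes K: "group_object C K" and x: "x \<in> Hom C Z (gob K)" "y \<in> Hom C Z (gob K)"
  shows "ginv K \<cdot> gop C Z K x y = gop C Z K (ginv K \<cdot> y) (ginv K \<cdot> x)"
proof -
  have i: "ginv K \<cdot> x \<in> Hom C Z (gob K)" "ginv K \<cdot> y \<in> Hom C Z (gob K)" "gop C Z K x y \<in> Hom C Z (gob K)"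
    "gop C Z K (ginv K \<cdot> y) (ginv K \<cdot> x) \<in> Hom C Z (gob K)" using K x by auto
  have "gop C Z K (gop C Z K (ginv K \<cdot> y) (ginv K \<cdot> x)) (gop C Z K x y) = gone Z K"
    using gop_assoc[OF K i(2,1,3)] gop_inv_cancel(1)[OF K x] gop_inv_left[OF K x(2)] by simp
  then show ?thesis using ginv_unique[OF K i(3,4)] by simp
qed

lemma ginv_gone:
  assumes K: "group_object C K" and Z: "Z \<in> Obj C"
  shows "ginv K \<cdot> gone Z K = gone Z K"
proof -
  note e = gone_in[OF K Z]
  show ?thesis using ginv_unique[OF K e e] gop_one_left[OF K e] by simp
qed

lemma ginv_ginv:
  assumes K: "group_object C K" and x: "x \<in> Hom C Z (gob K)"
  shows "ginv K \<cdot> (ginv K \<cdot> x) = x"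
proof -
  have i: "ginv K \<cdot> x \<in> Hom C Z (gob K)" using K x by auto
  show ?thesis using ginv_unique[OF K i x] gop_inv_right[OF K x] by simp
qed

section \<open>The category of group objects\<close>

lemma Obj_Grp [simp]: "K \<in> Obj (Grp C) \<longleftrightarrow> group_object C K"
  by (simp add: Grp_def)

lemma Comp_Grp [simp]: "Comp (Grp C) = Comp C"
  by (simp add: Grp_def)

lemma Id_Grp [simp]: "Id (Grp C) K = Id C (gob K)"
  by (simp add: Grp_def)

lemma Grp_homD:
  assumes "f \<in> Hom (Grp C) K L"
  shows "group_object C K" "group_object C L" "f \<in> Hom C (gob K) (gob L)"
  using assms by (auto simp: Grp_def)

lemma Grp_hom_gop:
  assumes "f \<in> Hom (Grp C) K L" "x \<in> Hom C Z (gob K)" "y \<in> Hom C Z (gob K)"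
  shows "f \<cdot> gop C Z K x y = gop C Z L (f \<cdot> x) (f \<cdot> y)"
proof -
  note f = Grp_homD[OF assms(1)]
  have e: "f \<cdot> gmul K = gmul L \<cdot> pmap C (gob K) (gob K) (gob L) (gob L) f f"
    using assms(1) by (simp add: Grp_def)
  have p: "pair C Z (gob K) (gob K) x y \<in> Hom C Z (Prod C (gob K) (gob K))" using assms by auto
  have q: "pmap C (gob K) (gob K) (gob L) (gob L) f f \<in> Hom C (Prod C (gob K) (gob K)) (Prod C (gob L) (gob L))"
    using f by auto
  show ?thesis unfolding gop_def
    using comp_assoc[OF f(3) p group_object_hom(2)[OF f(1)]] e
      comp_assoc[OF group_object_hom(2)[OF f(2)] p q] pmap_pair[OF f(3) f(3) assms(2,3)] by simp
qed

lemma Grp_homI: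
  assumes "group_object C K" "group_object C L" "f \<in> Hom C (gob K) (gob L)"
    and "\<And>Z x y. x \<in> Hom C Z (gob K) \<Longrightarrow> y \<in> Hom C Z (gob K) \<Longrightarrow>
      f \<cdot> gop C Z K x y = gop C Z L (f \<cdot> x) (f \<cdot> y)"
  shows "f \<in> Hom (Grp C) K L"
proof -
  let ?p = "pr1 C (gob K) (gob K)" and ?q = "pr2 C (gob K) (gob K)"
  have o: "gob K \<in> Obj C" using group_object_hom assms by auto
  have pq: "?p \<in> Hom C (Prod C (gob K) (gob K)) (gob K)" "?q \<in> Hom C (Prod C (gob K) (gob K)) (gob K)"
    using o by auto
  have "f \<cdot> gmul K = gmul L \<cdot> pmap C (gob K) (gob K) (gob L) (gob L) f f"
    using assms(4)[OF pq] group_object_hom[OF assms(1)] o unfolding gop_def pmap_def by simp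
  then show ?thesis using assms by (simp add: Grp_def)
qed

text \<open>Morphisms of \<open>Grp C\<close> are only required to respect multiplication; the unit
  follows by cancelling in \<open>f(1) f(1) = f(1)\<close>.\<close>

lemma Grp_hom_one:
  assumes f: "f \<in> Hom (Grp C) K L" and Z: "Z \<in> Obj C"
  shows "f \<cdot> gone Z K = gone Z L"
proof -
  note h = Grp_homD[OF f]
  note e = gone_in[OF h(1) Z]
  have i: "f \<cdot> gone Z K \<in> Hom C Z (gob L)" using e h by auto
  have "gop C Z L (f \<cdot> gone Z K) (f \<cdot> gone Z K) = gop C Z L (f \<cdot> gone Z K) (gone Z L)"
    using Grp_hom_gop[OF f e e] gop_one_left[OF h(1) e] gop_one_right[OF h(2) i] by simp
  then show ?thesis using gop_cancel_left[OF h(2) i i gone_in[OF h(2) Z]] by simp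
qed

lemma Grp_hom_inv:
  assumes f: "f \<in> Hom (Grp C) K L" and x: "x \<in> Hom C Z (gob K)"
  shows "f \<cdot> (ginv K \<cdot> x) = ginv L \<cdot> (f \<cdot> x)"
proof -
  note h = Grp_homD[OF f]
  have i: "ginv K \<cdot> x \<in> Hom C Z (gob K)" using x h by auto
  have j: "f \<cdot> x \<in> Hom C Z (gob L)" "f \<cdot> (ginv K \<cdot> x) \<in> Hom C Z (gob L)" using x i h by auto
  have "gop C Z L (f \<cdot> (ginv K \<cdot> x)) (f \<cdot> x) = gone Z L"
    using Grp_hom_gop[OF f i x] gop_inv_left[OF h(1) x] Grp_hom_one[OF f] Hom_Obj(1)[OF x] by simp
  then show ?thesis using ginv_unique[OF h(2) j] by simp
qed

lemma Grp_comp: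
  assumes "g \<in> Hom (Grp C) L M" "f \<in> Hom (Grp C) K L"
  shows "g \<cdot> f \<in> Hom (Grp C) K M"
proof (rule Grp_homI)
  note f = Grp_homD[OF assms(2)] and g = Grp_homD[OF assms(1)]
  show "group_object C K" "group_object C M" "g \<cdot> f \<in> Hom C (gob K) (gob M)" using f g by auto
  fix Z x y assume x: "x \<in> Hom C Z (gob K)" "y \<in> Hom C Z (gob K)"
  have fx: "f \<cdot> x \<in> Hom C Z (gob L)" "f \<cdot> y \<in> Hom C Z (gob L)" using f x by auto
  show "(g \<cdot> f) \<cdot> gop C Z K x y = gop C Z M ((g \<cdot> f) \<cdot> x) ((g \<cdot> f) \<cdot> y)"
    using comp_assoc[OF g(3) _ f(3)] gop_in[OF f(1) x] x Grp_hom_gop[OF assms(2) x]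
      Grp_hom_gop[OF assms(1) fx] by simp
qed

lemma Grp_Id: "group_object C K \<Longrightarrow> Id C (gob K) \<in> Hom (Grp C) K K"
  by (rule Grp_homI) (auto simp: group_object_hom Id_comp[OF gop_in])

lemma category_Grp: "category (Grp C)"
proof -
  have "(h \<cdot> g) \<cdot> f = h \<cdot> (g \<cdot> f)"
    if "f \<in> Hom (Grp C) A B" "g \<in> Hom (Grp C) B D" "h \<in> Hom (Grp C) D E" for A B D E f g h
    using comp_assoc[OF Grp_homD(3)[OF that(3)] Grp_homD(3)[OF that(1)] Grp_homD(3)[OF that(2)]] .
  then show ?thesis
    unfolding category_def by (auto dest: Grp_homD intro: Grp_Id Grp_comp)
qed

section \<open>Actions in terms of generalised elements\<close>

lemma left_actionI:
  assumes "group_object C K" "Y \<in> Obj C" "a \<in> Hom C (Prod C (gob K) Y) Y"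
    and "\<And>Z y. y \<in> Hom C Z Y \<Longrightarrow> a \<cdot> pair C Z (gob K) Y (gone Z K) y = y"
    and "\<And>Z g h y. g \<in> Hom C Z (gob K) \<Longrightarrow> h \<in> Hom C Z (gob K) \<Longrightarrow> y \<in> Hom C Z Y \<Longrightarrow>
      a \<cdot> pair C Z (gob K) Y (gop C Z K g h) y =
      a \<cdot> pair C Z (gob K) Y g (a \<cdot> pair C Z (gob K) Y h y)"
  shows "left_action C K Y a"
proof -
  let ?G = "gob K" let ?GG = "Prod C ?G ?G"
  have o: "?G \<in> Obj C" using group_object_hom assms by auto
  have "pr1 C ?G ?G \<cdot> pr1 C ?GG Y \<in> Hom C (Prod C ?GG Y) ?G"
    "pr2 C ?G ?G \<cdot> pr1 C ?GG Y \<in> Hom C (Prod C ?GG Y) ?G" "pr2 C ?GG Y \<in> Hom C (Prod C ?GG Y) Y"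
    using o assms(2) by auto
  then show ?thesis unfolding left_action_def Let_def using assms by simp
qed

lemma left_action_hom:
  assumes "left_action C K Y a"
  shows "Y \<in> Obj C" "a \<in> Hom C (Prod C (gob K) Y) Y"
  using assms unfolding left_action_def Let_def by auto

lemma left_action_one:
  assumes a: "left_action C K Y a" and K: "group_object C K" and y: "y \<in> Hom C Z Y"
  shows "a \<cdot> pair C Z (gob K) Y (gone Z K) y = y"
proof -
  note h = left_action_hom[OF a]
  have e: "gone Y K \<in> Hom C Y (gob K)" "Id C Y \<in> Hom C Y Y" using K h by auto
  have "(a \<cdot> pair C Y (gob K) Y (gone Y K) (Id C Y)) \<cdot> y = Id C Y \<cdot> y"
    using a unfolding left_action_def Let_def by simp
  then show ?thesis
    using comp_assoc[OF h(2) y pair_in[OF e]] pair_comp[OF y e] gone_comp[OF K y] y by simp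
qed

lemma left_action_gop:
  assumes a: "left_action C K Y a" and K: "group_object C K"
    and x: "g \<in> Hom C Z (gob K)" "h \<in> Hom C Z (gob K)" "y \<in> Hom C Z Y"
  shows "a \<cdot> pair C Z (gob K) Y (gop C Z K g h) y =
      a \<cdot> pair C Z (gob K) Y g (a \<cdot> pair C Z (gob K) Y h y)"
proof -
  let ?G = "gob K" let ?GG = "Prod C ?G ?G" let ?W = "Prod C ?GG Y"
  note ha = left_action_hom[OF a] and hK = group_object_hom[OF K]
  define w where "w = pair C Z ?GG Y (pair C Z ?G ?G g h) y"
  have xy: "pair C Z ?G ?G g h \<in> Hom C Z ?GG" using x by auto
  have w: "w \<in> Hom C Z ?W" unfolding w_def using x xy by auto
  let ?g = "pr1 C ?G ?G \<cdot> pr1 C ?GG Y" and ?h = "pr2 C ?G ?G \<cdot> pr1 C ?GG Y" and ?y = "pr2 C ?GG Y"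
  have pr: "pr1 C ?G ?G \<in> Hom C ?GG ?G" "pr2 C ?G ?G \<in> Hom C ?GG ?G"
    "pr1 C ?GG Y \<in> Hom C ?W ?GG" "?y \<in> Hom C ?W Y" using ha hK by auto
  have e: "?g \<cdot> w = g" "?h \<cdot> w = h" "?y \<cdot> w = y"
    using comp_assoc[OF pr(1) w pr(3)] comp_assoc[OF pr(2) w pr(3)] x xy by (simp_all add: w_def)
  have i: "?g \<in> Hom C ?W ?G" "?h \<in> Hom C ?W ?G" using pr by auto
  note g = gop_in[OF K i]
  have hy: "a \<cdot> pair C ?W ?G Y ?h ?y \<in> Hom C ?W Y" using i pr ha by auto
  have "(a \<cdot> pair C ?W ?G Y (gop C ?W K ?g ?h) ?y) \<cdot> w =
      (a \<cdot> pair C ?W ?G Y ?g (a \<cdot> pair C ?W ?G Y ?h ?y)) \<cdot> w"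
    using a unfolding left_action_def Let_def by auto
  then show ?thesis
    using comp_assoc[OF ha(2) w pair_in[OF g pr(4)]] comp_assoc[OF ha(2) w pair_in[OF i(1) hy]]
      comp_assoc[OF ha(2) w pair_in[OF i(2) pr(4)]] pair_comp[OF w g pr(4)] pair_comp[OF w i(1) hy]
      pair_comp[OF w i(2) pr(4)] gop_comp[OF K w i] e by simp
qed

end

section \<open>Slice categories\<close>

lemma slice_sel [simp]:
  "(A, f) \<in> Obj (slice C B) \<longleftrightarrow> f \<in> Hom C A B"
  "Comp (slice C B) = Comp C" "Id (slice C B) (A, f) = Id C A"
  "h \<in> Hom (slice C B) (A, f) (A', g) \<longleftrightarrow>
     h \<in> Hom C A A' \<and> f \<in> Hom C A B \<and> g \<in> Hom C A' B \<and> g \<cdot>\<^bsub>C\<^esub> h = f"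
  by (auto simp: slice_def)

context Cat
begin

lemma category_slice: "category (slice C Y)"
  unfolding category_def
proof (intro conjI)
  show "\<forall>A B f. f \<in> Hom (slice C Y) A B \<longrightarrow> A \<in> Obj (slice C Y) \<and> B \<in> Obj (slice C Y)"
    by auto
  show "\<forall>A\<in>Obj (slice C Y). Id (slice C Y) A \<in> Hom (slice C Y) A A"
    using Hom_Obj(1) by auto
  show "\<forall>A B D f g. f \<in> Hom (slice C Y) A B \<and> g \<in> Hom (slice C Y) B D \<longrightarrow>
      g \<cdot>\<^bsub>slice C Y\<^esub> f \<in> Hom (slice C Y) A D"
  proof (intro allI impI, elim conjE)
    fix A B D :: "'o \<times> 'a" and f g
    assume f: "f \<in> Hom (slice C Y) A B" "g \<in> Hom (slice C Y) B D"
    obtain A' \<alpha> B' \<beta> D' \<delta> where e: "A = (A', \<alpha>)" "B = (B', \<beta>)" "D = (D', \<delta>)" by (metis surj_pair)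
    have "\<delta> \<cdot> (g \<cdot> f) = \<alpha>" using f e comp_assoc[of \<delta> D' Y f A' B' g] by simp
    then show "g \<cdot>\<^bsub>slice C Y\<^esub> f \<in> Hom (slice C Y) A D" using f e by auto
  qed
  show "\<forall>A B f. f \<in> Hom (slice C Y) A B \<longrightarrow>
      f \<cdot>\<^bsub>slice C Y\<^esub> Id (slice C Y) A = f \<and> Id (slice C Y) B \<cdot>\<^bsub>slice C Y\<^esub> f = f"
    by auto
  show "\<forall>A B D E f g h. f \<in> Hom (slice C Y) A B \<and> g \<in> Hom (slice C Y) B D \<and> h \<in> Hom (slice C Y) D E \<longrightarrow>
      (h \<cdot>\<^bsub>slice C Y\<^esub> g) \<cdot>\<^bsub>slice C Y\<^esub> f = h \<cdot>\<^bsub>slice C Y\<^esub> (g \<cdot>\<^bsub>slice C Y\<^esub> f)"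
    by (auto intro: comp_assoc)
qed

text \<open>Being a pair of maps over \<open>B\<close> is exactly the commutation condition of a
  pullback, and the structure map of the product is forced by either projection.\<close>

lemma slice_product_iff:
  assumes "\<alpha> \<in> Hom C A B" "\<alpha>' \<in> Hom C A' B"
  shows "is_product (slice C B) (A, \<alpha>) (A', \<alpha>') (P, \<rho>) p q \<longleftrightarrow>
    is_pullback C A A' B \<alpha> \<alpha>' P p q \<and> \<rho> = \<alpha> \<cdot> p"
proof
  assume l: "is_product (slice C B) (A, \<alpha>) (A', \<alpha>') (P, \<rho>) p q"
  interpret S: Cat "slice C B" by (unfold_locales) (rule category_slice)
  note h = S.is_product_hom[OF l, simplified]
  have "is_pullback C A A' B \<alpha> \<alpha>' P p q"
  proof (rule is_pullbackI[OF assms])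
    show "p \<in> Hom C P A" "q \<in> Hom C P A'" "\<alpha> \<cdot> p = \<alpha>' \<cdot> q" using h by auto
    fix Z
    { fix x y assume x: "x \<in> Hom C Z A" "y \<in> Hom C Z A'" "\<alpha> \<cdot> x = \<alpha>' \<cdot> y"
      have "x \<in> Hom (slice C B) (Z, \<alpha> \<cdot> x) (A, \<alpha>)" "y \<in> Hom (slice C B) (Z, \<alpha> \<cdot> x) (A', \<alpha>')"
        using x assms by auto
      from S.tuple_is_product[OF l this] show "\<exists>u \<in> Hom C Z P. p \<cdot> u = x \<and> q \<cdot> u = y" by auto }
    { fix u v assume u: "u \<in> Hom C Z P" "v \<in> Hom C Z P" "p \<cdot> u = p \<cdot> v" "q \<cdot> u = q \<cdot> v"
      have e: "\<rho> \<cdot> w = \<alpha> \<cdot> (p \<cdot> w)" if "w \<in> Hom C Z P" for w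
        using comp_reduce[of \<alpha> p \<rho>, OF _ _ _ that] h by auto
      show "u = v"
        by (rule S.is_product_ext[OF l, of _ "(Z, \<rho> \<cdot> u)"]) (use u h e in auto) }
  qed
  then show "is_pullback C A A' B \<alpha> \<alpha>' P p q \<and> \<rho> = \<alpha> \<cdot> p" using h by simp
next
  assume l: "is_pullback C A A' B \<alpha> \<alpha>' P p q \<and> \<rho> = \<alpha> \<cdot> p"
  then have l: "is_pullback C A A' B \<alpha> \<alpha>' P p q" and r: "\<rho> = \<alpha> \<cdot> p" by auto
  interpret S: Cat "slice C B" by (unfold_locales) (rule category_slice)
  note h = is_pullback_hom[OF l]
  show "is_product (slice C B) (A, \<alpha>) (A', \<alpha>') (P, \<rho>) p q"
  proof (rule S.is_productI)
    have *: "\<alpha>' \<cdot> q = \<rho>" "\<rho> \<in> Hom C P B" using h r by auto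
    show "p \<in> Hom (slice C B) (P, \<rho>) (A, \<alpha>)" "q \<in> Hom (slice C B) (P, \<rho>) (A', \<alpha>')"
      using h r * by auto
    fix Zz :: "'o \<times> 'a"
    obtain Z z where Z: "Zz = (Z, z)" by (cases Zz)
    { fix x y assume "x \<in> Hom (slice C B) Zz (A, \<alpha>)" "y \<in> Hom (slice C B) Zz (A', \<alpha>')"
      then have x: "x \<in> Hom C Z A" "y \<in> Hom C Z A'" "\<alpha> \<cdot> x = \<alpha>' \<cdot> y" "z = \<alpha> \<cdot> x"
        by (auto simp: Z)
      note t = tuple_is_pullback[OF l x(1-3)]
      have "\<rho> \<cdot> tuple C Z P p q x y = z"
        using comp_assoc[OF h(1) t(1) h(3)] t x r by simp
      then show "\<exists>u \<in> Hom (slice C B) Zz (P, \<rho>). p \<cdot>\<^bsub>slice C B\<^esub> u = x \<and> q \<cdot>\<^bsub>slice C B\<^esub> u = y"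
        using t * x assms by (intro bexI[of _ "tuple C Z P p q x y"]) (auto simp: Z) }
    { fix u v assume "u \<in> Hom (slice C B) Zz (P, \<rho>)" "v \<in> Hom (slice C B) Zz (P, \<rho>)"
        "p \<cdot>\<^bsub>slice C B\<^esub> u = p \<cdot>\<^bsub>slice C B\<^esub> v" "q \<cdot>\<^bsub>slice C B\<^esub> u = q \<cdot>\<^bsub>slice C B\<^esub> v"
      then show "u = v" using is_pullback_ext[OF l] by (auto simp: Z) }
  qed
qed

end

section \<open>Finite limits in slices, and group objects over a base\<close>

context Fin_Lim
begin

lemma slice_terminal: "B \<in> Obj C \<Longrightarrow> is_terminal (slice C B) (B, Id C B)"
  unfolding is_terminal_def using Id_comp by fastforce

lemma Fin_Lim_slice: assumes B: "B \<in> Obj C" shows "Fin_Lim (slice C B)"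
proof -
  interpret S: Cat "slice C B" by (unfold_locales) (rule category_slice)
  show ?thesis
  proof (unfold_locales, unfold has_finite_limits_def, intro conjI ballI allI)
    show "\<exists>T. is_terminal (slice C B) T" using slice_terminal[OF B] by blast
    fix X Y :: "'o \<times> 'a"
    obtain A \<alpha> A' \<alpha>' where X: "X = (A, \<alpha>)" "Y = (A', \<alpha>')" by (metis surj_pair)
    { assume "X \<in> Obj (slice C B)" "Y \<in> Obj (slice C B)"
      then have a: "\<alpha> \<in> Hom C A B" "\<alpha>' \<in> Hom C A' B" using X by auto
      obtain P p q where "is_pullback C A A' B \<alpha> \<alpha>' P p q" using ex_pullback[OF a] .
      then show "\<exists>P p q. is_product (slice C B) X Y P p q"
        using slice_product_iff[OF a] X by blast }
    { fix f g assume "f \<in> Hom (slice C B) X Y" "g \<in> Hom (slice C B) X Y"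
      then have f: "f \<in> Hom C A A'" "g \<in> Hom C A A'" "\<alpha>' \<cdot> f = \<alpha>" "\<alpha>' \<cdot> g = \<alpha>"
        "\<alpha> \<in> Hom C A B" "\<alpha>' \<in> Hom C A' B" using X by auto
      obtain E e where e: "is_equaliser C A A' f g E e" using ex_equaliser[OF f(1,2)] .
      note h = is_equaliser_hom[OF e]
      have "is_equaliser (slice C B) X Y f g (E, \<alpha> \<cdot> e) e"
      proof (rule S.is_equaliserI)
        show "f \<in> Hom (slice C B) X Y" "g \<in> Hom (slice C B) X Y"
          "e \<in> Hom (slice C B) (E, \<alpha> \<cdot> e) X" "f \<cdot>\<^bsub>slice C B\<^esub> e = g \<cdot>\<^bsub>slice C B\<^esub> e"
          using f h X by auto
        fix Zz :: "'o \<times> 'a"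
        obtain Z z where Z: "Zz = (Z, z)" by (cases Zz)
        { fix x assume "x \<in> Hom (slice C B) Zz X" "f \<cdot>\<^bsub>slice C B\<^esub> x = g \<cdot>\<^bsub>slice C B\<^esub> x"
          then have x: "x \<in> Hom C Z A" "f \<cdot> x = g \<cdot> x" "\<alpha> \<cdot> x = z" "z \<in> Hom C Z B"
            by (auto simp: X Z)
          note u = factor_is_equaliser[OF e x(1,2)]
          have "(\<alpha> \<cdot> e) \<cdot> factor C Z E e x = z" using comp_assoc[OF f(5) u(1) h(3)] u x by simp
          then show "\<exists>u \<in> Hom (slice C B) Zz (E, \<alpha> \<cdot> e). e \<cdot>\<^bsub>slice C B\<^esub> u = x"
            using u x f h by (intro bexI[of _ "factor C Z E e x"]) (auto simp: Z) }
        { fix u v assume "u \<in> Hom (slice C B) Zz (E, \<alpha> \<cdot> e)" "v \<in> Hom (slice C B) Zz (E, \<alpha> \<cdot> e)"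
            "e \<cdot>\<^bsub>slice C B\<^esub> u = e \<cdot>\<^bsub>slice C B\<^esub> v"
          then show "u = v" using is_equaliser_ext[OF e] by (auto simp: Z) }
      qed
      then show "\<exists>E e. is_equaliser (slice C B) X Y f g E e" by blast }
  qed
qed

text \<open>An element of \<open>P\<close> over \<open>z\<close> is determined by its first
  component, so under \<open>p\<close> every axiom and every identity becomes the corresponding one
  of \<open>K\<close>.\<close>

lemma family_group:
  assumes K: "group_object C K" and P: "is_product C (gob K) Q P p q" and Q: "Q \<in> Obj C"
  defines "F \<equiv> family_group C K Q P p q"
  shows family_group_object: "group_object (slice C Q) F"
    and gob_family_group: "gob F = (P, q)"
    and family_group_gop: "\<And>Z z x y. x \<in> Hom C Z P \<Longrightarrow> y \<in> Hom C Z P \<Longrightarrow> q \<cdot> x = z \<Longrightarrow> q \<cdot> y = z \<Longrightarrow>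
       p \<cdot> gop (slice C Q) (Z, z) F x y = gop C Z K (p \<cdot> x) (p \<cdot> y)"
    and family_group_inv: "\<And>Z x. x \<in> Hom C Z P \<Longrightarrow> p \<cdot> (ginv F \<cdot> x) = ginv K \<cdot> (p \<cdot> x)"
    and family_group_unit: "p \<cdot> gunit F = gone (fst (term_obj (slice C Q))) K"
proof -
  interpret S: Fin_Lim "slice C Q" by (rule Fin_Lim_slice[OF Q])
  note h = is_product_hom[OF P] and K' = group_object_hom[OF K]
  have F0: "(P, q) \<in> Obj (slice C Q)" using h by simp
  obtain S s where S: "Prod (slice C Q) (P, q) (P, q) = (S, s)" by (meson surj_pair)
  obtain U u where U: "term_obj (slice C Q) = (U, u)" by (meson surj_pair)
  let ?r1 = "pr1 (slice C Q) (P, q) (P, q)" and ?r2 = "pr2 (slice C Q) (P, q) (P, q)"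
  have r: "?r1 \<in> Hom C S P" "?r2 \<in> Hom C S P" "s \<in> Hom C S Q" "q \<cdot> ?r1 = s" "q \<cdot> ?r2 = s"
    using S.pr_in[OF F0 F0] S by auto
  have u: "u \<in> Hom C U Q" using S.term_Obj U by simp
  have F: "F = \<lparr> gob = (P, q), gmul = tuple C S P p q (gop C S K (p \<cdot> ?r1) (p \<cdot> ?r2)) s,
      ginv = tuple C P P p q (ginv K \<cdot> p) q, gunit = tuple C U P p q (gunit K \<cdot> bang C U) u \<rparr>"
    unfolding F_def family_group_def by (simp add: S U Let_def)
  have pr: "p \<cdot> ?r1 \<in> Hom C S (gob K)" "p \<cdot> ?r2 \<in> Hom C S (gob K)" using h r by auto
  have m: "gmul F \<in> Hom C S P" "p \<cdot> gmul F = gop C S K (p \<cdot> ?r1) (p \<cdot> ?r2)" "q \<cdot> gmul F = s"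
    using tuple_is_product[OF P gop_in[OF K pr] r(3)] by (auto simp: F)
  have i: "ginv F \<in> Hom C P P" "p \<cdot> ginv F = ginv K \<cdot> p" "q \<cdot> ginv F = q"
    using tuple_is_product[OF P ginv_in[OF K h(1)] h(2)] by (auto simp: F)
  have e: "gunit F \<in> Hom C U P" "p \<cdot> gunit F = gone U K" "q \<cdot> gunit F = u"
    using tuple_is_product[OF P gone_in[OF K] u] Hom_Obj u by (auto simp: F)
  show gob: "gob F = (P, q)" by (simp add: F)
  have gop: "gop (slice C Q) (Z, z) F x y \<in> Hom C Z P"
      "p \<cdot> gop (slice C Q) (Z, z) F x y = gop C Z K (p \<cdot> x) (p \<cdot> y)"
      "q \<cdot> gop (slice C Q) (Z, z) F x y = z"
    if x: "x \<in> Hom C Z P" "y \<in> Hom C Z P" "q \<cdot> x = z" "q \<cdot> y = z" for Z z x y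
  proof -
    have z: "z \<in> Hom C Z Q" using x h by auto
    define w where "w = pair (slice C Q) (Z, z) (P, q) (P, q) x y"
    have x': "x \<in> Hom (slice C Q) (Z, z) (P, q)" "y \<in> Hom (slice C Q) (Z, z) (P, q)"
      using x z h by auto
    have w: "w \<in> Hom C Z S" "s \<cdot> w = z" "?r1 \<cdot> w = x" "?r2 \<cdot> w = y"
      using S.pair_in[OF x'] S.pr_pair[OF x'] S by (auto simp: w_def)
    have g: "gop (slice C Q) (Z, z) F x y = gmul F \<cdot> w"
      by (simp add: gop_def gob w_def)
    show "gop (slice C Q) (Z, z) F x y \<in> Hom C Z P" using g m w by auto
    show "p \<cdot> gop (slice C Q) (Z, z) F x y = gop C Z K (p \<cdot> x) (p \<cdot> y)"
      using g comp_reduce[OF m(2,1) h(1) w(1)] gop_comp[OF K w(1) pr] comp_assoc[OF h(1) w(1)] r w by simp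
    show "q \<cdot> gop (slice C Q) (Z, z) F x y = z"
      using g comp_reduce[OF m(3,1) h(2) w(1)] w by simp
  qed
  then show "\<And>Z z x y. x \<in> Hom C Z P \<Longrightarrow> y \<in> Hom C Z P \<Longrightarrow> q \<cdot> x = z \<Longrightarrow> q \<cdot> y = z \<Longrightarrow>
       p \<cdot> gop (slice C Q) (Z, z) F x y = gop C Z K (p \<cdot> x) (p \<cdot> y)" by blast
  have one: "S.gone (Z, z) F \<in> Hom C Z P" "p \<cdot> S.gone (Z, z) F = gone Z K" "q \<cdot> S.gone (Z, z) F = z"
    if z: "z \<in> Hom C Z Q" for Z z
  proof -
    have "bang (slice C Q) (Z, z) \<in> Hom (slice C Q) (Z, z) (U, u)"
      using S.bang_in[of "(Z, z)"] z unfolding U by simp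
    then have b: "bang (slice C Q) (Z, z) \<in> Hom C Z U" "u \<cdot> bang (slice C Q) (Z, z) = z"
      by simp_all
    show "S.gone (Z, z) F \<in> Hom C Z P" using b e by auto
    show "p \<cdot> S.gone (Z, z) F = gone Z K"
      using comp_reduce[OF e(2,1) h(1) b(1)] gone_comp[OF K b(1)] by simp
    show "q \<cdot> S.gone (Z, z) F = z" using comp_reduce[OF e(3,1) h(2) b(1)] b by simp
  qed
  have inv: "ginv F \<cdot> x \<in> Hom C Z P" "p \<cdot> (ginv F \<cdot> x) = ginv K \<cdot> (p \<cdot> x)" "q \<cdot> (ginv F \<cdot> x) = q \<cdot> x"
    if x: "x \<in> Hom C Z P" for Z x
    using comp_reduce[OF i(2,1) h(1) x] comp_reduce[OF i(3,1) h(2) x]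
      comp_assoc[OF K'(3) x h(1)] x i by auto
  show "\<And>Z x. x \<in> Hom C Z P \<Longrightarrow> p \<cdot> (ginv F \<cdot> x) = ginv K \<cdot> (p \<cdot> x)" using inv by blast
  show "p \<cdot> gunit F = gone (fst (term_obj (slice C Q))) K" using e(2) U by simp
  show "group_object (slice C Q) F"
  proof (rule S.group_objectI)
    show "gob F \<in> Obj (slice C Q)" "gmul F \<in> Hom (slice C Q) (Prod (slice C Q) (gob F) (gob F)) (gob F)"
      "ginv F \<in> Hom (slice C Q) (gob F) (gob F)" "gunit F \<in> Hom (slice C Q) (term_obj (slice C Q)) (gob F)"
      using F0 m i e r u h by (auto simp: gob S U)
    fix Zz :: "'o \<times> 'a" and x
    obtain Z z where Z: "Zz = (Z, z)" by (cases Zz)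
    { fix y w assume "x \<in> Hom (slice C Q) Zz (gob F)" "y \<in> Hom (slice C Q) Zz (gob F)"
        "w \<in> Hom (slice C Q) Zz (gob F)"
      then have x: "x \<in> Hom C Z P" "y \<in> Hom C Z P" "w \<in> Hom C Z P" "q \<cdot> x = z" "q \<cdot> y = z" "q \<cdot> w = z"
        by (auto simp: Z gob)
      have p: "p \<cdot> x \<in> Hom C Z (gob K)" "p \<cdot> y \<in> Hom C Z (gob K)" "p \<cdot> w \<in> Hom C Z (gob K)"
        using x h by auto
      show "gop (slice C Q) Zz F (gop (slice C Q) Zz F x y) w = gop (slice C Q) Zz F x (gop (slice C Q) Zz F y w)"
        unfolding Z by (rule is_product_ext[OF P, of _ Z]) (use x gop gop_assoc[OF K p] in simp_all) }
    { assume "x \<in> Hom (slice C Q) Zz (gob F)"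
      then have x: "x \<in> Hom C Z P" "q \<cdot> x = z" "z \<in> Hom C Z Q" by (auto simp: Z gob)
      have p: "p \<cdot> x \<in> Hom C Z (gob K)" using x h by auto
      show "gop (slice C Q) Zz F (S.gone Zz F) x = x"
        unfolding Z by (rule is_product_ext[OF P, of _ Z]) (use x gop one[OF x(3)] gop_one_left[OF K p] in simp_all)
      show "gop (slice C Q) Zz F x (S.gone Zz F) = x"
        unfolding Z by (rule is_product_ext[OF P, of _ Z]) (use x gop one[OF x(3)] gop_one_right[OF K p] in simp_all)
      show "gop (slice C Q) Zz F (ginv F \<cdot>\<^bsub>slice C Q\<^esub> x) x = S.gone Zz F"
        unfolding Z by (rule is_product_ext[OF P, of _ Z]) (use x gop one[OF x(3)] inv[OF x(1)] gop_inv_left[OF K p] in simp_all)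
      show "gop (slice C Q) Zz F x (ginv F \<cdot>\<^bsub>slice C Q\<^esub> x) = S.gone Zz F"
        unfolding Z by (rule is_product_ext[OF P, of _ Z]) (use x gop one[OF x(3)] inv[OF x(1)] gop_inv_right[OF K p] in simp_all) }
  qed
qed

text \<open>Closure is assumed elementwise. Since \<open>i\<close> is monic, factorisations through
  it are unique, so \<open>factor\<close> picks them, and the group axioms follow by cancelling
  \<open>i\<close>.\<close>

lemma subgroup_object:
  assumes H: "group_object C H" and i: "is_mono C B (gob H) i"
    and mul: "\<And>Z x y. x \<in> Hom C Z B \<Longrightarrow> y \<in> Hom C Z B \<Longrightarrow>
      \<exists>w \<in> Hom C Z B. i \<cdot> w = gop C Z H (i \<cdot> x) (i \<cdot> y)"
    and inv: "\<And>Z x. x \<in> Hom C Z B \<Longrightarrow> \<exists>w \<in> Hom C Z B. i \<cdot> w = ginv H \<cdot> (i \<cdot> x)"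
    and one: "\<exists>w \<in> Hom C (term_obj C) B. i \<cdot> w = gunit H"
  defines "M \<equiv> subgroup_object C H B i"
  shows subgroup_object_group: "group_object C M"
    and gob_subgroup_object: "gob M = B"
    and subgroup_object_incl: "i \<in> Hom (Grp C) M H"
proof -
  have ii: "i \<in> Hom C B (gob H)" and ext: "\<And>Z x y. x \<in> Hom C Z B \<Longrightarrow> y \<in> Hom C Z B \<Longrightarrow> i \<cdot> x = i \<cdot> y \<Longrightarrow> x = y"
    using i unfolding is_mono_def by blast+
  have B: "B \<in> Obj C" using ii Hom_Obj by blast
  have fac: "factor C Z B i f \<in> Hom C Z B \<and> i \<cdot> factor C Z B i f = f"
    if ex: "\<exists>w \<in> Hom C Z B. i \<cdot> w = f" for Z f
  proof -
    obtain w where w: "w \<in> Hom C Z B" "i \<cdot> w = f" using ex by blast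
    have "\<exists>!u. u \<in> Hom C Z B \<and> i \<cdot> u = f" by (rule ex1I[of _ w]) (use w ext in auto)
    from theI'[OF this] show ?thesis unfolding factor_def .
  qed
  let ?p = "pr1 C B B" and ?q = "pr2 C B B"
  have pq: "?p \<in> Hom C (Prod C B B) B" "?q \<in> Hom C (Prod C B B) B" using B by auto
  have ipq: "i \<cdot> ?p \<in> Hom C (Prod C B B) (gob H)" "i \<cdot> ?q \<in> Hom C (Prod C B B) (gob H)" using pq ii by auto
  have m: "gmul M \<in> Hom C (Prod C B B) B" "i \<cdot> gmul M = gop C (Prod C B B) H (i \<cdot> ?p) (i \<cdot> ?q)"
    using fac[OF mul[OF pq]] by (auto simp: M_def subgroup_object_def Let_def)
  have I: "ginv M \<in> Hom C B B" "i \<cdot> ginv M = ginv H \<cdot> i"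
    using fac[OF inv[OF Id_in[OF B]]] ii by (auto simp: M_def subgroup_object_def Let_def)
  have e: "gunit M \<in> Hom C (term_obj C) B" "i \<cdot> gunit M = gunit H"
    using fac[OF one] by (auto simp: M_def subgroup_object_def Let_def)
  show gob: "gob M = B" by (simp add: M_def subgroup_object_def Let_def)
  have gop: "gop C Z M x y \<in> Hom C Z B" "i \<cdot> gop C Z M x y = gop C Z H (i \<cdot> x) (i \<cdot> y)"
    if x: "x \<in> Hom C Z B" "y \<in> Hom C Z B" for Z x y
  proof -
    have w: "pair C Z B B x y \<in> Hom C Z (Prod C B B)" using x by auto
    show "gop C Z M x y \<in> Hom C Z B" unfolding gop_def gob using w m by auto
    show "i \<cdot> gop C Z M x y = gop C Z H (i \<cdot> x) (i \<cdot> y)"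
      using comp_reduce[OF m(2,1) ii w] gop_comp[OF H w ipq] comp_assoc[OF ii w pq(1)]
        comp_assoc[OF ii w pq(2)] x by (simp add: gop_def gob)
  qed
  have inv: "ginv M \<cdot> x \<in> Hom C Z B" "i \<cdot> (ginv M \<cdot> x) = ginv H \<cdot> (i \<cdot> x)" if x: "x \<in> Hom C Z B" for Z x
    using comp_reduce[OF I(2,1) ii x] ginv_assoc[OF H x ii] I x by auto
  have one: "gone Z M \<in> Hom C Z B" "i \<cdot> gone Z M = gone Z H" if "Z \<in> Obj C" for Z
    using comp_reduce[OF e(2,1) ii bang_in[OF that]] e that by auto
  note E = gop_assoc[OF H] gop_one_left[OF H] gop_one_right[OF H] gop_inv_left[OF H] gop_inv_right[OF H]
  show M: "group_object C M"
  proof (rule group_objectI)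
    show "gob M \<in> Obj C" "gmul M \<in> Hom C (Prod C (gob M) (gob M)) (gob M)"
      "ginv M \<in> Hom C (gob M) (gob M)" "gunit M \<in> Hom C (term_obj C) (gob M)"
      using B m I e by (auto simp: gob)
    fix Z x assume "x \<in> Hom C Z (gob M)"
    then have x: "x \<in> Hom C Z B" "i \<cdot> x \<in> Hom C Z (gob H)" "Z \<in> Obj C" using ii gob Hom_Obj by auto
    { fix y z assume "y \<in> Hom C Z (gob M)" "z \<in> Hom C Z (gob M)"
      then have y: "y \<in> Hom C Z B" "z \<in> Hom C Z B" "i \<cdot> y \<in> Hom C Z (gob H)" "i \<cdot> z \<in> Hom C Z (gob H)"
        using ii gob by auto
      show "gop C Z M (gop C Z M x y) z = gop C Z M x (gop C Z M y z)"
        by (rule ext[of _ Z]) (use x y gop E in simp_all) }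
    show "gop C Z M (gone Z M) x = x" "gop C Z M x (gone Z M) = x"
      "gop C Z M (ginv M \<cdot> x) x = gone Z M" "gop C Z M x (ginv M \<cdot> x) = gone Z M"
      by (rule ext[of _ Z]; use x gop inv one E in simp)+
  qed
  show "i \<in> Hom (Grp C) M H"
    by (rule Grp_homI[OF M H]) (use ii gop gob in auto)
qed

text \<open>An element of \<open>P\<close> over \<open>z\<close> amounts, via \<open>t\<close>, to
  an element of \<open>K\<close> over \<open>s \<cdot> z\<close>. Hence the operations and the
  axioms are those of \<open>K\<close> at the stage \<open>(Z, s \<cdot> z)\<close>.\<close>

lemma pullback_group:
  assumes s: "s \<in> Hom C Y X" and K: "group_object (slice C X) K" and gK: "gob K = (B, k)"
    and cone: "pullback_cone C Y X s K = (P, t, p)"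
  defines "F \<equiv> pullback_group C Y X s K"
  shows pullback_cone_is_pullback: "is_pullback C B Y X k s P t p"
    and pullback_group_object: "group_object (slice C Y) F"
    and gob_pullback_group: "gob F = (P, p)"
    and pullback_group_gop: "\<And>Z z x y. x \<in> Hom C Z P \<Longrightarrow> y \<in> Hom C Z P \<Longrightarrow> p \<cdot> x = z \<Longrightarrow> p \<cdot> y = z \<Longrightarrow>
       t \<cdot> gop (slice C Y) (Z, z) F x y = gop (slice C X) (Z, s \<cdot> z) K (t \<cdot> x) (t \<cdot> y)"
proof -
  have XY: "X \<in> Obj C" "Y \<in> Obj C" using Hom_Obj s by auto
  interpret S: Fin_Lim "slice C X" by (rule Fin_Lim_slice[OF XY(1)])
  interpret T: Fin_Lim "slice C Y" by (rule Fin_Lim_slice[OF XY(2)])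
  note K' = S.group_object_hom[OF K]
  have k: "k \<in> Hom C B X" using K' gK by simp
  obtain P' t' p' where "is_pullback C B Y X k s P' t' p'" using ex_pullback[OF k s] .
  then show pb: "is_pullback C B Y X k s P t p"
    using pullback_exists cone gK by (fastforce simp: pullback_cone_def)
  note h = is_pullback_hom[OF pb]
  have F0: "(P, p) \<in> Obj (slice C Y)" using h by simp
  obtain S v where S: "Prod (slice C Y) (P, p) (P, p) = (S, v)" by (meson surj_pair)
  obtain U u where U: "term_obj (slice C Y) = (U, u)" by (meson surj_pair)
  let ?r1 = "pr1 (slice C Y) (P, p) (P, p)" and ?r2 = "pr2 (slice C Y) (P, p) (P, p)"
  have r: "?r1 \<in> Hom C S P" "?r2 \<in> Hom C S P" "v \<in> Hom C S Y" "p \<cdot> ?r1 = v" "p \<cdot> ?r2 = v"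
    using T.pr_in[OF F0 F0] S by auto
  have u: "u \<in> Hom C U Y" using T.term_Obj U by simp
  have F: "F = \<lparr> gob = (P, p),
      gmul = tuple C S P t p (gop (slice C X) (S, s \<cdot> v) K (t \<cdot> ?r1) (t \<cdot> ?r2)) v,
      ginv = tuple C P P t p (ginv K \<cdot> t) p,
      gunit = tuple C U P t p (gunit K \<cdot> bang (slice C X) (U, s \<cdot> u)) u \<rparr>"
    unfolding F_def pullback_group_def by (simp add: S U Let_def cone)
  have el: "t \<cdot> x \<in> Hom (slice C X) (Z, s \<cdot> z) (B, k)" if "x \<in> Hom C Z P" "p \<cdot> x = z" for Z z x
  proof -
    have "k \<cdot> (t \<cdot> x) = s \<cdot> (p \<cdot> x)"
      using comp_reduce[OF h(5,3,1) that(1)] comp_assoc[OF s that(1) h(4)] by simp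
    then show ?thesis using that h k s by auto
  qed
  have el': "t \<cdot> x \<in> Hom (slice C X) (Z, s \<cdot> z) (gob K)" if "x \<in> Hom C Z P" "p \<cdot> x = z" for Z z x
    using el that gK by simp
  have m: "gmul F \<in> Hom C S P" "t \<cdot> gmul F = gop (slice C X) (S, s \<cdot> v) K (t \<cdot> ?r1) (t \<cdot> ?r2)"
    "p \<cdot> gmul F = v"
  proof -
    have "gop (slice C X) (S, s \<cdot> v) K (t \<cdot> ?r1) (t \<cdot> ?r2) \<in> Hom (slice C X) (S, s \<cdot> v) (gob K)"
      using S.gop_in[OF K el'[OF r(1,4)] el'[OF r(2,5)]] .
    then show "gmul F \<in> Hom C S P" "t \<cdot> gmul F = gop (slice C X) (S, s \<cdot> v) K (t \<cdot> ?r1) (t \<cdot> ?r2)"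
      "p \<cdot> gmul F = v"
      using tuple_is_pullback[OF pb _ r(3)] by (auto simp: F gK)
  qed
  have i: "ginv F \<in> Hom C P P" "t \<cdot> ginv F = ginv K \<cdot> t" "p \<cdot> ginv F = p"
  proof -
    have "t \<in> Hom (slice C X) (P, s \<cdot> p) (gob K)"
      using h gK comp_in[OF h(2,4)] by simp
    from S.ginv_in[OF K this] show "ginv F \<in> Hom C P P" "t \<cdot> ginv F = ginv K \<cdot> t" "p \<cdot> ginv F = p"
      using tuple_is_pullback[OF pb _ h(4)] by (auto simp: F gK)
  qed
  have e: "gunit F \<in> Hom C U P" "t \<cdot> gunit F = S.gone (U, s \<cdot> u) K" "p \<cdot> gunit F = u"
  proof -
    have "(U, s \<cdot> u) \<in> Obj (slice C X)" using comp_in[OF s u] by simp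
    from S.gone_in[OF K this]
    show "gunit F \<in> Hom C U P" "t \<cdot> gunit F = S.gone (U, s \<cdot> u) K" "p \<cdot> gunit F = u"
      using tuple_is_pullback[OF pb _ u] by (auto simp: F gK)
  qed
  show gob: "gob F = (P, p)" by (simp add: F)
  have gop: "gop (slice C Y) (Z, z) F x y \<in> Hom C Z P"
      "t \<cdot> gop (slice C Y) (Z, z) F x y = gop (slice C X) (Z, s \<cdot> z) K (t \<cdot> x) (t \<cdot> y)"
      "p \<cdot> gop (slice C Y) (Z, z) F x y = z"
    if x: "x \<in> Hom C Z P" "y \<in> Hom C Z P" "p \<cdot> x = z" "p \<cdot> y = z" for Z z x y
  proof -
    have z: "z \<in> Hom C Z Y" using x h by auto
    define w where "w = pair (slice C Y) (Z, z) (P, p) (P, p) x y"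
    have x': "x \<in> Hom (slice C Y) (Z, z) (P, p)" "y \<in> Hom (slice C Y) (Z, z) (P, p)"
      using x z h by auto
    have w: "w \<in> Hom C Z S" "v \<cdot> w = z" "?r1 \<cdot> w = x" "?r2 \<cdot> w = y"
      using T.pair_in[OF x'] T.pr_pair[OF x'] S by (auto simp: w_def)
    have g: "gop (slice C Y) (Z, z) F x y = gmul F \<cdot> w"
      by (simp add: gop_def gob w_def)
    have w': "w \<in> Hom (slice C X) (Z, s \<cdot> z) (S, s \<cdot> v)"
      using w z r s comp_assoc[OF s w(1) r(3)] by auto
    show "gop (slice C Y) (Z, z) F x y \<in> Hom C Z P" using g m w by auto
    show "t \<cdot> gop (slice C Y) (Z, z) F x y = gop (slice C X) (Z, s \<cdot> z) K (t \<cdot> x) (t \<cdot> y)"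
      using g comp_reduce[OF m(2,1) h(3) w(1)] S.gop_comp[OF K w' el'[OF r(1,4)] el'[OF r(2,5)]]
        comp_assoc[OF h(3) w(1)] r w by simp
    show "p \<cdot> gop (slice C Y) (Z, z) F x y = z"
      using g comp_reduce[OF m(3,1) h(4) w(1)] w by simp
  qed
  then show "\<And>Z z x y. x \<in> Hom C Z P \<Longrightarrow> y \<in> Hom C Z P \<Longrightarrow> p \<cdot> x = z \<Longrightarrow> p \<cdot> y = z \<Longrightarrow>
       t \<cdot> gop (slice C Y) (Z, z) F x y = gop (slice C X) (Z, s \<cdot> z) K (t \<cdot> x) (t \<cdot> y)" by blast
  have one: "T.gone (Z, z) F \<in> Hom C Z P" "t \<cdot> T.gone (Z, z) F = S.gone (Z, s \<cdot> z) K"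
    "p \<cdot> T.gone (Z, z) F = z"
    if z: "z \<in> Hom C Z Y" for Z z
  proof -
    have "bang (slice C Y) (Z, z) \<in> Hom (slice C Y) (Z, z) (U, u)"
      using T.bang_in[of "(Z, z)"] z unfolding U by simp
    then have b: "bang (slice C Y) (Z, z) \<in> Hom C Z U" "u \<cdot> bang (slice C Y) (Z, z) = z"
      by simp_all
    have b': "bang (slice C Y) (Z, z) \<in> Hom (slice C X) (Z, s \<cdot> z) (U, s \<cdot> u)"
      using b z comp_in[OF s z] comp_in[OF s u] comp_assoc[OF s b(1) u] by simp
    show "T.gone (Z, z) F \<in> Hom C Z P" using b e by auto
    show "t \<cdot> T.gone (Z, z) F = S.gone (Z, s \<cdot> z) K"
      using comp_reduce[OF e(2,1) h(3) b(1)] S.gone_comp[OF K b'] by simp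
    show "p \<cdot> T.gone (Z, z) F = z" using comp_reduce[OF e(3,1) h(4) b(1)] b by simp
  qed
  have inv: "ginv F \<cdot> x \<in> Hom C Z P" "t \<cdot> (ginv F \<cdot> x) = ginv K \<cdot> (t \<cdot> x)" "p \<cdot> (ginv F \<cdot> x) = p \<cdot> x"
    if x: "x \<in> Hom C Z P" for Z x
    using comp_reduce[OF i(2,1) h(3) x] comp_reduce[OF i(3,1) h(4) x]
      comp_assoc[of "ginv K" B B x Z P t] K'(3) gK h x i by auto
  show "group_object (slice C Y) F"
  proof (rule T.group_objectI)
    show "gob F \<in> Obj (slice C Y)" "gmul F \<in> Hom (slice C Y) (Prod (slice C Y) (gob F) (gob F)) (gob F)"
      "ginv F \<in> Hom (slice C Y) (gob F) (gob F)" "gunit F \<in> Hom (slice C Y) (term_obj (slice C Y)) (gob F)"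
      using F0 m i e r u h by (auto simp: gob S U)
    fix Zz :: "'o \<times> 'a" and x
    obtain Z z where Z: "Zz = (Z, z)" by (cases Zz)
    { fix y w assume "x \<in> Hom (slice C Y) Zz (gob F)" "y \<in> Hom (slice C Y) Zz (gob F)"
        "w \<in> Hom (slice C Y) Zz (gob F)"
      then have x: "x \<in> Hom C Z P" "y \<in> Hom C Z P" "w \<in> Hom C Z P" "p \<cdot> x = z" "p \<cdot> y = z" "p \<cdot> w = z"
        by (auto simp: Z gob)
      show "gop (slice C Y) Zz F (gop (slice C Y) Zz F x y) w = gop (slice C Y) Zz F x (gop (slice C Y) Zz F y w)"
        unfolding Z by (rule is_pullback_ext[OF pb, of _ Z])
          (use x gop S.gop_assoc[OF K el'[OF x(1,4)] el'[OF x(2,5)] el'[OF x(3,6)]] in simp_all) }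
    { assume "x \<in> Hom (slice C Y) Zz (gob F)"
      then have x: "x \<in> Hom C Z P" "p \<cdot> x = z" "z \<in> Hom C Z Y" by (auto simp: Z gob)
      note E = S.gop_one_left[OF K el'[OF x(1,2)]] S.gop_one_right[OF K el'[OF x(1,2)]]
        S.gop_inv_left[OF K el'[OF x(1,2)]] S.gop_inv_right[OF K el'[OF x(1,2)]]
      show "gop (slice C Y) Zz F (T.gone Zz F) x = x"
        unfolding Z by (rule is_pullback_ext[OF pb, of _ Z]) (use x gop one[OF x(3)] E in simp_all)
      show "gop (slice C Y) Zz F x (T.gone Zz F) = x"
        unfolding Z by (rule is_pullback_ext[OF pb, of _ Z]) (use x gop one[OF x(3)] E in simp_all)
      show "gop (slice C Y) Zz F (ginv F \<cdot>\<^bsub>slice C Y\<^esub> x) x = T.gone Zz F"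
        unfolding Z by (rule is_pullback_ext[OF pb, of _ Z]) (use x gop one[OF x(3)] inv[OF x(1)] E in simp_all)
      show "gop (slice C Y) Zz F x (ginv F \<cdot>\<^bsub>slice C Y\<^esub> x) = T.gone Zz F"
        unfolding Z by (rule is_pullback_ext[OF pb, of _ Z]) (use x gop one[OF x(3)] inv[OF x(1)] E in simp_all) }
  qed
qed

end

section \<open>Internal graphs\<close>

lemma Graph_sel [simp]:
  "X \<in> Obj (Graph C) \<longleftrightarrow> d0 X \<in> Hom C (edges X) (verts X) \<and> d1 X \<in> Hom C (edges X) (verts X)"
  "g \<cdot>\<^bsub>Graph C\<^esub> f = (fst g \<cdot>\<^bsub>C\<^esub> fst f, snd g \<cdot>\<^bsub>C\<^esub> snd f)"
  "Id (Graph C) X = (Id C (edges X), Id C (verts X))"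
  by (auto simp: Graph_def case_prod_unfold)

lemma Graph_Hom:
  "f \<in> Hom (Graph C) X Y \<longleftrightarrow> X \<in> Obj (Graph C) \<and> Y \<in> Obj (Graph C) \<and>
     fst f \<in> Hom C (edges X) (edges Y) \<and> snd f \<in> Hom C (verts X) (verts Y) \<and>
     d0 Y \<cdot>\<^bsub>C\<^esub> fst f = snd f \<cdot>\<^bsub>C\<^esub> d0 X \<and> d1 Y \<cdot>\<^bsub>C\<^esub> fst f = snd f \<cdot>\<^bsub>C\<^esub> d1 X"
  by (cases f) (auto simp: Graph_def)

lemma Graph_HomD:
  assumes "f \<in> Hom (Graph C) X Y"
  shows "fst f \<in> Hom C (edges X) (edges Y)" "snd f \<in> Hom C (verts X) (verts Y)"
    "d0 Y \<cdot>\<^bsub>C\<^esub> fst f = snd f \<cdot>\<^bsub>C\<^esub> d0 X" "d1 Y \<cdot>\<^bsub>C\<^esub> fst f = snd f \<cdot>\<^bsub>C\<^esub> d1 X"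
    "d0 X \<in> Hom C (edges X) (verts X)" "d1 X \<in> Hom C (edges X) (verts X)"
    "d0 Y \<in> Hom C (edges Y) (verts Y)" "d1 Y \<in> Hom C (edges Y) (verts Y)"
  using assms by (auto simp: Graph_Hom)

context Cat
begin

lemma Graph_Obj: "X \<in> Obj (Graph C) \<Longrightarrow> edges X \<in> Obj C \<and> verts X \<in> Obj C"
  using Hom_Obj by auto

lemma category_Graph: "category (Graph C)"
  unfolding category_def
proof (intro conjI allI impI ballI, goal_cases)
  case (4 A B D f g)
  then have f: "f \<in> Hom (Graph C) A B" and g: "g \<in> Hom (Graph C) B D" by auto
  note f' = Graph_HomD[OF f] and g' = Graph_HomD[OF g]
  have "d0 D \<cdot> (fst g \<cdot> fst f) = (snd g \<cdot> snd f) \<cdot> d0 A"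
    using comp_assoc[OF g'(7) f'(1) g'(1)] comp_assoc[OF g'(2) f'(1) g'(5)]
      comp_assoc[OF g'(2) f'(5) f'(2)] f'(3) g'(3) by simp
  moreover have "d1 D \<cdot> (fst g \<cdot> fst f) = (snd g \<cdot> snd f) \<cdot> d1 A"
    using comp_assoc[OF g'(8) f'(1) g'(1)] comp_assoc[OF g'(2) f'(1) g'(6)]
      comp_assoc[OF g'(2) f'(6) f'(2)] f'(4) g'(4) by simp
  ultimately show ?case using f' g' by (auto simp: Graph_Hom)
next
  case (3 A) then show ?case using Hom_Obj by (auto simp: Graph_Hom)
next
  case (7 A B D E f g h)
  then show ?case by (auto simp: Graph_Hom intro: comp_assoc)
qed (auto simp: Graph_Hom)

lemma is_product_of_pullback:
  assumes T: "is_terminal C T" and P: "is_pullback C A B T f g P p q"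
  shows "is_product C A B P p q"
proof (rule is_productI)
  note h = is_pullback_hom[OF P]
  show "p \<in> Hom C P A" "q \<in> Hom C P B" using h by auto
  fix Z
  { fix x y assume x: "x \<in> Hom C Z A" "y \<in> Hom C Z B"
    have "f \<cdot> x \<in> Hom C Z T" "g \<cdot> y \<in> Hom C Z T" using x h by auto
    then have "f \<cdot> x = g \<cdot> y" using T Hom_Obj(1)[OF x(1)] unfolding is_terminal_def by blast
    then show "\<exists>u \<in> Hom C Z P. p \<cdot> u = x \<and> q \<cdot> u = y" using tuple_is_pullback[OF P x] by blast }
  { fix u v assume "u \<in> Hom C Z P" "v \<in> Hom C Z P" "p \<cdot> u = p \<cdot> v" "q \<cdot> u = q \<cdot> v"
    then show "u = v" using is_pullback_ext[OF P] by blast }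
qed

section \<open>Limits and colimits of graphs, built on edges and vertices separately\<close>

lemma pullback_induced:
  assumes P: "is_pullback C A B D f g P p q" and P': "is_pullback C A' B' D' f' g' P' p' q'"
    and d: "a \<in> Hom C A A'" "b \<in> Hom C B B'" "d \<in> Hom C D D'" "f' \<cdot> a = d \<cdot> f" "g' \<cdot> b = d \<cdot> g"
  defines "u \<equiv> tuple C P P' p' q' (a \<cdot> p) (b \<cdot> q)"
  shows "u \<in> Hom C P P'" "p' \<cdot> u = a \<cdot> p" "q' \<cdot> u = b \<cdot> q"
proof -
  note h = is_pullback_hom[OF P] and h' = is_pullback_hom[OF P']
  have "f' \<cdot> (a \<cdot> p) = g' \<cdot> (b \<cdot> q)"
    using comp_reduce[OF d(4,1) h'(1) h(3)] comp_reduce[OF d(5,2) h'(2) h(4)]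
      comp_assoc[OF d(3) h(3,1)] comp_assoc[OF d(3) h(4,2)] h(5) by simp
  from tuple_is_pullback[OF P' _ _ this]
  show "u \<in> Hom C P P'" "p' \<cdot> u = a \<cdot> p" "q' \<cdot> u = b \<cdot> q" using d h unfolding u_def by auto
qed

text \<open>Shows that maps into a pullback, induced separately on edges and on vertices, commute
  with \<open>d0\<close> or \<open>d1\<close>; the primed data belong to the vertices. It is enough
  to compare after both projections.\<close>

lemma pullback_square:
  assumes P': "is_pullback C A' B' D' f' g' P' p' q'"
    and dP: "dP \<in> Hom C P P'" "p' \<cdot> dP = a \<cdot> p" "q' \<cdot> dP = b \<cdot> q"
    and x: "p \<cdot> uE = xE" "q \<cdot> uE = yE" "p' \<cdot> uV = xV" "q' \<cdot> uV = yV" "uE \<in> Hom C Z P" "uV \<in> Hom C Z' P'"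
    and d: "dZ \<in> Hom C Z Z'" "a \<in> Hom C A A'" "b \<in> Hom C B B'" "p \<in> Hom C P A" "q \<in> Hom C P B"
      "a \<cdot> xE = xV \<cdot> dZ" "b \<cdot> yE = yV \<cdot> dZ"
  shows "dP \<cdot> uE = uV \<cdot> dZ"
proof (rule is_pullback_ext[OF P', of _ Z])
  note h' = is_pullback_hom[OF P']
  show "dP \<cdot> uE \<in> Hom C Z P'" "uV \<cdot> dZ \<in> Hom C Z P'" using dP x d by auto
  show "p' \<cdot> (dP \<cdot> uE) = p' \<cdot> (uV \<cdot> dZ)"
    using comp_reduce[OF dP(2,1) h'(3) x(5)] comp_assoc[OF d(2) x(5) d(4)] comp_assoc[OF h'(3) d(1) x(6)] x d
    by simp
  show "q' \<cdot> (dP \<cdot> uE) = q' \<cdot> (uV \<cdot> dZ)"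
    using comp_reduce[OF dP(3,1) h'(4) x(5)] comp_assoc[OF d(3) x(5) d(5)] comp_assoc[OF h'(4) d(1) x(6)] x d
    by simp
qed

lemma graph_pullback:
  assumes f: "f \<in> Hom (Graph C) A D" and g: "g \<in> Hom (Graph C) B D"
    and PE: "is_pullback C (edges A) (edges B) (edges D) (fst f) (fst g) PE pE qE"
    and PV: "is_pullback C (verts A) (verts B) (verts D) (snd f) (snd g) PV pV qV"
  shows "is_pullback (Graph C) A B D f g
    \<lparr> edges = PE, verts = PV, d0 = tuple C PE PV pV qV (d0 A \<cdot> pE) (d0 B \<cdot> qE),
      d1 = tuple C PE PV pV qV (d1 A \<cdot> pE) (d1 B \<cdot> qE) \<rparr> (pE, pV) (qE, qV)" (is "is_pullback _ _ _ _ _ _ ?P _ _")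
proof -
  interpret G: Cat "Graph C" by unfold_locales (rule category_Graph)
  note f' = Graph_HomD[OF f] and g' = Graph_HomD[OF g]
  note e = is_pullback_hom[OF PE] and v = is_pullback_hom[OF PV]
  note i0 = pullback_induced[OF PE PV f'(5) g'(5) f'(7) f'(3)[symmetric] g'(3)[symmetric]]
  note i1 = pullback_induced[OF PE PV f'(6) g'(6) f'(8) f'(4)[symmetric] g'(4)[symmetric]]
  have pq: "(pE, pV) \<in> Hom (Graph C) ?P A" "(qE, qV) \<in> Hom (Graph C) ?P B"
    using i0 i1 f' g' e v by (auto simp: Graph_Hom)
  show ?thesis
  proof (rule G.is_pullbackI[OF f g pq])
    show "f \<cdot>\<^bsub>Graph C\<^esub> (pE, pV) = g \<cdot>\<^bsub>Graph C\<^esub> (qE, qV)" using e v by simp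
    fix Z
    { fix x y assume xy: "x \<in> Hom (Graph C) Z A" "y \<in> Hom (Graph C) Z B"
        "f \<cdot>\<^bsub>Graph C\<^esub> x = g \<cdot>\<^bsub>Graph C\<^esub> y"
      note x = Graph_HomD[OF xy(1)] and y = Graph_HomD[OF xy(2)]
      have uE: "fst f \<cdot> fst x = fst g \<cdot> fst y" and uV: "snd f \<cdot> snd x = snd g \<cdot> snd y" using xy by auto
      note tE = tuple_is_pullback[OF PE x(1) y(1) uE] and tV = tuple_is_pullback[OF PV x(2) y(2) uV]
      note s0 = pullback_square[OF PV i0 tE(2,3) tV(2,3) tE(1) tV(1) x(5) f'(5) g'(5) e(3,4) x(3) y(3)]
      note s1 = pullback_square[OF PV i1 tE(2,3) tV(2,3) tE(1) tV(1) x(6) f'(6) g'(6) e(3,4) x(4) y(4)]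
      let ?u = "(tuple C (edges Z) PE pE qE (fst x) (fst y), tuple C (verts Z) PV pV qV (snd x) (snd y))"
      have "?u \<in> Hom (Graph C) Z ?P" using s0 s1 tE tV x i0 i1 by (simp add: Graph_Hom)
      then show "\<exists>u\<in>Hom (Graph C) Z ?P. (pE, pV) \<cdot>\<^bsub>Graph C\<^esub> u = x \<and> (qE, qV) \<cdot>\<^bsub>Graph C\<^esub> u = y"
        using tE tV by (intro bexI[of _ ?u]) auto }
    { fix u w assume "u \<in> Hom (Graph C) Z ?P" "w \<in> Hom (Graph C) Z ?P"
        "(pE, pV) \<cdot>\<^bsub>Graph C\<^esub> u = (pE, pV) \<cdot>\<^bsub>Graph C\<^esub> w" "(qE, qV) \<cdot>\<^bsub>Graph C\<^esub> u = (qE, qV) \<cdot>\<^bsub>Graph C\<^esub> w"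
      then show "u = w"
        using is_pullback_ext[OF PE, of "fst u" "edges Z" "fst w"]
          is_pullback_ext[OF PV, of "snd u" "verts Z" "snd w"]
        by (intro prod_eqI) (auto simp: Graph_Hom) }
  qed
qed

lemma graph_equaliser:
  assumes f: "f \<in> Hom (Graph C) A B" and g: "g \<in> Hom (Graph C) A B"
    and PE: "is_equaliser C (edges A) (edges B) (fst f) (fst g) PE pE"
    and PV: "is_equaliser C (verts A) (verts B) (snd f) (snd g) PV pV"
  shows "is_equaliser (Graph C) A B f g
    \<lparr> edges = PE, verts = PV, d0 = factor C PE PV pV (d0 A \<cdot> pE), d1 = factor C PE PV pV (d1 A \<cdot> pE) \<rparr>
    (pE, pV)" (is "is_equaliser _ _ _ _ _ ?P _")
proof -
  interpret G: Cat "Graph C" by unfold_locales (rule category_Graph)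
  note f' = Graph_HomD[OF f] and g' = Graph_HomD[OF g]
  note e = is_equaliser_hom[OF PE] and v = is_equaliser_hom[OF PV]
  have "snd f \<cdot> (d0 A \<cdot> pE) = snd g \<cdot> (d0 A \<cdot> pE)"
    using comp_reduce[OF f'(3)[symmetric] f'(5) f'(2) e(3)] comp_reduce[OF g'(3)[symmetric] f'(5) g'(2) e(3)]
      comp_assoc[OF f'(7) e(3) f'(1)] comp_assoc[OF f'(7) e(3) g'(1)] e(4) by simp
  note i0 = factor_is_equaliser[OF PV comp_in[OF f'(5) e(3)] this]
  have "snd f \<cdot> (d1 A \<cdot> pE) = snd g \<cdot> (d1 A \<cdot> pE)"
    using comp_reduce[OF f'(4)[symmetric] f'(6) f'(2) e(3)] comp_reduce[OF g'(4)[symmetric] f'(6) g'(2) e(3)]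
      comp_assoc[OF f'(8) e(3) f'(1)] comp_assoc[OF f'(8) e(3) g'(1)] e(4) by simp
  note i1 = factor_is_equaliser[OF PV comp_in[OF f'(6) e(3)] this]
  have p: "(pE, pV) \<in> Hom (Graph C) ?P A"
    using i0 i1 f' g' e v by (auto simp: Graph_Hom)
  show ?thesis
  proof (rule G.is_equaliserI[OF f g p])
    show "f \<cdot>\<^bsub>Graph C\<^esub> (pE, pV) = g \<cdot>\<^bsub>Graph C\<^esub> (pE, pV)" using e v by simp
    fix Z
    { fix x assume xy: "x \<in> Hom (Graph C) Z A" "f \<cdot>\<^bsub>Graph C\<^esub> x = g \<cdot>\<^bsub>Graph C\<^esub> x"
      note x = Graph_HomD[OF xy(1)]
      have uE: "fst f \<cdot> fst x = fst g \<cdot> fst x" and uV: "snd f \<cdot> snd x = snd g \<cdot> snd x" using xy by auto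
      note tE = factor_is_equaliser[OF PE x(1) uE] and tV = factor_is_equaliser[OF PV x(2) uV]
      let ?u = "(factor C (edges Z) PE pE (fst x), factor C (verts Z) PV pV (snd x))"
      have "d0 ?P \<cdot> fst ?u = snd ?u \<cdot> d0 Z"
      proof (rule is_equaliser_ext[OF PV, of _ "edges Z"])
        show "pV \<cdot> (d0 ?P \<cdot> fst ?u) = pV \<cdot> (snd ?u \<cdot> d0 Z)"
          using comp_reduce[OF i0(2,1) v(3) tE(1)] comp_reduce[OF tV(2,1) v(3) x(5)]
            comp_assoc[OF f'(5) tE(1) e(3)] tE x by simp
      qed (use i0 tE tV x in auto)
      moreover have "d1 ?P \<cdot> fst ?u = snd ?u \<cdot> d1 Z"
      proof (rule is_equaliser_ext[OF PV, of _ "edges Z"])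
        show "pV \<cdot> (d1 ?P \<cdot> fst ?u) = pV \<cdot> (snd ?u \<cdot> d1 Z)"
          using comp_reduce[OF i1(2,1) v(3) tE(1)] comp_reduce[OF tV(2,1) v(3) x(6)]
            comp_assoc[OF f'(6) tE(1) e(3)] tE x by simp
      qed (use i1 tE tV x in auto)
      ultimately have "?u \<in> Hom (Graph C) Z ?P" using tE tV x i0 i1 by (simp add: Graph_Hom)
      then show "\<exists>u\<in>Hom (Graph C) Z ?P. (pE, pV) \<cdot>\<^bsub>Graph C\<^esub> u = x"
        using tE tV by (intro bexI[of _ ?u]) auto }
    { fix u w assume "u \<in> Hom (Graph C) Z ?P" "w \<in> Hom (Graph C) Z ?P"
        "(pE, pV) \<cdot>\<^bsub>Graph C\<^esub> u = (pE, pV) \<cdot>\<^bsub>Graph C\<^esub> w"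
      then show "u = w"
        using is_equaliser_ext[OF PE, of "fst u" "edges Z" "fst w"]
          is_equaliser_ext[OF PV, of "snd u" "verts Z" "snd w"]
        by (intro prod_eqI) (auto simp: Graph_Hom) }
  qed
qed

lemma graph_coequaliser:
  assumes f: "f \<in> Hom (Graph C) A B" and g: "g \<in> Hom (Graph C) A B"
    and QE: "is_coequaliser C (edges A) (edges B) (fst f) (fst g) QE qE"
    and QV: "is_coequaliser C (verts A) (verts B) (snd f) (snd g) QV qV"
  shows "is_coequaliser (Graph C) A B f g
    \<lparr> edges = QE, verts = QV, d0 = cofactor C QE QV qE (qV \<cdot> d0 B), d1 = cofactor C QE QV qE (qV \<cdot> d1 B) \<rparr>
    (qE, qV)" (is "is_coequaliser _ _ _ _ _ ?Q _")
proof -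
  interpret G: Cat "Graph C" by unfold_locales (rule category_Graph)
  note f' = Graph_HomD[OF f] and g' = Graph_HomD[OF g]
  note e = is_coequaliser_hom[OF QE] and v = is_coequaliser_hom[OF QV]
  have "(qV \<cdot> d0 B) \<cdot> fst f = (qV \<cdot> d0 B) \<cdot> fst g"
    using comp_assoc[OF v(3) f'(1) f'(7)] comp_assoc[OF v(3) g'(1) f'(7)] f'(3) g'(3)
      comp_assoc[OF v(3) f'(5,2)] comp_assoc[OF v(3) f'(5) g'(2)] v(4) by simp
  note i0 = cofactor_is_coequaliser[OF QE comp_in[OF v(3) f'(7)] this]
  have "(qV \<cdot> d1 B) \<cdot> fst f = (qV \<cdot> d1 B) \<cdot> fst g"
    using comp_assoc[OF v(3) f'(1) f'(8)] comp_assoc[OF v(3) g'(1) f'(8)] f'(4) g'(4)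
      comp_assoc[OF v(3) f'(6,2)] comp_assoc[OF v(3) f'(6) g'(2)] v(4) by simp
  note i1 = cofactor_is_coequaliser[OF QE comp_in[OF v(3) f'(8)] this]
  have q: "(qE, qV) \<in> Hom (Graph C) B ?Q"
    using i0 i1 f' g' e v by (auto simp: Graph_Hom)
  show ?thesis
  proof (rule G.is_coequaliserI[OF f g q])
    show "(qE, qV) \<cdot>\<^bsub>Graph C\<^esub> f = (qE, qV) \<cdot>\<^bsub>Graph C\<^esub> g" using e v by simp
    fix Z
    { fix x assume xy: "x \<in> Hom (Graph C) B Z" "x \<cdot>\<^bsub>Graph C\<^esub> f = x \<cdot>\<^bsub>Graph C\<^esub> g"
      note x = Graph_HomD[OF xy(1)]
      have uE: "fst x \<cdot> fst f = fst x \<cdot> fst g" and uV: "snd x \<cdot> snd f = snd x \<cdot> snd g" using xy by auto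
      note tE = cofactor_is_coequaliser[OF QE x(1) uE] and tV = cofactor_is_coequaliser[OF QV x(2) uV]
      let ?u = "(cofactor C QE (edges Z) qE (fst x), cofactor C QV (verts Z) qV (snd x))"
      have "d0 Z \<cdot> fst ?u = snd ?u \<cdot> d0 ?Q"
      proof (rule is_coequaliser_ext[OF QE, of _ "verts Z"])
        show "(d0 Z \<cdot> fst ?u) \<cdot> qE = (snd ?u \<cdot> d0 ?Q) \<cdot> qE"
          using comp_assoc[OF x(7) e(3) tE(1)] comp_assoc[OF tV(1) e(3) i0(1)] i0(2) tE x
            comp_assoc[OF tV(1) f'(7) v(3)] tV by simp
      qed (use i0 tE tV x in auto)
      moreover have "d1 Z \<cdot> fst ?u = snd ?u \<cdot> d1 ?Q"
      proof (rule is_coequaliser_ext[OF QE, of _ "verts Z"])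
        show "(d1 Z \<cdot> fst ?u) \<cdot> qE = (snd ?u \<cdot> d1 ?Q) \<cdot> qE"
          using comp_assoc[OF x(8) e(3) tE(1)] comp_assoc[OF tV(1) e(3) i1(1)] i1(2) tE x
            comp_assoc[OF tV(1) f'(8) v(3)] tV by simp
      qed (use i1 tE tV x in auto)
      ultimately have "?u \<in> Hom (Graph C) ?Q Z" using tE tV x i0 i1 by (simp add: Graph_Hom)
      then show "\<exists>u\<in>Hom (Graph C) ?Q Z. u \<cdot>\<^bsub>Graph C\<^esub> (qE, qV) = x"
        using tE tV by (intro bexI[of _ ?u]) auto }
    { fix u w assume "u \<in> Hom (Graph C) ?Q Z" "w \<in> Hom (Graph C) ?Q Z"
        "u \<cdot>\<^bsub>Graph C\<^esub> (qE, qV) = w \<cdot>\<^bsub>Graph C\<^esub> (qE, qV)"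
      then show "u = w"
        using is_coequaliser_ext[OF QE, of "fst u" "edges Z" "fst w"]
          is_coequaliser_ext[OF QV, of "snd u" "verts Z" "snd w"]
        by (intro prod_eqI) (auto simp: Graph_Hom) }
  qed
qed

text \<open>Any coequaliser of graphs is isomorphic to the one built on edges and vertices
  separately, which exists as \<open>C\<close> has coequalisers; the universal property is carried
  over along the two components of the isomorphism.\<close>

lemma graph_coequaliser_components:
  assumes C: "has_coequalisers C" and Q: "is_coequaliser (Graph C) A B f g Q q"
  shows "is_coequaliser C (edges A) (edges B) (fst f) (fst g) (edges Q) (fst q)"
    "is_coequaliser C (verts A) (verts B) (snd f) (snd g) (verts Q) (snd q)"
proof -
  interpret G: Cat "Graph C" by unfold_locales (rule category_Graph)
  note h = is_coequaliser_hom[OF Q]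
  note f' = Graph_HomD[OF h(1)] and g' = Graph_HomD[OF h(2)]
  obtain QE qE where QE: "is_coequaliser C (edges A) (edges B) (fst f) (fst g) QE qE"
    using C f' g' unfolding has_coequalisers_def by blast
  obtain QV qV where QV: "is_coequaliser C (verts A) (verts B) (snd f) (snd g) QV qV"
    using C f' g' unfolding has_coequalisers_def by blast
  obtain u v where u: "u \<in> Hom (Graph C) \<lparr> edges = QE, verts = QV, d0 = cofactor C QE QV qE (qV \<cdot> d0 B), d1 = cofactor C QE QV qE (qV \<cdot> d1 B) \<rparr> Q"
      "v \<in> Hom (Graph C) Q \<lparr> edges = QE, verts = QV, d0 = cofactor C QE QV qE (qV \<cdot> d0 B), d1 = cofactor C QE QV qE (qV \<cdot> d1 B) \<rparr>"
    and e: "u \<cdot>\<^bsub>Graph C\<^esub> (qE, qV) = q"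
      "v \<cdot>\<^bsub>Graph C\<^esub> u = Id (Graph C) \<lparr> edges = QE, verts = QV, d0 = cofactor C QE QV qE (qV \<cdot> d0 B), d1 = cofactor C QE QV qE (qV \<cdot> d1 B) \<rparr>"
      "u \<cdot>\<^bsub>Graph C\<^esub> v = Id (Graph C) Q"
    using G.is_coequaliser_unique[OF graph_coequaliser[OF h(1,2) QE QV] Q] by metis
  show "is_coequaliser C (edges A) (edges B) (fst f) (fst g) (edges Q) (fst q)"
    using is_coequaliser_transport[OF QE, of "fst u" "edges Q" "fst v"] u e by (auto simp: Graph_Hom)
  show "is_coequaliser C (verts A) (verts B) (snd f) (snd g) (verts Q) (snd q)"
    using is_coequaliser_transport[OF QV, of "snd u" "verts Q" "snd v"] u e by (auto simp: Graph_Hom)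
qed

lemma has_coequalisers_Graph:
  assumes C: "has_coequalisers C"
  shows "has_coequalisers (Graph C)"
  unfolding has_coequalisers_def
proof (intro allI ballI)
  fix A B f g assume h: "f \<in> Hom (Graph C) A B" "g \<in> Hom (Graph C) A B"
  note f' = Graph_HomD[OF h(1)] and g' = Graph_HomD[OF h(2)]
  obtain QE qE where QE: "is_coequaliser C (edges A) (edges B) (fst f) (fst g) QE qE"
    using C f' g' unfolding has_coequalisers_def by blast
  obtain QV qV where QV: "is_coequaliser C (verts A) (verts B) (snd f) (snd g) QV qV"
    using C f' g' unfolding has_coequalisers_def by blast
  show "\<exists>Q q. is_coequaliser (Graph C) A B f g Q q" using graph_coequaliser[OF h QE QV] by blast
qed

text \<open>The structure maps of a constant graph are identities, so the edge component is forced
  by the vertex component. This is what later reduces homomorphisms into \<open>\<Delta>(K)\<close>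
  to vertices.\<close>

lemma const_graph_Hom:
  "f \<in> Hom (Graph C) X (const_graph C A) \<longleftrightarrow> X \<in> Obj (Graph C) \<and> A \<in> Obj C \<and>
     snd f \<in> Hom C (verts X) A \<and> fst f = snd f \<cdot> d0 X \<and> fst f = snd f \<cdot> d1 X"
proof (intro iffI conjI)
  assume f: "f \<in> Hom (Graph C) X (const_graph C A)"
  note f' = Graph_HomD[OF f]
  show "X \<in> Obj (Graph C)" using f by (simp add: Graph_Hom)
  show "A \<in> Obj C" using f'(2) Hom_Obj by (simp add: const_graph_def)
  show "snd f \<in> Hom C (verts X) A" "fst f = snd f \<cdot> d0 X" "fst f = snd f \<cdot> d1 X"
    using f' Id_comp[of "fst f" "edges X" A] by (auto simp: const_graph_def)
next
  assume a: "X \<in> Obj (Graph C) \<and> A \<in> Obj C \<and>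
     snd f \<in> Hom C (verts X) A \<and> fst f = snd f \<cdot> d0 X \<and> fst f = snd f \<cdot> d1 X"
  then have "fst f \<in> Hom C (edges X) A" by auto
  then show "f \<in> Hom (Graph C) X (const_graph C A)"
    using a Id_comp[of "fst f" "edges X" A] by (auto simp: Graph_Hom const_graph_def)
qed

end

section \<open>Finite limits in the category of graphs and their components\<close>

context Fin_Lim
begin

lemma Graph_terminal: "is_terminal (Graph C) (const_graph C (term_obj C))"
  unfolding is_terminal_def
proof (intro conjI ballI)
  show "const_graph C (term_obj C) \<in> Obj (Graph C)" by (simp add: const_graph_def)
  fix X assume X: "X \<in> Obj (Graph C)"
  then have o: "edges X \<in> Obj C" "verts X \<in> Obj C" using Graph_Obj by auto
  have "bang C (verts X) \<cdot> d0 X = bang C (edges X)" "bang C (verts X) \<cdot> d1 X = bang C (edges X)" using X by auto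
  then have "(bang C (edges X), bang C (verts X)) \<in> Hom (Graph C) X (const_graph C (term_obj C))"
    unfolding const_graph_Hom using X o by (simp only: fst_conv snd_conv bang_in Graph_sel term_Obj simp_thms)
  moreover have "f = (bang C (edges X), bang C (verts X))" if "f \<in> Hom (Graph C) X (const_graph C (term_obj C))" for f
  proof -
    have "snd f = bang C (verts X)" using that bang_unique[OF _ bang_in[OF o(2)]] unfolding const_graph_Hom by blast
    moreover have "fst f \<in> Hom C (edges X) (term_obj C)" using that X unfolding const_graph_Hom by auto
    then have "fst f = bang C (edges X)" using bang_unique[OF _ bang_in[OF o(1)]] by blast
    ultimately show ?thesis by (simp add: prod_eq_iff)
  qed
  ultimately show "\<exists>!f. f \<in> Hom (Graph C) X (const_graph C (term_obj C))" by blast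
qed

text \<open>Products are obtained as pullbacks over the terminal graph, so that the componentwise
  pullbacks suffice.\<close>

lemma Fin_Lim_Graph: "Fin_Lim (Graph C)"
proof -
  interpret G: Cat "Graph C" by unfold_locales (rule category_Graph)
  show ?thesis
  proof (unfold_locales, unfold has_finite_limits_def, intro conjI ballI allI)
    show "\<exists>T. is_terminal (Graph C) T" using Graph_terminal by blast
    fix X Y
    { assume o: "X \<in> Obj (Graph C)" "Y \<in> Obj (Graph C)"
      obtain f where f: "f \<in> Hom (Graph C) X (const_graph C (term_obj C))"
        using Graph_terminal o unfolding is_terminal_def by blast
      obtain g where g: "g \<in> Hom (Graph C) Y (const_graph C (term_obj C))"
        using Graph_terminal o unfolding is_terminal_def by blast
      note f' = Graph_HomD[OF f] and g' = Graph_HomD[OF g]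
      obtain PE pE qE where "is_pullback C (edges X) (edges Y) (edges (const_graph C (term_obj C))) (fst f) (fst g) PE pE qE"
        using ex_pullback[OF f'(1) g'(1)] .
      moreover obtain PV pV qV where "is_pullback C (verts X) (verts Y) (verts (const_graph C (term_obj C))) (snd f) (snd g) PV pV qV"
        using ex_pullback[OF f'(2) g'(2)] .
      ultimately show "\<exists>P p q. is_product (Graph C) X Y P p q"
        using G.is_product_of_pullback[OF Graph_terminal graph_pullback[OF f g]] by blast }
    { fix f g assume f: "f \<in> Hom (Graph C) X Y" and g: "g \<in> Hom (Graph C) X Y"
      note f' = Graph_HomD[OF f] and g' = Graph_HomD[OF g]
      obtain PE pE where "is_equaliser C (edges X) (edges Y) (fst f) (fst g) PE pE"
        using ex_equaliser[OF f'(1) g'(1)] .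
      moreover obtain PV pV where "is_equaliser C (verts X) (verts Y) (snd f) (snd g) PV pV"
        using ex_equaliser[OF f'(2) g'(2)] .
      ultimately show "\<exists>E e. is_equaliser (Graph C) X Y f g E e"
        using graph_equaliser[OF f g] by blast }
  qed
qed

lemma graph_pullback_components:
  assumes P: "is_pullback (Graph C) A B D f g P p q"
  shows "is_pullback C (edges A) (edges B) (edges D) (fst f) (fst g) (edges P) (fst p) (fst q)"
    "is_pullback C (verts A) (verts B) (verts D) (snd f) (snd g) (verts P) (snd p) (snd q)"
proof -
  interpret G: Cat "Graph C" by unfold_locales (rule category_Graph)
  note h = G.is_pullback_hom[OF P]
  note f' = Graph_HomD[OF h(1)] and g' = Graph_HomD[OF h(2)]
  obtain PE pE qE where PE: "is_pullback C (edges A) (edges B) (edges D) (fst f) (fst g) PE pE qE"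
    using ex_pullback[OF f'(1) g'(1)] .
  obtain PV pV qV where PV: "is_pullback C (verts A) (verts B) (verts D) (snd f) (snd g) PV pV qV"
    using ex_pullback[OF f'(2) g'(2)] .
  define P0 where "P0 = \<lparr> edges = PE, verts = PV, d0 = tuple C PE PV pV qV (d0 A \<cdot> pE) (d0 B \<cdot> qE),
      d1 = tuple C PE PV pV qV (d1 A \<cdot> pE) (d1 B \<cdot> qE) \<rparr>"
  have s: "edges P0 = PE" "verts P0 = PV" by (simp_all add: P0_def)
  obtain u v where u: "u \<in> Hom (Graph C) P0 P" "v \<in> Hom (Graph C) P P0"
    and e: "(pE, pV) \<cdot>\<^bsub>Graph C\<^esub> v = p" "(qE, qV) \<cdot>\<^bsub>Graph C\<^esub> v = q"
      "v \<cdot>\<^bsub>Graph C\<^esub> u = Id (Graph C) P0" "u \<cdot>\<^bsub>Graph C\<^esub> v = Id (Graph C) P"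
    using G.is_pullback_unique[OF graph_pullback[OF h(1,2) PE PV] P] unfolding P0_def by metis
  show "is_pullback C (edges A) (edges B) (edges D) (fst f) (fst g) (edges P) (fst p) (fst q)"
    using is_pullback_transport[OF PE, of "fst u" "edges P" "fst v"] u e s by (auto simp: Graph_Hom)
  show "is_pullback C (verts A) (verts B) (verts D) (snd f) (snd g) (verts P) (snd p) (snd q)"
    using is_pullback_transport[OF PV, of "snd u" "verts P" "snd v"] u e s by (auto simp: Graph_Hom)
qed

lemma graph_equaliser_components:
  assumes P: "is_equaliser (Graph C) A B f g P p"
  shows "is_equaliser C (edges A) (edges B) (fst f) (fst g) (edges P) (fst p)"
    "is_equaliser C (verts A) (verts B) (snd f) (snd g) (verts P) (snd p)"
proof -
  interpret G: Cat "Graph C" by unfold_locales (rule category_Graph)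
  note h = G.is_equaliser_hom[OF P]
  note f' = Graph_HomD[OF h(1)] and g' = Graph_HomD[OF h(2)]
  obtain PE pE where PE: "is_equaliser C (edges A) (edges B) (fst f) (fst g) PE pE"
    using ex_equaliser[OF f'(1) g'(1)] .
  obtain PV pV where PV: "is_equaliser C (verts A) (verts B) (snd f) (snd g) PV pV"
    using ex_equaliser[OF f'(2) g'(2)] .
  define P0 where "P0 = \<lparr> edges = PE, verts = PV, d0 = factor C PE PV pV (d0 A \<cdot> pE),
    d1 = factor C PE PV pV (d1 A \<cdot> pE) \<rparr>"
  have s: "edges P0 = PE" "verts P0 = PV" by (simp_all add: P0_def)
  obtain u v where u: "u \<in> Hom (Graph C) P0 P" "v \<in> Hom (Graph C) P P0"
    and e: "(pE, pV) \<cdot>\<^bsub>Graph C\<^esub> v = p"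
      "v \<cdot>\<^bsub>Graph C\<^esub> u = Id (Graph C) P0" "u \<cdot>\<^bsub>Graph C\<^esub> v = Id (Graph C) P"
    using G.is_equaliser_unique[OF graph_equaliser[OF h(1,2) PE PV] P] unfolding P0_def by metis
  show "is_equaliser C (edges A) (edges B) (fst f) (fst g) (edges P) (fst p)"
    using is_equaliser_transport[OF PE, of "fst u" "edges P" "fst v"] u e s by (auto simp: Graph_Hom)
  show "is_equaliser C (verts A) (verts B) (snd f) (snd g) (verts P) (snd p)"
    using is_equaliser_transport[OF PV, of "snd u" "verts P" "snd v"] u e s by (auto simp: Graph_Hom)
qed

end

section \<open>Groups over a graph\<close>

text \<open>The image of a group object under a functor preserving finite products. Chosen products
  and terminal objects need not be preserved on the nose; the \<open>tuple\<close> and the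
  \<open>THE\<close> are the comparison maps that repair this.\<close>

definition functor_group ::
  "('d, 'x) cat \<Rightarrow> ('e, 'y) cat \<Rightarrow> ('d \<Rightarrow> 'e) \<Rightarrow> ('x \<Rightarrow> 'y) \<Rightarrow> ('d, 'x) grp \<Rightarrow> ('e, 'y) grp" where
  "functor_group D E Fo Fa K =
     (let G = gob K; F = Fo G
      in \<lparr> gob = F,
           gmul = Fa (gmul K) \<cdot>\<^bsub>E\<^esub>
             tuple E (Prod E F F) (Fo (Prod D G G)) (Fa (pr1 D G G)) (Fa (pr2 D G G)) (pr1 E F F) (pr2 E F F),
           ginv = Fa (ginv K),
           gunit = Fa (gunit K) \<cdot>\<^bsub>E\<^esub> (THE f. f \<in> Hom E (term_obj E) (Fo (term_obj D))) \<rparr>)"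

text \<open>A functor preserving finite products. It is applied to the edge and vertex projections,
  for which the composition law holds for arbitrary pairs of arrows; hence \<open>Fa_comp\<close>
  carries no typing premise.\<close>

locale Prod_Functor = D: Fin_Lim D + E: Fin_Lim E
  for D :: "('d, 'x) cat" and E :: "('e, 'y) cat" +
  fixes Fo :: "'d \<Rightarrow> 'e" and Fa :: "'x \<Rightarrow> 'y"
  assumes Fa_hom: "f \<in> Hom D A B \<Longrightarrow> Fa f \<in> Hom E (Fo A) (Fo B)"
    and Fa_comp: "Fa (g \<cdot>\<^bsub>D\<^esub> f) = Fa g \<cdot>\<^bsub>E\<^esub> Fa f"
    and Fa_product: "is_product D A B P p q \<Longrightarrow> is_product E (Fo A) (Fo B) (Fo P) (Fa p) (Fa q)"
    and Fa_terminal: "is_terminal D T \<Longrightarrow> is_terminal E (Fo T)"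
begin

text \<open>A pair of elements of \<open>Fo G\<close> is one element \<open>w\<close> of
  \<open>Fo (G \<times> G)\<close>, since the product is preserved. In this form the comparison map
  disappears from the multiplication.\<close>

lemma functor_group_gop:
  assumes K: "group_object D K" and w: "w \<in> Hom E Z (Fo (Prod D (gob K) (gob K)))"
  shows "gop E Z (functor_group D E Fo Fa K) (Fa (pr1 D (gob K) (gob K)) \<cdot>\<^bsub>E\<^esub> w)
      (Fa (pr2 D (gob K) (gob K)) \<cdot>\<^bsub>E\<^esub> w) = Fa (gmul K) \<cdot>\<^bsub>E\<^esub> w"
proof -
  let ?G = "gob K" let ?F = "Fo ?G" let ?GG = "Prod D ?G ?G"
  note h = D.group_object_hom[OF K]
  have P: "is_product E ?F ?F (Fo ?GG) (Fa (pr1 D ?G ?G)) (Fa (pr2 D ?G ?G))"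
    by (rule Fa_product[OF D.Prod_is_product]) (use h in auto)
  note pr = E.is_product_hom[OF P]
  have o: "?F \<in> Obj E" using pr E.Hom_Obj by blast
  have pe: "pr1 E ?F ?F \<in> Hom E (Prod E ?F ?F) ?F" "pr2 E ?F ?F \<in> Hom E (Prod E ?F ?F) ?F"
    using o by auto
  note t = E.tuple_is_product[OF P pe]
  let ?t = "tuple E (Prod E ?F ?F) (Fo ?GG) (Fa (pr1 D ?G ?G)) (Fa (pr2 D ?G ?G)) (pr1 E ?F ?F) (pr2 E ?F ?F)"
  let ?x = "Fa (pr1 D ?G ?G) \<cdot>\<^bsub>E\<^esub> w" and ?y = "Fa (pr2 D ?G ?G) \<cdot>\<^bsub>E\<^esub> w"
  have xy: "?x \<in> Hom E Z ?F" "?y \<in> Hom E Z ?F" using pr w by auto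
  note p = E.pair_in[OF xy]
  have "?t \<cdot>\<^bsub>E\<^esub> pair E Z ?F ?F ?x ?y = w"
  proof (rule E.is_product_ext[OF P _ w])
    show "?t \<cdot>\<^bsub>E\<^esub> pair E Z ?F ?F ?x ?y \<in> Hom E Z (Fo ?GG)" using t p by auto
    show "Fa (pr1 D ?G ?G) \<cdot>\<^bsub>E\<^esub> (?t \<cdot>\<^bsub>E\<^esub> pair E Z ?F ?F ?x ?y) = ?x"
      using E.comp_reduce[OF t(2,1) pr(1) p] E.pr_pair[OF xy] by simp
    show "Fa (pr2 D ?G ?G) \<cdot>\<^bsub>E\<^esub> (?t \<cdot>\<^bsub>E\<^esub> pair E Z ?F ?F ?x ?y) = ?y"
      using E.comp_reduce[OF t(3,1) pr(2) p] E.pr_pair[OF xy] by simp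
  qed
  then show ?thesis
    using E.comp_assoc[OF Fa_hom[OF h(2)] p t(1)] by (simp add: gop_def functor_group_def Let_def)
qed

lemma Fa_pair:
  assumes o: "A \<in> Obj D" "B \<in> Obj D" and x: "x \<in> Hom E Z (Fo A)" "y \<in> Hom E Z (Fo B)"
  obtains w where "w \<in> Hom E Z (Fo (Prod D A B))" "Fa (pr1 D A B) \<cdot>\<^bsub>E\<^esub> w = x"
    "Fa (pr2 D A B) \<cdot>\<^bsub>E\<^esub> w = y"
  using E.tuple_is_product[OF Fa_product[OF D.Prod_is_product[OF o]] x] that by blast

lemma Fa_gop:
  assumes K: "group_object D K" and x: "x \<in> Hom D Z (gob K)" "y \<in> Hom D Z (gob K)"
  shows "gop E (Fo Z) (functor_group D E Fo Fa K) (Fa x) (Fa y) = Fa (gop D Z K x y)"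
  using functor_group_gop[OF K Fa_hom[OF D.pair_in[OF x]]] D.pr_pair[OF x]
  by (simp add: Fa_comp[symmetric] gop_def)

text \<open>Every tuple of elements at stage \<open>Z\<close> factors through the image of the
  generic tuple of \<open>D\<close>, and \<open>nat\<close> moves the multiplication across; so each
  axiom is the image of the axiom of \<open>K\<close> for generic elements.\<close>

lemma group_object_functor_group:
  assumes K: "group_object D K"
  shows "group_object E (functor_group D E Fo Fa K)" (is "group_object E ?F")
proof -
  let ?G = "gob K" let ?GG = "Prod D ?G ?G" let ?W = "Prod D ?GG ?G"
  note h = D.group_object_hom[OF K]
  have G: "gob ?F = Fo ?G" by (simp add: functor_group_def Let_def)
  have id: "Id D ?G \<in> Hom D ?G ?G" using h by simp
  have FG: "Fo ?G \<in> Obj E" using Fa_hom[OF id] E.Hom_Obj by blast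
  have pr: "pr1 E (Fo ?G) (Fo ?G) \<in> Hom E (Prod E (Fo ?G) (Fo ?G)) (Fo ?G)"
    "pr2 E (Fo ?G) (Fo ?G) \<in> Hom E (Prod E (Fo ?G) (Fo ?G)) (Fo ?G)" using FG by auto
  define t where "t = (THE f. f \<in> Hom E (term_obj E) (Fo (term_obj D)))"
  have T: "is_terminal E (Fo (term_obj D))" using Fa_terminal[OF D.term_is_terminal] .
  have t: "t \<in> Hom E (term_obj E) (Fo (term_obj D))"
    unfolding t_def by (rule theI') (use T E.term_Obj in \<open>auto simp: is_terminal_def\<close>)
  have u: "gunit ?F = Fa (gunit K) \<cdot>\<^bsub>E\<^esub> t" "ginv ?F = Fa (ginv K)"
    by (simp_all add: functor_group_def Let_def t_def)
  have gone: "E.gone Z ?F = Fa (D.gone ?G K) \<cdot>\<^bsub>E\<^esub> x" if x: "x \<in> Hom E Z (Fo ?G)" for Z x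
  proof -
    have b: "bang E Z \<in> Hom E Z (term_obj E)" "Fa (bang D ?G) \<in> Hom E (Fo ?G) (Fo (term_obj D))"
      using E.Hom_Obj[OF x] Fa_hom[OF D.bang_in[OF h(1)]] by auto
    have "t \<cdot>\<^bsub>E\<^esub> bang E Z = Fa (bang D ?G) \<cdot>\<^bsub>E\<^esub> x"
      using T E.comp_in[OF t b(1)] E.comp_in[OF b(2) x] E.Hom_Obj[OF x] unfolding is_terminal_def by blast
    then show ?thesis
      using E.comp_assoc[OF Fa_hom[OF h(4)] b(1) t] E.comp_assoc[OF Fa_hom[OF h(4)] x b(2)]
      by (simp add: u Fa_comp)
  qed
  have m: "gmul ?F \<in> Hom E (Prod E (gob ?F) (gob ?F)) (gob ?F)"
  proof -
    have "tuple E (Prod E (Fo ?G) (Fo ?G)) (Fo ?GG) (Fa (pr1 D ?G ?G)) (Fa (pr2 D ?G ?G)) (pr1 E (Fo ?G) (Fo ?G))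
       (pr2 E (Fo ?G) (Fo ?G)) \<in> Hom E (Prod E (Fo ?G) (Fo ?G)) (Fo ?GG)"
      using E.tuple_is_product(1)[OF Fa_product[OF D.Prod_is_product[OF h(1,1)]] pr] .
    from E.comp_in[OF Fa_hom[OF h(2)] this] show ?thesis by (simp add: functor_group_def Let_def)
  qed
  have nat: "gop E Z ?F (Fa x \<cdot>\<^bsub>E\<^esub> c) (Fa y \<cdot>\<^bsub>E\<^esub> c) = Fa (gop D Z' K x y) \<cdot>\<^bsub>E\<^esub> c"
    if "c \<in> Hom E Z (Fo Z')" "x \<in> Hom D Z' ?G" "y \<in> Hom D Z' ?G" for Z Z' c x y
    using E.gop_comp_of_mul[OF m that(1), of "Fa x" "Fa y"] Fa_hom[OF that(2)] Fa_hom[OF that(3)]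
      Fa_gop[OF K that(2,3)] unfolding G by simp
  show ?thesis
  proof (rule E.group_objectI)
    show "gob ?F \<in> Obj E" "gmul ?F \<in> Hom E (Prod E (gob ?F) (gob ?F)) (gob ?F)"
      "ginv ?F \<in> Hom E (gob ?F) (gob ?F)" "gunit ?F \<in> Hom E (term_obj E) (gob ?F)"
      using FG G m Fa_hom[OF h(3)] E.comp_in[OF Fa_hom[OF h(4)] t] by (auto simp: u)
    fix Z x assume "x \<in> Hom E Z (gob ?F)"
    then have x: "x \<in> Hom E Z (Fo ?G)" by (simp add: G)
    { fix y z assume "y \<in> Hom E Z (gob ?F)" "z \<in> Hom E Z (gob ?F)"
      then have y: "y \<in> Hom E Z (Fo ?G)" "z \<in> Hom E Z (Fo ?G)" by (simp_all add: G)
      obtain v where v: "v \<in> Hom E Z (Fo ?GG)" "Fa (pr1 D ?G ?G) \<cdot>\<^bsub>E\<^esub> v = x" "Fa (pr2 D ?G ?G) \<cdot>\<^bsub>E\<^esub> v = y"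
        using Fa_pair[OF h(1,1) x y(1)] .
      obtain w where w: "w \<in> Hom E Z (Fo ?W)" "Fa (pr1 D ?GG ?G) \<cdot>\<^bsub>E\<^esub> w = v" "Fa (pr2 D ?GG ?G) \<cdot>\<^bsub>E\<^esub> w = z"
        using Fa_pair[OF _ h(1) v(1) y(2)] h(1) by auto
      have p: "pr1 D ?G ?G \<in> Hom D ?GG ?G" "pr2 D ?G ?G \<in> Hom D ?GG ?G" "pr1 D ?GG ?G \<in> Hom D ?W ?GG"
        "pr2 D ?GG ?G \<in> Hom D ?W ?G" using h by auto
      let ?a = "pr1 D ?G ?G \<cdot>\<^bsub>D\<^esub> pr1 D ?GG ?G" and ?b = "pr2 D ?G ?G \<cdot>\<^bsub>D\<^esub> pr1 D ?GG ?G" and ?c = "pr2 D ?GG ?G"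
      have ab: "?a \<in> Hom D ?W ?G" "?b \<in> Hom D ?W ?G" using p by auto
      have e: "x = Fa ?a \<cdot>\<^bsub>E\<^esub> w" "y = Fa ?b \<cdot>\<^bsub>E\<^esub> w" "z = Fa ?c \<cdot>\<^bsub>E\<^esub> w"
        using E.comp_assoc[OF Fa_hom[OF p(1)] w(1) Fa_hom[OF p(3)]]
          E.comp_assoc[OF Fa_hom[OF p(2)] w(1) Fa_hom[OF p(3)]] v w by (simp_all add: Fa_comp)
      show "gop E Z ?F (gop E Z ?F x y) z = gop E Z ?F x (gop E Z ?F y z)"
        unfolding e using nat[OF w(1)] ab p(4) D.gop_in[OF K] D.gop_assoc[OF K ab p(4)] by simp }
    \<comment> \<open>\<open>Fa (Id D ?G)\<close> acts as an identity because \<open>x\<close>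
      factors through \<open>Fa\<close> of a projection, and \<open>Fa\<close> respects the
      composite of that projection with the identity.\<close>
    have e: "x = Fa (Id D ?G) \<cdot>\<^bsub>E\<^esub> x"
    proof -
      obtain w where w: "w \<in> Hom E Z (Fo ?GG)" "Fa (pr1 D ?G ?G) \<cdot>\<^bsub>E\<^esub> w = x" using Fa_pair[OF h(1,1) x x] by metis
      have "Fa (Id D ?G) \<cdot>\<^bsub>E\<^esub> Fa (pr1 D ?G ?G) = Fa (pr1 D ?G ?G)"
        using D.Id_comp[OF D.pr_in(1)[OF h(1,1)]] by (simp add: Fa_comp[symmetric])
      from E.comp_reduce[OF this Fa_hom[OF D.pr_in(1)[OF h(1,1)]] Fa_hom[OF id] w(1)] w(2)
      show ?thesis by simp
    qed
    have i: "D.gone ?G K \<in> Hom D ?G ?G" using K h by auto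
    show "gop E Z ?F (E.gone Z ?F) x = x"
      using nat[OF x i id] D.gop_one_left[OF K id] gone[OF x] e by simp
    show "gop E Z ?F x (E.gone Z ?F) = x"
      using nat[OF x id i] D.gop_one_right[OF K id] gone[OF x] e by simp
    show "gop E Z ?F (ginv ?F \<cdot>\<^bsub>E\<^esub> x) x = E.gone Z ?F"
      using nat[OF x h(3) id] D.gop_inv_left[OF K id] gone[OF x] e h(3) by (simp add: u)
    show "gop E Z ?F x (ginv ?F \<cdot>\<^bsub>E\<^esub> x) = E.gone Z ?F"
      using nat[OF x id h(3)] D.gop_inv_right[OF K id] gone[OF x] e h(3) by (simp add: u)
  qed
qed

end

section \<open>Edge groups and vertex groups of a graph of groups\<close>

definition edge_group ::
  "('o, 'a) cat \<Rightarrow> ('o, 'a) graph \<Rightarrow> (('o, 'a) graph \<times> ('a \<times> 'a), 'a \<times> 'a) grp \<Rightarrow> ('o \<times> 'a, 'a) grp" where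
  "edge_group C Q = functor_group (slice (Graph C) Q) (slice C (edges Q)) (\<lambda>(X, f). (edges X, fst f)) fst"

definition vert_group ::
  "('o, 'a) cat \<Rightarrow> ('o, 'a) graph \<Rightarrow> (('o, 'a) graph \<times> ('a \<times> 'a), 'a \<times> 'a) grp \<Rightarrow> ('o \<times> 'a, 'a) grp" where
  "vert_group C Q = functor_group (slice (Graph C) Q) (slice C (verts Q)) (\<lambda>(X, f). (verts X, snd f)) snd"

lemma gob_edge_group [simp]: "gob \<G> = (\<Gamma>, \<gamma>) \<Longrightarrow> gob (edge_group C Q \<G>) = (edges \<Gamma>, fst \<gamma>)"
  by (simp add: edge_group_def functor_group_def Let_def)

lemma gob_vert_group [simp]: "gob \<G> = (\<Gamma>, \<gamma>) \<Longrightarrow> gob (vert_group C Q \<G>) = (verts \<Gamma>, snd \<gamma>)"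
  by (simp add: vert_group_def functor_group_def Let_def)

context Fin_Lim
begin

text \<open>The terminal object of a slice is chosen arbitrarily. Being an isomorphism onto the base
  is a description that passing to edges or vertices visibly preserves.\<close>

lemma slice_terminal_iff:
  assumes B: "B \<in> Obj C"
  shows "is_terminal (slice C B) (T, t) \<longleftrightarrow> is_iso C T B t"
proof
  assume T: "is_terminal (slice C B) (T, t)"
  then have t: "t \<in> Hom C T B" by (simp add: is_terminal_def)
  have "(B, Id C B) \<in> Obj (slice C B)" using B by simp
  then obtain u where u: "u \<in> Hom (slice C B) (B, Id C B) (T, t)" using T unfolding is_terminal_def by metis
  then have u': "u \<in> Hom C B T" "t \<cdot> u = Id C B" by auto
  have "t \<cdot> (u \<cdot> t) = t" using comp_reduce[OF u'(2,1) t t] t by simp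
  then have "u \<cdot> t \<in> Hom (slice C B) (T, t) (T, t)" "Id C T \<in> Hom (slice C B) (T, t) (T, t)"
    using u' t Hom_Obj by auto
  then have "u \<cdot> t = Id C T" using T unfolding is_terminal_def by (metis slice_sel(1) t)
  then show "is_iso C T B t" using u' t unfolding is_iso_def by blast
next
  assume "is_iso C T B t"
  then obtain u where u: "t \<in> Hom C T B" "u \<in> Hom C B T" "u \<cdot> t = Id C T" "t \<cdot> u = Id C B"
    unfolding is_iso_def by blast
  show "is_terminal (slice C B) (T, t)"
    unfolding is_terminal_def
  proof (intro conjI ballI)
    show "(T, t) \<in> Obj (slice C B)" using u by simp
    fix X assume "X \<in> Obj (slice C B)"
    then obtain A f where X: "X = (A, f)" "f \<in> Hom C A B" by (cases X) auto
    have e: "t \<cdot> (u \<cdot> f) = f" using comp_reduce[OF u(4,2,1) X(2)] X by simp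
    show "\<exists>!h. h \<in> Hom (slice C B) X (T, t)"
    proof (rule ex1I[of _ "u \<cdot> f"])
      show "u \<cdot> f \<in> Hom (slice C B) X (T, t)" using X u e by auto
      fix h assume "h \<in> Hom (slice C B) X (T, t)"
      then have h: "h \<in> Hom C A T" "t \<cdot> h = f" using X by auto
      show "h = u \<cdot> f" using comp_reduce[OF u(3,1,2) h(1)] h by simp
    qed
  qed
qed

text \<open>Products in a slice are pullbacks and pullbacks of graphs are componentwise; terminal
  objects are isomorphisms onto the base, whose components are again isomorphisms.\<close>

lemma
  assumes Q: "Q \<in> Obj (Graph C)"
  shows edges_functor: "Prod_Functor (slice (Graph C) Q) (slice C (edges Q)) (\<lambda>(X, f). (edges X, fst f)) fst"
    and verts_functor: "Prod_Functor (slice (Graph C) Q) (slice C (verts Q)) (\<lambda>(X, f). (verts X, snd f)) snd"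
proof -
  have o: "edges Q \<in> Obj C" "verts Q \<in> Obj C" using Graph_Obj[OF Q] by auto
  interpret G: Fin_Lim "Graph C" by (rule Fin_Lim_Graph)
  have iso: "is_iso C (edges T) (edges Q) (fst t)" "is_iso C (verts T) (verts Q) (snd t)"
    if t: "is_iso (Graph C) T Q t" for T t
  proof -
    obtain g where "t \<in> Hom (Graph C) T Q" "g \<in> Hom (Graph C) Q T" "g \<cdot>\<^bsub>Graph C\<^esub> t = Id (Graph C) T"
      "t \<cdot>\<^bsub>Graph C\<^esub> g = Id (Graph C) Q" using t unfolding is_iso_def by blast
    then show "is_iso C (edges T) (edges Q) (fst t)" "is_iso C (verts T) (verts Q) (snd t)"
      unfolding is_iso_def by (auto dest: Graph_HomD(1,2))
  qed
  have prod: "is_product (slice C (edges Q)) (edges A, fst f) (edges B, fst g) (edges P, fst r) (fst p) (fst q) \<and>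
      is_product (slice C (verts Q)) (verts A, snd f) (verts B, snd g) (verts P, snd r) (snd p) (snd q)"
    if l: "is_product (slice (Graph C) Q) (A, f) (B, g) (P, r) p q" for A B P f g r p q
  proof -
    interpret S: Fin_Lim "slice (Graph C) Q" by (rule G.Fin_Lim_slice[OF Q])
    have fg: "f \<in> Hom (Graph C) A Q" "g \<in> Hom (Graph C) B Q" using S.is_product_hom[OF l] by auto
    have l: "is_pullback (Graph C) A B Q f g P p q" "r = f \<cdot>\<^bsub>Graph C\<^esub> p"
      using G.slice_product_iff[OF fg] l by auto
    note f = Graph_HomD[OF fg(1)] and g = Graph_HomD[OF fg(2)]
    show ?thesis
      using graph_pullback_components[OF l(1)] slice_product_iff[OF f(1) g(1)] slice_product_iff[OF f(2) g(2)] l(2)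
      by simp
  qed
  show "Prod_Functor (slice (Graph C) Q) (slice C (edges Q)) (\<lambda>(X, f). (edges X, fst f)) fst"
  proof (intro Prod_Functor.intro G.Fin_Lim_slice[OF Q] Fin_Lim_slice[OF o(1)] Prod_Functor_axioms.intro)
    fix A B P T :: "('o, 'a) graph \<times> 'a \<times> 'a" and f g p q
    show "f \<in> Hom (slice (Graph C) Q) A B \<Longrightarrow>
       fst f \<in> Hom (slice C (edges Q)) (case A of (X, f) \<Rightarrow> (edges X, fst f)) (case B of (X, f) \<Rightarrow> (edges X, fst f))"
      by (cases A; cases B) (auto simp: Graph_Hom)
    show "fst (g \<cdot>\<^bsub>slice (Graph C) Q\<^esub> f) = fst g \<cdot>\<^bsub>slice C (edges Q)\<^esub> fst f" by simp
    show "is_product (slice (Graph C) Q) A B P p q \<Longrightarrow>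
       is_product (slice C (edges Q)) (case A of (X, f) \<Rightarrow> (edges X, fst f)) (case B of (X, f) \<Rightarrow> (edges X, fst f))
        (case P of (X, f) \<Rightarrow> (edges X, fst f)) (fst p) (fst q)"
      using prod[of "fst A" "snd A" "fst B" "snd B" "fst P" "snd P" p q] by (simp add: case_prod_unfold)
    show "is_terminal (slice (Graph C) Q) T \<Longrightarrow> is_terminal (slice C (edges Q)) (case T of (X, f) \<Rightarrow> (edges X, fst f))"
      using iso G.slice_terminal_iff[OF Q] slice_terminal_iff[OF o(1)] by (cases T) auto
  qed
  show "Prod_Functor (slice (Graph C) Q) (slice C (verts Q)) (\<lambda>(X, f). (verts X, snd f)) snd"
  proof (intro Prod_Functor.intro G.Fin_Lim_slice[OF Q] Fin_Lim_slice[OF o(2)] Prod_Functor_axioms.intro)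
    fix A B P T :: "('o, 'a) graph \<times> 'a \<times> 'a" and f g p q
    show "f \<in> Hom (slice (Graph C) Q) A B \<Longrightarrow>
       snd f \<in> Hom (slice C (verts Q)) (case A of (X, f) \<Rightarrow> (verts X, snd f)) (case B of (X, f) \<Rightarrow> (verts X, snd f))"
      by (cases A; cases B) (auto simp: Graph_Hom)
    show "snd (g \<cdot>\<^bsub>slice (Graph C) Q\<^esub> f) = snd g \<cdot>\<^bsub>slice C (verts Q)\<^esub> snd f" by simp
    show "is_product (slice (Graph C) Q) A B P p q \<Longrightarrow>
       is_product (slice C (verts Q)) (case A of (X, f) \<Rightarrow> (verts X, snd f)) (case B of (X, f) \<Rightarrow> (verts X, snd f))
        (case P of (X, f) \<Rightarrow> (verts X, snd f)) (snd p) (snd q)"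
      using prod[of "fst A" "snd A" "fst B" "snd B" "fst P" "snd P" p q] by (simp add: case_prod_unfold)
    show "is_terminal (slice (Graph C) Q) T \<Longrightarrow> is_terminal (slice C (verts Q)) (case T of (X, f) \<Rightarrow> (verts X, snd f))"
      using iso G.slice_terminal_iff[OF Q] slice_terminal_iff[OF o(2)] by (cases T) auto
  qed
qed

section \<open>Products with constant graphs, and constant groups\<close>

lemma times_graph_Obj: "A \<in> Obj C \<Longrightarrow> X \<in> Obj (Graph C) \<Longrightarrow> times_graph C A X \<in> Obj (Graph C)"
  using Hom_Obj by (auto simp: times_graph_def)

lemma times_graph_sel [simp]:
  "edges (times_graph C A X) = Prod C A (edges X)" "verts (times_graph C A X) = Prod C A (verts X)"
  "d0 (times_graph C A X) = pmap C A (edges X) A (verts X) (Id C A) (d0 X)"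
  "d1 (times_graph C A X) = pmap C A (edges X) A (verts X) (Id C A) (d1 X)"
  by (simp_all add: times_graph_def)

lemma times_graph_product:
  assumes A: "A \<in> Obj C" and X: "X \<in> Obj (Graph C)"
  shows "is_product (Graph C) (const_graph C A) X (times_graph C A X) (times_pr1 C A X) (times_pr2 C A X)"
proof -
  interpret G: Cat "Graph C" by unfold_locales (rule category_Graph)
  have o: "edges X \<in> Obj C" "verts X \<in> Obj C" using Graph_Obj[OF X] by auto
  have d: "d0 X \<in> Hom C (edges X) (verts X)" "d1 X \<in> Hom C (edges X) (verts X)" using X by auto
  note T = times_graph_Obj[OF A X]
  note idA = Id_in[OF A]
  have p1: "times_pr1 C A X \<in> Hom (Graph C) (times_graph C A X) (const_graph C A)"
    unfolding const_graph_Hom times_pr1_def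
    using T A o pr_pmap(1)[OF idA d(1)] pr_pmap(1)[OF idA d(2)] Id_comp[OF pr_in(1)[OF A o(1)]] by simp
  have p2: "times_pr2 C A X \<in> Hom (Graph C) (times_graph C A X) X"
    unfolding Graph_Hom times_pr2_def
    using T X A o pr_pmap(2)[OF idA d(1)] pr_pmap(2)[OF idA d(2)] by simp
  show ?thesis
  proof (rule G.is_productI[OF p1 p2])
    fix Z
    { fix x y assume x: "x \<in> Hom (Graph C) Z (const_graph C A)" and y: "y \<in> Hom (Graph C) Z X"
      note y' = Graph_HomD[OF y]
      have x': "snd x \<in> Hom C (verts Z) A" "fst x = snd x \<cdot> d0 Z" "fst x = snd x \<cdot> d1 Z" "fst x \<in> Hom C (edges Z) A"
        using x y' unfolding const_graph_Hom by auto
      let ?u = "(pair C (edges Z) A (edges X) (fst x) (fst y), pair C (verts Z) A (verts X) (snd x) (snd y))"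
      have "d0 (times_graph C A X) \<cdot> fst ?u = snd ?u \<cdot> d0 Z" "d1 (times_graph C A X) \<cdot> fst ?u = snd ?u \<cdot> d1 Z"
        using pmap_pair[OF idA d(1) x'(4) y'(1)] pmap_pair[OF idA d(2) x'(4) y'(1)] x' y'
          pair_comp[OF y'(5) x'(1) y'(2)] pair_comp[OF y'(6) x'(1) y'(2)] Id_comp[OF x'(4)] by simp_all
      then have "?u \<in> Hom (Graph C) Z (times_graph C A X)"
        unfolding Graph_Hom using T x' y' by auto
      moreover have "times_pr1 C A X \<cdot>\<^bsub>Graph C\<^esub> ?u = x" "times_pr2 C A X \<cdot>\<^bsub>Graph C\<^esub> ?u = y"
        using pr_pair[OF x'(4) y'(1)] pr_pair[OF x'(1) y'(2)] by (simp_all add: times_pr1_def times_pr2_def)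
      ultimately show "\<exists>u\<in>Hom (Graph C) Z (times_graph C A X). times_pr1 C A X \<cdot>\<^bsub>Graph C\<^esub> u = x \<and> times_pr2 C A X \<cdot>\<^bsub>Graph C\<^esub> u = y"
        by blast }
    { fix u v assume "u \<in> Hom (Graph C) Z (times_graph C A X)" "v \<in> Hom (Graph C) Z (times_graph C A X)"
        "times_pr1 C A X \<cdot>\<^bsub>Graph C\<^esub> u = times_pr1 C A X \<cdot>\<^bsub>Graph C\<^esub> v"
        "times_pr2 C A X \<cdot>\<^bsub>Graph C\<^esub> u = times_pr2 C A X \<cdot>\<^bsub>Graph C\<^esub> v"
      then show "u = v"
        using pair_ext[of "fst u" "edges Z" A "edges X" "fst v"] pair_ext[of "snd u" "verts Z" A "verts X" "snd v"] A o
        by (intro prod_eqI) (auto simp: times_pr1_def times_pr2_def Graph_Hom) }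
  qed
qed

lemma times_map_in:
  assumes A: "f \<in> Hom C A B" and h: "h \<in> Hom (Graph C) X Y"
  shows "times_map C A X B Y f h \<in> Hom (Graph C) (times_graph C A X) (times_graph C B Y)"
proof -
  note h' = Graph_HomD[OF h]
  have XY: "X \<in> Obj (Graph C)" "Y \<in> Obj (Graph C)" using h by (auto simp: Graph_Hom)
  have o: "A \<in> Obj C" "B \<in> Obj C" "edges X \<in> Obj C" using A h' Hom_Obj by auto
  note i = Id_in[OF o(1)] Id_in[OF o(2)]
  have pr: "pr1 C A (edges X) \<in> Hom C (Prod C A (edges X)) A" "pr2 C A (edges X) \<in> Hom C (Prod C A (edges X)) (edges X)"
    using o by auto
  have "pmap C B (edges Y) B (verts Y) (Id C B) d \<cdot> pmap C A (edges X) B (edges Y) f (fst h) =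
      pmap C A (verts X) B (verts Y) f (snd h) \<cdot> pmap C A (edges X) A (verts X) (Id C A) d'"
    if d: "d \<cdot> fst h = snd h \<cdot> d'" "d \<in> Hom C (edges Y) (verts Y)" "d' \<in> Hom C (edges X) (verts X)" for d d'
    using pmap_eq[OF i(2) d(2) pmap_in[OF A h'(1)]] pmap_eq[OF A h'(2) pmap_in[OF i(1) d(3)]]
      pr_pmap[OF A h'(1)] pr_pmap[OF i(1) d(3)] comp_reduce[OF d(1) h'(1) d(2) pr(2)]
      comp_assoc[OF h'(2) pr(2) d(3)] Id_comp[OF comp_in[OF A pr(1)]] Id_comp[OF pr(1)] by simp
  then show ?thesis
    unfolding Graph_Hom using times_graph_Obj XY o h' A by (auto simp: times_map_def)
qed

lemma times_map_pr:
  assumes A: "f \<in> Hom C A B" and h: "h \<in> Hom (Graph C) X Y"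
  shows "times_pr1 C B Y \<cdot>\<^bsub>Graph C\<^esub> times_map C A X B Y f h = (f, f) \<cdot>\<^bsub>Graph C\<^esub> times_pr1 C A X"
    "times_pr2 C B Y \<cdot>\<^bsub>Graph C\<^esub> times_map C A X B Y f h = h \<cdot>\<^bsub>Graph C\<^esub> times_pr2 C A X"
  using pr_pmap[OF A Graph_HomD(1)[OF h]] pr_pmap[OF A Graph_HomD(2)[OF h]]
  by (simp_all add: times_map_def times_pr1_def times_pr2_def)

text \<open>An element of a constant graph consists of a vertex component and its composite with
  \<open>d0\<close>, equally with \<open>d1\<close>. Operating on both components stays inside the
  constant graph because the operations of \<open>K\<close> are natural in the stage.\<close>

lemma const_group:
  assumes K: "group_object C K"
  shows const_group_object: "group_object (Graph C) (const_group C K)"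
    and gob_const_group: "gob (const_group C K) = const_graph C (gob K)"
    and const_group_gop: "\<And>Z x y. x \<in> Hom (Graph C) Z (const_graph C (gob K)) \<Longrightarrow>
      y \<in> Hom (Graph C) Z (const_graph C (gob K)) \<Longrightarrow>
      gop (Graph C) Z (const_group C K) x y =
      (gop C (edges Z) K (fst x) (fst y), gop C (verts Z) K (snd x) (snd y))"
proof -
  interpret G: Fin_Lim "Graph C" by (rule Fin_Lim_Graph)
  let ?X = "const_graph C (gob K)" let ?S = "Prod (Graph C) ?X ?X"
  let ?r1 = "pr1 (Graph C) ?X ?X" and ?r2 = "pr2 (Graph C) ?X ?X"
  let ?U = "term_obj (Graph C)" let ?F = "const_group C K"
  note h = group_object_hom[OF K]
  have X: "?X \<in> Obj (Graph C)" using h by (simp add: const_graph_def)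
  show gob: "gob ?F = ?X" by (simp add: const_group_def Let_def)
  have F: "gmul ?F = (gop C (edges ?S) K (fst ?r1) (fst ?r2), gop C (verts ?S) K (snd ?r1) (snd ?r2))"
    "ginv ?F = (ginv K, ginv K)"
    "gunit ?F = (gone (edges ?U) K, gone (verts ?U) K)"
    by (simp_all add: const_group_def Let_def)
  have el: "snd x \<in> Hom C (verts Z) (gob K)" "fst x = snd x \<cdot> d0 Z" "fst x = snd x \<cdot> d1 Z"
    "fst x \<in> Hom C (edges Z) (gob K)" "d0 Z \<in> Hom C (edges Z) (verts Z)" "d1 Z \<in> Hom C (edges Z) (verts Z)"
    if "x \<in> Hom (Graph C) Z ?X" for x Z
    using that unfolding const_graph_Hom by auto
  note r1 = el[OF G.pr_in(1)[OF X X]] and r2 = el[OF G.pr_in(2)[OF X X]]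
  note U = G.term_Obj
  have m: "gmul ?F \<in> Hom (Graph C) ?S ?X"
    unfolding const_graph_Hom F
    using gop_comp[OF K r1(5) r1(1) r2(1)] gop_comp[OF K r1(6) r1(1) r2(1)] gop_in[OF K r1(1) r2(1)] r1 r2
      G.Prod_Obj[OF X X] h(1) by simp
  have i: "ginv ?F \<in> Hom (Graph C) ?X ?X"
    unfolding const_graph_Hom F using X h by (simp add: const_graph_def)
  have dU: "d0 ?U \<in> Hom C (edges ?U) (verts ?U)" "d1 ?U \<in> Hom C (edges ?U) (verts ?U)" using U by auto
  have e: "gunit ?F \<in> Hom (Graph C) ?U ?X"
    unfolding const_graph_Hom F using U gone_comp[OF K dU(1)] gone_comp[OF K dU(2)] h gone_in[OF K] Hom_Obj dU by simp
  show gop: "\<And>Z x y. x \<in> Hom (Graph C) Z ?X \<Longrightarrow> y \<in> Hom (Graph C) Z ?X \<Longrightarrow>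
      gop (Graph C) Z ?F x y = (gop C (edges Z) K (fst x) (fst y), gop C (verts Z) K (snd x) (snd y))"
  proof -
    fix Z x y assume x: "x \<in> Hom (Graph C) Z ?X" "y \<in> Hom (Graph C) Z ?X"
    let ?w = "pair (Graph C) Z ?X ?X x y"
    note w = Graph_HomD[OF G.pair_in[OF x]]
    have "fst ?r1 \<cdot> fst ?w = fst x" "snd ?r1 \<cdot> snd ?w = snd x" "fst ?r2 \<cdot> fst ?w = fst y" "snd ?r2 \<cdot> snd ?w = snd y"
      using G.pr_pair[OF x] by (auto simp: prod_eq_iff)
    then show "gop (Graph C) Z ?F x y = (gop C (edges Z) K (fst x) (fst y), gop C (verts Z) K (snd x) (snd y))"
      unfolding gop_def[of "Graph C"] gob
      using gop_comp[OF K w(1) r1(4) r2(4)] gop_comp[OF K w(2) r1(1) r2(1)] by (simp add: F)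
  qed
  have gop_in': "gop (Graph C) Z ?F x y \<in> Hom (Graph C) Z ?X"
    if "x \<in> Hom (Graph C) Z ?X" "y \<in> Hom (Graph C) Z ?X" for Z x y
    using G.gop_in_of_mul[of ?F x Z y] m that by (simp add: gob)
  have one: "G.gone Z ?F = (gone (edges Z) K, gone (verts Z) K)" if "Z \<in> Obj (Graph C)" for Z
    using Graph_HomD[OF G.bang_in[OF that]] gone_comp[OF K] by (simp add: F)
  have one_in: "G.gone Z ?F \<in> Hom (Graph C) Z ?X" if "Z \<in> Obj (Graph C)" for Z
    using G.comp_in[OF e G.bang_in[OF that]] .
  have inv_in: "ginv ?F \<cdot>\<^bsub>Graph C\<^esub> x \<in> Hom (Graph C) Z ?X" if "x \<in> Hom (Graph C) Z ?X" for Z x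
    using G.comp_in[OF i that] .
  show "group_object (Graph C) ?F"
  proof (rule G.group_objectI)
    show "gob ?F \<in> Obj (Graph C)" "gmul ?F \<in> Hom (Graph C) (Prod (Graph C) (gob ?F) (gob ?F)) (gob ?F)"
      "ginv ?F \<in> Hom (Graph C) (gob ?F) (gob ?F)" "gunit ?F \<in> Hom (Graph C) (term_obj (Graph C)) (gob ?F)"
      using X m i e by (simp_all add: gob)
    fix Z x assume "x \<in> Hom (Graph C) Z (gob ?F)"
    then have x: "x \<in> Hom (Graph C) Z ?X" by (simp add: gob)
    note x' = el[OF x]
    have Z: "Z \<in> Obj (Graph C)" using G.Hom_Obj[OF x] by blast
    { fix y z assume "y \<in> Hom (Graph C) Z (gob ?F)" "z \<in> Hom (Graph C) Z (gob ?F)"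
      then have y: "y \<in> Hom (Graph C) Z ?X" "z \<in> Hom (Graph C) Z ?X" by (simp_all add: gob)
      note y' = el[OF y(1)] el[OF y(2)]
      show "gop (Graph C) Z ?F (gop (Graph C) Z ?F x y) z = gop (Graph C) Z ?F x (gop (Graph C) Z ?F y z)"
        using gop[OF gop_in'[OF x y(1)] y(2)] gop[OF x gop_in'[OF y]] gop[OF x y(1)] gop[OF y]
          gop_assoc[OF K x'(1) y'(1) y'(7)] gop_assoc[OF K x'(4) y'(4) y'(10)] by (simp del: Graph_sel) }
    show "gop (Graph C) Z ?F (G.gone Z ?F) x = x"
      using gop[OF one_in[OF Z] x] one[OF Z] gop_one_left[OF K x'(1)] gop_one_left[OF K x'(4)] by (simp del: Graph_sel)
    show "gop (Graph C) Z ?F x (G.gone Z ?F) = x"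
      using gop[OF x one_in[OF Z]] one[OF Z] gop_one_right[OF K x'(1)] gop_one_right[OF K x'(4)] by (simp del: Graph_sel)
    have iv: "ginv ?F \<cdot>\<^bsub>Graph C\<^esub> x = (ginv K \<cdot> fst x, ginv K \<cdot> snd x)" by (simp add: F)
    show "gop (Graph C) Z ?F (ginv ?F \<cdot>\<^bsub>Graph C\<^esub> x) x = G.gone Z ?F"
      using gop[OF inv_in[OF x] x] one[OF Z] gop_inv_left[OF K x'(1)] gop_inv_left[OF K x'(4)]
      by (simp del: Graph_sel add: iv)
    show "gop (Graph C) Z ?F x (ginv ?F \<cdot>\<^bsub>Graph C\<^esub> x) = G.gone Z ?F"
      using gop[OF x inv_in[OF x]] one[OF Z] gop_inv_right[OF K x'(1)] gop_inv_right[OF K x'(4)]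
      by (simp del: Graph_sel add: iv)
  qed
qed

end

section \<open>Fibrewise homomorphisms\<close>

text \<open>Homomorphisms to \<open>K\<close> from the fibres of a group \<open>H\<close> over \<open>B\<close>, that is, homomorphisms from \<open>H\<close>
  to \<open>K \<times> B\<close> over \<open>B\<close>.\<close>

definition fibre_hom :: "('o, 'a) cat \<Rightarrow> 'o \<Rightarrow> ('o \<times> 'a, 'a) grp \<Rightarrow> ('o, 'a) grp \<Rightarrow> 'a \<Rightarrow> bool" where
  "fibre_hom C B H K f \<longleftrightarrow> f \<in> Hom C (fst (gob H)) (gob K) \<and>
     (\<forall>Z z. \<forall>x \<in> Hom (slice C B) (Z, z) (gob H). \<forall>y \<in> Hom (slice C B) (Z, z) (gob H).
        f \<cdot>\<^bsub>C\<^esub> gop (slice C B) (Z, z) H x y = gop C Z K (f \<cdot>\<^bsub>C\<^esub> x) (f \<cdot>\<^bsub>C\<^esub> y))"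

lemma fibre_hom_gop:
  assumes "fibre_hom C B H K f" "x \<in> Hom (slice C B) (Z, z) (gob H)" "y \<in> Hom (slice C B) (Z, z) (gob H)"
  shows "f \<cdot>\<^bsub>C\<^esub> gop (slice C B) (Z, z) H x y = gop C Z K (f \<cdot>\<^bsub>C\<^esub> x) (f \<cdot>\<^bsub>C\<^esub> y)"
  using assms unfolding fibre_hom_def by blast

lemma fibre_hom_in: "fibre_hom C B H K f \<Longrightarrow> f \<in> Hom C (fst (gob H)) (gob K)"
  by (simp add: fibre_hom_def)

context Fin_Lim
begin

lemma fibre_hom_comp:
  assumes f: "fibre_hom C B H K f" and g: "g \<in> Hom (Grp C) K L" and H: "gob H = (A, \<alpha>)"
    and HG: "group_object (slice C B) H" and B: "B \<in> Obj C"
  shows "fibre_hom C B H L (g \<cdot> f)"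
  unfolding fibre_hom_def
proof (intro conjI allI ballI)
  interpret S: Fin_Lim "slice C B" by (rule Fin_Lim_slice[OF B])
  note f' = fibre_hom_in[OF f, unfolded H fst_conv] and g' = Grp_homD[OF g]
  show "g \<cdot> f \<in> Hom C (fst (gob H)) (gob L)" using f' g' H by auto
  fix Z z x y assume x: "x \<in> Hom (slice C B) (Z, z) (gob H)" "y \<in> Hom (slice C B) (Z, z) (gob H)"
  then have x': "x \<in> Hom C Z A" "y \<in> Hom C Z A" by (auto simp: H)
  have p: "gop (slice C B) (Z, z) H x y \<in> Hom C Z A" using S.gop_in[OF HG x] by (simp add: H)
  have fx: "f \<cdot> x \<in> Hom C Z (gob K)" "f \<cdot> y \<in> Hom C Z (gob K)" using f' x' by auto
  show "(g \<cdot> f) \<cdot> gop (slice C B) (Z, z) H x y = gop C Z L ((g \<cdot> f) \<cdot> x) ((g \<cdot> f) \<cdot> y)"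
    using fibre_hom_gop[OF f x] comp_assoc[OF g'(3) p f'] comp_assoc[OF g'(3) _ f'] x' Grp_hom_gop[OF g fx] by simp
qed

text \<open>The second component of a map over \<open>Q\<close> into \<open>K \<times> Q\<close> is
  prescribed, so only the first one carries information, and multiplication is read off
  there.\<close>

lemma Hom_family_group:
  assumes H: "group_object (slice C Q) H" "gob H = (A, \<alpha>)" and K: "group_object C K"
    and P: "is_product C (gob K) Q P p q"
  shows "f \<in> Hom (Grp (slice C Q)) H (family_group C K Q P p q) \<longleftrightarrow>
    f \<in> Hom C A P \<and> q \<cdot> f = \<alpha> \<and> fibre_hom C Q H K (p \<cdot> f)"
proof -
  note h = is_product_hom[OF P]
  have Q: "Q \<in> Obj C" using h Hom_Obj by blast
  interpret S: Fin_Lim "slice C Q" by (rule Fin_Lim_slice[OF Q])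
  note F = family_group[OF K P Q]
  let ?F = "family_group C K Q P p q"
  have a: "\<alpha> \<in> Hom C A Q" using S.group_object_hom(1)[OF H(1)] H(2) by simp
  have FG: "gop (slice C Q) (Z, z) ?F x y \<in> Hom C Z P" "q \<cdot> gop (slice C Q) (Z, z) ?F x y = z"
    if "x \<in> Hom C Z P" "y \<in> Hom C Z P" "q \<cdot> x = z" "q \<cdot> y = z" for Z z x y
    using S.gop_in[OF F(1), of x "(Z, z)" y] F(2) that h by auto
  show ?thesis
  proof (intro iffI conjI)
    assume f: "f \<in> Hom (Grp (slice C Q)) H ?F"
    from S.Grp_homD(3)[OF f] show f': "f \<in> Hom C A P" and q: "q \<cdot> f = \<alpha>" using H F by auto
    show "fibre_hom C Q H K (p \<cdot> f)"
      unfolding fibre_hom_def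
    proof (intro conjI allI ballI)
      show "p \<cdot> f \<in> Hom C (fst (gob H)) (gob K)" using f' h H by auto
      fix Z z x y assume x: "x \<in> Hom (slice C Q) (Z, z) (gob H)" "y \<in> Hom (slice C Q) (Z, z) (gob H)"
      then have x': "x \<in> Hom C Z A" "y \<in> Hom C Z A" "\<alpha> \<cdot> x = z" "\<alpha> \<cdot> y = z" by (auto simp: H)
      have g: "gop (slice C Q) (Z, z) H x y \<in> Hom C Z A" using S.gop_in[OF H(1) x] by (simp add: H)
      have "q \<cdot> (f \<cdot> x) = z" "q \<cdot> (f \<cdot> y) = z" using comp_reduce[OF q f' h(2)] x' by auto
      then show "(p \<cdot> f) \<cdot> gop (slice C Q) (Z, z) H x y = gop C Z K ((p \<cdot> f) \<cdot> x) ((p \<cdot> f) \<cdot> y)"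
        using S.Grp_hom_gop[OF f x] F(3)[of "f \<cdot> x" Z "f \<cdot> y" z] comp_assoc[OF h(1) g f']
          comp_assoc[OF h(1) _ f'] x' f' by auto
    qed
  next
    assume "f \<in> Hom C A P \<and> q \<cdot> f = \<alpha> \<and> fibre_hom C Q H K (p \<cdot> f)"
    then have f: "f \<in> Hom C A P" "q \<cdot> f = \<alpha>" and fh: "fibre_hom C Q H K (p \<cdot> f)" by auto
    show "f \<in> Hom (Grp (slice C Q)) H ?F"
    proof (rule S.Grp_homI[OF H(1) F(1)])
      show "f \<in> Hom (slice C Q) (gob H) (gob ?F)" using f h F H a by simp
      fix Zz :: "'o \<times> 'a" and x y
      obtain Z z where Z: "Zz = (Z, z)" by (cases Zz)
      assume "x \<in> Hom (slice C Q) Zz (gob H)" "y \<in> Hom (slice C Q) Zz (gob H)"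
      then have x: "x \<in> Hom (slice C Q) (Z, z) (gob H)" "y \<in> Hom (slice C Q) (Z, z) (gob H)" by (simp_all add: Z)
      then have x': "x \<in> Hom C Z A" "y \<in> Hom C Z A" "\<alpha> \<cdot> x = z" "\<alpha> \<cdot> y = z" by (auto simp: H)
      have g: "gop (slice C Q) (Z, z) H x y \<in> Hom C Z A" "\<alpha> \<cdot> gop (slice C Q) (Z, z) H x y = z"
        using S.gop_in[OF H(1) x] by (simp_all add: H)
      have fx: "q \<cdot> (f \<cdot> x) = z" "q \<cdot> (f \<cdot> y) = z" "f \<cdot> x \<in> Hom C Z P" "f \<cdot> y \<in> Hom C Z P"
        using comp_reduce[OF f(2,1) h(2)] x' f by auto
      note e = FG[OF fx(3,4,1,2)] F(3)[OF fx(3,4,1,2)]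
      have "f \<cdot> gop (slice C Q) (Z, z) H x y = gop (slice C Q) (Z, z) ?F (f \<cdot> x) (f \<cdot> y)"
      proof (rule is_product_ext[OF P, of _ Z])
        show "p \<cdot> (f \<cdot> gop (slice C Q) (Z, z) H x y) = p \<cdot> gop (slice C Q) (Z, z) ?F (f \<cdot> x) (f \<cdot> y)"
          using fibre_hom_gop[OF fh x] e(3) comp_assoc[OF h(1) g(1) f(1)] comp_assoc[OF h(1) _ f(1)] x' by simp
        show "q \<cdot> (f \<cdot> gop (slice C Q) (Z, z) H x y) = q \<cdot> gop (slice C Q) (Z, z) ?F (f \<cdot> x) (f \<cdot> y)"
          using e(2) comp_reduce[OF f(2,1) h(2) g(1)] g by simp
      qed (use f g e in auto)
      then show "f \<cdot>\<^bsub>slice C Q\<^esub> gop (slice C Q) Zz H x y =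
          gop (slice C Q) Zz ?F (f \<cdot>\<^bsub>slice C Q\<^esub> x) (f \<cdot>\<^bsub>slice C Q\<^esub> y)" by (simp add: Z)
    qed
  qed
qed

text \<open>Universal arrows to a functor \<open>K \<mapsto> c K \<times> Q\<close>, in terms of fibrewise homomorphisms; both \<open>times_group\<close>
  and \<open>Delta\<close> are of this form.\<close>

lemma universal_arrow_iff:
  fixes c :: "('k, 'b) grp \<Rightarrow> ('o, 'a) grp" and M :: "('k, 'b) cat"
  assumes H: "group_object (slice C Q) H" "gob H = (A, \<alpha>)"
    and c: "\<And>K. group_object M K \<Longrightarrow> group_object C (c K)"
    and P: "\<And>K. group_object M K \<Longrightarrow> is_product C (gob (c K)) Q (P K) (p K) (q K)"
    and Fm: "\<And>K h. h \<in> Hom (Grp M) L K \<Longrightarrow> Fm K h \<in> Hom C (P L) (P K) \<and> q K \<cdot> Fm K h = q L \<and>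
       p K \<cdot> Fm K h = ch h \<cdot> p L \<and> ch h \<in> Hom C (gob (c L)) (gob (c K)) \<and> group_object M K"
    and L: "group_object M L" and GrpM: "\<And>K. K \<in> Obj (Grp M) \<longleftrightarrow> group_object M K"
  shows "\<eta> \<in> Hom (Grp (slice C Q)) H (family_group C (c L) Q (P L) (p L) (q L)) \<and>
     (\<forall>K \<in> Obj (Grp M). \<forall>g \<in> Hom (Grp (slice C Q)) H (family_group C (c K) Q (P K) (p K) (q K)).
        \<exists>!h. h \<in> Hom (Grp M) L K \<and> Fm K h \<cdot>\<^bsub>Grp (slice C Q)\<^esub> \<eta> = g) \<longleftrightarrow>
    \<eta> \<in> Hom C A (P L) \<and> q L \<cdot> \<eta> = \<alpha> \<and> fibre_hom C Q H (c L) (p L \<cdot> \<eta>) \<and>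
     (\<forall>K f. group_object M K \<longrightarrow> fibre_hom C Q H (c K) f \<longrightarrow>
        (\<exists>!h. h \<in> Hom (Grp M) L K \<and> ch h \<cdot> (p L \<cdot> \<eta>) = f))" (is "?L \<and> ?L' \<longleftrightarrow> ?R1 \<and> ?R2 \<and> ?R3 \<and> ?R'")
proof -
  have Q: "Q \<in> Obj C" using is_product_hom[OF P[OF L]] Hom_Obj by blast
  interpret S: Fin_Lim "slice C Q" by (rule Fin_Lim_slice[OF Q])
  note hom = Hom_family_group[OF H c P]
  have a: "\<alpha> \<in> Hom C A Q" using S.group_object_hom(1)[OF H(1)] H(2) by simp
  have eq: "?L' \<longleftrightarrow> ?R'" if eta: "\<eta> \<in> Hom C A (P L)" "q L \<cdot> \<eta> = \<alpha>"
  proof -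
    have *: "(\<forall>g \<in> Hom (Grp (slice C Q)) H (family_group C (c K) Q (P K) (p K) (q K)).
        \<exists>!h. h \<in> Hom (Grp M) L K \<and> Fm K h \<cdot> \<eta> = g) \<longleftrightarrow>
      (\<forall>f. fibre_hom C Q H (c K) f \<longrightarrow> (\<exists>!h. h \<in> Hom (Grp M) L K \<and> ch h \<cdot> (p L \<cdot> \<eta>) = f))"
      if K: "group_object M K" for K
    proof -
      note k = is_product_hom[OF P[OF K]] and l = is_product_hom[OF P[OF L]]
      have eq: "Fm K h \<cdot> \<eta> = g \<longleftrightarrow> ch h \<cdot> (p L \<cdot> \<eta>) = p K \<cdot> g"
        if h: "h \<in> Hom (Grp M) L K" and g: "g \<in> Hom C A (P K)" "q K \<cdot> g = \<alpha>" for h g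
      proof -
        have F: "Fm K h \<in> Hom C (P L) (P K)" "q K \<cdot> Fm K h = q L" "p K \<cdot> Fm K h = ch h \<cdot> p L"
          "ch h \<in> Hom C (gob (c L)) (gob (c K))" using Fm[OF h] by auto
        have e: "p K \<cdot> (Fm K h \<cdot> \<eta>) = ch h \<cdot> (p L \<cdot> \<eta>)" "q K \<cdot> (Fm K h \<cdot> \<eta>) = \<alpha>" "Fm K h \<cdot> \<eta> \<in> Hom C A (P K)"
          using comp_reduce[OF F(3,1) k(1) eta(1)] comp_reduce[OF F(2,1) k(2) eta(1)]
            comp_assoc[OF F(4) eta(1) l(1)] eta F by auto
        show ?thesis using is_product_ext[OF P[OF K] e(3) g(1)] e g by auto
      qed
      have ex: "\<exists>g. g \<in> Hom C A (P K) \<and> q K \<cdot> g = \<alpha> \<and> p K \<cdot> g = f" if "fibre_hom C Q H (c K) f" for f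
        using tuple_is_product[OF P[OF K] _ a, of f] fibre_hom_in[OF that] H(2) by auto
      show ?thesis (is "?A \<longleftrightarrow> ?B")
      proof
        assume A: ?A
        show ?B
        proof (intro allI impI)
          fix f assume f: "fibre_hom C Q H (c K) f"
          obtain g where g: "g \<in> Hom C A (P K)" "q K \<cdot> g = \<alpha>" "p K \<cdot> g = f" using ex[OF f] by blast
          have "g \<in> Hom (Grp (slice C Q)) H (family_group C (c K) Q (P K) (p K) (q K))"
            using hom[OF K K] f g by simp
          then have "\<exists>!h. h \<in> Hom (Grp M) L K \<and> Fm K h \<cdot> \<eta> = g" using A by blast
          then show "\<exists>!h. h \<in> Hom (Grp M) L K \<and> ch h \<cdot> (p L \<cdot> \<eta>) = f"
            using eq g by (metis (no_types, lifting))
        qed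
      next
        assume B: ?B
        show ?A
        proof
          fix g assume "g \<in> Hom (Grp (slice C Q)) H (family_group C (c K) Q (P K) (p K) (q K))"
          then have g: "g \<in> Hom C A (P K)" "q K \<cdot> g = \<alpha>" "fibre_hom C Q H (c K) (p K \<cdot> g)"
            using hom[OF K K] by auto
          then have "\<exists>!h. h \<in> Hom (Grp M) L K \<and> ch h \<cdot> (p L \<cdot> \<eta>) = p K \<cdot> g" using B by blast
          then show "\<exists>!h. h \<in> Hom (Grp M) L K \<and> Fm K h \<cdot> \<eta> = g"
            using eq g by (metis (no_types, lifting))
        qed
      qed
    qed
    have C: "Comp (Grp (slice C Q)) = Comp C" by simp
    show ?thesis
      unfolding C
    proof (intro iffI allI impI)
      fix K f assume l: "\<forall>K\<in>Obj (Grp M). \<forall>g \<in> Hom (Grp (slice C Q)) H (family_group C (c K) Q (P K) (p K) (q K)).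
        \<exists>!h. h \<in> Hom (Grp M) L K \<and> Fm K h \<cdot> \<eta> = g" and K: "group_object M K" and f: "fibre_hom C Q H (c K) f"
      show "\<exists>!h. h \<in> Hom (Grp M) L K \<and> ch h \<cdot> (p L \<cdot> \<eta>) = f"
        using *[OF K, THEN iffD1, OF bspec[OF l GrpM[THEN iffD2, OF K]]] f by blast
    next
      assume r: "\<forall>K f. group_object M K \<longrightarrow> fibre_hom C Q H (c K) f \<longrightarrow>
        (\<exists>!h. h \<in> Hom (Grp M) L K \<and> ch h \<cdot> (p L \<cdot> \<eta>) = f)"
      show "\<forall>K\<in>Obj (Grp M). \<forall>g \<in> Hom (Grp (slice C Q)) H (family_group C (c K) Q (P K) (p K) (q K)).
        \<exists>!h. h \<in> Hom (Grp M) L K \<and> Fm K h \<cdot> \<eta> = g"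
      proof (rule ballI)
        fix K assume "K \<in> Obj (Grp M)"
        then have K: "group_object M K" using GrpM by blast
        show "\<forall>g \<in> Hom (Grp (slice C Q)) H (family_group C (c K) Q (P K) (p K) (q K)).
          \<exists>!h. h \<in> Hom (Grp M) L K \<and> Fm K h \<cdot> \<eta> = g"
          by (rule *[OF K, THEN iffD2]) (use r K in blast)
      qed
    qed
  qed
  \<comment> \<open>Conjoins the two equivalences; the second one is available only for an
    \<open>\<eta>\<close> that is already known to be a map over \<open>Q\<close>.\<close>
  have "(l \<and> l' \<longleftrightarrow> a \<and> b \<and> c \<and> r')" if "l \<longleftrightarrow> a \<and> b \<and> c" "a \<Longrightarrow> b \<Longrightarrow> l' \<longleftrightarrow> r'" for l l' a b c r'
    using that by blast
  from this[OF hom[OF L L] eq] show ?thesis .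
qed

section \<open>Graphs of groups in terms of their vertex groups\<close>

lemma vert_group_object:
  assumes Q: "Q \<in> Obj (Graph C)" and G: "group_object (slice (Graph C) Q) \<G>"
  shows "group_object (slice C (verts Q)) (vert_group C Q \<G>)" "group_object (slice C (edges Q)) (edge_group C Q \<G>)"
  unfolding vert_group_def edge_group_def
  using Prod_Functor.group_object_functor_group[OF verts_functor[OF Q] G]
    Prod_Functor.group_object_functor_group[OF edges_functor[OF Q] G] by auto

lemma graph_group_gop:
  assumes Q: "Q \<in> Obj (Graph C)" and G: "group_object (slice (Graph C) Q) \<G>"
    and x: "x \<in> Hom (slice (Graph C) Q) (Z, z) (gob \<G>)" "y \<in> Hom (slice (Graph C) Q) (Z, z) (gob \<G>)"
  shows "fst (gop (slice (Graph C) Q) (Z, z) \<G> x y) =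
      gop (slice C (edges Q)) (edges Z, fst z) (edge_group C Q \<G>) (fst x) (fst y)"
    "snd (gop (slice (Graph C) Q) (Z, z) \<G> x y) =
      gop (slice C (verts Q)) (verts Z, snd z) (vert_group C Q \<G>) (snd x) (snd y)"
  using Prod_Functor.Fa_gop[OF verts_functor[OF Q] G x] Prod_Functor.Fa_gop[OF edges_functor[OF Q] G x]
  by (simp_all add: vert_group_def edge_group_def)

text \<open>The multiplication of \<open>\<G>\<close> is a map of graphs on the fibre square
  \<open>S\<close> of \<open>\<Gamma>\<close> over \<open>Q\<close>, so it commutes with
  \<open>d\<close>. The pair \<open>(x, y)\<close> is one edge element \<open>w\<close> of
  \<open>S\<close>, and \<open>d S \<cdot> w\<close> represents the pair of its ends.\<close>

lemma edge_vert_gop: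
  assumes Q: "Q \<in> Obj (Graph C)" and G: "group_object (slice (Graph C) Q) \<G>" "gob \<G> = (\<Gamma>, \<gamma>)"
    and x: "x \<in> Hom C Z (edges \<Gamma>)" "fst \<gamma> \<cdot> x = z" "y \<in> Hom C Z (edges \<Gamma>)" "fst \<gamma> \<cdot> y = z"
    and d: "d = d0 \<or> d = d1"
  shows "d \<Gamma> \<cdot> gop (slice C (edges Q)) (Z, z) (edge_group C Q \<G>) x y =
    gop (slice C (verts Q)) (Z, d Q \<cdot> z) (vert_group C Q \<G>) (d \<Gamma> \<cdot> x) (d \<Gamma> \<cdot> y)"
proof -
  interpret G: Fin_Lim "Graph C" by (rule Fin_Lim_Graph)
  interpret S: Fin_Lim "slice (Graph C) Q" by (rule G.Fin_Lim_slice[OF Q])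
  interpret V: Prod_Functor "slice (Graph C) Q" "slice C (verts Q)" "\<lambda>(X, f). (verts X, snd f)" snd
    by (rule verts_functor[OF Q])
  interpret E: Prod_Functor "slice (Graph C) Q" "slice C (edges Q)" "\<lambda>(X, f). (edges X, fst f)" fst
    by (rule edges_functor[OF Q])
  note h = S.group_object_hom[OF G(1)]
  have o: "(\<Gamma>, \<gamma>) \<in> Obj (slice (Graph C) Q)" using h G by simp
  have g: "\<gamma> \<in> Hom (Graph C) \<Gamma> Q" using o by simp
  note g' = Graph_HomD[OF g]
  obtain S s where S: "Prod (slice (Graph C) Q) (\<Gamma>, \<gamma>) (\<Gamma>, \<gamma>) = (S, s)" by (meson surj_pair)
  let ?r1 = "pr1 (slice (Graph C) Q) (\<Gamma>, \<gamma>) (\<Gamma>, \<gamma>)" and ?r2 = "pr2 (slice (Graph C) Q) (\<Gamma>, \<gamma>) (\<Gamma>, \<gamma>)"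
  have r: "?r1 \<in> Hom (Graph C) S \<Gamma>" "?r2 \<in> Hom (Graph C) S \<Gamma>" "s \<in> Hom (Graph C) S Q"
    using S.pr_in[OF o o] S by auto
  have m: "gmul \<G> \<in> Hom (Graph C) S \<Gamma>" using h(2) G S by simp
  note r1 = Graph_HomD[OF r(1)] and r2 = Graph_HomD[OF r(2)] and m' = Graph_HomD[OF m] and s' = Graph_HomD[OF r(3)]
  have z: "z \<in> Hom C Z (edges Q)" using x g' by auto
  have x': "x \<in> Hom (slice C (edges Q)) (Z, z) (case (\<Gamma>, \<gamma>) of (X, f) \<Rightarrow> (edges X, fst f))"
    "y \<in> Hom (slice C (edges Q)) (Z, z) (case (\<Gamma>, \<gamma>) of (X, f) \<Rightarrow> (edges X, fst f))"
    using x z g' by auto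
  obtain w where w: "w \<in> Hom (slice C (edges Q)) (Z, z) (case (S, s) of (X, f) \<Rightarrow> (edges X, fst f))"
    "fst ?r1 \<cdot> w = x" "fst ?r2 \<cdot> w = y"
    using E.Fa_pair[OF o o x'] S by (auto simp del: split_paired_Ex)
  have w': "w \<in> Hom C Z (edges S)" "fst s \<cdot> w = z" using w by auto
  have E: "gop (slice C (edges Q)) (Z, z) (edge_group C Q \<G>) x y = fst (gmul \<G>) \<cdot> w"
    using E.functor_group_gop[OF G(1), of w "(Z, z)"] w G S by (simp add: edge_group_def)
  have dS: "d S \<in> Hom C (edges S) (verts S)" "d \<Gamma> \<in> Hom C (edges \<Gamma>) (verts \<Gamma>)" "d Q \<in> Hom C (edges Q) (verts Q)"
    "d \<Gamma> \<cdot> fst (gmul \<G>) = snd (gmul \<G>) \<cdot> d S" "d \<Gamma> \<cdot> fst ?r1 = snd ?r1 \<cdot> d S" "d \<Gamma> \<cdot> fst ?r2 = snd ?r2 \<cdot> d S"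
    "d Q \<cdot> fst s = snd s \<cdot> d S"
    using d r1 r2 m' s' g' by auto
  have v: "d S \<cdot> w \<in> Hom C Z (verts S)" using dS w' by auto
  have "snd s \<cdot> (d S \<cdot> w) = d Q \<cdot> z"
    using comp_reduce[OF dS(7)[symmetric] dS(1) s'(2) w'(1)] comp_assoc[OF dS(3) w'(1) s'(1)] w' by simp
  then have v': "d S \<cdot> w \<in> Hom (slice C (verts Q)) (Z, d Q \<cdot> z) (case (S, s) of (X, f) \<Rightarrow> (verts X, snd f))"
    using v z dS s' by auto
  have "snd ?r1 \<cdot> (d S \<cdot> w) = d \<Gamma> \<cdot> x" "snd ?r2 \<cdot> (d S \<cdot> w) = d \<Gamma> \<cdot> y"
    using comp_reduce[OF dS(5)[symmetric] dS(1) r1(2) w'(1)] comp_assoc[OF dS(2) w'(1) r1(1)]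
      comp_reduce[OF dS(6)[symmetric] dS(1) r2(2) w'(1)] comp_assoc[OF dS(2) w'(1) r2(1)] w by simp_all
  then have "gop (slice C (verts Q)) (Z, d Q \<cdot> z) (vert_group C Q \<G>) (d \<Gamma> \<cdot> x) (d \<Gamma> \<cdot> y) = snd (gmul \<G>) \<cdot> (d S \<cdot> w)"
    using V.functor_group_gop[OF G(1), of "d S \<cdot> w" "(Z, d Q \<cdot> z)"] v' G S by (simp add: vert_group_def)
  then show ?thesis
    using E comp_reduce[OF dS(4) m'(1) dS(2) w'(1)] comp_assoc[OF m'(2) w'(1) dS(1)] by simp
qed

text \<open>Both sides of the multiplication law are maps into a constant graph, so they agree as
  soon as their vertex components do; the edge component of \<open>f\<close> is forced in the same
  way.\<close>

lemma graph_fibre_hom_iff: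
  assumes Q: "Q \<in> Obj (Graph C)" and G: "group_object (slice (Graph C) Q) \<G>" "gob \<G> = (\<Gamma>, \<gamma>)"
    and K: "group_object C K"
  shows "fibre_hom (Graph C) Q \<G> (const_group C K) f \<longleftrightarrow>
    fibre_hom C (verts Q) (vert_group C Q \<G>) K (snd f) \<and> fst f = snd f \<cdot> d0 \<Gamma> \<and> fst f = snd f \<cdot> d1 \<Gamma>"
proof -
  interpret G: Fin_Lim "Graph C" by (rule Fin_Lim_Graph)
  interpret S: Fin_Lim "slice (Graph C) Q" by (rule G.Fin_Lim_slice[OF Q])
  interpret V: Prod_Functor "slice (Graph C) Q" "slice C (verts Q)" "\<lambda>(X, f). (verts X, snd f)" snd
    by (rule verts_functor[OF Q])
  note h = S.group_object_hom[OF G(1)]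
  note c = const_group[OF K]
  have o: "(\<Gamma>, \<gamma>) \<in> Obj (slice (Graph C) Q)" using h G by simp
  have g: "\<gamma> \<in> Hom (Graph C) \<Gamma> Q" using o by simp
  note g' = Graph_HomD[OF g]
  have \<Gamma>: "\<Gamma> \<in> Obj (Graph C)" using G.Hom_Obj[OF g] by blast
  show ?thesis
  proof
    assume f: "fibre_hom (Graph C) Q \<G> (const_group C K) f"
    have f0: "f \<in> Hom (Graph C) \<Gamma> (const_graph C (gob K))" using fibre_hom_in[OF f] G c by simp
    note f1 = f0[unfolded const_graph_Hom] and f2 = Graph_HomD[OF f0]
    have f3: "snd f \<in> Hom C (verts \<Gamma>) (gob K)" using f1 by simp
    obtain S s where S: "Prod (slice (Graph C) Q) (\<Gamma>, \<gamma>) (\<Gamma>, \<gamma>) = (S, s)" by (meson surj_pair)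
    let ?r1 = "pr1 (slice (Graph C) Q) (\<Gamma>, \<gamma>) (\<Gamma>, \<gamma>)" and ?r2 = "pr2 (slice (Graph C) Q) (\<Gamma>, \<gamma>) (\<Gamma>, \<gamma>)"
    have r: "?r1 \<in> Hom (slice (Graph C) Q) (S, s) (\<Gamma>, \<gamma>)" "?r2 \<in> Hom (slice (Graph C) Q) (S, s) (\<Gamma>, \<gamma>)"
      using S.pr_in[OF o o] S by auto
    then have rG: "?r1 \<in> Hom (Graph C) S \<Gamma>" "?r2 \<in> Hom (Graph C) S \<Gamma>" by auto
    have m: "gmul \<G> \<in> Hom (Graph C) S \<Gamma>" using h(2) G S by simp
    note r1 = Graph_HomD[OF rG(1)] and r2 = Graph_HomD[OF rG(2)] and m' = Graph_HomD[OF m]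
    \<comment> \<open>The law is read at the generic pair of elements. Every pair of elements of the
      vertex groups is the restriction of its vertex component along some \<open>w\<close>, which is
      how the law on vertices follows.\<close>
    have "gop (slice (Graph C) Q) (S, s) \<G> ?r1 ?r2 = gmul \<G>"
      using S.pair_pr[OF o o] h(2) G S S.comp_Id[OF h(2)] by (simp add: gop_def del: Graph_sel slice_sel(3))
    then have "f \<cdot>\<^bsub>Graph C\<^esub> gmul \<G> = gop (Graph C) S (const_group C K) (f \<cdot>\<^bsub>Graph C\<^esub> ?r1) (f \<cdot>\<^bsub>Graph C\<^esub> ?r2)"
      using fibre_hom_gop[OF f, of ?r1 S s ?r2] r G by simp
    then have e: "snd f \<cdot> snd (gmul \<G>) = gop C (verts S) K (snd f \<cdot> snd ?r1) (snd f \<cdot> snd ?r2)"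
      using c(3)[OF G.comp_in[OF f0 rG(1)] G.comp_in[OF f0 rG(2)]] by simp
    have "fibre_hom C (verts Q) (vert_group C Q \<G>) K (snd f)"
      unfolding fibre_hom_def
    proof (intro conjI allI ballI)
      show "snd f \<in> Hom C (fst (gob (vert_group C Q \<G>))) (gob K)"
        unfolding gob_vert_group[OF G(2)] fst_conv by (rule f3)
      fix Z z x y
      assume "x \<in> Hom (slice C (verts Q)) (Z, z) (gob (vert_group C Q \<G>))"
        "y \<in> Hom (slice C (verts Q)) (Z, z) (gob (vert_group C Q \<G>))"
      then have x: "x \<in> Hom (slice C (verts Q)) (Z, z) (case (\<Gamma>, \<gamma>) of (X, f) \<Rightarrow> (verts X, snd f))"
        "y \<in> Hom (slice C (verts Q)) (Z, z) (case (\<Gamma>, \<gamma>) of (X, f) \<Rightarrow> (verts X, snd f))" using G by auto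
      obtain w where w: "w \<in> Hom (slice C (verts Q)) (Z, z) (case (S, s) of (X, f) \<Rightarrow> (verts X, snd f))"
        "snd ?r1 \<cdot> w = x" "snd ?r2 \<cdot> w = y"
        using V.Fa_pair[OF o o x] S by (auto simp del: split_paired_Ex)
      have w': "w \<in> Hom C Z (verts S)" using w by simp
      have "gop (slice C (verts Q)) (Z, z) (vert_group C Q \<G>) x y = snd (gmul \<G>) \<cdot> w"
        using V.functor_group_gop[OF G(1), of w "(Z, z)"] w G S by (simp add: vert_group_def)
      then show "snd f \<cdot> gop (slice C (verts Q)) (Z, z) (vert_group C Q \<G>) x y = gop C Z K (snd f \<cdot> x) (snd f \<cdot> y)"
        using comp_reduce[OF e m'(2) f3 w'] gop_comp[OF K w' comp_in[OF f3 r1(2)] comp_in[OF f3 r2(2)]]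
          comp_assoc[OF f3 w' r1(2)] comp_assoc[OF f3 w' r2(2)] w by simp
    qed
    then show "fibre_hom C (verts Q) (vert_group C Q \<G>) K (snd f) \<and> fst f = snd f \<cdot> d0 \<Gamma> \<and> fst f = snd f \<cdot> d1 \<Gamma>"
      using f1 by blast
  next
    assume "fibre_hom C (verts Q) (vert_group C Q \<G>) K (snd f) \<and> fst f = snd f \<cdot> d0 \<Gamma> \<and> fst f = snd f \<cdot> d1 \<Gamma>"
    then have f: "fibre_hom C (verts Q) (vert_group C Q \<G>) K (snd f)" and d: "fst f = snd f \<cdot> d0 \<Gamma>" "fst f = snd f \<cdot> d1 \<Gamma>"
      by auto
    have f3: "snd f \<in> Hom C (verts \<Gamma>) (gob K)" using fibre_hom_in[OF f] G by simp
    have f0: "f \<in> Hom (Graph C) \<Gamma> (const_graph C (gob K))"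
      unfolding const_graph_Hom using f3 d \<Gamma> group_object_hom(1)[OF K] by blast
    show "fibre_hom (Graph C) Q \<G> (const_group C K) f"
      unfolding fibre_hom_def
    proof (intro conjI allI ballI)
      show "f \<in> Hom (Graph C) (fst (gob \<G>)) (gob (const_group C K))" using f0 G c by simp
      fix Z z x y assume x: "x \<in> Hom (slice (Graph C) Q) (Z, z) (gob \<G>)" "y \<in> Hom (slice (Graph C) Q) (Z, z) (gob \<G>)"
      then have x': "x \<in> Hom (Graph C) Z \<Gamma>" "y \<in> Hom (Graph C) Z \<Gamma>" using G by auto
      have xV: "snd x \<in> Hom (slice C (verts Q)) (verts Z, snd z) (gob (vert_group C Q \<G>))"
        "snd y \<in> Hom (slice C (verts Q)) (verts Z, snd z) (gob (vert_group C Q \<G>))"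
        using V.Fa_hom[OF x(1)] V.Fa_hom[OF x(2)] G by auto
      have l: "f \<cdot>\<^bsub>Graph C\<^esub> gop (slice (Graph C) Q) (Z, z) \<G> x y \<in> Hom (Graph C) Z (const_graph C (gob K))"
        using G.comp_in[OF f0, of "gop (slice (Graph C) Q) (Z, z) \<G> x y" Z] S.gop_in[OF G(1) x] G by (simp del: Graph_sel)
      have r: "gop (Graph C) Z (const_group C K) (f \<cdot>\<^bsub>Graph C\<^esub> x) (f \<cdot>\<^bsub>Graph C\<^esub> y) \<in> Hom (Graph C) Z (const_graph C (gob K))"
        using G.gop_in[OF c(1), of "f \<cdot>\<^bsub>Graph C\<^esub> x" Z "f \<cdot>\<^bsub>Graph C\<^esub> y"] G.comp_in[OF f0 x'(1)] G.comp_in[OF f0 x'(2)] c(2)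
        by (simp del: Graph_sel)
      have s: "snd (f \<cdot>\<^bsub>Graph C\<^esub> gop (slice (Graph C) Q) (Z, z) \<G> x y) = snd (gop (Graph C) Z (const_group C K) (f \<cdot>\<^bsub>Graph C\<^esub> x) (f \<cdot>\<^bsub>Graph C\<^esub> y))"
        using c(3)[OF G.comp_in[OF f0 x'(1)] G.comp_in[OF f0 x'(2)]] graph_group_gop(2)[OF Q G(1) x] fibre_hom_gop[OF f xV] by simp
      show "f \<cdot>\<^bsub>Graph C\<^esub> gop (slice (Graph C) Q) (Z, z) \<G> x y = gop (Graph C) Z (const_group C K) (f \<cdot>\<^bsub>Graph C\<^esub> x) (f \<cdot>\<^bsub>Graph C\<^esub> y)"
        using l r s unfolding const_graph_Hom by (simp add: prod_eq_iff del: Graph_sel)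
    qed
  qed
qed

end

section \<open>Regular and Bass--Serre categories\<close>

context Cat
begin

lemma regular_epi_hom: "regular_epi C B Q q \<Longrightarrow> q \<in> Hom C B Q"
  by (auto simp: regular_epi_def dest: is_coequaliser_hom(3))

lemma regular_epi_cancel:
  assumes "regular_epi C B Q q" "u \<in> Hom C Q Z" "v \<in> Hom C Q Z" "u \<cdot> q = v \<cdot> q"
  shows "u = v"
  using assms is_coequaliser_ext unfolding regular_epi_def by blast

text \<open>The pair of which \<open>q\<close> is a coequaliser is itself a pair of elements
  identified by \<open>q\<close>, so testing on such pairs suffices and no kernel pair has to be
  formed.\<close>

lemma regular_epi_descent:
  assumes q: "regular_epi C B Q q" and x: "x \<in> Hom C B Z"
    and eq: "\<And>Y k l. k \<in> Hom C Y B \<Longrightarrow> l \<in> Hom C Y B \<Longrightarrow> q \<cdot> k = q \<cdot> l \<Longrightarrow> x \<cdot> k = x \<cdot> l"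
  obtains u where "u \<in> Hom C Q Z" "u \<cdot> q = x"
proof -
  obtain A f g where c: "is_coequaliser C A B f g Q q" using q unfolding regular_epi_def by blast
  have "x \<cdot> f = x \<cdot> g" using eq is_coequaliser_hom[OF c] by blast
  then show thesis using is_coequaliser_factor[OF c x] that by blast
qed

lemma slice_coequaliserI:
  assumes c: "is_coequaliser C A A' f g Q q" and k: "\<kappa> \<in> Hom C Q B"
  shows "is_coequaliser (slice C B) (A, \<kappa> \<cdot> (q \<cdot> f)) (A', \<kappa> \<cdot> q) f g (Q, \<kappa>) q"
proof -
  interpret S: Cat "slice C B" by unfold_locales (rule category_slice)
  note h = is_coequaliser_hom[OF c]
  have kq: "\<kappa> \<cdot> q \<in> Hom C A' B" "\<kappa> \<cdot> (q \<cdot> f) \<in> Hom C A B" using h k by auto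
  show ?thesis
  proof (rule S.is_coequaliserI)
    show "f \<in> Hom (slice C B) (A, \<kappa> \<cdot> (q \<cdot> f)) (A', \<kappa> \<cdot> q)" "g \<in> Hom (slice C B) (A, \<kappa> \<cdot> (q \<cdot> f)) (A', \<kappa> \<cdot> q)"
      using kq h comp_assoc[OF k h(1,3)] comp_assoc[OF k h(2,3)] by simp_all
    show "q \<in> Hom (slice C B) (A', \<kappa> \<cdot> q) (Q, \<kappa>)" "q \<cdot>\<^bsub>slice C B\<^esub> f = q \<cdot>\<^bsub>slice C B\<^esub> g" using h k kq by auto
    fix Zz :: "'o \<times> 'a"
    obtain Z z where Z: "Zz = (Z, z)" by (cases Zz)
    { fix x assume "x \<in> Hom (slice C B) (A', \<kappa> \<cdot> q) Zz" "x \<cdot>\<^bsub>slice C B\<^esub> f = x \<cdot>\<^bsub>slice C B\<^esub> g"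
      then have x: "x \<in> Hom C A' Z" "x \<cdot> f = x \<cdot> g" "z \<cdot> x = \<kappa> \<cdot> q" "z \<in> Hom C Z B" by (auto simp: Z)
      obtain u where u: "u \<in> Hom C Q Z" "u \<cdot> q = x" using is_coequaliser_factor[OF c x(1,2)] .
      have "z \<cdot> u = \<kappa>" by (rule is_coequaliser_ext[OF c]) (use u x k comp_assoc[OF x(4) h(3) u(1)] in auto)
      then show "\<exists>u\<in>Hom (slice C B) (Q, \<kappa>) Zz. u \<cdot>\<^bsub>slice C B\<^esub> q = x" using u x k Z by auto }
    { fix u v assume "u \<in> Hom (slice C B) (Q, \<kappa>) Zz" "v \<in> Hom (slice C B) (Q, \<kappa>) Zz"
        "u \<cdot>\<^bsub>slice C B\<^esub> q = v \<cdot>\<^bsub>slice C B\<^esub> q"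
      then show "u = v" using is_coequaliser_ext[OF c] by (auto simp: Z) }
  qed
qed

end

locale Regular = Fin_Lim C for C :: "('o, 'a) cat" (structure) +
  assumes regular: "regular_category C"
begin

text \<open>Regular epimorphisms are locally surjective on elements: the cover \<open>c\<close> is
  the pullback of \<open>f\<close> along \<open>g\<close>.\<close>

lemma regular_epi_lift:
  assumes f: "regular_epi C A D f" and g: "g \<in> Hom C B D"
  obtains P c x where "regular_epi C P B c" "x \<in> Hom C P A" "f \<cdot> x = g \<cdot> c" "c \<in> Hom C P B"
proof -
  obtain P p q where P: "is_pullback C A B D f g P p q" using ex_pullback[OF regular_epi_hom[OF f] g] .
  then have "regular_epi C P B q" using regular f unfolding regular_category_def by blast
  then show thesis using that is_pullback_hom[OF P] by blast
qed

text \<open>The image is the quotient of \<open>A\<close> by the kernel pair of \<open>f\<close>.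
  For \<open>i\<close> to be monic, elements \<open>x\<close> and \<open>y\<close> with the same
  image are lifted to \<open>A\<close> over a common cover; there they form an element of the kernel
  pair and so become equal in \<open>R\<close>.\<close>

lemma image_factorisation:
  assumes f: "f \<in> Hom C A B"
  obtains R e i where "regular_epi C A R e" "is_mono C R B i" "i \<cdot> e = f"
proof -
  obtain K k0 k1 where K: "is_pullback C A A B f f K k0 k1" using ex_pullback[OF f f] .
  then obtain R e where e: "is_coequaliser C K A k0 k1 R e"
    using regular unfolding regular_category_def by blast
  note k = is_pullback_hom[OF K] and e' = is_coequaliser_hom[OF e]
  obtain i where i: "i \<in> Hom C R B" "i \<cdot> e = f" using is_coequaliser_factor[OF e f k(5)] .
  have re: "regular_epi C A R e" using e unfolding regular_epi_def by blast
  have "x = y" if x: "x \<in> Hom C Z R" "y \<in> Hom C Z R" "i \<cdot> x = i \<cdot> y" for Z x y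
  proof -
    obtain Z1 c1 x1 where c1: "regular_epi C Z1 Z c1" "x1 \<in> Hom C Z1 A" "e \<cdot> x1 = x \<cdot> c1" "c1 \<in> Hom C Z1 Z"
      using regular_epi_lift[OF re x(1)] .
    have yc: "y \<cdot> c1 \<in> Hom C Z1 R" using x c1 by auto
    obtain Z2 c2 y2 where c2: "regular_epi C Z2 Z1 c2" "y2 \<in> Hom C Z2 A" "e \<cdot> y2 = (y \<cdot> c1) \<cdot> c2" "c2 \<in> Hom C Z2 Z1"
      using regular_epi_lift[OF re yc] .
    have x12: "x1 \<cdot> c2 \<in> Hom C Z2 A" "c1 \<cdot> c2 \<in> Hom C Z2 Z" using c1 c2 by auto
    have ex: "e \<cdot> (x1 \<cdot> c2) = x \<cdot> (c1 \<cdot> c2)"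
      using comp_reduce[OF c1(3,2) e'(3) c2(4)] comp_assoc[OF x(1) c2(4) c1(4)] by simp
    have ey: "e \<cdot> y2 = y \<cdot> (c1 \<cdot> c2)" using c2(3) comp_assoc[OF x(2) c2(4) c1(4)] by simp
    have "f \<cdot> (x1 \<cdot> c2) = f \<cdot> y2"
      using comp_reduce[OF i(2) e'(3) i(1) x12(1)] comp_reduce[OF i(2) e'(3) i(1) c2(2)] ex ey
        comp_assoc[OF i(1) x12(2) x(1)] comp_assoc[OF i(1) x12(2) x(2)] x(3) by simp
    note t = tuple_is_pullback[OF K x12(1) c2(2) this]
    have "e \<cdot> (x1 \<cdot> c2) = e \<cdot> y2"
      using comp_assoc[OF e'(3) t(1) k(3)] comp_assoc[OF e'(3) t(1) k(4)] t e'(4) by simp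
    then have "(x \<cdot> c1) \<cdot> c2 = (y \<cdot> c1) \<cdot> c2"
      using ex ey comp_assoc[OF x(1) c2(4) c1(4)] comp_assoc[OF x(2) c2(4) c1(4)] by simp
    then have "x \<cdot> c1 = y \<cdot> c1" using regular_epi_cancel[OF c2(1) _ yc] x c1 by blast
    then show "x = y" using regular_epi_cancel[OF c1(1) x(1,2)] by blast
  qed
  then have "is_mono C R B i" unfolding is_mono_def using i by blast
  then show thesis using that re i by blast
qed

end

text \<open>The forgetful functor of the slice has the right adjoint
  \<open>Z \<mapsto> Z \<times> B\<close> and so preserves coequalisers: a map \<open>x\<close> to
  \<open>Z\<close> is tested as the map \<open>(x, \<alpha>')\<close> to \<open>Z \<times> B\<close>
  over \<open>B\<close>.\<close>

lemma (in Fin_Lim) slice_coequaliserD: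
  assumes c: "is_coequaliser (slice C B) (A, \<alpha>) (A', \<alpha>') f g (Q, \<kappa>) q" and B: "B \<in> Obj C"
  shows "is_coequaliser C A A' f g Q q"
proof -
  interpret S: Cat "slice C B" by unfold_locales (rule category_slice)
  note h = is_coequaliser_hom[OF c, simplified]
  have h': "f \<in> Hom C A A'" "g \<in> Hom C A A'" "q \<in> Hom C A' Q" "\<alpha>' \<in> Hom C A' B" "\<kappa> \<in> Hom C Q B" using h by auto
  show ?thesis
  proof (rule is_coequaliserI)
    show "f \<in> Hom C A A'" "g \<in> Hom C A A'" "q \<in> Hom C A' Q" "q \<cdot> f = q \<cdot> g" using h by auto
    fix Z
    { fix x assume x: "x \<in> Hom C A' Z" "x \<cdot> f = x \<cdot> g"
      have Z: "Z \<in> Obj C" using x Hom_Obj by blast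
      have a: "\<alpha>' \<cdot> f = \<alpha>' \<cdot> g" using h by simp
      have "pair C A' Z B x \<alpha>' \<in> Hom (slice C B) (A', \<alpha>') (Prod C Z B, pr2 C Z B)" using x h' Z B by auto
      moreover have "pair C A' Z B x \<alpha>' \<cdot> f = pair C A' Z B x \<alpha>' \<cdot> g"
        using pair_comp[OF h'(1) x(1) h'(4)] pair_comp[OF h'(2) x(1) h'(4)] a x by simp
      ultimately obtain u where "u \<in> Hom (slice C B) (Q, \<kappa>) (Prod C Z B, pr2 C Z B)" "u \<cdot> q = pair C A' Z B x \<alpha>'"
        using S.is_coequaliser_factor[OF c, of "pair C A' Z B x \<alpha>'" "(Prod C Z B, pr2 C Z B)"] by auto
      then have u: "u \<in> Hom C Q (Prod C Z B)" "u \<cdot> q = pair C A' Z B x \<alpha>'" by auto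
      have "(pr1 C Z B \<cdot> u) \<cdot> q = x" using comp_assoc[OF pr_in(1)[OF Z B] h'(3) u(1)] u x h' by simp
      then show "\<exists>u \<in> Hom C Q Z. u \<cdot> q = x" using u Z B by blast }
    { fix u v assume u: "u \<in> Hom C Q Z" "v \<in> Hom C Q Z" "u \<cdot> q = v \<cdot> q"
      have Z: "Z \<in> Obj C" using u Hom_Obj by blast
      have "pair C Q Z B u \<kappa> = pair C Q Z B v \<kappa>"
        by (rule S.is_coequaliser_ext[OF c, of _ "(Prod C Z B, pr2 C Z B)"])
          (use u h' Z B pair_comp[OF h'(3) u(1) h'(5)] pair_comp[OF h'(3) u(2) h'(5)] in auto)
      then show "u = v" using pr_pair(1)[OF u(1) h'(5)] pr_pair(1)[OF u(2) h'(5)] by metis }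
  qed
qed

text \<open>The definition supplies finite limits in the slices only. Over a terminal object the
  slice is \<open>C\<close> itself, as structure maps exist and are unique; products and equalisers
  are taken from there.\<close>

lemma Bass_Serre_Fin_Lim:
  fixes C :: "('o, 'a) cat" (structure)
  assumes C: "Bass_Serre C"
  shows "Fin_Lim C"
proof -
  interpret Cat C by unfold_locales (use C in \<open>simp add: Bass_Serre_def\<close>)
  obtain T where T: "is_terminal C T" using C unfolding Bass_Serre_def by blast
  have T0: "T \<in> Obj C" using T unfolding is_terminal_def by blast
  have lim: "has_finite_limits (slice C T)"
    using C T0 unfolding Bass_Serre_def locally_action_Barr_exact_def action_Barr_exact_def regular_category_def by blast
  interpret S: Fin_Lim "slice C T" by unfold_locales (use category_slice lim in auto)
  have ex: "\<exists>a. a \<in> Hom C A T" if "A \<in> Obj C" for A using T that unfolding is_terminal_def by blast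
  have un: "a = b" if "a \<in> Hom C A T" "b \<in> Hom C A T" for A a b
    using T that Hom_Obj(1)[OF that(1)] unfolding is_terminal_def by blast
  show ?thesis
  proof (unfold_locales, unfold has_finite_limits_def, intro conjI ballI allI)
    show "\<exists>T. is_terminal C T" using T by blast
    fix A B
    { assume A: "A \<in> Obj C" "B \<in> Obj C"
      obtain a b where a: "a \<in> Hom C A T" "b \<in> Hom C B T" using ex A by blast
      obtain P p where P: "Prod (slice C T) (A, a) (B, b) = (P, p)" by (meson surj_pair)
      have "is_product (slice C T) (A, a) (B, b) (P, p) (pr1 (slice C T) (A, a) (B, b)) (pr2 (slice C T) (A, a) (B, b))"
        using S.Prod_is_product[of "(A, a)" "(B, b)"] a P by simp
      then show "\<exists>P p q. is_product C A B P p q"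
        using slice_product_iff[OF a] is_product_of_pullback[OF T] by blast }
    { fix f g assume f: "f \<in> Hom C A B" "g \<in> Hom C A B"
      obtain a where a: "a \<in> Hom C A T" using ex Hom_Obj[OF f(1)] by blast
      obtain b where b: "b \<in> Hom C B T" using ex Hom_Obj[OF f(1)] by blast
      have "b \<cdot> f = a" "b \<cdot> g = a" using un[OF comp_in[OF b f(1)] a] un[OF comp_in[OF b f(2)] a] by auto
      then have fg: "f \<in> Hom (slice C T) (A, a) (B, b)" "g \<in> Hom (slice C T) (A, a) (B, b)" using f a b by auto
      obtain Ee e where e: "is_equaliser (slice C T) (A, a) (B, b) f g Ee e" using S.ex_equaliser[OF fg] .
      obtain E \<epsilon> where E: "Ee = (E, \<epsilon>)" by (cases Ee)
      note h = S.is_equaliser_hom[OF e, unfolded E, simplified]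
      have "is_equaliser C A B f g E e"
      proof (rule is_equaliserI)
        show "f \<in> Hom C A B" "g \<in> Hom C A B" "e \<in> Hom C E A" "f \<cdot> e = g \<cdot> e" using h by auto
        fix Z
        { fix x assume x: "x \<in> Hom C Z A" "f \<cdot> x = g \<cdot> x"
          have "x \<in> Hom (slice C T) (Z, a \<cdot> x) (A, a)" using x a by auto
          from S.factor_is_equaliser[OF e this] show "\<exists>u\<in>Hom C Z E. e \<cdot> u = x" using x E by auto }
        { fix u v assume u: "u \<in> Hom C Z E" "v \<in> Hom C Z E" "e \<cdot> u = e \<cdot> v"
          have eps: "\<epsilon> \<in> Hom C E T" using h by auto
          have "\<epsilon> \<cdot> u = \<epsilon> \<cdot> v" using un[OF comp_in[OF eps u(1)] comp_in[OF eps u(2)]] .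
          then show "u = v" using S.is_equaliser_ext[OF e, of u "(Z, \<epsilon> \<cdot> u)" v] u eps E by auto }
      qed
      then show "\<exists>E e. is_equaliser C A B f g E e" by blast }
  qed
qed

section \<open>Local arguments in a Bass--Serre category\<close>

locale Bass_Serre_Cat =
  fixes C :: "('o, 'a) cat" (structure)
  assumes Bass_Serre: "Bass_Serre C"

sublocale Bass_Serre_Cat \<subseteq> Fin_Lim
  by (rule Bass_Serre_Fin_Lim[OF Bass_Serre])

context Bass_Serre_Cat
begin

lemma Regular_slice: "B \<in> Obj C \<Longrightarrow> Regular (slice C B)"
  using Bass_Serre Fin_Lim_slice
  unfolding Bass_Serre_def locally_action_Barr_exact_def action_Barr_exact_def Regular_def Regular_axioms_def by blast

lemma coequalisers: "has_coequalisers C"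
  using Bass_Serre unfolding Bass_Serre_def by blast

lemma ex_coequaliser:
  assumes "f \<in> Hom C A B" "g \<in> Hom C A B"
  obtains Q q where "is_coequaliser C A B f g Q q"
  using coequalisers assms unfolding has_coequalisers_def by blast

lemma slice_regular_epiD:
  assumes "regular_epi (slice C B) (A, \<alpha>) (Q, \<kappa>) q" "B \<in> Obj C"
  shows "regular_epi C A Q q"
  using assms slice_coequaliserD unfolding regular_epi_def by fast

text \<open>Regularity is available in slices, so the lifting is done over \<open>D\<close>, where
  \<open>f\<close> becomes a map from \<open>(A, f)\<close> to the terminal object.\<close>

lemma regular_epi_lift:
  assumes f: "regular_epi C A D f" and g: "g \<in> Hom C B D"
  obtains P c x where "regular_epi C P B c" "x \<in> Hom C P A" "f \<cdot> x = g \<cdot> c" "c \<in> Hom C P B"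
proof -
  have D: "D \<in> Obj C" using g Hom_Obj by blast
  interpret S: Regular "slice C D" by (rule Regular_slice[OF D])
  note f' = regular_epi_hom[OF f]
  obtain E k l where "is_coequaliser C E A k l D f" using f unfolding regular_epi_def by blast
  from slice_coequaliserI[OF this Id_in[OF D]] have r: "regular_epi (slice C D) (A, f) (D, Id C D) f"
    unfolding regular_epi_def using f' by auto
  have "g \<in> Hom (slice C D) (B, g) (D, Id C D)" using g D by simp
  with r obtain P c x where P: "regular_epi (slice C D) P (B, g) c" "x \<in> Hom (slice C D) P (A, f)"
    "f \<cdot>\<^bsub>slice C D\<^esub> x = g \<cdot>\<^bsub>slice C D\<^esub> c" "c \<in> Hom (slice C D) P (B, g)" by (rule S.regular_epi_lift)
  obtain P0 p where e: "P = (P0, p)" by (cases P)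
  show thesis
    by (rule that[of P0 c x]) (use P e slice_regular_epiD[of D P0 p B g c] D in auto)
qed

text \<open>Exactness in terms of elements: \<open>u\<close> and \<open>v\<close> have the same image in the quotient by a group
  action iff locally \<open>u = g v\<close>.\<close>

lemma action_effective:
  assumes B: "B \<in> Obj C" and H: "group_object (slice C B) H" "gob H = (H0, h)"
    and a: "left_action (slice C B) H (Y, \<beta>) a"
    and u: "u \<in> Hom C Z Y" "v \<in> Hom C Z Y"
    and eq: "\<And>T \<tau>. \<tau> \<in> Hom C Y T \<Longrightarrow>
      (\<And>Z z g y. g \<in> Hom (slice C B) (Z, z) (H0, h) \<Longrightarrow> y \<in> Hom (slice C B) (Z, z) (Y, \<beta>) \<Longrightarrow>
         \<tau> \<cdot> (a \<cdot> pair (slice C B) (Z, z) (H0, h) (Y, \<beta>) g y) = \<tau> \<cdot> y) \<Longrightarrow> \<tau> \<cdot> u = \<tau> \<cdot> v"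
  obtains Z' c g where "regular_epi C Z' Z c" "c \<in> Hom C Z' Z"
    "g \<in> Hom (slice C B) (Z', \<beta> \<cdot> (v \<cdot> c)) (H0, h)"
    "u \<cdot> c = a \<cdot> pair (slice C B) (Z', \<beta> \<cdot> (v \<cdot> c)) (H0, h) (Y, \<beta>) g (v \<cdot> c)"
proof -
  interpret S: Regular "slice C B" by (rule Regular_slice[OF B])
  let ?S = "slice C B"
  note aH = S.left_action_hom[OF a, unfolded H]
  have oH: "(H0, h) \<in> Obj ?S" using S.group_object_hom(1)[OF H(1)] H(2) by simp
  note oY = aH(1)
  have \<beta>: "\<beta> \<in> Hom C Y B" using oY by simp
  let ?HY = "Prod ?S (H0, h) (Y, \<beta>)" and ?YY = "Prod ?S (Y, \<beta>) (Y, \<beta>)"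
  let ?p = "pr2 ?S (H0, h) (Y, \<beta>)"
  have p: "?p \<in> Hom ?S ?HY (Y, \<beta>)" "pr1 ?S (H0, h) (Y, \<beta>) \<in> Hom ?S ?HY (H0, h)" using oH oY by auto
  let ?f = "pair ?S ?HY (Y, \<beta>) (Y, \<beta>) a ?p"
  have f: "?f \<in> Hom ?S ?HY ?YY" using aH p by auto
  obtain R e i where e: "regular_epi ?S ?HY R e" and i: "is_mono ?S R ?YY i" and ie: "i \<cdot>\<^bsub>?S\<^esub> e = ?f"
    using S.image_factorisation[OF f] .
  let ?r0 = "pr1 ?S (Y, \<beta>) (Y, \<beta>) \<cdot>\<^bsub>?S\<^esub> i" and ?r1 = "pr2 ?S (Y, \<beta>) (Y, \<beta>) \<cdot>\<^bsub>?S\<^esub> i"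
  have exact: "action_Barr_exact ?S"
    using Bass_Serre B unfolding Bass_Serre_def locally_action_Barr_exact_def by blast
  have "group_object ?S H \<and> left_action ?S H (Y, \<beta>) a \<and> regular_epi ?S (Prod ?S (gob H) (Y, \<beta>)) R e \<and>
      is_mono ?S R ?YY i \<and> i \<cdot>\<^bsub>?S\<^esub> e = pair ?S (Prod ?S (gob H) (Y, \<beta>)) (Y, \<beta>) (Y, \<beta>) a (pr2 ?S (gob H) (Y, \<beta>))"
    unfolding H(2) by (intro conjI H(1) a e i ie)
  note ex = exact[unfolded action_Barr_exact_def, THEN conjunct2, rule_format, OF this]
  obtain Q q where q: "is_coequaliser ?S R (Y, \<beta>) ?r0 ?r1 Q q"
    and K: "is_pullback ?S (Y, \<beta>) (Y, \<beta>) Q q q R ?r0 ?r1"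
    using ex by blast
  note q' = is_coequaliser_hom[OF q] and e' = S.regular_epi_hom[OF e]
  have i': "i \<in> Hom ?S R ?YY" using i unfolding is_mono_def by blast
  have re: "?r0 \<cdot>\<^bsub>?S\<^esub> e = a" "?r1 \<cdot>\<^bsub>?S\<^esub> e = ?p"
    using S.comp_assoc[OF S.pr_in(1)[OF oY oY] e' i'] S.comp_assoc[OF S.pr_in(2)[OF oY oY] e' i'] ie
      S.pr_pair[OF aH(2) p(1)] by simp_all
  have qa: "q \<cdot>\<^bsub>?S\<^esub> a = q \<cdot>\<^bsub>?S\<^esub> ?p"
    using S.comp_assoc[OF q'(3) e' q'(1)] S.comp_assoc[OF q'(3) e' q'(2)] re q'(4) by simp
  obtain Q0 \<kappa> where Q: "Q = (Q0, \<kappa>)" by (cases Q)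
  have q0: "q \<in> Hom C Y Q0" "\<kappa> \<cdot> q = \<beta>" "\<kappa> \<in> Hom C Q0 B" using q'(3) Q by auto
  \<comment> \<open>The coequaliser \<open>q\<close> of the orbit congruence is itself an invariant
    map, so the hypothesis about invariant maps applies to it.\<close>
  have quv: "q \<cdot> u = q \<cdot> v"
  proof (rule eq[OF q0(1)])
    fix Z z g y assume g: "g \<in> Hom ?S (Z, z) (H0, h)" and y: "y \<in> Hom ?S (Z, z) (Y, \<beta>)"
    note P = S.pair_in[OF g y]
    have "q \<cdot>\<^bsub>?S\<^esub> (a \<cdot>\<^bsub>?S\<^esub> pair ?S (Z, z) (H0, h) (Y, \<beta>) g y) = q \<cdot>\<^bsub>?S\<^esub> (?p \<cdot>\<^bsub>?S\<^esub> pair ?S (Z, z) (H0, h) (Y, \<beta>) g y)"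
      using S.comp_assoc[OF q'(3) P aH(2)] S.comp_assoc[OF q'(3) P p(1)] qa by simp
    then show "q \<cdot> (a \<cdot> pair ?S (Z, z) (H0, h) (Y, \<beta>) g y) = q \<cdot> y" using S.pr_pair[OF g y] by simp
  qed
  have bu: "\<beta> \<cdot> u = \<beta> \<cdot> v"
    using comp_reduce[OF q0(2,1,3) u(1)] comp_reduce[OF q0(2,1,3) u(2)] quv by simp
  have uS: "u \<in> Hom ?S (Z, \<beta> \<cdot> u) (Y, \<beta>)" "v \<in> Hom ?S (Z, \<beta> \<cdot> u) (Y, \<beta>)" using u \<beta> bu by auto
  note t = S.tuple_is_pullback[OF K uS, simplified, OF quv]
  let ?w = "tuple ?S (Z, \<beta> \<cdot> u) R (pr1 ?S (Y, \<beta>) (Y, \<beta>) \<cdot> i) (pr2 ?S (Y, \<beta>) (Y, \<beta>) \<cdot> i) u v"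
  \<comment> \<open>By effectiveness \<open>(u, v)\<close> is an element \<open>?w\<close> of the
    congruence \<open>R\<close>. As \<open>e\<close> is a regular epimorphism onto \<open>R\<close>,
    this element lifts locally to a pair \<open>(g, v)\<close> in
    \<open>H \<times> Y\<close>.\<close>
  obtain P c x where c: "regular_epi ?S P (Z, \<beta> \<cdot> u) c" "x \<in> Hom ?S P ?HY" "e \<cdot>\<^bsub>?S\<^esub> x = ?w \<cdot>\<^bsub>?S\<^esub> c"
    "c \<in> Hom ?S P (Z, \<beta> \<cdot> u)" using S.regular_epi_lift[OF e t(1)] .
  obtain Z' z' where P: "P = (Z', z')" by (cases P)
  have c': "c \<in> Hom C Z' Z" "\<beta> \<cdot> (v \<cdot> c) = z'" using c P comp_assoc[OF \<beta> _ u(2)] bu by auto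
  let ?g = "pr1 ?S (H0, h) (Y, \<beta>) \<cdot>\<^bsub>?S\<^esub> x"
  have "?r0 \<cdot>\<^bsub>?S\<^esub> (e \<cdot>\<^bsub>?S\<^esub> x) = u \<cdot> c" "?r1 \<cdot>\<^bsub>?S\<^esub> (e \<cdot>\<^bsub>?S\<^esub> x) = v \<cdot> c"
    unfolding c(3) using S.comp_assoc[OF q'(1) c(4) t(1)] S.comp_assoc[OF q'(2) c(4) t(1)] t by simp_all
  then have uc: "a \<cdot>\<^bsub>?S\<^esub> x = u \<cdot> c" "?p \<cdot>\<^bsub>?S\<^esub> x = v \<cdot> c"
    using S.comp_assoc[OF q'(1) c(2) e'] S.comp_assoc[OF q'(2) c(2) e'] re by simp_all
  have g: "?g \<in> Hom ?S (Z', z') (H0, h)" using S.comp_in[OF p(2) c(2)] P by simp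
  have x: "pair ?S (Z', z') (H0, h) (Y, \<beta>) ?g (v \<cdot> c) = x"
    using S.pair_eta[OF c(2) oH oY] uc P by simp
  show thesis
  proof (rule that)
    show "regular_epi C Z' Z c" using slice_regular_epiD[OF c(1)[unfolded P] B] .
    show "c \<in> Hom C Z' Z" using c' by simp
    show "?g \<in> Hom ?S (Z', \<beta> \<cdot> (v \<cdot> c)) (H0, h)" using g c' by simp
    show "u \<cdot> c = a \<cdot> pair ?S (Z', \<beta> \<cdot> (v \<cdot> c)) (H0, h) (Y, \<beta>) ?g (v \<cdot> c)" using x c'(2) uc(1) by simp
  qed
qed

end

section \<open>The fundamental group\<close>

text \<open>In terms of vertices alone, a homomorphism \<open>\<G> \<rightarrow> \<Delta>(K)\<close> is a fibrewise homomorphism from the vertex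
  groups to \<open>K\<close> whose two restrictions to the edge groups agree.\<close>

definition vert_hom ::
  "('o, 'a) cat \<Rightarrow> ('o, 'a) graph \<Rightarrow> (('o, 'a) graph \<times> ('a \<times> 'a), 'a \<times> 'a) grp \<Rightarrow> ('o, 'a) grp \<Rightarrow> 'a \<Rightarrow> bool" where
  "vert_hom C Q \<G> K f \<longleftrightarrow> fibre_hom C (verts Q) (vert_group C Q \<G>) K f \<and>
     f \<cdot>\<^bsub>C\<^esub> d0 (fst (gob \<G>)) = f \<cdot>\<^bsub>C\<^esub> d1 (fst (gob \<G>))"

text \<open>The universal property of \<open>\<pi>\<close> with its unit, read on vertices;
  \<open>Delta_universal_iff\<close> shows that nothing is lost by this.\<close>

definition universal_vert_hom ::
  "('o, 'a) cat \<Rightarrow> ('o, 'a) graph \<Rightarrow> (('o, 'a) graph \<times> ('a \<times> 'a), 'a \<times> 'a) grp \<Rightarrow> ('o, 'a) grp \<Rightarrow> 'a \<Rightarrow> bool" where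
  "universal_vert_hom C Q \<G> L e \<longleftrightarrow> group_object C L \<and> vert_hom C Q \<G> L e \<and>
     (\<forall>K f. group_object C K \<longrightarrow> vert_hom C Q \<G> K f \<longrightarrow> (\<exists>!h. h \<in> Hom (Grp C) L K \<and> h \<cdot>\<^bsub>C\<^esub> e = f))"

context Fin_Lim
begin

text \<open>The instance of \<open>universal_arrow_iff\<close> for groups of \<open>C\<close>
  itself: the unit into \<open>L H \<times> A\<close> is replaced by its first component
  \<open>e\<close>.\<close>

lemma times_group_universal:
  assumes A: "A \<in> Obj C"
    and adj: "is_left_adjoint (Grp C) (Grp (slice C A)) (times_group C A) (times_group_map C A) L \<eta>"
    and H: "group_object (slice C A) H" "gob H = (B, \<beta>)"
  defines "e \<equiv> pr1 C (gob (L H)) A \<cdot> \<eta> H"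
  shows "group_object C (L H)" "fibre_hom C A H (L H) e"
    "\<And>K f. group_object C K \<Longrightarrow> fibre_hom C A H K f \<Longrightarrow> \<exists>!h. h \<in> Hom (Grp C) (L H) K \<and> h \<cdot> e = f"
proof -
  interpret S: Fin_Lim "slice C A" by (rule Fin_Lim_slice[OF A])
  have u: "L H \<in> Obj (Grp C)" "\<eta> H \<in> Hom (Grp (slice C A)) H (times_group C A (L H)) \<and>
     (\<forall>K \<in> Obj (Grp C). \<forall>g \<in> Hom (Grp (slice C A)) H (times_group C A K).
        \<exists>!h. h \<in> Hom (Grp C) (L H) K \<and> times_group_map C A (L H) K h \<cdot>\<^bsub>Grp (slice C A)\<^esub> \<eta> H = g)"
    using adj H S.Obj_Grp unfolding is_left_adjoint_def by blast+
  then show LH: "group_object C (L H)" by simp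
  have *: "times_group_map C A (L H) K h \<in> Hom C (Prod C (gob (L H)) A) (Prod C (gob K) A) \<and>
      pr2 C (gob K) A \<cdot> times_group_map C A (L H) K h = pr2 C (gob (L H)) A \<and>
      pr1 C (gob K) A \<cdot> times_group_map C A (L H) K h = h \<cdot> pr1 C (gob (L H)) A \<and>
      h \<in> Hom C (gob (L H)) (gob K) \<and> group_object C K" if h: "h \<in> Hom (Grp C) (L H) K" for K h
  proof -
    note h' = Grp_homD[OF h]
    show ?thesis unfolding times_group_map_def
      using h' pmap_in[OF h'(3) Id_in[OF A]] pr_pmap[OF h'(3) Id_in[OF A]] group_object_hom(1)[OF h'(1)]
        Id_comp[OF pr_in(2)] A by simp
  qed
  have "\<eta> H \<in> Hom C B (Prod C (gob (L H)) A) \<and> pr2 C (gob (L H)) A \<cdot> \<eta> H = \<beta> \<and> fibre_hom C A H (L H) e \<and>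
     (\<forall>K f. group_object C K \<longrightarrow> fibre_hom C A H K f \<longrightarrow> (\<exists>!h. h \<in> Hom (Grp C) (L H) K \<and> h \<cdot> e = f))"
    unfolding e_def
    by (rule iffD1[OF universal_arrow_iff[OF H, where c = "\<lambda>K. K" and P = "\<lambda>K. Prod C (gob K) A" and p = "\<lambda>K. pr1 C (gob K) A"
          and q = "\<lambda>K. pr2 C (gob K) A" and Fm = "times_group_map C A (L H)" and ch = "\<lambda>h. h" and M = C]])
      (use * LH A u Prod_is_product[OF group_object_hom(1)] in \<open>simp_all add: times_group_def[symmetric]\<close>)
  then show "fibre_hom C A H (L H) e"
    "\<And>K f. group_object C K \<Longrightarrow> fibre_hom C A H K f \<Longrightarrow> \<exists>!h. h \<in> Hom (Grp C) (L H) K \<and> h \<cdot> e = f" by blast+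
qed

lemma Delta_map_pr:
  assumes Q: "Q \<in> Obj (Graph C)" and h: "h \<in> Hom C (gob L) (gob K)"
  shows "Delta_map C Q L K h \<in> Hom (Graph C) (times_graph C (gob L) Q) (times_graph C (gob K) Q)"
    "times_pr2 C (gob K) Q \<cdot>\<^bsub>Graph C\<^esub> Delta_map C Q L K h = times_pr2 C (gob L) Q"
    "times_pr1 C (gob K) Q \<cdot>\<^bsub>Graph C\<^esub> Delta_map C Q L K h = (h, h) \<cdot>\<^bsub>Graph C\<^esub> times_pr1 C (gob L) Q"
proof -
  interpret G: Fin_Lim "Graph C" by (rule Fin_Lim_Graph)
  have i: "Id (Graph C) Q \<in> Hom (Graph C) Q Q" using G.Id_in[OF Q] .
  have "times_pr2 C (gob L) Q \<in> Hom (Graph C) (times_graph C (gob L) Q) Q"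
    using G.is_product_hom(2)[OF times_graph_product[OF Hom_Obj(1)[OF h] Q]] .
  then show "Delta_map C Q L K h \<in> Hom (Graph C) (times_graph C (gob L) Q) (times_graph C (gob K) Q)"
    "times_pr2 C (gob K) Q \<cdot>\<^bsub>Graph C\<^esub> Delta_map C Q L K h = times_pr2 C (gob L) Q"
    "times_pr1 C (gob K) Q \<cdot>\<^bsub>Graph C\<^esub> Delta_map C Q L K h = (h, h) \<cdot>\<^bsub>Graph C\<^esub> times_pr1 C (gob L) Q"
    unfolding Delta_map_def
    using times_map_in[OF h i] times_map_pr[OF h i] G.Id_comp[of "times_pr2 C (gob L) Q"] by metis+
qed

text \<open>\<open>universal_arrow_iff\<close> is applied in the category of graphs to the constant
  groups, and maps into these are then replaced by their vertex components.\<close>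

lemma Delta_universal_iff:
  assumes Q: "Q \<in> Obj (Graph C)" and G: "group_object (slice (Graph C) Q) \<G>" "gob \<G> = (\<Gamma>, \<gamma>)"
    and L: "group_object C L"
  shows "\<eta> \<in> Hom (GoG C Q) \<G> (Delta C Q L) \<and>
     (\<forall>K \<in> Obj (Grp C). \<forall>g \<in> Hom (GoG C Q) \<G> (Delta C Q K).
        \<exists>!h. h \<in> Hom (Grp C) L K \<and> Delta_map C Q L K h \<cdot>\<^bsub>GoG C Q\<^esub> \<eta> = g) \<longleftrightarrow>
    \<eta> \<in> Hom (Graph C) \<Gamma> (times_graph C (gob L) Q) \<and> times_pr2 C (gob L) Q \<cdot>\<^bsub>Graph C\<^esub> \<eta> = \<gamma> \<and>
    fst (times_pr1 C (gob L) Q \<cdot>\<^bsub>Graph C\<^esub> \<eta>) = snd (times_pr1 C (gob L) Q \<cdot>\<^bsub>Graph C\<^esub> \<eta>) \<cdot> d0 \<Gamma> \<and>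
    universal_vert_hom C Q \<G> L (snd (times_pr1 C (gob L) Q \<cdot>\<^bsub>Graph C\<^esub> \<eta>))" (is "?lhs \<longleftrightarrow> ?rhs")
proof -
  interpret G: Fin_Lim "Graph C" by (rule Fin_Lim_Graph)
  let ?e = "times_pr1 C (gob L) Q \<cdot>\<^bsub>Graph C\<^esub> \<eta>"
  have *: "Delta_map C Q L K h \<in> Hom (Graph C) (times_graph C (gob L) Q) (times_graph C (gob K) Q) \<and>
      times_pr2 C (gob K) Q \<cdot>\<^bsub>Graph C\<^esub> Delta_map C Q L K h = times_pr2 C (gob L) Q \<and>
      times_pr1 C (gob K) Q \<cdot>\<^bsub>Graph C\<^esub> Delta_map C Q L K h = (h, h) \<cdot>\<^bsub>Graph C\<^esub> times_pr1 C (gob L) Q \<and>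
      (h, h) \<in> Hom (Graph C) (gob (const_group C L)) (gob (const_group C K)) \<and> group_object C K"
    if h: "h \<in> Hom (Grp C) L K" for K h
  proof -
    note h' = Grp_homD[OF h]
    have "(h, h) \<in> Hom (Graph C) (gob (const_group C L)) (gob (const_group C K))"
      unfolding gob_const_group[OF h'(1)] gob_const_group[OF h'(2)] const_graph_Hom
      using h' group_object_hom(1) by (simp add: const_graph_def)
    then show ?thesis using Delta_map_pr[OF Q h'(3)] h'(2) by blast
  qed
  have "?lhs \<longleftrightarrow> \<eta> \<in> Hom (Graph C) \<Gamma> (times_graph C (gob L) Q) \<and> times_pr2 C (gob L) Q \<cdot>\<^bsub>Graph C\<^esub> \<eta> = \<gamma> \<and>
     fibre_hom (Graph C) Q \<G> (const_group C L) ?e \<and>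
     (\<forall>K f. group_object C K \<longrightarrow> fibre_hom (Graph C) Q \<G> (const_group C K) f \<longrightarrow>
        (\<exists>!h. h \<in> Hom (Grp C) L K \<and> (h, h) \<cdot>\<^bsub>Graph C\<^esub> ?e = f))"
    unfolding GoG_def Delta_def
    by (rule G.universal_arrow_iff[OF G, where c = "const_group C" and P = "\<lambda>K. times_graph C (gob K) Q"
          and p = "\<lambda>K. times_pr1 C (gob K) Q" and q = "\<lambda>K. times_pr2 C (gob K) Q" and Fm = "Delta_map C Q L"
          and ch = "\<lambda>h. (h, h)" and M = C, OF const_group_object _ * L Obj_Grp])
      (simp_all only: gob_const_group times_graph_product[OF group_object_hom(1) Q])
  moreover have "fibre_hom (Graph C) Q \<G> (const_group C L) ?e \<and>
     (\<forall>K f. group_object C K \<longrightarrow> fibre_hom (Graph C) Q \<G> (const_group C K) f \<longrightarrow>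
        (\<exists>!h. h \<in> Hom (Grp C) L K \<and> (h, h) \<cdot>\<^bsub>Graph C\<^esub> ?e = f)) \<longleftrightarrow>
     fst ?e = snd ?e \<cdot> d0 \<Gamma> \<and> universal_vert_hom C Q \<G> L (snd ?e)" (is "?a \<and> ?u \<longleftrightarrow> ?b")
  proof -
    have fv: "fibre_hom (Graph C) Q \<G> (const_group C K) f \<longleftrightarrow> fst f = snd f \<cdot> d0 \<Gamma> \<and> vert_hom C Q \<G> K (snd f)"
      if "group_object C K" for K f
      using graph_fibre_hom_iff[OF Q G that, of f] unfolding vert_hom_def G(2) fst_conv by auto
    have \<Gamma>: "d0 \<Gamma> \<in> Hom C (edges \<Gamma>) (verts \<Gamma>)"
    proof -
      interpret S: Fin_Lim "slice (Graph C) Q" by (rule G.Fin_Lim_slice[OF Q])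
      have "\<gamma> \<in> Hom (Graph C) \<Gamma> Q" using S.group_object_hom(1)[OF G(1)] G(2) by simp
      then show ?thesis by (rule Graph_HomD(5))
    qed
    have eq: "(h, h) \<cdot>\<^bsub>Graph C\<^esub> ?e = f \<longleftrightarrow> h \<cdot> snd ?e = snd f"
      if h: "h \<in> Hom (Grp C) L K" and e: "fst ?e = snd ?e \<cdot> d0 \<Gamma>" "vert_hom C Q \<G> L (snd ?e)"
        and f: "fst f = snd f \<cdot> d0 \<Gamma>" for K f h
    proof -
      have "snd ?e \<in> Hom C (verts \<Gamma>) (gob L)"
        using fibre_hom_in[OF e(2)[unfolded vert_hom_def, THEN conjunct1]]
        unfolding gob_vert_group[OF G(2)] fst_conv .
      from comp_assoc[OF Grp_homD(3)[OF h] \<Gamma> this] have "h \<cdot> fst ?e = (h \<cdot> snd ?e) \<cdot> d0 \<Gamma>" using e(1) by simp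
      then show ?thesis using f by (auto simp: prod_eq_iff)
    qed
    show ?thesis
    proof
      assume l: "?a \<and> ?u"
      then have e: "fst ?e = snd ?e \<cdot> d0 \<Gamma>" "vert_hom C Q \<G> L (snd ?e)" using fv[OF L] by auto
      have "\<exists>!h. h \<in> Hom (Grp C) L K \<and> h \<cdot> snd ?e = f" if K: "group_object C K" and f: "vert_hom C Q \<G> K f" for K f
      proof -
        have "\<exists>!h. h \<in> Hom (Grp C) L K \<and> (h, h) \<cdot>\<^bsub>Graph C\<^esub> ?e = (f \<cdot> d0 \<Gamma>, f)"
          using l K fv[OF K, of "(f \<cdot> d0 \<Gamma>, f)"] f by simp
        then show ?thesis using eq[OF _ e, of _ K "(f \<cdot> d0 \<Gamma>, f)"] by (metis fst_conv snd_conv)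
      qed
      then show ?b using e L unfolding universal_vert_hom_def by blast
    next
      assume r: ?b
      then have e: "fst ?e = snd ?e \<cdot> d0 \<Gamma>" "vert_hom C Q \<G> L (snd ?e)" unfolding universal_vert_hom_def by auto
      have "\<exists>!h. h \<in> Hom (Grp C) L K \<and> (h, h) \<cdot>\<^bsub>Graph C\<^esub> ?e = f"
        if K: "group_object C K" and f: "fibre_hom (Graph C) Q \<G> (const_group C K) f" for K f
      proof -
        have f': "fst f = snd f \<cdot> d0 \<Gamma>" "vert_hom C Q \<G> K (snd f)" using fv[OF K] f by auto
        then have "\<exists>!h. h \<in> Hom (Grp C) L K \<and> h \<cdot> snd ?e = snd f"
          using r K unfolding universal_vert_hom_def by blast
        then show ?thesis using eq[OF _ e f'(1)] by metis
      qed
      moreover have ?a using fv[OF L] e by blast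
      ultimately show "?a \<and> ?u" by blast
    qed
  qed
  ultimately show ?thesis by argo
qed

end

section \<open>Existence of the fundamental group\<close>

context Bass_Serre_Cat
begin

lemma ex_universal_fibre_hom:
  assumes A: "A \<in> Obj C" and H: "group_object (slice C A) H" "gob H = (B, \<beta>)"
  obtains L e where "group_object C L" "fibre_hom C A H L e" "generates C B L e"
    "\<And>K f. group_object C K \<Longrightarrow> fibre_hom C A H K f \<Longrightarrow> \<exists>!h. h \<in> Hom (Grp C) L K \<and> h \<cdot> e = f"
proof -
  interpret S: Fin_Lim "slice C A" by (rule Fin_Lim_slice[OF A])
  have "\<forall>A \<in> Obj C. \<exists>L \<eta>.
        is_left_adjoint (Grp C) (Grp (slice C A)) (times_group C A) (times_group_map C A) L \<eta> \<and>
        (\<forall>H \<in> Obj (Grp (slice C A)).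
           generates C (fst (gob H)) (L H) (pr1 C (gob (L H)) A \<cdot> \<eta> H))"
    using Bass_Serre unfolding Bass_Serre_def by blast
  then obtain L \<eta> where l: "is_left_adjoint (Grp C) (Grp (slice C A)) (times_group C A) (times_group_map C A) L \<eta>"
    and g: "\<forall>H \<in> Obj (Grp (slice C A)). generates C (fst (gob H)) (L H) (pr1 C (gob (L H)) A \<cdot> \<eta> H)"
    using A by blast
  have "generates C B (L H) (pr1 C (gob (L H)) A \<cdot> \<eta> H)"
    using bspec[OF g S.Obj_Grp[THEN iffD2, OF H(1)]] H(2) by simp
  from that[OF times_group_universal(1,2)[OF A l H] this times_group_universal(3)[OF A l H]] show thesis .
qed

text \<open>By \<open>edge_vert_gop\<close> the structure maps of \<open>\<Gamma>\<close> are
  homomorphisms from the edge groups to the vertex groups, over the structure maps of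
  \<open>Q\<close>.\<close>

lemma edge_fibre_hom:
  assumes Q: "Q \<in> Obj (Graph C)" and G: "group_object (slice (Graph C) Q) \<G>" "gob \<G> = (\<Gamma>, \<gamma>)"
    and e: "fibre_hom C (verts Q) (vert_group C Q \<G>) L e" and d: "d = d0 \<or> d = d1"
  shows "fibre_hom C (edges Q) (edge_group C Q \<G>) L (e \<cdot> d \<Gamma>)"
  unfolding fibre_hom_def
proof (intro conjI allI ballI)
  interpret G: Fin_Lim "Graph C" by (rule Fin_Lim_Graph)
  interpret S: Fin_Lim "slice (Graph C) Q" by (rule G.Fin_Lim_slice[OF Q])
  have g: "\<gamma> \<in> Hom (Graph C) \<Gamma> Q" using S.group_object_hom(1)[OF G(1)] G(2) by simp
  note g' = Graph_HomD[OF g]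
  have dd: "d \<Gamma> \<in> Hom C (edges \<Gamma>) (verts \<Gamma>)" "d Q \<in> Hom C (edges Q) (verts Q)" "d Q \<cdot> fst \<gamma> = snd \<gamma> \<cdot> d \<Gamma>"
    using d g' by auto
  have e': "e \<in> Hom C (verts \<Gamma>) (gob L)" using fibre_hom_in[OF e] unfolding gob_vert_group[OF G(2)] by simp
  show "e \<cdot> d \<Gamma> \<in> Hom C (fst (gob (edge_group C Q \<G>))) (gob L)"
    unfolding gob_edge_group[OF G(2)] using e' dd by auto
  fix Z z x y
  assume x0: "x \<in> Hom (slice C (edges Q)) (Z, z) (gob (edge_group C Q \<G>))"
    "y \<in> Hom (slice C (edges Q)) (Z, z) (gob (edge_group C Q \<G>))"
  then have x: "x \<in> Hom C Z (edges \<Gamma>)" "fst \<gamma> \<cdot> x = z" "y \<in> Hom C Z (edges \<Gamma>)" "fst \<gamma> \<cdot> y = z" "z \<in> Hom C Z (edges Q)"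
    unfolding gob_edge_group[OF G(2)] by auto
  have "snd \<gamma> \<cdot> (d \<Gamma> \<cdot> w) = d Q \<cdot> z" if "w \<in> Hom C Z (edges \<Gamma>)" "fst \<gamma> \<cdot> w = z" for w
    using comp_reduce[OF dd(3)[symmetric] dd(1) g'(2) that(1)] comp_assoc[OF dd(2) that(1) g'(1)] that by simp
  then have v: "d \<Gamma> \<cdot> x \<in> Hom (slice C (verts Q)) (Z, d Q \<cdot> z) (gob (vert_group C Q \<G>))"
    "d \<Gamma> \<cdot> y \<in> Hom (slice C (verts Q)) (Z, d Q \<cdot> z) (gob (vert_group C Q \<G>))"
    unfolding gob_vert_group[OF G(2)] using x dd g' by auto
  interpret E: Fin_Lim "slice C (edges Q)" by (rule Fin_Lim_slice) (use dd Hom_Obj in blast)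
  have p: "gop (slice C (edges Q)) (Z, z) (edge_group C Q \<G>) x y \<in> Hom C Z (edges \<Gamma>)"
    using E.gop_in[OF vert_group_object(2)[OF Q G(1)] x0] unfolding gob_edge_group[OF G(2)] by simp
  show "(e \<cdot> d \<Gamma>) \<cdot> gop (slice C (edges Q)) (Z, z) (edge_group C Q \<G>) x y =
      gop C Z L ((e \<cdot> d \<Gamma>) \<cdot> x) ((e \<cdot> d \<Gamma>) \<cdot> y)"
    using comp_assoc[OF e' p dd(1)] comp_assoc[OF e' x(1) dd(1)] comp_assoc[OF e' x(3) dd(1)]
      edge_vert_gop[OF Q G x(1-4) d] fibre_hom_gop[OF e v] by simp
qed

text \<open>The usual construction of a colimit: form the internal coproducts \<open>L\<close> of
  the vertex groups and \<open>M\<close> of the edge groups, and coequalise in \<open>Grp C\<close>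
  the two homomorphisms \<open>M \<rightarrow> L\<close> induced by \<open>d0\<close> and
  \<open>d1\<close>.\<close>

lemma ex_universal_vert_hom:
  assumes Q: "Q \<in> Obj (Graph C)" and G: "group_object (slice (Graph C) Q) \<G>" "gob \<G> = (\<Gamma>, \<gamma>)"
  obtains L e where "universal_vert_hom C Q \<G> L e"
proof -
  interpret G: Fin_Lim "Graph C" by (rule Fin_Lim_Graph)
  interpret S: Fin_Lim "slice (Graph C) Q" by (rule G.Fin_Lim_slice[OF Q])
  interpret GC: Cat "Grp C" by unfold_locales (rule category_Grp)
  have oQ: "edges Q \<in> Obj C" "verts Q \<in> Obj C" using Graph_Obj[OF Q] by auto
  have g: "\<gamma> \<in> Hom (Graph C) \<Gamma> Q" using S.group_object_hom(1)[OF G(1)] G(2) by simp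
  note g' = Graph_HomD[OF g] and gg = vert_group_object[OF Q G(1)]
  obtain L e where L: "group_object C L" and e: "fibre_hom C (verts Q) (vert_group C Q \<G>) L e"
    and ue: "\<And>K f. group_object C K \<Longrightarrow> fibre_hom C (verts Q) (vert_group C Q \<G>) K f \<Longrightarrow>
      \<exists>!h. h \<in> Hom (Grp C) L K \<and> h \<cdot> e = f"
    using ex_universal_fibre_hom[OF oQ(2) gg(1) gob_vert_group[OF G(2)]] by metis
  obtain M m where M: "group_object C M" and m: "fibre_hom C (edges Q) (edge_group C Q \<G>) M m"
    and um: "\<And>K f. group_object C K \<Longrightarrow> fibre_hom C (edges Q) (edge_group C Q \<G>) K f \<Longrightarrow>
      \<exists>!h. h \<in> Hom (Grp C) M K \<and> h \<cdot> m = f"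
    using ex_universal_fibre_hom[OF oQ(1) gg(2) gob_edge_group[OF G(2)]] by metis
  have e': "e \<in> Hom C (verts \<Gamma>) (gob L)" using fibre_hom_in[OF e] unfolding gob_vert_group[OF G(2)] by simp
  have m': "m \<in> Hom C (edges \<Gamma>) (gob M)" using fibre_hom_in[OF m] unfolding gob_edge_group[OF G(2)] by simp
  obtain h0 where h0: "h0 \<in> Hom (Grp C) M L" "h0 \<cdot> m = e \<cdot> d0 \<Gamma>"
    using um[OF L edge_fibre_hom[OF Q G e, of d0]] by blast
  obtain h1 where h1: "h1 \<in> Hom (Grp C) M L" "h1 \<cdot> m = e \<cdot> d1 \<Gamma>"
    using um[OF L edge_fibre_hom[OF Q G e, of d1]] by blast
  obtain P k where k: "is_coequaliser (Grp C) M L h0 h1 P k"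
    using Bass_Serre h0(1) h1(1) unfolding Bass_Serre_def has_coequalisers_def by blast
  note k' = is_coequaliser_hom[OF k] and kh = Grp_homD[OF is_coequaliser_hom(3)[OF k]]
  have k0: "k \<cdot> h0 = k \<cdot> h1" using k'(4) by simp
  have red: "(f \<cdot> e) \<cdot> d0 \<Gamma> = (f \<cdot> h0) \<cdot> m" "(f \<cdot> e) \<cdot> d1 \<Gamma> = (f \<cdot> h1) \<cdot> m" if f: "f \<in> Hom C (gob L) K" for f K
    using comp_assoc[OF f g'(5) e'] comp_assoc[OF f g'(6) e'] comp_assoc[OF f m' Grp_homD(3)[OF h0(1)]]
      comp_assoc[OF f m' Grp_homD(3)[OF h1(1)]] h0 h1 by simp_all
  have "universal_vert_hom C Q \<G> P (k \<cdot> e)"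
    unfolding universal_vert_hom_def
  proof (intro conjI allI impI)
    show "group_object C P" using kh by simp
    show "vert_hom C Q \<G> P (k \<cdot> e)"
      unfolding vert_hom_def G(2) fst_conv
      using fibre_hom_comp[OF e k'(3) gob_vert_group[OF G(2)] gg(1) oQ(2)] red[OF kh(3)] k0 by simp
    fix K f assume K: "group_object C K" and f: "vert_hom C Q \<G> K f"
    then have f': "fibre_hom C (verts Q) (vert_group C Q \<G>) K f" "f \<cdot> d0 \<Gamma> = f \<cdot> d1 \<Gamma>"
      unfolding vert_hom_def G(2) by auto
    obtain n where n: "n \<in> Hom (Grp C) L K" "n \<cdot> e = f" using ue[OF K f'(1)] by blast
    note n' = Grp_homD(3)[OF n(1)]
    \<comment> \<open>Homomorphisms out of \<open>M\<close> are determined on the edge groups, so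
      agreement of the two restrictions of \<open>f\<close> there makes \<open>n\<close> coequalise
      \<open>h0\<close> and \<open>h1\<close>.\<close>
    have "(n \<cdot> h0) \<cdot> m = (n \<cdot> h1) \<cdot> m" using red[OF n'] n f' by simp
    moreover have "fibre_hom C (edges Q) (edge_group C Q \<G>) K ((n \<cdot> h0) \<cdot> m)"
      using edge_fibre_hom[OF Q G f'(1), of d0] red(1)[OF n'] n by simp
    ultimately have "n \<cdot> h0 = n \<cdot> h1"
      using um[OF K] Grp_comp[OF n(1) h0(1)] Grp_comp[OF n(1) h1(1)] by metis
    then obtain h where h: "h \<in> Hom (Grp C) P K" "h \<cdot> k = n"
      using GC.is_coequaliser_factor[OF k n(1)] by auto
    show "\<exists>!h. h \<in> Hom (Grp C) P K \<and> h \<cdot> (k \<cdot> e) = f"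
    proof (rule ex1I[of _ h])
      show "h \<in> Hom (Grp C) P K \<and> h \<cdot> (k \<cdot> e) = f"
        using h n comp_assoc[OF Grp_homD(3)[OF h(1)] e' kh(3)] by simp
      fix l assume l: "l \<in> Hom (Grp C) P K \<and> l \<cdot> (k \<cdot> e) = f"
      then have l': "l \<in> Hom (Grp C) P K" "(l \<cdot> k) \<cdot> e = f"
        using comp_assoc[OF Grp_homD(3) e' kh(3)] by auto
      have "l \<cdot> k = h \<cdot> k"
        using ue[OF K f'(1)] Grp_comp[OF l'(1) k'(3)] l'(2) n h(2) by metis
      then show "l = h" using GC.is_coequaliser_ext[OF k l'(1) h(1)] by simp
    qed
  qed
  then show thesis by (rule that)
qed

lemma ex_left_adjoint_Delta:
  assumes Q: "Q \<in> Obj (Graph C)"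
  shows "\<exists>L \<eta>. is_left_adjoint (Grp C) (GoG C Q) (Delta C Q) (Delta_map C Q) L \<eta>"
proof -
  interpret G: Fin_Lim "Graph C" by (rule Fin_Lim_Graph)
  interpret S: Fin_Lim "slice (Graph C) Q" by (rule G.Fin_Lim_slice[OF Q])
  have "\<exists>L \<eta>. L \<in> Obj (Grp C) \<and> \<eta> \<in> Hom (GoG C Q) \<G> (Delta C Q L) \<and>
     (\<forall>K \<in> Obj (Grp C). \<forall>g \<in> Hom (GoG C Q) \<G> (Delta C Q K).
        \<exists>!h. h \<in> Hom (Grp C) L K \<and> Delta_map C Q L K h \<cdot>\<^bsub>GoG C Q\<^esub> \<eta> = g)"
    if "\<G> \<in> Obj (GoG C Q)" for \<G>
  proof -
    have G: "group_object (slice (Graph C) Q) \<G>" using that unfolding GoG_def by simp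
    obtain \<Gamma> \<gamma> where g: "gob \<G> = (\<Gamma>, \<gamma>)" by (meson surj_pair)
    have \<gamma>: "\<gamma> \<in> Hom (Graph C) \<Gamma> Q" using S.group_object_hom(1)[OF G] g by simp
    obtain L e where u: "universal_vert_hom C Q \<G> L e" using ex_universal_vert_hom[OF Q G g] .
    have L: "group_object C L" using u unfolding universal_vert_hom_def by blast
    have e: "e \<in> Hom C (verts \<Gamma>) (gob L)" "e \<cdot> d0 \<Gamma> = e \<cdot> d1 \<Gamma>"
      using u fibre_hom_in[of C "verts Q" "vert_group C Q \<G>" L e]
      unfolding universal_vert_hom_def vert_hom_def gob_vert_group[OF g] g by auto
    \<comment> \<open>The universal homomorphism on vertices extends to a map of graphs into the
      constant graph; paired with \<open>\<gamma>\<close> it becomes the unit into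
      \<open>\<Delta>(L)\<close>.\<close>
    have "(e \<cdot> d0 \<Gamma>, e) \<in> Hom (Graph C) \<Gamma> (const_graph C (gob L))"
      unfolding const_graph_Hom using e L group_object_hom(1) G.Hom_Obj(1)[OF \<gamma>] by simp
    note t = G.tuple_is_product[OF times_graph_product[OF group_object_hom(1)[OF L] Q] this \<gamma>]
    show ?thesis
      by (rule exI[of _ L], rule exI)
        (use L Delta_universal_iff[OF Q G g L, THEN iffD2, OF conjI, OF t(1) conjI, OF t(3)] t u in auto)
  qed
  then obtain L \<eta> where "\<forall>\<G> \<in> Obj (GoG C Q). L \<G> \<in> Obj (Grp C) \<and> \<eta> \<G> \<in> Hom (GoG C Q) \<G> (Delta C Q (L \<G>)) \<and>
     (\<forall>K \<in> Obj (Grp C). \<forall>g \<in> Hom (GoG C Q) \<G> (Delta C Q K).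
        \<exists>!h. h \<in> Hom (Grp C) (L \<G>) K \<and> Delta_map C Q (L \<G>) K h \<cdot>\<^bsub>GoG C Q\<^esub> \<eta> \<G> = g)" by metis
  then show ?thesis unfolding is_left_adjoint_def by blast
qed

text \<open>\<open>colim_Delta\<close> is a choice, so its universal property rests on the existence
  of some left adjoint. The later facts split the unit into its projection to \<open>Q\<close> and a
  universal homomorphism on vertices.\<close>

lemma pi1_universal:
  assumes Q: "Q \<in> Obj (Graph C)" and G: "group_object (slice (Graph C) Q) \<G>" "gob \<G> = (\<Gamma>, \<gamma>)"
  shows "group_object C (pi1 C Q \<G>)"
    "pi1_unit C Q \<G> \<in> Hom (GoG C Q) \<G> (Delta C Q (pi1 C Q \<G>))"
    "\<And>K g. group_object C K \<Longrightarrow> g \<in> Hom (GoG C Q) \<G> (Delta C Q K) \<Longrightarrow>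
       \<exists>!h. h \<in> Hom (Grp C) (pi1 C Q \<G>) K \<and> Delta_map C Q (pi1 C Q \<G>) K h \<cdot>\<^bsub>GoG C Q\<^esub> pi1_unit C Q \<G> = g"
    "pi1_unit C Q \<G> \<in> Hom (Graph C) \<Gamma> (times_graph C (gob (pi1 C Q \<G>)) Q)"
    "times_pr2 C (gob (pi1 C Q \<G>)) Q \<cdot>\<^bsub>Graph C\<^esub> pi1_unit C Q \<G> = \<gamma>"
    "fst (times_pr1 C (gob (pi1 C Q \<G>)) Q \<cdot>\<^bsub>Graph C\<^esub> pi1_unit C Q \<G>) =
      snd (times_pr1 C (gob (pi1 C Q \<G>)) Q \<cdot>\<^bsub>Graph C\<^esub> pi1_unit C Q \<G>) \<cdot> d0 \<Gamma>"
    "universal_vert_hom C Q \<G> (pi1 C Q \<G>) (snd (times_pr1 C (gob (pi1 C Q \<G>)) Q \<cdot>\<^bsub>Graph C\<^esub> pi1_unit C Q \<G>))"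
proof -
  interpret G: Fin_Lim "Graph C" by (rule Fin_Lim_Graph)
  interpret S: Fin_Lim "slice (Graph C) Q" by (rule G.Fin_Lim_slice[OF Q])
  obtain L \<eta> where "is_left_adjoint (Grp C) (GoG C Q) (Delta C Q) (Delta_map C Q) L \<eta>"
    using ex_left_adjoint_Delta[OF Q] by blast
  then have "(\<lambda>(L, \<eta>). is_left_adjoint (Grp C) (GoG C Q) (Delta C Q) (Delta_map C Q) L \<eta>) (colim_Delta C Q)"
    unfolding colim_Delta_def by (rule_tac someI[of _ "(L, \<eta>)"]) simp
  then have l: "is_left_adjoint (Grp C) (GoG C Q) (Delta C Q) (Delta_map C Q) (pi1 C Q) (pi1_unit C Q)"
    unfolding pi1_def[abs_def] pi1_unit_def[abs_def] by (simp add: case_prod_unfold)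
  have o: "\<G> \<in> Obj (GoG C Q)" using G(1) unfolding GoG_def by simp
  have L: "pi1 C Q \<G> \<in> Obj (Grp C)" and
    u: "pi1_unit C Q \<G> \<in> Hom (GoG C Q) \<G> (Delta C Q (pi1 C Q \<G>)) \<and>
     (\<forall>K \<in> Obj (Grp C). \<forall>g \<in> Hom (GoG C Q) \<G> (Delta C Q K).
        \<exists>!h. h \<in> Hom (Grp C) (pi1 C Q \<G>) K \<and> Delta_map C Q (pi1 C Q \<G>) K h \<cdot>\<^bsub>GoG C Q\<^esub> pi1_unit C Q \<G> = g)"
    using l o unfolding is_left_adjoint_def by blast+
  show L': "group_object C (pi1 C Q \<G>)" using L by simp
  show "pi1_unit C Q \<G> \<in> Hom (GoG C Q) \<G> (Delta C Q (pi1 C Q \<G>))"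
    "\<And>K g. group_object C K \<Longrightarrow> g \<in> Hom (GoG C Q) \<G> (Delta C Q K) \<Longrightarrow>
       \<exists>!h. h \<in> Hom (Grp C) (pi1 C Q \<G>) K \<and> Delta_map C Q (pi1 C Q \<G>) K h \<cdot>\<^bsub>GoG C Q\<^esub> pi1_unit C Q \<G> = g"
    using u Obj_Grp by blast+
  show "pi1_unit C Q \<G> \<in> Hom (Graph C) \<Gamma> (times_graph C (gob (pi1 C Q \<G>)) Q)"
    "times_pr2 C (gob (pi1 C Q \<G>)) Q \<cdot>\<^bsub>Graph C\<^esub> pi1_unit C Q \<G> = \<gamma>"
    "fst (times_pr1 C (gob (pi1 C Q \<G>)) Q \<cdot>\<^bsub>Graph C\<^esub> pi1_unit C Q \<G>) =
      snd (times_pr1 C (gob (pi1 C Q \<G>)) Q \<cdot>\<^bsub>Graph C\<^esub> pi1_unit C Q \<G>) \<cdot> d0 \<Gamma>"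
    "universal_vert_hom C Q \<G> (pi1 C Q \<G>) (snd (times_pr1 C (gob (pi1 C Q \<G>)) Q \<cdot>\<^bsub>Graph C\<^esub> pi1_unit C Q \<G>))"
    using iffD1[OF Delta_universal_iff[OF Q G L'] u] by blast+
qed

end

section \<open>Orbits and deviation in a single object\<close>

context Bass_Serre_Cat
begin

text \<open>The case of a group of \<open>C\<close> itself, reduced to the slice over the terminal
  object. The work lies in comparing the operations and products chosen in that slice with those
  chosen in \<open>C\<close>.\<close>

lemma group_action_effective:
  assumes K: "group_object C K" and a: "left_action C K Y a"
    and u: "u \<in> Hom C Z Y" "v \<in> Hom C Z Y"
    and eq: "\<And>T \<tau>. \<tau> \<in> Hom C Y T \<Longrightarrow>
      (\<And>Z g y. g \<in> Hom C Z (gob K) \<Longrightarrow> y \<in> Hom C Z Y \<Longrightarrow> \<tau> \<cdot> (a \<cdot> pair C Z (gob K) Y g y) = \<tau> \<cdot> y) \<Longrightarrow>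
      \<tau> \<cdot> u = \<tau> \<cdot> v"
  obtains Z' c g where "regular_epi C Z' Z c" "c \<in> Hom C Z' Z" "g \<in> Hom C Z' (gob K)"
    "u \<cdot> c = a \<cdot> pair C Z' (gob K) Y g (v \<cdot> c)"
proof -
  let ?B = "term_obj C" let ?K = "gob K" let ?S = "slice C ?B"
  note K' = group_object_hom[OF K] and a' = left_action_hom[OF a]
  interpret S: Fin_Lim ?S by (rule Fin_Lim_slice[OF term_Obj])
  \<comment> \<open>\<open>gob K\<close> serves as its own product with the terminal object, so
    \<open>family_group\<close> gives \<open>K\<close> as a group of the slice without changing the
    object.\<close>
  have P: "is_product C ?K ?B ?K (Id C ?K) (bang C ?K)"
  proof (rule is_productI)
    fix Z
    { fix x y assume "x \<in> Hom C Z ?K" "y \<in> Hom C Z ?B"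
      then show "\<exists>u\<in>Hom C Z ?K. Id C ?K \<cdot> u = x \<and> bang C ?K \<cdot> u = y"
        using bang_unique[of y Z "bang C Z"] Hom_Obj(1) by (intro bexI[of _ x]) auto }
  qed (use K' in auto)
  define H where "H = family_group C K ?B ?K (Id C ?K) (bang C ?K)"
  note F = family_group[OF K P term_Obj, folded H_def]
  have gop: "gop ?S (Z, z) H x y = gop C Z K x y"
    if x: "x \<in> Hom ?S (Z, z) (?K, bang C ?K)" "y \<in> Hom ?S (Z, z) (?K, bang C ?K)" for Z z x y
  proof -
    have "gop ?S (Z, z) H x y \<in> Hom ?S (Z, z) (?K, bang C ?K)" using S.gop_in[OF F(1), unfolded F(2), OF x] .
    then have "gop ?S (Z, z) H x y \<in> Hom C Z ?K" by simp
    moreover have x': "x \<in> Hom C Z ?K" "y \<in> Hom C Z ?K" "bang C ?K \<cdot> x = z" "bang C ?K \<cdot> y = z" using x by simp_all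
    ultimately show ?thesis using F(3)[OF x'] x'(1,2) by simp
  qed
  have oH: "(?K, bang C ?K) \<in> Obj ?S" and oY: "(Y, bang C Y) \<in> Obj ?S" using K' a' by auto
  obtain W w where W: "Prod ?S (?K, bang C ?K) (Y, bang C Y) = (W, w)" by (meson surj_pair)
  let ?r1 = "pr1 ?S (?K, bang C ?K) (Y, bang C Y)" and ?r2 = "pr2 ?S (?K, bang C ?K) (Y, bang C Y)"
  have r: "?r1 \<in> Hom C W ?K" "?r2 \<in> Hom C W Y" "w \<in> Hom C W ?B" using S.pr_in[OF oH oY] W by auto
  \<comment> \<open>The action \<open>a\<close> composed with the comparison from the product chosen
    in the slice to the product chosen in \<open>C\<close>.\<close>
  define b where "b = a \<cdot> pair C W ?K Y ?r1 ?r2"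
  have b: "b \<in> Hom C W Y" unfolding b_def using r a' by auto
  have bb: "b \<cdot> pair ?S (Z, z) (?K, bang C ?K) (Y, bang C Y) g y = a \<cdot> pair C Z ?K Y g y"
    if g: "g \<in> Hom ?S (Z, z) (?K, bang C ?K)" "y \<in> Hom ?S (Z, z) (Y, bang C Y)" for Z z g y
  proof -
    have p: "pair ?S (Z, z) (?K, bang C ?K) (Y, bang C Y) g y \<in> Hom C Z W" using S.pair_in[OF g] W by simp
    show ?thesis unfolding b_def
      using comp_assoc[OF a'(2) p pair_in[OF r(1,2)]] pair_comp[OF p r(1,2)] S.pr_pair[OF g] by simp
  qed
  have el: "x \<in> Hom ?S (Z, z) (A, bang C A)" if "x \<in> Hom C Z A" "z \<in> Hom C Z ?B" for x Z z A
    using that bang_unique[OF that(2) bang_in] Hom_Obj[OF that(1)] by simp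
  have act: "left_action ?S H (Y, bang C Y) b"
  proof (rule S.left_actionI[OF F(1) oY])
    have "w = bang C W" using bang_unique[OF r(3) bang_in] Hom_Obj r(3) by blast
    then show "b \<in> Hom ?S (Prod ?S (gob H) (Y, bang C Y)) (Y, bang C Y)"
      unfolding F(2) W using b a' r by simp
    fix Zz :: "'o \<times> 'a" and y
    obtain Z z where Z: "Zz = (Z, z)" by (cases Zz)
    assume "y \<in> Hom ?S Zz (Y, bang C Y)"
    then have y: "y \<in> Hom ?S (Z, z) (Y, bang C Y)" by (simp add: Z)
    then have yC: "y \<in> Hom C Z Y" and z: "z \<in> Hom C Z ?B" by auto
    \<comment> \<open>Only the multiplications of \<open>H\<close> and \<open>K\<close> have been
      compared; the units agree because an idempotent element of a group is neutral.\<close>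
    { have e: "S.gone (Z, z) H \<in> Hom ?S (Z, z) (?K, bang C ?K)" using S.gone_in[OF F(1), of "(Z, z)"] z F(2) by simp
      then have eC: "S.gone (Z, z) H \<in> Hom C Z ?K" by auto
      have "gop C Z K (S.gone (Z, z) H) (S.gone (Z, z) H) = gop C Z K (S.gone (Z, z) H) (gone Z K)"
        using gop[OF e e] S.gop_one_left[OF F(1), of "S.gone (Z, z) H" "(Z, z)"] e F(2) gop_one_right[OF K eC] by simp
      then have "S.gone (Z, z) H = gone Z K"
        using gop_cancel_left[OF K eC eC gone_in[OF K]] Hom_Obj[OF z] by blast
      then show "b \<cdot>\<^bsub>?S\<^esub> pair ?S Zz (gob H) (Y, bang C Y) (S.gone Zz H) y = y"
        using bb[OF e y] left_action_one[OF a K yC] by (simp add: F(2) Z) }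
    fix g k assume "g \<in> Hom ?S Zz (gob H)" "k \<in> Hom ?S Zz (gob H)"
    then have g: "g \<in> Hom ?S (Z, z) (?K, bang C ?K)" "k \<in> Hom ?S (Z, z) (?K, bang C ?K)" by (simp_all add: Z F(2))
    then have gC: "g \<in> Hom C Z ?K" "k \<in> Hom C Z ?K" by auto
    have gk: "gop C Z K g k \<in> Hom ?S (Z, z) (?K, bang C ?K)" using el[OF gop_in[OF K gC] z] .
    have ky: "a \<cdot> pair C Z ?K Y k y \<in> Hom ?S (Z, z) (Y, bang C Y)"
      using el[OF comp_in[OF a'(2) pair_in[OF gC(2) yC]] z] .
    show "b \<cdot>\<^bsub>?S\<^esub> pair ?S Zz (gob H) (Y, bang C Y) (gop ?S Zz H g k) y =
       b \<cdot>\<^bsub>?S\<^esub> pair ?S Zz (gob H) (Y, bang C Y) g (b \<cdot>\<^bsub>?S\<^esub> pair ?S Zz (gob H) (Y, bang C Y) k y)"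
      using bb[OF gk y] bb[OF g(2) y] bb[OF g(1) ky] gop[OF g] left_action_gop[OF a K gC yC]
      by (simp add: F(2) Z)
  qed
  obtain Z' c g where c: "regular_epi C Z' Z c" "c \<in> Hom C Z' Z"
    "g \<in> Hom ?S (Z', bang C Y \<cdot> (v \<cdot> c)) (?K, bang C ?K)"
    "u \<cdot> c = b \<cdot> pair ?S (Z', bang C Y \<cdot> (v \<cdot> c)) (?K, bang C ?K) (Y, bang C Y) g (v \<cdot> c)"
  proof (rule action_effective[OF term_Obj F(1,2) act u])
    fix T \<tau> assume \<tau>: "\<tau> \<in> Hom C Y T"
      and t: "\<And>Z z g y. g \<in> Hom ?S (Z, z) (?K, bang C ?K) \<Longrightarrow> y \<in> Hom ?S (Z, z) (Y, bang C Y) \<Longrightarrow>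
        \<tau> \<cdot> (b \<cdot> pair ?S (Z, z) (?K, bang C ?K) (Y, bang C Y) g y) = \<tau> \<cdot> y"
    show "\<tau> \<cdot> u = \<tau> \<cdot> v"
    proof (rule eq[OF \<tau>])
      fix Z g y assume g: "g \<in> Hom C Z ?K" "y \<in> Hom C Z Y"
      have z: "bang C Z \<in> Hom C Z ?B" using Hom_Obj(1)[OF g(1)] by simp
      show "\<tau> \<cdot> (a \<cdot> pair C Z ?K Y g y) = \<tau> \<cdot> y"
        using t[OF el[OF g(1) z] el[OF g(2) z]] bb[OF el[OF g(1) z] el[OF g(2) z]] by simp
    qed
  qed
  have vc: "v \<cdot> c \<in> Hom ?S (Z', bang C Y \<cdot> (v \<cdot> c)) (Y, bang C Y)" using c u a' by auto
  show thesis by (rule that[OF c(1,2), of g]) (use c bb[OF c(3) vc] in auto)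
qed

end

text \<open>One component, edges or vertices, of the whole situation. Here \<open>P\<close> is
  \<open>\<pi>\<close>, and \<open>\<Gamma>\<close> is the total object of the graph of groups, with
  \<open>j\<close> its element of \<open>G\<close> and \<open>\<gamma>\<close> its point of
  \<open>Q\<close>. The assumptions \<open>stab_ex\<close> and \<open>stab_ext\<close> describe the
  elements of \<open>\<Gamma>\<close> as the pairs \<open>(g, y)\<close> with
  \<open>g s(y) = s(y)\<close>, so that the chosen equaliser and pullback need not appear.\<close>

locale level = Bass_Serre_Cat C for C :: "('o, 'a) cat" (structure) +
  fixes G P :: "('o, 'a) grp" and \<phi> :: 'a and X Q \<Gamma> T :: 'o and a q s j \<gamma> \<eta> \<tau> \<Phi> :: 'a
  assumes G [simp]: "group_object C G" and P [simp]: "group_object C P"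
    and \<phi>: "\<phi> \<in> Hom (Grp C) P G"
    and action: "left_action C G X a"
    and q: "is_coequaliser C (Prod C (gob G) X) X a (pr2 C (gob G) X) Q q"
    and s: "s \<in> Hom C Q X" "q \<cdot> s = Id C Q"
    and stab: "j \<in> Hom C \<Gamma> (gob G)" "\<gamma> \<in> Hom C \<Gamma> Q" "a \<cdot> pair C \<Gamma> (gob G) X j (s \<cdot> \<gamma>) = s \<cdot> \<gamma>"
    and stab_ex: "\<And>Z g y. g \<in> Hom C Z (gob G) \<Longrightarrow> y \<in> Hom C Z Q \<Longrightarrow>
      a \<cdot> pair C Z (gob G) X g (s \<cdot> y) = s \<cdot> y \<Longrightarrow> \<exists>u \<in> Hom C Z \<Gamma>. j \<cdot> u = g \<and> \<gamma> \<cdot> u = y"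
    and stab_ext: "\<And>Z u v. u \<in> Hom C Z \<Gamma> \<Longrightarrow> v \<in> Hom C Z \<Gamma> \<Longrightarrow> j \<cdot> u = j \<cdot> v \<Longrightarrow> \<gamma> \<cdot> u = \<gamma> \<cdot> v \<Longrightarrow> u = v"
    and \<eta>: "\<eta> \<in> Hom C \<Gamma> (gob P)" "\<phi> \<cdot> \<eta> = j"
    and \<tau>: "is_coequaliser C (Prod C (gob P) \<Gamma>) (Prod C (gob P) Q)
      (pair C (Prod C (gob P) \<Gamma>) (gob P) Q (pr1 C (gob P) \<Gamma>) (\<gamma> \<cdot> pr2 C (gob P) \<Gamma>))
      (pair C (Prod C (gob P) \<Gamma>) (gob P) Q
        (gop C (Prod C (gob P) \<Gamma>) P (pr1 C (gob P) \<Gamma>) (\<eta> \<cdot> pr2 C (gob P) \<Gamma>)) (\<gamma> \<cdot> pr2 C (gob P) \<Gamma>)) T \<tau>"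
    and \<Phi>: "\<Phi> \<in> Hom C T X"
      "\<Phi> \<cdot> \<tau> = a \<cdot> pair C (Prod C (gob P) Q) (gob G) X (\<phi> \<cdot> pr1 C (gob P) Q) (s \<cdot> pr2 C (gob P) Q)"
begin

abbreviation act :: "'o \<Rightarrow> 'a \<Rightarrow> 'a \<Rightarrow> 'a" where
  "act Z g x \<equiv> a \<cdot> pair C Z (gob G) X g x"

text \<open>The class \<open>[p, y]\<close> in \<open>T\<close>.\<close>

abbreviation proj :: "'o \<Rightarrow> 'a \<Rightarrow> 'a \<Rightarrow> 'a" where
  "proj Z p y \<equiv> \<tau> \<cdot> pair C Z (gob P) Q p y"

lemma objs [simp]: "gob G \<in> Obj C" "gob P \<in> Obj C" "X \<in> Obj C" "Q \<in> Obj C" "\<Gamma> \<in> Obj C"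
  using group_object_hom(1)[OF G] group_object_hom(1)[OF P] Hom_Obj[OF s(1)] Hom_Obj(1)[OF stab(1)] by auto

lemma phi_in: "\<phi> \<in> Hom C (gob P) (gob G)"
  using Grp_homD(3)[OF \<phi>] .

lemmas arrs = phi_in left_action_hom(2)[OF action] is_coequaliser_hom(3)[OF q] s(1) stab(1,2) \<eta>(1)
  is_coequaliser_hom(3)[OF \<tau>] \<Phi>(1)

section \<open>Calculations with elements of \<open>X\<close> and \<open>T\<close>\<close>

lemma act_in: "g \<in> Hom C Z (gob G) \<Longrightarrow> x \<in> Hom C Z X \<Longrightarrow> act Z g x \<in> Hom C Z X"
  using arrs by auto

lemma proj_in: "p \<in> Hom C Z (gob P) \<Longrightarrow> y \<in> Hom C Z Q \<Longrightarrow> proj Z p y \<in> Hom C Z T"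
  using arrs by auto

lemma act_comp: "c \<in> Hom C Z' Z \<Longrightarrow> g \<in> Hom C Z (gob G) \<Longrightarrow> x \<in> Hom C Z X \<Longrightarrow>
    act Z g x \<cdot> c = act Z' (g \<cdot> c) (x \<cdot> c)"
  using arrs by (simp add: cat_simps)

lemma proj_comp: "c \<in> Hom C Z' Z \<Longrightarrow> p \<in> Hom C Z (gob P) \<Longrightarrow> y \<in> Hom C Z Q \<Longrightarrow>
    proj Z p y \<cdot> c = proj Z' (p \<cdot> c) (y \<cdot> c)"
  using arrs by (simp add: cat_simps)

lemmas act_one = left_action_one[OF action G]
lemmas act_gop = left_action_gop[OF action G]

lemma q_act: assumes g: "g \<in> Hom C Z (gob G)" and x: "x \<in> Hom C Z X" shows "q \<cdot> act Z g x = q \<cdot> x"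
proof -
  note p = pair_in[OF g x] and h = is_coequaliser_hom[OF q]
  have "q \<cdot> (a \<cdot> pair C Z (gob G) X g x) = q \<cdot> (pr2 C (gob G) X \<cdot> pair C Z (gob G) X g x)"
    using comp_assoc[OF h(3) p h(1)] comp_assoc[OF h(3) p h(2)] h(4) by simp
  then show ?thesis using pr_pair[OF g x] by simp
qed

lemma qs: "y \<in> Hom C Z Q \<Longrightarrow> q \<cdot> (s \<cdot> y) = y"
  using comp_reduce[OF s(2,1)] arrs by simp

lemma act_stab: assumes u: "u \<in> Hom C Z \<Gamma>" shows "act Z (j \<cdot> u) (s \<cdot> (\<gamma> \<cdot> u)) = s \<cdot> (\<gamma> \<cdot> u)"
proof -
  have "act \<Gamma> j (s \<cdot> \<gamma>) \<cdot> u = (s \<cdot> \<gamma>) \<cdot> u" using stab(3) by simp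
  then show ?thesis using arrs u act_comp[OF u stab(1), of "s \<cdot> \<gamma>"] by (simp add: cat_simps)
qed

lemma phi_eta: "u \<in> Hom C Z \<Gamma> \<Longrightarrow> \<phi> \<cdot> (\<eta> \<cdot> u) = j \<cdot> u"
  using comp_reduce[OF \<eta>(2,1) phi_in] .

text \<open>The relation that defines \<open>T\<close>, restricted from the generic pair to
  \<open>(p, u)\<close>.\<close>

lemma proj_stab:
  assumes u: "u \<in> Hom C Z \<Gamma>" and p: "p \<in> Hom C Z (gob P)"
  shows "proj Z (gop C Z P p (\<eta> \<cdot> u)) (\<gamma> \<cdot> u) = proj Z p (\<gamma> \<cdot> u)"
proof -
  let ?W = "Prod C (gob P) \<Gamma>" and ?p = "pr1 C (gob P) \<Gamma>" and ?u = "pr2 C (gob P) \<Gamma>"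
  have pr: "?p \<in> Hom C ?W (gob P)" "?u \<in> Hom C ?W \<Gamma>" by auto
  have pr': "\<gamma> \<cdot> ?u \<in> Hom C ?W Q" "\<eta> \<cdot> ?u \<in> Hom C ?W (gob P)" using pr arrs by auto
  note w = pair_in[OF p u] and e = pr_pair[OF p u]
  have "proj ?W ?p (\<gamma> \<cdot> ?u) = proj ?W (gop C ?W P ?p (\<eta> \<cdot> ?u)) (\<gamma> \<cdot> ?u)"
    using is_coequaliser_hom(4)[OF \<tau>] .
  then have "proj ?W ?p (\<gamma> \<cdot> ?u) \<cdot> pair C Z (gob P) \<Gamma> p u = proj ?W (gop C ?W P ?p (\<eta> \<cdot> ?u)) (\<gamma> \<cdot> ?u) \<cdot> pair C Z (gob P) \<Gamma> p u"
    by simp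
  then show ?thesis
    using proj_comp[OF w pr(1) pr'(1)] proj_comp[OF w gop_in[OF P pr(1) pr'(2)] pr'(1)]
      gop_comp[OF P w pr(1) pr'(2)] comp_assoc[OF stab(2) w pr(2)] comp_assoc[OF \<eta>(1) w pr(2)] e by simp
qed

lemma Phi_proj:
  assumes p: "p \<in> Hom C Z (gob P)" and y: "y \<in> Hom C Z Q"
  shows "\<Phi> \<cdot> proj Z p y = act Z (\<phi> \<cdot> p) (s \<cdot> y)"
proof -
  let ?W = "Prod C (gob P) Q" and ?p = "pr1 C (gob P) Q" and ?y = "pr2 C (gob P) Q"
  have pr: "?p \<in> Hom C ?W (gob P)" "?y \<in> Hom C ?W Q" by auto
  note w = pair_in[OF p y] and e = pr_pair[OF p y]
  have \<tau>': "\<tau> \<in> Hom C ?W T" using arrs by simp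
  have pr': "\<phi> \<cdot> ?p \<in> Hom C ?W (gob G)" "s \<cdot> ?y \<in> Hom C ?W X" using pr arrs by auto
  have "\<Phi> \<cdot> proj Z p y = act ?W (\<phi> \<cdot> ?p) (s \<cdot> ?y) \<cdot> pair C Z (gob P) Q p y"
    using comp_assoc[OF \<Phi>(1) w \<tau>'] \<Phi>(2) by simp
  then show ?thesis
    using act_comp[OF w pr'] comp_assoc[OF phi_in w pr(1)] comp_assoc[OF s(1) w pr(2)] e by simp
qed

text \<open>As a coequaliser map, \<open>\<tau>\<close> is a regular epimorphism, so it is locally
  surjective on elements.\<close>

lemma proj_cover:
  assumes t: "t \<in> Hom C Z T"
  obtains Z' c p y where "regular_epi C Z' Z c" "c \<in> Hom C Z' Z" "p \<in> Hom C Z' (gob P)" "y \<in> Hom C Z' Q"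
    "proj Z' p y = t \<cdot> c"
proof -
  have "regular_epi C (Prod C (gob P) Q) T \<tau>" using \<tau> unfolding regular_epi_def by blast
  then obtain Z' c x where c: "regular_epi C Z' Z c" "x \<in> Hom C Z' (Prod C (gob P) Q)" "\<tau> \<cdot> x = t \<cdot> c" "c \<in> Hom C Z' Z"
    using regular_epi_lift[OF _ t] by blast
  show thesis
    by (rule that[OF c(1,4) comp_pr_in(1)[OF _ _ c(2)] comp_pr_in(2)[OF _ _ c(2)]]) (use c pair_eta[OF c(2)] in auto)
qed

text \<open>Invariant maps on \<open>X\<close> factor through the coequaliser \<open>q\<close>, so
  they identify \<open>u\<close> and \<open>v\<close>, and effectiveness of the action
  applies.\<close>

lemma orbit:
  assumes "u \<in> Hom C Z X" "v \<in> Hom C Z X" "q \<cdot> u = q \<cdot> v"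
  obtains Z' c g where "regular_epi C Z' Z c" "c \<in> Hom C Z' Z" "g \<in> Hom C Z' (gob G)" "u \<cdot> c = act Z' g (v \<cdot> c)"
proof (rule group_action_effective[OF G action assms(1,2)])
  fix T \<tau> assume t: "\<tau> \<in> Hom C X T" and
    eq: "\<And>Z g y. g \<in> Hom C Z (gob G) \<Longrightarrow> y \<in> Hom C Z X \<Longrightarrow> \<tau> \<cdot> act Z g y = \<tau> \<cdot> y"
  have "\<tau> \<cdot> a = \<tau> \<cdot> pr2 C (gob G) X"
    using eq[OF pr_in(1)[OF objs(1,3)] pr_in(2)[OF objs(1,3)]] comp_Id[OF arrs(2)] by simp
  then obtain k where "k \<in> Hom C Q T" "k \<cdot> q = \<tau>" using is_coequaliser_factor[OF q t] by metis
  then show "\<tau> \<cdot> u = \<tau> \<cdot> v"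
    using comp_assoc[OF _ assms(1) arrs(3)] comp_assoc[OF _ assms(2) arrs(3)] assms(3) by metis
qed (use that in blast)

text \<open>\<open>x\<close> and \<open>s(q x)\<close> have the same image in \<open>Q\<close>,
  since \<open>s\<close> is a section of \<open>q\<close>; hence they lie locally in one
  orbit.\<close>

lemma section_cover:
  assumes x: "x \<in> Hom C Z X"
  obtains Z' c g where "regular_epi C Z' Z c" "c \<in> Hom C Z' Z" "g \<in> Hom C Z' (gob G)"
    "act Z' g (s \<cdot> (q \<cdot> (x \<cdot> c))) = x \<cdot> c"
proof -
  have qx: "q \<cdot> x \<in> Hom C Z Q" using arrs(3) x by blast
  have e: "s \<cdot> (q \<cdot> x) \<in> Hom C Z X" "q \<cdot> x = q \<cdot> (s \<cdot> (q \<cdot> x))"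
    using comp_in[OF arrs(4) qx] qs[OF qx] by simp_all
  obtain Z' c g where c: "regular_epi C Z' Z c" "c \<in> Hom C Z' Z" "g \<in> Hom C Z' (gob G)"
    "x \<cdot> c = act Z' g ((s \<cdot> (q \<cdot> x)) \<cdot> c)" using orbit[OF x e] .
  have "(s \<cdot> (q \<cdot> x)) \<cdot> c = s \<cdot> (q \<cdot> (x \<cdot> c))" using arrs x c(2) by (simp add: cat_simps)
  then show thesis using that[OF c(1-3)] c(4) by simp
qed

text \<open>Applying \<open>q\<close> gives \<open>y = y'\<close>. Then \<open>g^(-1) g'\<close>
  fixes \<open>s(y)\<close>, and as such it is an element of \<open>\<Gamma>\<close> over
  \<open>y\<close>.\<close>

lemma same_point:
  assumes g: "g \<in> Hom C Z (gob G)" "g' \<in> Hom C Z (gob G)" and y: "y \<in> Hom C Z Q" "y' \<in> Hom C Z Q"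
    and e: "act Z g (s \<cdot> y) = act Z g' (s \<cdot> y')"
  obtains u where "u \<in> Hom C Z \<Gamma>" "\<gamma> \<cdot> u = y" "y' = y" "gop C Z G g (j \<cdot> u) = g'"
proof -
  have sy: "s \<cdot> y \<in> Hom C Z X" "s \<cdot> y' \<in> Hom C Z X" using y arrs by auto
  have yy: "y' = y" using q_act[OF g(1) sy(1)] q_act[OF g(2) sy(2)] e qs y by simp
  have i: "ginv G \<cdot> g \<in> Hom C Z (gob G)" "gop C Z G (ginv G \<cdot> g) g' \<in> Hom C Z (gob G)"
    using ginv_in[OF G g(1)] gop_in[OF G ginv_in[OF G g(1)] g(2)] by auto
  have "act Z (gop C Z G (ginv G \<cdot> g) g') (s \<cdot> y) = act Z (ginv G \<cdot> g) (act Z g (s \<cdot> y))"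
    using act_gop[OF i(1) g(2) sy(1)] e yy by simp
  also have "\<dots> = s \<cdot> y"
    using act_gop[OF i(1) g(1) sy(1)] gop_inv_left[OF G g(1)] act_one[OF sy(1)] by simp
  finally obtain u where "u \<in> Hom C Z \<Gamma>" "j \<cdot> u = gop C Z G (ginv G \<cdot> g) g'" "\<gamma> \<cdot> u = y"
    using stab_ex[OF i(2) y(1)] by blast
  then show thesis using that[of u] yy gop_inv_cancel(2)[OF G g] by simp
qed

text \<open>For the generic element \<open>Id C X\<close>, \<open>section_cover\<close> gives a
  regular epimorphism onto \<open>X\<close> whose points have the form \<open>g s(y)\<close>; it can
  be cancelled.\<close>

lemma X_ext:
  assumes x: "x \<in> Hom C X W" "x' \<in> Hom C X W"
    and eq: "\<And>Z g y. g \<in> Hom C Z (gob G) \<Longrightarrow> y \<in> Hom C Z Q \<Longrightarrow> x \<cdot> act Z g (s \<cdot> y) = x' \<cdot> act Z g (s \<cdot> y)"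
  shows "x = x'"
proof -
  obtain Z c g where c: "regular_epi C Z X c" "c \<in> Hom C Z X" "g \<in> Hom C Z (gob G)"
    "act Z g (s \<cdot> (q \<cdot> (Id C X \<cdot> c))) = Id C X \<cdot> c" using section_cover[OF Id_in[OF objs(3)]] .
  have "q \<cdot> (Id C X \<cdot> c) \<in> Hom C Z Q" using arrs c(2) by auto
  then have "x \<cdot> c = x' \<cdot> c" using eq[OF c(3)] c by (metis Id_comp)
  then show ?thesis using regular_epi_cancel[OF c(1) x] by blast
qed

text \<open>The universal property of \<open>X\<close> as the quotient of
  \<open>G \<times> Q\<close> by the stabilisers. The map is defined on a cover of \<open>X\<close>
  over which the generic element has the form \<open>g s(y)\<close>, and it descends because two
  such presentations of one element differ by a stabiliser.\<close>

lemma X_factor: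
  assumes k: "\<kappa> \<in> Hom C (Prod C (gob G) Q) W"
    and eq: "\<And>Z g u. g \<in> Hom C Z (gob G) \<Longrightarrow> u \<in> Hom C Z \<Gamma> \<Longrightarrow>
      \<kappa> \<cdot> pair C Z (gob G) Q (gop C Z G g (j \<cdot> u)) (\<gamma> \<cdot> u) = \<kappa> \<cdot> pair C Z (gob G) Q g (\<gamma> \<cdot> u)"
  obtains x where "x \<in> Hom C X W"
    "\<And>Z g y. g \<in> Hom C Z (gob G) \<Longrightarrow> y \<in> Hom C Z Q \<Longrightarrow> x \<cdot> act Z g (s \<cdot> y) = \<kappa> \<cdot> pair C Z (gob G) Q g y"
proof -
  let ?k = "\<lambda>Z g y. \<kappa> \<cdot> pair C Z (gob G) Q g y"
  have kk: "?k Z g y = ?k Z g' y'"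
    if pt: "g \<in> Hom C Z (gob G)" "g' \<in> Hom C Z (gob G)" "y \<in> Hom C Z Q" "y' \<in> Hom C Z Q"
      "act Z g (s \<cdot> y) = act Z g' (s \<cdot> y')" for Z g g' y y'
  proof -
    obtain u where "u \<in> Hom C Z \<Gamma>" "\<gamma> \<cdot> u = y" "y' = y" "gop C Z G g (j \<cdot> u) = g'"
      using same_point[OF pt] .
    then show ?thesis using eq[OF pt(1), of u] by simp
  qed
  have kc: "?k Z g y \<cdot> c = ?k Z' (g \<cdot> c) (y \<cdot> c)"
    if "c \<in> Hom C Z' Z" "g \<in> Hom C Z (gob G)" "y \<in> Hom C Z Q" for Z Z' c g y
    using that k by (simp add: cat_simps)
  obtain Z c g where c: "regular_epi C Z X c" "c \<in> Hom C Z X" "g \<in> Hom C Z (gob G)"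
    "act Z g (s \<cdot> (q \<cdot> (Id C X \<cdot> c))) = Id C X \<cdot> c" using section_cover[OF Id_in[OF objs(3)]] .
  then have c4: "act Z g (s \<cdot> (q \<cdot> c)) = c" by simp
  have qc: "q \<cdot> c \<in> Hom C Z Q" and sqc: "s \<cdot> (q \<cdot> c) \<in> Hom C Z X" using arrs c(2) by auto
  have kZ: "?k Z g (q \<cdot> c) \<in> Hom C Z W" using k c(3) qc by auto
  have ac: "act Y (g \<cdot> m) (s \<cdot> ((q \<cdot> c) \<cdot> m)) = c \<cdot> m" if "m \<in> Hom C Y Z" for Y m
    using act_comp[OF that c(3) sqc] c4 arrs c(2) that by (simp add: cat_simps)
  have "?k Z g (q \<cdot> c) \<cdot> m = ?k Z g (q \<cdot> c) \<cdot> l"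
    if m: "m \<in> Hom C Y Z" and l: "l \<in> Hom C Y Z" and ml: "c \<cdot> m = c \<cdot> l" for Y m l
    unfolding kc[OF m c(3) qc] kc[OF l c(3) qc]
    by (rule kk) (use m l c(3) qc ac[OF m] ac[OF l] ml in auto)
  then obtain x where x: "x \<in> Hom C X W" "x \<cdot> c = ?k Z g (q \<cdot> c)"
    using regular_epi_descent[OF c(1) kZ] by metis
  show thesis
  proof (rule that[OF x(1)])
    fix Y h y assume h: "h \<in> Hom C Y (gob G)" and y: "y \<in> Hom C Y Q"
    have sy: "s \<cdot> y \<in> Hom C Y X" using y arrs by auto
    note A = act_in[OF h sy]
    \<comment> \<open>To evaluate the descended map at \<open>h s(y)\<close>, that element is lifted
      to the cover; its two presentations then have the same value under
      \<open>\<kappa>\<close>.\<close>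
    obtain Y' b m where b: "regular_epi C Y' Y b" "m \<in> Hom C Y' Z" "c \<cdot> m = act Y h (s \<cdot> y) \<cdot> b" "b \<in> Hom C Y' Y"
      using regular_epi_lift[OF c(1) A] .
    have e: "c \<cdot> m = act Y' (h \<cdot> b) (s \<cdot> (y \<cdot> b))"
      using b(3) act_comp[OF b(4) h sy] comp_assoc[OF s(1) b(4) y] by simp
    have "(x \<cdot> act Y h (s \<cdot> y)) \<cdot> b = x \<cdot> (c \<cdot> m)" using comp_assoc[OF x(1) b(4) A] b(3) by simp
    also have "\<dots> = ?k Z g (q \<cdot> c) \<cdot> m" using comp_reduce[OF x(2) c(2) x(1) b(2)] .
    also have "\<dots> = ?k Y' (g \<cdot> m) ((q \<cdot> c) \<cdot> m)" using kc[OF b(2) c(3) qc] .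
    also have "\<dots> = ?k Y' (h \<cdot> b) (y \<cdot> b)"
      by (rule kk) (use b h y c(3) qc ac[OF b(2)] e in auto)
    also have "\<dots> = ?k Y h y \<cdot> b" using kc[OF b(4) h y] by simp
    finally show "x \<cdot> act Y h (s \<cdot> y) = ?k Y h y"
      using regular_epi_cancel[OF b(1) comp_in[OF x(1) A] comp_in[OF k pair_in[OF h y]]] by blast
  qed
qed

text \<open>If \<open>\<psi>\<close> inverts \<open>\<phi>\<close>, the inverse of
  \<open>\<Phi>\<close> sends \<open>g s(y)\<close> to \<open>[\<psi>(g), y]\<close>. This is well
  defined since \<open>\<psi>(g j(u)) = \<psi>(g) \<eta>(u)\<close>, so the stabiliser is absorbed
  by the relation in \<open>T\<close>.\<close>

lemma iso_Phi:
  assumes "is_iso C (gob P) (gob G) \<phi>"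
  shows "is_iso C T X \<Phi>"
proof -
  obtain \<psi> where \<psi>: "\<psi> \<in> Hom C (gob G) (gob P)" "\<psi> \<cdot> \<phi> = Id C (gob P)" "\<phi> \<cdot> \<psi> = Id C (gob G)"
    using assms unfolding is_iso_def by blast
  have c1: "\<psi> \<cdot> (\<phi> \<cdot> p) = p" if "p \<in> Hom C Z (gob P)" for p Z
    using comp_reduce[OF \<psi>(2) phi_in \<psi>(1) that] that by simp
  have c2: "\<phi> \<cdot> (\<psi> \<cdot> g) = g" if "g \<in> Hom C Z (gob G)" for g Z
    using comp_reduce[OF \<psi>(3,1) phi_in that] that by simp
  have hom: "\<psi> \<cdot> gop C Z G g (j \<cdot> u) = gop C Z P (\<psi> \<cdot> g) (\<eta> \<cdot> u)" if g: "g \<in> Hom C Z (gob G)" and u: "u \<in> Hom C Z \<Gamma>" for Z g u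
  proof -
    have i: "\<psi> \<cdot> g \<in> Hom C Z (gob P)" "\<eta> \<cdot> u \<in> Hom C Z (gob P)" using g u \<psi> arrs by auto
    show ?thesis using c1[OF gop_in[OF P i]] Grp_hom_gop[OF \<phi> i] c2[OF g] phi_eta[OF u] by simp
  qed
  let ?\<kappa> = "\<tau> \<cdot> pmap C (gob G) Q (gob P) Q \<psi> (Id C Q)"
  have m: "pmap C (gob G) Q (gob P) Q \<psi> (Id C Q) \<in> Hom C (Prod C (gob G) Q) (Prod C (gob P) Q)"
    using \<psi>(1) by auto
  have k: "?\<kappa> \<in> Hom C (Prod C (gob G) Q) T" using arrs m by blast
  have kp: "?\<kappa> \<cdot> pair C Z (gob G) Q g y = proj Z (\<psi> \<cdot> g) y" if "g \<in> Hom C Z (gob G)" "y \<in> Hom C Z Q" for Z g y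
    using comp_assoc[OF arrs(8) pair_in[OF that] m] pmap_pair[OF \<psi>(1) Id_in that] that by simp
  have hk: "?\<kappa> \<cdot> pair C Z (gob G) Q (gop C Z G g (j \<cdot> u)) (\<gamma> \<cdot> u) = ?\<kappa> \<cdot> pair C Z (gob G) Q g (\<gamma> \<cdot> u)"
    if g: "g \<in> Hom C Z (gob G)" and u: "u \<in> Hom C Z \<Gamma>" for Z g u
  proof -
    have "\<psi> \<cdot> g \<in> Hom C Z (gob P)" using g \<psi> by auto
    moreover have "gop C Z G g (j \<cdot> u) \<in> Hom C Z (gob G)" "\<gamma> \<cdot> u \<in> Hom C Z Q"
      using gop_in[OF G g comp_in[OF stab(1) u]] comp_in[OF stab(2) u] by auto
    ultimately show ?thesis
      using kp[of "gop C Z G g (j \<cdot> u)" Z "\<gamma> \<cdot> u"] kp[OF g, of "\<gamma> \<cdot> u"] hom[OF g u] proj_stab[OF u] by simp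
  qed
  obtain x where x: "x \<in> Hom C X T"
    "\<And>Z g y. g \<in> Hom C Z (gob G) \<Longrightarrow> y \<in> Hom C Z Q \<Longrightarrow> x \<cdot> act Z g (s \<cdot> y) = ?\<kappa> \<cdot> pair C Z (gob G) Q g y"
    by (rule X_factor[OF k hk], assumption, assumption, rule that, assumption, blast)
  have "\<Phi> \<cdot> x = Id C X"
  proof (rule X_ext)
    fix Z g y assume g: "g \<in> Hom C Z (gob G)" and y: "y \<in> Hom C Z Q"
    have A: "act Z g (s \<cdot> y) \<in> Hom C Z X" using act_in[OF g] y arrs by auto
    have "\<psi> \<cdot> g \<in> Hom C Z (gob P)" using g \<psi> by auto
    then show "(\<Phi> \<cdot> x) \<cdot> act Z g (s \<cdot> y) = Id C X \<cdot> act Z g (s \<cdot> y)"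
      using comp_assoc[OF \<Phi>(1) A x(1)] x(2)[OF g y] kp[OF g y] Phi_proj[OF _ y] c2[OF g] A by simp
  qed (use x \<Phi> in auto)
  moreover have "x \<cdot> \<Phi> = Id C T"
  proof (rule is_coequaliser_ext[OF \<tau>])
    let ?W = "Prod C (gob P) Q" and ?p = "pr1 C (gob P) Q" and ?y = "pr2 C (gob P) Q"
    have pr: "?p \<in> Hom C ?W (gob P)" "?y \<in> Hom C ?W Q" by auto
    have t: "proj ?W ?p ?y = \<tau>" using arrs by simp
    have fp: "\<phi> \<cdot> ?p \<in> Hom C ?W (gob G)" using pr phi_in by auto
    have "(x \<cdot> \<Phi>) \<cdot> \<tau> = x \<cdot> (\<Phi> \<cdot> proj ?W ?p ?y)" unfolding t using comp_assoc[OF x(1) arrs(8) \<Phi>(1)] .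
    also have "\<dots> = proj ?W ?p ?y" using Phi_proj[OF pr] x(2)[OF fp pr(2)] kp[OF fp pr(2)] c1[OF pr(1)] by simp
    finally show "(x \<cdot> \<Phi>) \<cdot> \<tau> = Id C T \<cdot> \<tau>" using t arrs by simp
  qed (use x \<Phi> Hom_Obj[OF \<Phi>(1)] in auto)
  ultimately show ?thesis unfolding is_iso_def using x \<Phi> by blast
qed

text \<open>A section \<open>\<sigma>\<close> of \<open>\<Phi>\<close> differs from the tautological lift \<open>[p, y]\<close> of \<open>\<phi>(p) s(y)\<close> by an element \<open>n\<close>
  of the kernel of \<open>\<phi>\<close>.\<close>

definition deviation :: "'a \<Rightarrow> 'o \<Rightarrow> 'a \<Rightarrow> 'a \<Rightarrow> 'a \<Rightarrow> bool" where
  "deviation \<sigma> Z p y n \<longleftrightarrow> n \<in> Hom C Z (gob P) \<and> \<phi> \<cdot> n = gone Z G \<and>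
     proj Z (gop C Z P n p) y = \<sigma> \<cdot> act Z (\<phi> \<cdot> p) (s \<cdot> y)"

text \<open>Locally the value of the section is some class \<open>[p', y']\<close>. It lies over
  \<open>\<phi>(p) s(y)\<close>, so \<open>y' = y\<close> and
  \<open>\<phi>(p) = \<phi>(p') j(u)\<close> for a stabiliser element \<open>u\<close>. Replacing
  \<open>p'\<close> by \<open>p' \<eta>(u)\<close> keeps the class and makes the images in
  \<open>G\<close> equal.\<close>

lemma deviation_exists:
  assumes \<sigma>: "\<sigma> \<in> Hom C X T" "\<Phi> \<cdot> \<sigma> = Id C X" and p: "p \<in> Hom C Z (gob P)" and y: "y \<in> Hom C Z Q"
  obtains Z' c n where "regular_epi C Z' Z c" "c \<in> Hom C Z' Z" "deviation \<sigma> Z' (p \<cdot> c) (y \<cdot> c) n"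
proof -
  have fs: "\<phi> \<cdot> p \<in> Hom C Z (gob G)" "s \<cdot> y \<in> Hom C Z X" using p y arrs by auto
  note A = act_in[OF fs]
  obtain Z' c p' y' where c: "regular_epi C Z' Z c" "c \<in> Hom C Z' Z" "p' \<in> Hom C Z' (gob P)" "y' \<in> Hom C Z' Q"
    "proj Z' p' y' = (\<sigma> \<cdot> act Z (\<phi> \<cdot> p) (s \<cdot> y)) \<cdot> c" using proj_cover[OF comp_in[OF \<sigma>(1) A]] .
  have pc: "p \<cdot> c \<in> Hom C Z' (gob P)" "y \<cdot> c \<in> Hom C Z' Q" using p y c by auto
  have fsc: "\<phi> \<cdot> (p \<cdot> c) \<in> Hom C Z' (gob G)" "s \<cdot> (y \<cdot> c) \<in> Hom C Z' X" "\<phi> \<cdot> p' \<in> Hom C Z' (gob G)"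
    using pc c arrs by auto
  have t: "proj Z' p' y' = \<sigma> \<cdot> act Z' (\<phi> \<cdot> (p \<cdot> c)) (s \<cdot> (y \<cdot> c))"
    using c(5) comp_assoc[OF \<sigma>(1) c(2) A] act_comp[OF c(2) fs] comp_assoc[OF phi_in c(2) p] comp_assoc[OF s(1) c(2) y] by simp
  have "act Z' (\<phi> \<cdot> p') (s \<cdot> y') = act Z' (\<phi> \<cdot> (p \<cdot> c)) (s \<cdot> (y \<cdot> c))"
    using arg_cong[OF t, of "\<lambda>t. \<Phi> \<cdot> t"] Phi_proj[OF c(3,4)] comp_reduce[OF \<sigma>(2,1) \<Phi>(1) act_in[OF fsc(1,2)]]
      Id_comp[OF act_in[OF fsc(1,2)]] by simp
  then obtain u where u: "u \<in> Hom C Z' \<Gamma>" "\<gamma> \<cdot> u = y'" "y \<cdot> c = y'" "gop C Z' G (\<phi> \<cdot> p') (j \<cdot> u) = \<phi> \<cdot> (p \<cdot> c)"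
    using same_point[OF fsc(3,1) c(4) pc(2)] by metis
  have eu: "\<eta> \<cdot> u \<in> Hom C Z' (gob P)" using u arrs by auto
  note pe = gop_in[OF P c(3) eu]
  \<comment> \<open>\<open>n = p' \<eta>(u) p^(-1)\<close>, which is in the kernel since
    \<open>\<phi>(p' \<eta>(u)) = \<phi>(p)\<close>.\<close>
  let ?n = "gop C Z' P (gop C Z' P p' (\<eta> \<cdot> u)) (ginv P \<cdot> (p \<cdot> c))"
  have n: "?n \<in> Hom C Z' (gob P)" using gop_in[OF P pe ginv_in[OF P pc(1)]] .
  have "\<phi> \<cdot> ?n = gone Z' G"
    using Grp_hom_gop[OF \<phi> pe ginv_in[OF P pc(1)]] Grp_hom_gop[OF \<phi> c(3) eu] phi_eta[OF u(1)] u(4)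
      Grp_hom_inv[OF \<phi> pc(1)] gop_inv_right[OF G fsc(1)] by simp
  moreover have "proj Z' (gop C Z' P ?n (p \<cdot> c)) (y \<cdot> c) = \<sigma> \<cdot> act Z' (\<phi> \<cdot> (p \<cdot> c)) (s \<cdot> (y \<cdot> c))"
    using gop_inv_cancel(4)[OF P pc(1) pe] proj_stab[OF u(1) c(3)] u t by simp
  ultimately have "deviation \<sigma> Z' (p \<cdot> c) (y \<cdot> c) ?n" unfolding deviation_def using n by simp
  then show thesis using that c by blast
qed

text \<open>Stability under change of stage, needed to compare and glue deviations that are only
  given on covers.\<close>

lemma deviation_comp:
  assumes d: "deviation \<sigma> Z p y n" and \<sigma>: "\<sigma> \<in> Hom C X T" and p: "p \<in> Hom C Z (gob P)" and y: "y \<in> Hom C Z Q"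
    and c: "c \<in> Hom C Z' Z"
  shows "deviation \<sigma> Z' (p \<cdot> c) (y \<cdot> c) (n \<cdot> c)"
proof -
  have n: "n \<in> Hom C Z (gob P)" "\<phi> \<cdot> n = gone Z G" "proj Z (gop C Z P n p) y = \<sigma> \<cdot> act Z (\<phi> \<cdot> p) (s \<cdot> y)"
    using d unfolding deviation_def by auto
  have fs: "\<phi> \<cdot> p \<in> Hom C Z (gob G)" "s \<cdot> y \<in> Hom C Z X" using p y arrs by auto
  have "\<phi> \<cdot> (n \<cdot> c) = gone Z' G" using comp_assoc[OF phi_in c n(1)] n(2) gone_comp[OF G c] by simp
  moreover have "proj Z' (gop C Z' P (n \<cdot> c) (p \<cdot> c)) (y \<cdot> c) = \<sigma> \<cdot> act Z' (\<phi> \<cdot> (p \<cdot> c)) (s \<cdot> (y \<cdot> c))"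
    using arg_cong[OF n(3), of "\<lambda>t. t \<cdot> c"] proj_comp[OF c gop_in[OF P n(1) p] y] gop_comp[OF P c n(1) p]
      comp_assoc[OF \<sigma> c act_in[OF fs]] act_comp[OF c fs] comp_assoc[OF phi_in c p] comp_assoc[OF s(1) c y] by simp
  ultimately show ?thesis unfolding deviation_def using n c by auto
qed

end

section \<open>Cosets and generation\<close>

context Bass_Serre_Cat
begin

definition locally_surjective :: "'o \<Rightarrow> 'o \<Rightarrow> 'a \<Rightarrow> bool" where
  "locally_surjective A B k \<longleftrightarrow> (\<forall>Z. \<forall>x \<in> Hom C Z B. \<exists>Z' c l. regular_epi C Z' Z c \<and> c \<in> Hom C Z' Z \<and>
     l \<in> Hom C Z' A \<and> k \<cdot> l = x \<cdot> c)"

lemma locally_surjectiveE: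
  assumes "locally_surjective A B k" "x \<in> Hom C Z B"
  obtains Z' c l where "regular_epi C Z' Z c" "c \<in> Hom C Z' Z" "l \<in> Hom C Z' A" "k \<cdot> l = x \<cdot> c"
  using assms unfolding locally_surjective_def by blast

text \<open>\<open>R\<close> is the object of cosets \<open>x k(L)\<close>, the quotient of
  \<open>K\<close> by the action of \<open>L\<close> in which \<open>l\<close> sends
  \<open>x\<close> to \<open>x k(l)^(-1)\<close>. The last property is effectiveness of this action,
  applied to \<open>x\<close> and the unit.\<close>

lemma coset_quotient:
  assumes k: "k \<in> Hom (Grp C) L K"
  obtains R r where "r \<in> Hom C (gob K) R"
    "\<And>Z x l. x \<in> Hom C Z (gob K) \<Longrightarrow> l \<in> Hom C Z (gob L) \<Longrightarrow> r \<cdot> gop C Z K x (k \<cdot> l) = r \<cdot> x"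
    "\<And>Z x. x \<in> Hom C Z (gob K) \<Longrightarrow> r \<cdot> x = r \<cdot> gone Z K \<Longrightarrow>
       \<exists>Z' c l. regular_epi C Z' Z c \<and> c \<in> Hom C Z' Z \<and> l \<in> Hom C Z' (gob L) \<and> k \<cdot> l = x \<cdot> c"
proof -
  note h = Grp_homD[OF k]
  have o: "gob L \<in> Obj C" "gob K \<in> Obj C" using group_object_hom(1) h by auto
  let ?W = "Prod C (gob L) (gob K)" and ?l = "pr1 C (gob L) (gob K)" and ?x = "pr2 C (gob L) (gob K)"
  have pr: "?l \<in> Hom C ?W (gob L)" "?x \<in> Hom C ?W (gob K)" using o by auto
  have kl: "ginv K \<cdot> (k \<cdot> ?l) \<in> Hom C ?W (gob K)" using ginv_in[OF h(2) comp_in[OF h(3) pr(1)]] .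
  \<comment> \<open>The inverse turns right translation into a left action.\<close>
  define a where "a = gop C ?W K ?x (ginv K \<cdot> (k \<cdot> ?l))"
  have a: "a \<in> Hom C ?W (gob K)" unfolding a_def using gop_in[OF h(2) pr(2) kl] .
  have aa: "a \<cdot> pair C Z (gob L) (gob K) l x = gop C Z K x (ginv K \<cdot> (k \<cdot> l))"
    if l: "l \<in> Hom C Z (gob L)" and x: "x \<in> Hom C Z (gob K)" for Z l x
    unfolding a_def
    using gop_comp[OF h(2) pair_in[OF l x] pr(2) kl] ginv_assoc[OF h(2) pair_in[OF l x] comp_in[OF h(3) pr(1)]]
      comp_assoc[OF h(3) pair_in[OF l x] pr(1)] pr_pair[OF l x] by simp
  have act: "left_action C L (gob K) a"
  proof (rule left_actionI[OF h(1) o(2) a])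
    fix Z y assume y: "y \<in> Hom C Z (gob K)"
    have Z: "Z \<in> Obj C" using y Hom_Obj by blast
    show "a \<cdot> pair C Z (gob L) (gob K) (gone Z L) y = y"
      using aa[OF gone_in[OF h(1) Z] y] Grp_hom_one[OF k Z] ginv_gone[OF h(2) Z] gop_one_right[OF h(2) y] by simp
    fix l m assume l: "l \<in> Hom C Z (gob L)" and m: "m \<in> Hom C Z (gob L)"
    have i: "k \<cdot> l \<in> Hom C Z (gob K)" "k \<cdot> m \<in> Hom C Z (gob K)" using l m h by auto
    note j = ginv_in[OF h(2) i(1)] ginv_in[OF h(2) i(2)]
    show "a \<cdot> pair C Z (gob L) (gob K) (gop C Z L l m) y =
       a \<cdot> pair C Z (gob L) (gob K) l (a \<cdot> pair C Z (gob L) (gob K) m y)"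
      using aa[OF gop_in[OF h(1) l m] y] aa[OF m y] aa[OF l gop_in[OF h(2) y j(2)]] Grp_hom_gop[OF k l m]
        ginv_gop[OF h(2) i] gop_assoc[OF h(2) y j(2,1)] by simp
  qed
  obtain R r where r: "is_coequaliser C ?W (gob K) a ?x R r" using ex_coequaliser[OF a pr(2)] .
  note r' = is_coequaliser_hom[OF r]
  have ra: "r \<cdot> gop C Z K x (ginv K \<cdot> (k \<cdot> l)) = r \<cdot> x"
    if l: "l \<in> Hom C Z (gob L)" and x: "x \<in> Hom C Z (gob K)" for Z l x
    using aa[OF l x] comp_assoc[OF r'(3) pair_in[OF l x] a] comp_assoc[OF r'(3) pair_in[OF l x] pr(2)] r'(4)
      pr_pair[OF l x] by simp
  show thesis
  proof (rule that[OF r'(3)])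
    fix Z x assume x: "x \<in> Hom C Z (gob K)"
    { fix l assume l: "l \<in> Hom C Z (gob L)"
      have kl: "k \<cdot> l \<in> Hom C Z (gob K)" using l h by auto
      show "r \<cdot> gop C Z K x (k \<cdot> l) = r \<cdot> x"
        using ra[OF l gop_in[OF h(2) x kl]] gop_inv_cancel(3)[OF h(2) kl x] by simp }
    assume e: "r \<cdot> x = r \<cdot> gone Z K"
    have one: "gone Z K \<in> Hom C Z (gob K)" using x Hom_Obj h by auto
    show "\<exists>Z' c l. regular_epi C Z' Z c \<and> c \<in> Hom C Z' Z \<and> l \<in> Hom C Z' (gob L) \<and> k \<cdot> l = x \<cdot> c"
    proof (rule group_action_effective[OF h(1) act x one])
      fix T \<tau> assume \<tau>: "\<tau> \<in> Hom C (gob K) T"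
        and eq: "\<And>Z g y. g \<in> Hom C Z (gob L) \<Longrightarrow> y \<in> Hom C Z (gob K) \<Longrightarrow>
          \<tau> \<cdot> (a \<cdot> pair C Z (gob L) (gob K) g y) = \<tau> \<cdot> y"
      have "\<tau> \<cdot> a = \<tau> \<cdot> ?x" using eq[OF pr] o comp_Id[OF a] by simp
      then obtain t where "t \<in> Hom C R T" "t \<cdot> r = \<tau>" using is_coequaliser_factor[OF r \<tau>] by metis
      then show "\<tau> \<cdot> x = \<tau> \<cdot> gone Z K"
        using comp_assoc[OF _ x r'(3)] comp_assoc[OF _ one r'(3)] e by metis
    next
      fix Z' c l assume c: "regular_epi C Z' Z c" "c \<in> Hom C Z' Z" "l \<in> Hom C Z' (gob L)"
        "x \<cdot> c = a \<cdot> pair C Z' (gob L) (gob K) l (gone Z K \<cdot> c)"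
      have o': "gone Z K \<cdot> c = gone Z' K" "gone Z' K \<in> Hom C Z' (gob K)"
        using gone_comp[OF h(2) c(2)] one c(2) gone_in[OF h(2) Hom_Obj(1)[OF c(2)]] by auto
      \<comment> \<open>Lying in the orbit of the unit means \<open>x = k(l)^(-1)\<close> on the
        cover, so the preimage is the inverse of \<open>l\<close>.\<close>
      have "k \<cdot> (ginv L \<cdot> l) = x \<cdot> c"
        using aa[OF c(3) o'(2)] c(4) o'(1) Grp_hom_inv[OF k c(3)] gop_one_left[OF h(2) ginv_in[OF h(2) comp_in[OF h(3) c(3)]]]
        by simp
      then show ?thesis using c ginv_in[OF h(1) c(3)] by blast
    qed
  qed
qed

text \<open>The generation axiom concerns the coproduct \<open>L\<close> of the vertex groups, so
  what is needed is that the comparison \<open>k : L \<rightarrow> P\<close> is locally surjective.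
  Its image \<open>N\<close> is a subgroup through which the vertex groups map, so the universal
  property of \<open>P\<close> provides a section of the inclusion of \<open>N\<close>, and
  \<open>N\<close> is all of \<open>P\<close>.\<close>

lemma universal_vert_hom_generates:
  assumes Q: "Q \<in> Obj (Graph C)" and G: "group_object (slice (Graph C) Q) \<G>" "gob \<G> = (\<Gamma>, \<gamma>)"
    and u: "universal_vert_hom C Q \<G> P e"
    and f: "f \<in> Hom C (gob P) W"
    and inv: "\<And>Z p w. p \<in> Hom C Z (gob P) \<Longrightarrow> w \<in> Hom C Z (verts \<Gamma>) \<Longrightarrow> f \<cdot> gop C Z P p (e \<cdot> w) = f \<cdot> p"
    and x: "x \<in> Hom C Z (gob P)" "x' \<in> Hom C Z (gob P)"
  shows "f \<cdot> x = f \<cdot> x'"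
proof -
  interpret GF: Fin_Lim "Graph C" by (rule Fin_Lim_Graph)
  interpret S: Fin_Lim "slice (Graph C) Q" by (rule GF.Fin_Lim_slice[OF Q])
  have \<gamma>: "\<gamma> \<in> Hom (Graph C) \<Gamma> Q" using S.group_object_hom(1)[OF G(1)] G(2) by simp
  note \<gamma>' = Graph_HomD[OF \<gamma>]
  have oQ: "verts Q \<in> Obj C" "verts \<Gamma> \<in> Obj C" using \<gamma>'(2) Hom_Obj by auto
  note V = vert_group_object(1)[OF Q G(1)]
  have P: "group_object C P" and ve: "vert_hom C Q \<G> P e" using u unfolding universal_vert_hom_def by auto
  have fe: "fibre_hom C (verts Q) (vert_group C Q \<G>) P e" "e \<cdot> d0 \<Gamma> = e \<cdot> d1 \<Gamma>"
    using ve unfolding vert_hom_def G(2) by auto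
  obtain L b where L: "group_object C L" and b: "fibre_hom C (verts Q) (vert_group C Q \<G>) L b"
    and gen: "generates C (verts \<Gamma>) L b"
    and ub: "\<And>K f. group_object C K \<Longrightarrow> fibre_hom C (verts Q) (vert_group C Q \<G>) K f \<Longrightarrow>
       \<exists>!h. h \<in> Hom (Grp C) L K \<and> h \<cdot> b = f"
    using ex_universal_fibre_hom[OF oQ(1) V gob_vert_group[OF G(2)]] by metis
  obtain k where k: "k \<in> Hom (Grp C) L P" "k \<cdot> b = e" using ub[OF P fe(1)] by blast
  note k' = Grp_homD(3)[OF k(1)]
  have b': "b \<in> Hom C (verts \<Gamma>) (gob L)" and e': "e \<in> Hom C (verts \<Gamma>) (gob P)"
    using fibre_hom_in[OF b] fibre_hom_in[OF fe(1)] unfolding gob_vert_group[OF G(2)] by simp_all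
  obtain R r where r: "r \<in> Hom C (gob P) R"
    and r1: "\<And>Z x l. x \<in> Hom C Z (gob P) \<Longrightarrow> l \<in> Hom C Z (gob L) \<Longrightarrow> r \<cdot> gop C Z P x (k \<cdot> l) = r \<cdot> x"
    and r2: "\<And>Z x. x \<in> Hom C Z (gob P) \<Longrightarrow> r \<cdot> x = r \<cdot> gone Z P \<Longrightarrow>
       \<exists>Z' c l. regular_epi C Z' Z c \<and> c \<in> Hom C Z' Z \<and> l \<in> Hom C Z' (gob L) \<and> k \<cdot> l = x \<cdot> c"
    using coset_quotient[OF k(1)] by metis
  have oP: "gob P \<in> Obj C" using group_object_hom(1)[OF P] .
  note oneP = gone_in[OF P oP]
  \<comment> \<open>\<open>M\<close> is the image of \<open>k\<close>, described as the trivial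
    coset: the elements on which \<open>r\<close> takes its value at the unit are exactly those that
    lift locally to \<open>L\<close>.\<close>
  obtain M i where i: "is_equaliser C (gob P) R r (r \<cdot> gone (gob P) P) M i" using ex_equaliser[OF r comp_in[OF r oneP]] .
  note i' = is_equaliser_hom[OF i]
  have rone: "(r \<cdot> gone (gob P) P) \<cdot> y = r \<cdot> gone Y P" if "y \<in> Hom C Y (gob P)" for Y y
    using comp_assoc[OF r that oneP] gone_comp[OF P that] by simp
  have memI: "\<exists>m \<in> Hom C Y M. i \<cdot> m = y" if "y \<in> Hom C Y (gob P)" "r \<cdot> y = r \<cdot> gone Y P" for Y y
    using factor_is_equaliser[OF i that(1)] rone[OF that(1)] that(2) by auto
  have memD: "r \<cdot> (i \<cdot> m) = r \<cdot> gone Y P" if m: "m \<in> Hom C Y M" for Y m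
    using comp_reduce[OF i'(4) i'(3) r m] comp_assoc[OF comp_in[OF r oneP] m i'(3)] rone[OF comp_in[OF i'(3) m]] by simp
  have rk: "r \<cdot> (k \<cdot> l) = r \<cdot> gone Y P" if l: "l \<in> Hom C Y (gob L)" for Y l
    using r1[OF gone_in[OF P Hom_Obj(1)[OF l]] l] gop_one_left[OF P comp_in[OF k' l]] by simp
  have loc: "r \<cdot> y = r \<cdot> gone Y P" if c: "regular_epi C Y' Y c" "c \<in> Hom C Y' Y" "k \<cdot> l = y \<cdot> c" "l \<in> Hom C Y' (gob L)"
    and y: "y \<in> Hom C Y (gob P)" for Y Y' c l y
  proof (rule regular_epi_cancel[OF c(1)])
    note o = gone_in[OF P Hom_Obj(1)[OF y]]
    show "r \<cdot> y \<in> Hom C Y R" "r \<cdot> gone Y P \<in> Hom C Y R" using comp_in[OF r y] comp_in[OF r o] by auto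
    show "(r \<cdot> y) \<cdot> c = (r \<cdot> gone Y P) \<cdot> c"
      using comp_assoc[OF r c(2) y] comp_assoc[OF r c(2) o] gone_comp[OF P c(2)] rk[OF c(4)] c(3) by simp
  qed
  define N where "N = subgroup_object C P M i"
  have N: "group_object C N" "gob N = M" "i \<in> Hom (Grp C) N P"
  proof -
    \<comment> \<open>Elements of \<open>M\<close> lift to \<open>L\<close> only locally, so a
      product is lifted over two successive covers, and the equation obtained for \<open>r\<close>
      is cancelled along both.\<close>
    have mul: "\<exists>w\<in>Hom C Y M. i \<cdot> w = gop C Y P (i \<cdot> y) (i \<cdot> z)" if y: "y \<in> Hom C Y M" and z: "z \<in> Hom C Y M" for Y y z
    proof -
      have iy: "i \<cdot> y \<in> Hom C Y (gob P)" "i \<cdot> z \<in> Hom C Y (gob P)" using y z i' by auto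
      obtain Y1 c1 l1 where c1: "regular_epi C Y1 Y c1" "c1 \<in> Hom C Y1 Y" "l1 \<in> Hom C Y1 (gob L)" "k \<cdot> l1 = (i \<cdot> y) \<cdot> c1"
        using r2[OF iy(1) memD[OF y]] by blast
      have izc: "(i \<cdot> z) \<cdot> c1 \<in> Hom C Y1 (gob P)" using iy c1 by auto
      have "i \<cdot> (z \<cdot> c1) = (i \<cdot> z) \<cdot> c1" using comp_assoc[OF i'(3) c1(2) z] by simp
      then obtain Y2 c2 l2 where c2: "regular_epi C Y2 Y1 c2" "c2 \<in> Hom C Y2 Y1" "l2 \<in> Hom C Y2 (gob L)" "k \<cdot> l2 = ((i \<cdot> z) \<cdot> c1) \<cdot> c2"
        using r2[OF izc] memD[OF comp_in[OF z c1(2)]] by auto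
      have lc: "l1 \<cdot> c2 \<in> Hom C Y2 (gob L)" using c1 c2 by auto
      let ?g = "gop C Y P (i \<cdot> y) (i \<cdot> z)"
      have g: "?g \<in> Hom C Y (gob P)" using gop_in[OF P iy] .
      have gc: "?g \<cdot> c1 \<in> Hom C Y1 (gob P)" using g c1 by auto
      have "(?g \<cdot> c1) \<cdot> c2 = k \<cdot> gop C Y2 L (l1 \<cdot> c2) l2"
        using gop_comp[OF P c1(2) iy] gop_comp[OF P c2(2), of "(i \<cdot> y) \<cdot> c1" "(i \<cdot> z) \<cdot> c1"] comp_in[OF iy(1) c1(2)] izc
          Grp_hom_gop[OF k(1) lc c2(3)] c1(4) c2(4) comp_assoc[OF k' c2(2) c1(3)] by simp
      then have "r \<cdot> (?g \<cdot> c1) = r \<cdot> gone Y1 P" using loc[OF c2(1,2) _ gop_in[OF L lc c2(3)] gc] by simp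
      then have "(r \<cdot> ?g) \<cdot> c1 = (r \<cdot> gone Y P) \<cdot> c1"
        using comp_assoc[OF r c1(2) g] comp_assoc[OF r c1(2) gone_in[OF P Hom_Obj(1)[OF y]]] gone_comp[OF P c1(2)] by simp
      then have "r \<cdot> ?g = r \<cdot> gone Y P"
        using regular_epi_cancel[OF c1(1) comp_in[OF r g] comp_in[OF r gone_in[OF P Hom_Obj(1)[OF y]]]] by blast
      then show ?thesis using memI[OF g] by blast
    qed
    have inv: "\<exists>w\<in>Hom C Y M. i \<cdot> w = ginv P \<cdot> (i \<cdot> y)" if y: "y \<in> Hom C Y M" for Y y
    proof -
      have iy: "i \<cdot> y \<in> Hom C Y (gob P)" using y i' by auto
      obtain Y1 c1 l1 where c1: "regular_epi C Y1 Y c1" "c1 \<in> Hom C Y1 Y" "l1 \<in> Hom C Y1 (gob L)" "k \<cdot> l1 = (i \<cdot> y) \<cdot> c1"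
        using r2[OF iy memD[OF y]] by blast
      have "k \<cdot> (ginv L \<cdot> l1) = (ginv P \<cdot> (i \<cdot> y)) \<cdot> c1"
        using Grp_hom_inv[OF k(1) c1(3)] ginv_assoc[OF P c1(2) iy] c1(4) by simp
      from loc[OF c1(1,2) this ginv_in[OF L c1(3)] ginv_in[OF P iy]] show ?thesis using memI[OF ginv_in[OF P iy]] by blast
    qed
    have one: "\<exists>w\<in>Hom C (term_obj C) M. i \<cdot> w = gunit P"
    proof -
      have t: "gunit P \<in> Hom C (term_obj C) (gob P)" using group_object_hom(4)[OF P] .
      have "bang C (term_obj C) = Id C (term_obj C)" by (rule bang_unique[of _ "term_obj C"]) auto
      then have "gone (term_obj C) P = gunit P" using t by simp
      then show ?thesis using memI[OF t] by simp
    qed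
    from subgroup_object[OF P is_equaliser_mono[OF i] mul inv one, folded N_def]
    show "group_object C N" "gob N = M" "i \<in> Hom (Grp C) N P" by auto
  qed
  have "r \<cdot> e = r \<cdot> gone (verts \<Gamma>) P" using rk[OF b'] k(2) by simp
  then obtain n where n: "n \<in> Hom C (verts \<Gamma>) M" "i \<cdot> n = e" using memI[OF e'] by blast
  have mono: "y = z" if "y \<in> Hom C Y M" "z \<in> Hom C Y M" "i \<cdot> y = i \<cdot> z" for Y y z
    using is_equaliser_ext[OF i that] .
  have "vert_hom C Q \<G> N n"
    unfolding vert_hom_def
  proof (intro conjI)
    show "n \<cdot> d0 (fst (gob \<G>)) = n \<cdot> d1 (fst (gob \<G>))"
      unfolding G(2) fst_conv
      by (rule mono[of _ "edges \<Gamma>"]) (use n \<gamma>' fe(2) comp_assoc[OF i'(3) _ n(1)] in auto)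
    show "fibre_hom C (verts Q) (vert_group C Q \<G>) N n"
      unfolding fibre_hom_def
    proof (intro conjI allI ballI)
      show "n \<in> Hom C (fst (gob (vert_group C Q \<G>))) (gob N)" unfolding gob_vert_group[OF G(2)] using n N by simp
      interpret SV: Fin_Lim "slice C (verts Q)" by (rule Fin_Lim_slice[OF oQ(1)])
      fix Y y z w assume w: "z \<in> Hom (slice C (verts Q)) (Y, y) (gob (vert_group C Q \<G>))"
        "w \<in> Hom (slice C (verts Q)) (Y, y) (gob (vert_group C Q \<G>))"
      then have w': "z \<in> Hom C Y (verts \<Gamma>)" "w \<in> Hom C Y (verts \<Gamma>)" unfolding gob_vert_group[OF G(2)] by auto
      have g: "gop (slice C (verts Q)) (Y, y) (vert_group C Q \<G>) z w \<in> Hom C Y (verts \<Gamma>)"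
        using SV.gop_in[OF V w] unfolding gob_vert_group[OF G(2)] by simp
      have nz: "n \<cdot> z \<in> Hom C Y (gob N)" "n \<cdot> w \<in> Hom C Y (gob N)" using n w' N by auto
      show "n \<cdot> gop (slice C (verts Q)) (Y, y) (vert_group C Q \<G>) z w = gop C Y N (n \<cdot> z) (n \<cdot> w)"
        by (rule mono[of _ Y])
          (use n(1) g gop_in[OF N(1) nz] N(2) Grp_hom_gop[OF N(3) nz] fibre_hom_gop[OF fe(1) w]
            comp_reduce[OF n(2,1) i'(3)] w' in auto)
    qed
  qed
  \<comment> \<open>\<open>i \<cdot> w\<close> is an endomorphism of \<open>P\<close> that agrees
    with the identity on the vertex groups, so by uniqueness it is the identity.\<close>
  then obtain w where w: "w \<in> Hom (Grp C) P N" "w \<cdot> e = n" using u N(1) unfolding universal_vert_hom_def by blast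
  note w' = Grp_homD(3)[OF w(1)]
  have "(i \<cdot> w) \<cdot> e = e" using comp_assoc[OF i'(3) e'] w' N(2) w n by auto
  moreover have "Id C (gob P) \<cdot> e = e" using e' by simp
  ultimately have iw: "i \<cdot> w = Id C (gob P)"
    using u P ve Grp_comp[OF N(3) w(1)] Grp_Id[OF P] unfolding universal_vert_hom_def by metis
  have surj: "\<exists>Z' c l. regular_epi C Z' Y c \<and> c \<in> Hom C Z' Y \<and> l \<in> Hom C Z' (gob L) \<and> k \<cdot> l = y \<cdot> c"
    if y: "y \<in> Hom C Y (gob P)" for Y y
  proof -
    have wy: "w \<cdot> y \<in> Hom C Y M" "i \<cdot> (w \<cdot> y) = y"
      using w' N(2) y comp_reduce[OF iw _ i'(3) y] by auto
    show ?thesis using r2[OF y] memD[OF wy(1)] wy(2) by simp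
  qed
  let ?B = "Prod C (gob L) (verts \<Gamma>)" and ?l = "pr1 C (gob L) (verts \<Gamma>)" and ?g = "pr2 C (gob L) (verts \<Gamma>)"
  have oL: "gob L \<in> Obj C" using group_object_hom(1)[OF L] .
  have pr: "?l \<in> Hom C ?B (gob L)" "?g \<in> Hom C ?B (verts \<Gamma>)" using oL oQ by auto
  have gen': "is_coequaliser C ?B (gob L) ?l (gop C ?B L ?l (b \<cdot> ?g)) (term_obj C) (bang C (gob L))"
    using gen unfolding generates_def Let_def .
  have fk: "f \<cdot> k \<in> Hom C (gob L) W" using f k' by auto
  have bg: "b \<cdot> ?g \<in> Hom C ?B (gob L)" using b' pr by auto
  \<comment> \<open>Invariance of \<open>f\<close> under the vertex groups is just what the
    generation axiom for \<open>L\<close> asks of \<open>f \<cdot> k\<close>, which is therefore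
    constant.\<close>
  have "(f \<cdot> k) \<cdot> ?l = (f \<cdot> k) \<cdot> gop C ?B L ?l (b \<cdot> ?g)"
    using comp_assoc[OF f pr(1) k'] comp_assoc[OF f gop_in[OF L pr(1) bg] k'] Grp_hom_gop[OF k(1) pr(1) bg]
      comp_reduce[OF k(2) b' k' pr(2)] inv[OF comp_in[OF k' pr(1)] pr(2)] by simp
  then obtain t where t: "t \<in> Hom C (term_obj C) W" "t \<cdot> bang C (gob L) = f \<cdot> k"
    using is_coequaliser_factor[OF gen' fk] by metis
  have const: "f \<cdot> y = t \<cdot> bang C Y" if y: "y \<in> Hom C Y (gob P)" for Y y
  proof -
    have Y: "bang C Y \<in> Hom C Y (term_obj C)" using Hom_Obj(1)[OF y] by simp
    obtain Y' c l where c: "regular_epi C Y' Y c" "c \<in> Hom C Y' Y" "l \<in> Hom C Y' (gob L)" "k \<cdot> l = y \<cdot> c"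
      using surj[OF y] by blast
    have "(f \<cdot> y) \<cdot> c = (t \<cdot> bang C Y) \<cdot> c"
      using comp_assoc[OF f c(2) y] comp_assoc[OF t(1) c(2) Y] comp_assoc[OF f c(3) k'] c(4) c(2)
        comp_reduce[OF t(2) bang_in[OF oL] t(1) c(3)] c(3) by simp
    then show ?thesis using regular_epi_cancel[OF c(1) comp_in[OF f y] comp_in[OF t(1) Y]] by blast
  qed
  show ?thesis using const[OF x(1)] const[OF x(2)] by simp
qed

end

section \<open>Connected graphs\<close>

text \<open>The two components of one action share \<open>G\<close>, \<open>P\<close> and
  \<open>\<phi>\<close> and are prefixed \<open>E\<close> and \<open>V\<close>; the assumptions on
  graph maps tie them together. The universal property is needed on vertices alone, since edge
  groups enter it only as a condition.\<close>

locale graph_level =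
  E: level C G P \<phi> "edges X" "edges Q" "edges \<Gamma>" "edges T" "fst a" "fst q" "fst s" "fst j" "fst \<gamma>" "fst \<eta>" "fst \<tau>" "fst \<Phi>" +
  V: level C G P \<phi> "verts X" "verts Q" "verts \<Gamma>" "verts T" "snd a" "snd q" "snd s" "snd j" "snd \<gamma>" "snd \<eta>" "snd \<tau>" "snd \<Phi>"
  for C :: "('o, 'a) cat" (structure) and G P :: "('o, 'a) grp" and \<phi> :: 'a and X Q \<Gamma> T :: "('o, 'a) graph"
    and a q s j \<gamma> \<eta> \<tau> \<Phi> :: "'a \<times> 'a" +
  fixes \<G> :: "(('o, 'a) graph \<times> ('a \<times> 'a), 'a \<times> 'a) grp"
  assumes graph_action: "graph_action C G X a"
    and q_graph: "q \<in> Hom (Graph C) X Q" and s_graph: "s \<in> Hom (Graph C) Q X"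
    and \<tau>_graph: "\<tau> \<in> Hom (Graph C) (times_graph C (gob P) Q) T"
    and \<Phi>_graph: "\<Phi> \<in> Hom (Graph C) T X"
    and \<G>: "group_object (slice (Graph C) Q) \<G>" "gob \<G> = (\<Gamma>, \<gamma>)"
    and universal: "universal_vert_hom C Q \<G> P (snd \<eta>)"
    and connected: "connected C X"
begin

lemma fibre_eta: "fibre_hom C (verts Q) (vert_group C Q \<G>) P (snd \<eta>)"
  using universal unfolding universal_vert_hom_def vert_hom_def by blast

lemma Q_Obj: "Q \<in> Obj (Graph C)"
  using q_graph by (simp add: Graph_Hom)

lemma dX: "d \<in> {d0, d1} \<Longrightarrow> d X \<in> Hom C (edges X) (verts X)"
  using Graph_HomD(5,6)[OF q_graph] by auto

lemma dQ: "d \<in> {d0, d1} \<Longrightarrow> d Q \<in> Hom C (edges Q) (verts Q)"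
  using Graph_HomD(5,6)[OF s_graph] by auto

lemma dT: "d \<in> {d0, d1} \<Longrightarrow> d T \<in> Hom C (edges T) (verts T)"
  using Graph_HomD(5,6)[OF \<Phi>_graph] by auto

lemma d_s: assumes d: "d \<in> {d0, d1}" and e: "e \<in> Hom C Z (edges Q)"
  shows "d X \<cdot> (fst s \<cdot> e) = snd s \<cdot> (d Q \<cdot> e)"
proof -
  have "d X \<cdot> fst s = snd s \<cdot> d Q" using d Graph_HomD(3,4)[OF s_graph] by auto
  from E.comp_reduce[OF this E.s(1) dX[OF d] e] E.comp_assoc[OF V.s(1) e dQ[OF d]] show ?thesis by simp
qed

lemma d_act:
  assumes d: "d \<in> {d0, d1}" and g: "g \<in> Hom C Z (gob G)" and x: "x \<in> Hom C Z (edges X)"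
  shows "d X \<cdot> E.act Z g x = V.act Z g (d X \<cdot> x)"
proof -
  let ?m = "pmap C (gob G) (edges X) (gob G) (verts X) (Id C (gob G)) (d X)"
  have e: "d X \<cdot> fst a = snd a \<cdot> ?m" using graph_action d unfolding graph_action_def by blast
  have m: "?m \<in> Hom C (Prod C (gob G) (edges X)) (Prod C (gob G) (verts X))"
    using E.pmap_in[OF E.Id_in dX[OF d]] by simp
  show ?thesis
    using E.comp_reduce[OF e E.arrs(2) dX[OF d] E.pair_in[OF g x]] E.comp_assoc[OF V.arrs(2) E.pair_in[OF g x] m]
      E.pmap_pair[OF E.Id_in dX[OF d] g x] g by simp
qed

lemma d_proj:
  assumes d: "d \<in> {d0, d1}" and p: "p \<in> Hom C Z (gob P)" and y: "y \<in> Hom C Z (edges Q)"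
  shows "d T \<cdot> E.proj Z p y = V.proj Z p (d Q \<cdot> y)"
proof -
  let ?m = "pmap C (gob P) (edges Q) (gob P) (verts Q) (Id C (gob P)) (d Q)"
  have e: "d T \<cdot> fst \<tau> = snd \<tau> \<cdot> ?m" using Graph_HomD(3,4)[OF \<tau>_graph] d by auto
  have m: "?m \<in> Hom C (Prod C (gob P) (edges Q)) (Prod C (gob P) (verts Q))"
    using E.pmap_in[OF E.Id_in dQ[OF d]] by simp
  show ?thesis
    using E.comp_reduce[OF e E.arrs(8) dT[OF d] E.pair_in[OF p y]] E.comp_assoc[OF V.arrs(8) E.pair_in[OF p y] m]
      E.pmap_pair[OF E.Id_in dQ[OF d] p y] p by simp
qed

section \<open>Consequences of connectedness\<close>

lemma X_connected:
  obtains K \<kappa> where "is_coequaliser C (edges X) (verts X) (d0 X) (d1 X) K \<kappa>" "is_terminal C K"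
proof -
  obtain K \<kappa> where "is_coequaliser C (edges X) (verts X) (d0 X) (d1 X) K \<kappa>"
    using E.ex_coequaliser[OF dX dX, of d0 d1] by blast
  from E.coequaliser_exists[OF this] connected that show thesis unfolding connected_def by blast
qed

text \<open>Such an \<open>f\<close> factors through the coequaliser of \<open>d0\<close> and
  \<open>d1\<close>, which is terminal.\<close>

lemma const_on_X:
  assumes f: "f \<in> Hom C (verts X) W" "f \<cdot> d0 X = f \<cdot> d1 X" and x: "x \<in> Hom C Z (verts X)" "x' \<in> Hom C Z (verts X)"
  shows "f \<cdot> x = f \<cdot> x'"
proof -
  obtain K \<kappa> where K: "is_coequaliser C (edges X) (verts X) (d0 X) (d1 X) K \<kappa>" "is_terminal C K"
    using X_connected .
  obtain t where t: "t \<in> Hom C K W" "t \<cdot> \<kappa> = f" using E.is_coequaliser_factor[OF K(1) f] .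
  note k = is_coequaliser_hom(3)[OF K(1)]
  have "\<kappa> \<cdot> x = \<kappa> \<cdot> x'"
    using K(2) E.comp_in[OF k x(1)] E.comp_in[OF k x(2)] E.Hom_Obj(1)[OF x(1)] unfolding is_terminal_def by blast
  then show ?thesis using E.comp_reduce[OF t(2) k t(1) x(1)] E.comp_reduce[OF t(2) k t(1) x(2)] by simp
qed

text \<open>Connectedness also says that vertices exist locally: the coequaliser map from
  \<open>verts X\<close> to a terminal object is a regular epimorphism. Applying \<open>q\<close>
  gives a vertex of \<open>Q\<close>.\<close>

lemma vertex_cover:
  assumes Z: "Z \<in> Obj C"
  obtains Z' c y where "regular_epi C Z' Z c" "c \<in> Hom C Z' Z" "y \<in> Hom C Z' (verts Q)"
proof -
  obtain K \<kappa> where K: "is_coequaliser C (edges X) (verts X) (d0 X) (d1 X) K \<kappa>" "is_terminal C K"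
    using X_connected .
  obtain b where b: "b \<in> Hom C Z K" using K(2) Z unfolding is_terminal_def by blast
  have "regular_epi C (verts X) K \<kappa>" using K(1) unfolding regular_epi_def by blast
  then obtain Z' c x where "regular_epi C Z' Z c" "x \<in> Hom C Z' (verts X)" "c \<in> Hom C Z' Z"
    using E.regular_epi_lift[OF _ b] by metis
  then show thesis using that E.comp_in[OF V.arrs(3)] by blast
qed

text \<open>A map on \<open>verts Q\<close> that identifies the ends of edges becomes constant on
  \<open>X\<close> after composition with \<open>q\<close>, and \<open>s\<close> brings this back to
  \<open>Q\<close>. Uniqueness of the factorisation holds because \<open>Q\<close> locally has a
  vertex.\<close>

lemma Q_connected: "is_coequaliser C (edges Q) (verts Q) (d0 Q) (d1 Q) (term_obj C) (bang C (verts Q))"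
proof (rule E.is_coequaliserI)
  show d: "d0 Q \<in> Hom C (edges Q) (verts Q)" "d1 Q \<in> Hom C (edges Q) (verts Q)" using dQ by auto
  show "bang C (verts Q) \<in> Hom C (verts Q) (term_obj C)" by simp
  show "bang C (verts Q) \<cdot> d0 Q = bang C (verts Q) \<cdot> d1 Q" using d by simp
  fix W
  { fix x assume x: "x \<in> Hom C (verts Q) W" "x \<cdot> d0 Q = x \<cdot> d1 Q"
    have xq: "x \<cdot> snd q \<in> Hom C (verts X) W" using x V.arrs by auto
    note q' = Graph_HomD[OF q_graph]
    have xd: "(x \<cdot> snd q) \<cdot> d0 X = (x \<cdot> snd q) \<cdot> d1 X"
      using E.comp_assoc[OF x(1) q'(5,2)] E.comp_assoc[OF x(1) q'(6,2)] q'(3,4)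
        E.comp_reduce[OF x(2) d(1) x(1) q'(1)] E.comp_assoc[OF x(1) q'(1) d(2)] by simp
    obtain K \<kappa> where K: "is_coequaliser C (edges X) (verts X) (d0 X) (d1 X) K \<kappa>" "is_terminal C K"
      using X_connected .
    obtain t where t: "t \<in> Hom C K W" "t \<cdot> \<kappa> = x \<cdot> snd q" using E.is_coequaliser_factor[OF K(1) xq xd] .
    note k = is_coequaliser_hom(3)[OF K(1)]
    obtain u where u: "u \<in> Hom C (term_obj C) K" using K(2) E.term_Obj unfolding is_terminal_def by blast
    have "\<kappa> \<cdot> snd s = u \<cdot> bang C (verts Q)"
      using K(2) E.comp_in[OF k V.s(1)] E.comp_in[OF u E.bang_in] V.objs unfolding is_terminal_def by blast
    then have "(t \<cdot> u) \<cdot> bang C (verts Q) = (x \<cdot> snd q) \<cdot> snd s"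
      using E.comp_assoc[OF t(1) E.bang_in u] E.comp_reduce[OF t(2) k t(1) V.s(1)] by simp
    also have "\<dots> = x" using E.comp_assoc[OF x(1) V.s(1) V.arrs(3)] V.s(2) x by simp
    finally show "\<exists>u\<in>Hom C (term_obj C) W. u \<cdot> bang C (verts Q) = x" using t u by blast }
  { fix u v assume u: "u \<in> Hom C (term_obj C) W" "v \<in> Hom C (term_obj C) W" "u \<cdot> bang C (verts Q) = v \<cdot> bang C (verts Q)"
    obtain Z c y where c: "regular_epi C Z (term_obj C) c" "c \<in> Hom C Z (term_obj C)" "y \<in> Hom C Z (verts Q)"
      using vertex_cover[OF E.term_Obj] .
    have "bang C (verts Q) \<cdot> y = c" using E.bang_unique[OF E.comp_in[OF E.bang_in c(3)] c(2)] by simp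
    then have "u \<cdot> c = v \<cdot> c"
      using E.comp_assoc[OF u(1) c(3) E.bang_in] E.comp_assoc[OF u(2) c(3) E.bang_in] u(3) by simp
    then show "u = v" using E.regular_epi_cancel[OF c(1) u(1,2)] by blast }
qed

text \<open>The vertex groups act, over \<open>verts Q\<close>, on \<open>\<pi> \<times> Q\<close>
  by \<open>(p, z) \<mapsto> (p \<eta>(w)^(-1), z)\<close>, and \<open>\<tau>\<close> is the
  quotient. As the acting group varies with the vertex, exactness is needed in the slice over
  \<open>verts Q\<close>.\<close>

lemma proj_effective:
  assumes p: "p \<in> Hom C Z (gob P)" "p' \<in> Hom C Z (gob P)" and y: "y \<in> Hom C Z (verts Q)" "y' \<in> Hom C Z (verts Q)"
    and e: "V.proj Z p y = V.proj Z p' y'"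
  obtains Z' c w where "regular_epi C Z' Z c" "c \<in> Hom C Z' Z" "w \<in> Hom C Z' (verts \<Gamma>)" "snd \<gamma> \<cdot> w = y' \<cdot> c"
    "p \<cdot> c = gop C Z' P (p' \<cdot> c) (ginv P \<cdot> (snd \<eta> \<cdot> w))"
proof -
  let ?S = "slice C (verts Q)" let ?H = "vert_group C Q \<G>" let ?Y = "Prod C (gob P) (verts Q)"
  let ?\<Gamma> = "(verts \<Gamma>, snd \<gamma>)" and ?YQ = "(?Y, pr2 C (gob P) (verts Q))"
  interpret S: Fin_Lim ?S by (rule E.Fin_Lim_slice[OF V.objs(4)])
  note H = E.vert_group_object(1)[OF Q_Obj \<G>(1)] and gH = gob_vert_group[OF \<G>(2), of C Q]
  note f = fibre_hom_gop[OF fibre_eta, unfolded gH]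
  have o\<Gamma>: "?\<Gamma> \<in> Obj ?S" and oY: "?YQ \<in> Obj ?S" using V.arrs by auto
  have prY: "pr1 C (gob P) (verts Q) \<in> Hom C ?Y (gob P)" "pr2 C (gob P) (verts Q) \<in> Hom C ?Y (verts Q)" by auto
  obtain W w where W: "Prod ?S ?\<Gamma> ?YQ = (W, w)" by (meson surj_pair)
  let ?r1 = "pr1 ?S ?\<Gamma> ?YQ" and ?r2 = "pr2 ?S ?\<Gamma> ?YQ"
  have r: "?r1 \<in> Hom C W (verts \<Gamma>)" "?r2 \<in> Hom C W ?Y" "w \<in> Hom C W (verts Q)" "pr2 C (gob P) (verts Q) \<cdot> ?r2 = w"
    using S.pr_in[OF o\<Gamma> oY] W by auto
  have rp: "pr1 C (gob P) (verts Q) \<cdot> ?r2 \<in> Hom C W (gob P)" using r by auto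
  have re: "snd \<eta> \<cdot> ?r1 \<in> Hom C W (gob P)" using r V.arrs by auto
  note rg = E.gop_in[OF E.P rp E.ginv_in[OF E.P re]]
  \<comment> \<open>The action map; the inverse is there because right translation has to become a
    left action.\<close>
  define b where "b = pair C W (gob P) (verts Q) (gop C W P (pr1 C (gob P) (verts Q) \<cdot> ?r2) (ginv P \<cdot> (snd \<eta> \<cdot> ?r1))) w"
  have b: "b \<in> Hom C W ?Y" unfolding b_def using E.pair_in[OF rg r(3)] .
  have bb: "b \<cdot> pair ?S (Z, z) ?\<Gamma> ?YQ u v = pair C Z (gob P) (verts Q) (gop C Z P (pr1 C (gob P) (verts Q) \<cdot> v) (ginv P \<cdot> (snd \<eta> \<cdot> u))) z"
    if u: "u \<in> Hom ?S (Z, z) ?\<Gamma>" and v: "v \<in> Hom ?S (Z, z) ?YQ" for Z z u v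
  proof -
    have t: "pair ?S (Z, z) ?\<Gamma> ?YQ u v \<in> Hom C Z W" "w \<cdot> pair ?S (Z, z) ?\<Gamma> ?YQ u v = z" using S.pair_in[OF u v] W by auto
    show ?thesis unfolding b_def
      using E.pair_comp[OF t(1) rg r(3)] E.gop_comp[OF E.P t(1) rp E.ginv_in[OF E.P re]] E.ginv_assoc[OF E.P t(1) re]
        E.comp_assoc[OF prY(1) t(1) r(2)] E.comp_assoc[OF V.arrs(7) t(1) r(1)] S.pr_pair[OF u v] t(2) by simp
  qed
  have pairS: "pair C Z (gob P) (verts Q) p z \<in> Hom ?S (Z, z) ?YQ" if "p \<in> Hom C Z (gob P)" "z \<in> Hom C Z (verts Q)" for Z p z
    using E.pair_in[OF that] that prY by simp
  have etaS: "snd \<eta> \<cdot> u \<in> Hom C Z (gob P)" if "u \<in> Hom ?S (Z, z) ?\<Gamma>" for u Z z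
    using that V.arrs by auto
  have act: "left_action ?S ?H ?YQ b"
  proof (rule S.left_actionI[OF H oY])
    show "b \<in> Hom ?S (Prod ?S (gob ?H) ?YQ) ?YQ"
      unfolding gH W using b r(3) prY E.pr_pair(2)[OF rg r(3)] by (simp add: b_def)
    fix Zz :: "'o \<times> 'a" and v
    obtain Z z where Z: "Zz = (Z, z)" by (cases Zz)
    assume "v \<in> Hom ?S Zz ?YQ"
    then have v: "v \<in> Hom ?S (Z, z) ?YQ" by (simp add: Z)
    then have v': "v \<in> Hom C Z ?Y" "z \<in> Hom C Z (verts Q)" "pr2 C (gob P) (verts Q) \<cdot> v = z" by auto
    have pv: "pr1 C (gob P) (verts Q) \<cdot> v \<in> Hom C Z (gob P)" using v' by auto
    have ZO: "Z \<in> Obj C" using v' E.Hom_Obj by blast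
    { have e: "S.gone (Z, z) ?H \<in> Hom ?S (Z, z) ?\<Gamma>" using S.gone_in[OF H, of "(Z, z)"] v' unfolding gH by simp
      have "gop C Z P (snd \<eta> \<cdot> S.gone (Z, z) ?H) (snd \<eta> \<cdot> S.gone (Z, z) ?H) = gop C Z P (snd \<eta> \<cdot> S.gone (Z, z) ?H) (E.gone Z P)"
        using f[OF e e] S.gop_one_left[OF H, unfolded gH, OF e] E.gop_one_right[OF E.P etaS[OF e]] gH e
        by (simp del: slice_sel(4))
      then have "snd \<eta> \<cdot> S.gone (Z, z) ?H = E.gone Z P"
        using E.gop_cancel_left[OF E.P etaS[OF e] etaS[OF e] E.gone_in[OF E.P ZO]] by blast
      then show "b \<cdot>\<^bsub>?S\<^esub> pair ?S Zz (gob ?H) ?YQ (S.gone Zz ?H) v = v"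
        unfolding Z gH using bb[OF e v] E.ginv_gone[OF E.P ZO] E.gop_one_right[OF E.P pv] E.pair_eta[OF v'(1)] v'(3) by simp }
    fix g k assume "g \<in> Hom ?S Zz (gob ?H)" "k \<in> Hom ?S Zz (gob ?H)"
    then have g: "g \<in> Hom ?S (Z, z) ?\<Gamma>" and k: "k \<in> Hom ?S (Z, z) ?\<Gamma>" unfolding Z gH by auto
    have gk: "gop ?S (Z, z) ?H g k \<in> Hom ?S (Z, z) ?\<Gamma>" using S.gop_in[OF H, unfolded gH, OF g k] .
    note eg = etaS[OF g] and ek = etaS[OF k]
    note ig = E.ginv_in[OF E.P eg] and ik = E.ginv_in[OF E.P ek]
    have kv: "pair C Z (gob P) (verts Q) (gop C Z P (pr1 C (gob P) (verts Q) \<cdot> v) (ginv P \<cdot> (snd \<eta> \<cdot> k))) z \<in> Hom ?S (Z, z) ?YQ"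
      using pairS[OF E.gop_in[OF E.P pv ik] v'(2)] .
    show "b \<cdot>\<^bsub>?S\<^esub> pair ?S Zz (gob ?H) ?YQ (gop ?S Zz ?H g k) v =
       b \<cdot>\<^bsub>?S\<^esub> pair ?S Zz (gob ?H) ?YQ g (b \<cdot>\<^bsub>?S\<^esub> pair ?S Zz (gob ?H) ?YQ k v)"
      unfolding Z gH
      using bb[OF gk v] bb[OF k v] bb[OF g kv] f[OF g k] E.ginv_gop[OF E.P eg ek] E.gop_assoc[OF E.P pv ik ig]
        E.pr_pair(1)[OF E.gop_in[OF E.P pv ik] v'(2)] by simp
  qed
  let ?u = "pair C Z (gob P) (verts Q) p y" and ?v = "pair C Z (gob P) (verts Q) p' y'"
  note uv = E.pair_in[OF p(1) y(1)] E.pair_in[OF p(2) y(2)]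
  obtain Z' c g where c: "regular_epi C Z' Z c" "c \<in> Hom C Z' Z"
    "g \<in> Hom ?S (Z', pr2 C (gob P) (verts Q) \<cdot> (?v \<cdot> c)) ?\<Gamma>"
    "?u \<cdot> c = b \<cdot> pair ?S (Z', pr2 C (gob P) (verts Q) \<cdot> (?v \<cdot> c)) ?\<Gamma> ?YQ g (?v \<cdot> c)"
  proof (rule E.action_effective[OF V.objs(4) H gH act uv])
    fix T' t assume t: "t \<in> Hom C ?Y T'"
      and eq: "\<And>Z z g y. g \<in> Hom ?S (Z, z) ?\<Gamma> \<Longrightarrow> y \<in> Hom ?S (Z, z) ?YQ \<Longrightarrow> t \<cdot> (b \<cdot> pair ?S (Z, z) ?\<Gamma> ?YQ g y) = t \<cdot> y"
    let ?W = "Prod C (gob P) (verts \<Gamma>)" and ?p = "pr1 C (gob P) (verts \<Gamma>)" and ?w = "pr2 C (gob P) (verts \<Gamma>)"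
    have pr: "?p \<in> Hom C ?W (gob P)" "?w \<in> Hom C ?W (verts \<Gamma>)" by auto
    have gw: "snd \<gamma> \<cdot> ?w \<in> Hom C ?W (verts Q)" "snd \<eta> \<cdot> ?w \<in> Hom C ?W (gob P)" using pr V.arrs by auto
    have wS: "?w \<in> Hom ?S (?W, snd \<gamma> \<cdot> ?w) ?\<Gamma>" using pr gw V.arrs by simp
    note pe = E.gop_in[OF E.P pr(1) gw(2)]
    \<comment> \<open>Invariance is applied at the generic point
      \<open>(p \<eta>(w), \<gamma>(w))\<close>, which \<open>w\<close> moves to
      \<open>(p, \<gamma>(w))\<close>. So \<open>t\<close> coequalises the pair that defines
      \<open>T\<close> and factors through \<open>\<tau>\<close>.\<close>
    have "t \<cdot> pair C ?W (gob P) (verts Q) ?p (snd \<gamma> \<cdot> ?w) = t \<cdot> pair C ?W (gob P) (verts Q) (gop C ?W P ?p (snd \<eta> \<cdot> ?w)) (snd \<gamma> \<cdot> ?w)"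
      using eq[OF wS pairS[OF pe gw(1)]] bb[OF wS pairS[OF pe gw(1)]] E.pr_pair(1)[OF pe gw(1)] E.gop_inv_cancel(3)[OF E.P gw(2) pr(1)]
      by simp
    then obtain k where k: "k \<in> Hom C (verts T) T'" "k \<cdot> snd \<tau> = t" using E.is_coequaliser_factor[OF V.\<tau> t] by metis
    show "t \<cdot> ?u = t \<cdot> ?v"
      using E.comp_reduce[OF k(2) V.arrs(8) k(1) uv(1)] E.comp_reduce[OF k(2) V.arrs(8) k(1) uv(2)] e by simp
  qed
  have vc: "?v \<cdot> c = pair C Z' (gob P) (verts Q) (p' \<cdot> c) (y' \<cdot> c)" "?u \<cdot> c = pair C Z' (gob P) (verts Q) (p \<cdot> c) (y \<cdot> c)"
    using E.pair_comp[OF c(2) p(2) y(2)] E.pair_comp[OF c(2) p(1) y(1)] by auto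
  have pc: "p \<cdot> c \<in> Hom C Z' (gob P)" "p' \<cdot> c \<in> Hom C Z' (gob P)" "y \<cdot> c \<in> Hom C Z' (verts Q)" "y' \<cdot> c \<in> Hom C Z' (verts Q)"
    using p y c(2) by auto
  have base: "pr2 C (gob P) (verts Q) \<cdot> (?v \<cdot> c) = y' \<cdot> c" unfolding vc using E.pr_pair[OF pc(2,4)] by simp
  have g: "g \<in> Hom ?S (Z', y' \<cdot> c) ?\<Gamma>" using c(3) unfolding base .
  have "?u \<cdot> c = pair C Z' (gob P) (verts Q) (gop C Z' P (p' \<cdot> c) (ginv P \<cdot> (snd \<eta> \<cdot> g))) (y' \<cdot> c)"
    using c(4)[unfolded base, unfolded vc] bb[OF g pairS[OF pc(2,4)]] E.pr_pair(1)[OF pc(2,4)] unfolding vc by simp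
  then have "p \<cdot> c = gop C Z' P (p' \<cdot> c) (ginv P \<cdot> (snd \<eta> \<cdot> g))"
    unfolding vc(2) using E.pr_pair(1)[OF pc(1,3)] E.pr_pair(1)[OF E.gop_in[OF E.P pc(2) E.ginv_in[OF E.P etaS[OF g]]] pc(4)] by metis
  then show thesis using that[OF c(1,2), of g] g by simp
qed

text \<open>\<open>j\<close> and \<open>\<gamma>\<close> are jointly monic, so an element of a
  vertex group with trivial image in \<open>G\<close> is the unit of that vertex group, and
  \<open>\<eta>\<close> preserves units. Thus the kernel of \<open>\<phi>\<close> meets the images
  of the vertex groups trivially.\<close>

lemma eta_trivial:
  assumes w: "w \<in> Hom C Z (verts \<Gamma>)" and j: "snd j \<cdot> w = E.gone Z G"
  shows "snd \<eta> \<cdot> w = E.gone Z P"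
proof -
  let ?S = "slice C (verts Q)" let ?H = "vert_group C Q \<G>"
  interpret S: Fin_Lim ?S by (rule E.Fin_Lim_slice[OF V.objs(4)])
  note H = E.vert_group_object(1)[OF Q_Obj \<G>(1)] and gH = gob_vert_group[OF \<G>(2), of C Q]
  let ?z = "snd \<gamma> \<cdot> w" let ?e = "S.gone (Z, ?z) ?H"
  have z: "?z \<in> Hom C Z (verts Q)" using w V.arrs by auto
  have Z: "Z \<in> Obj C" using E.Hom_Obj(1)[OF w] .
  have e: "?e \<in> Hom ?S (Z, ?z) (verts \<Gamma>, snd \<gamma>)" using S.gone_in[OF H, of "(Z, ?z)"] z unfolding gH by simp
  then have e': "?e \<in> Hom C Z (verts \<Gamma>)" "snd \<gamma> \<cdot> ?e = ?z" by auto
  have ee: "snd \<eta> \<cdot> ?e \<in> Hom C Z (gob P)" using e' V.arrs by auto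
  have "gop C Z P (snd \<eta> \<cdot> ?e) (snd \<eta> \<cdot> ?e) = gop C Z P (snd \<eta> \<cdot> ?e) (E.gone Z P)"
    using fibre_hom_gop[OF fibre_eta, unfolded gH, OF e e] S.gop_one_left[OF H, unfolded gH, OF e]
      E.gop_one_right[OF E.P ee] by (simp del: slice_sel(4))
  then have 1: "snd \<eta> \<cdot> ?e = E.gone Z P"
    using E.gop_cancel_left[OF E.P ee ee E.gone_in[OF E.P Z]] by blast
  have "snd j \<cdot> ?e = snd j \<cdot> w" using V.phi_eta[OF e'(1)] 1 E.Grp_hom_one[OF E.\<phi> Z] j by simp
  then have "?e = w" using V.stab_ext[OF e'(1) w] e'(2) by blast
  then show ?thesis using 1 by simp
qed

text \<open>The coset map descends to the vertices of \<open>X\<close> because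
  \<open>j(u) = \<phi>(\<eta>(u))\<close>. Both ends of an edge \<open>g s(y)\<close> lie in the
  coset of \<open>g\<close>, as \<open>s\<close> is a map of graphs and the action commutes with
  \<open>d0\<close> and \<open>d1\<close>.\<close>

lemma phi_locally_surjective: "E.locally_surjective (gob P) (gob G) \<phi>"
proof -
  obtain R r where r: "r \<in> Hom C (gob G) R"
    and r1: "\<And>Z x l. x \<in> Hom C Z (gob G) \<Longrightarrow> l \<in> Hom C Z (gob P) \<Longrightarrow> r \<cdot> gop C Z G x (\<phi> \<cdot> l) = r \<cdot> x"
    and r2: "\<And>Z x. x \<in> Hom C Z (gob G) \<Longrightarrow> r \<cdot> x = r \<cdot> E.gone Z G \<Longrightarrow>
       \<exists>Z' c l. regular_epi C Z' Z c \<and> c \<in> Hom C Z' Z \<and> l \<in> Hom C Z' (gob P) \<and> \<phi> \<cdot> l = x \<cdot> c"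
    using E.coset_quotient[OF E.\<phi>] by metis
  have prV: "pr1 C (gob G) (verts Q) \<in> Hom C (Prod C (gob G) (verts Q)) (gob G)" by simp
  have k: "r \<cdot> pr1 C (gob G) (verts Q) \<in> Hom C (Prod C (gob G) (verts Q)) R" using r prV by auto
  have kp: "(r \<cdot> pr1 C (gob G) (verts Q)) \<cdot> pair C Z (gob G) (verts Q) g y = r \<cdot> g"
    if "g \<in> Hom C Z (gob G)" "y \<in> Hom C Z (verts Q)" for Z g y
    using E.comp_assoc[OF r E.pair_in[OF that] prV] E.pr_pair[OF that] by simp
  have keq: "(r \<cdot> pr1 C (gob G) (verts Q)) \<cdot> pair C Z (gob G) (verts Q) (gop C Z G g (snd j \<cdot> u)) (snd \<gamma> \<cdot> u) =
      (r \<cdot> pr1 C (gob G) (verts Q)) \<cdot> pair C Z (gob G) (verts Q) g (snd \<gamma> \<cdot> u)"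
    if g: "g \<in> Hom C Z (gob G)" and u: "u \<in> Hom C Z (verts \<Gamma>)" for Z g u
  proof -
    have i: "snd \<eta> \<cdot> u \<in> Hom C Z (gob P)" "snd \<gamma> \<cdot> u \<in> Hom C Z (verts Q)" "snd j \<cdot> u \<in> Hom C Z (gob G)"
      using u V.arrs by auto
    show ?thesis using kp[OF E.gop_in[OF E.G g i(3)] i(2)] kp[OF g i(2)] r1[OF g i(1)] V.phi_eta[OF u] by simp
  qed
  obtain \<xi> where \<xi>: "\<xi> \<in> Hom C (verts X) R"
    "\<And>Z g y. g \<in> Hom C Z (gob G) \<Longrightarrow> y \<in> Hom C Z (verts Q) \<Longrightarrow>
       \<xi> \<cdot> V.act Z g (snd s \<cdot> y) = (r \<cdot> pr1 C (gob G) (verts Q)) \<cdot> pair C Z (gob G) (verts Q) g y"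
    by (rule V.X_factor[OF k keq], assumption, assumption, rule that, assumption, blast)
  have d: "(\<xi> \<cdot> d X) \<cdot> E.act Z g (fst s \<cdot> y) = r \<cdot> g"
    if d: "d \<in> {d0, d1}" and g: "g \<in> Hom C Z (gob G)" and y: "y \<in> Hom C Z (edges Q)" for d Z g y
  proof -
    have sy: "fst s \<cdot> y \<in> Hom C Z (edges X)" "d Q \<cdot> y \<in> Hom C Z (verts Q)" using y E.arrs dQ[OF d] by auto
    show ?thesis
      using E.comp_assoc[OF \<xi>(1) E.act_in[OF g sy(1)] dX[OF d]] d_act[OF d g sy(1)] d_s[OF d y] \<xi>(2)[OF g sy(2)] kp[OF g sy(2)]
      by simp
  qed
  have x01: "\<xi> \<cdot> d0 X = \<xi> \<cdot> d1 X"
    by (rule E.X_ext) (use \<xi>(1) dX[of d0] dX[of d1] d[of d0] d[of d1] in auto)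
  have const: "r \<cdot> g = r \<cdot> E.gone Z G" if g: "g \<in> Hom C Z (gob G)" for Z g
  proof -
    have Z: "Z \<in> Obj C" using E.Hom_Obj(1)[OF g] .
    note o = E.gone_in[OF E.G Z]
    \<comment> \<open>Connectedness compares vertices, not elements of \<open>G\<close>; so
      \<open>g\<close> and the unit are compared through \<open>g s(y)\<close> and
      \<open>s(y)\<close> at a vertex \<open>y\<close>, which exists only locally.\<close>
    obtain Z' c y where c: "regular_epi C Z' Z c" "c \<in> Hom C Z' Z" "y \<in> Hom C Z' (verts Q)" using vertex_cover[OF Z] .
    have gc: "g \<cdot> c \<in> Hom C Z' (gob G)" "E.gone Z G \<cdot> c \<in> Hom C Z' (gob G)" "snd s \<cdot> y \<in> Hom C Z' (verts X)"
      using g o c V.arrs by auto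
    have "r \<cdot> (g \<cdot> c) = r \<cdot> (E.gone Z G \<cdot> c)"
      using const_on_X[OF \<xi>(1) x01 V.act_in[OF gc(1,3)] V.act_in[OF gc(2,3)]] \<xi>(2)[OF gc(1) c(3)] \<xi>(2)[OF gc(2) c(3)]
        kp[OF gc(1) c(3)] kp[OF gc(2) c(3)] by simp
    then have "(r \<cdot> g) \<cdot> c = (r \<cdot> E.gone Z G) \<cdot> c" using E.comp_assoc[OF r c(2) g] E.comp_assoc[OF r c(2) o] by simp
    then show ?thesis using E.regular_epi_cancel[OF c(1) E.comp_in[OF r g] E.comp_in[OF r o]] by blast
  qed
  show ?thesis unfolding E.locally_surjective_def using r2 const by blast
qed

text \<open>The product with \<open>\<pi>\<close> preserves the coequaliser that expresses
  connectedness of \<open>Q\<close>, so \<open>f\<close> depends on \<open>p\<close> alone. It is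
  then invariant under right multiplication by the vertex groups, which generate
  \<open>\<pi>\<close>.\<close>

lemma const_on_proj:
  assumes f: "f \<in> Hom C (Prod C (gob P) (verts Q)) W"
    and stab: "\<And>Z p u. p \<in> Hom C Z (gob P) \<Longrightarrow> u \<in> Hom C Z (verts \<Gamma>) \<Longrightarrow>
      f \<cdot> pair C Z (gob P) (verts Q) (gop C Z P p (snd \<eta> \<cdot> u)) (snd \<gamma> \<cdot> u) = f \<cdot> pair C Z (gob P) (verts Q) p (snd \<gamma> \<cdot> u)"
    and edge: "\<And>Z p e. p \<in> Hom C Z (gob P) \<Longrightarrow> e \<in> Hom C Z (edges Q) \<Longrightarrow>
      f \<cdot> pair C Z (gob P) (verts Q) p (d0 Q \<cdot> e) = f \<cdot> pair C Z (gob P) (verts Q) p (d1 Q \<cdot> e)"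
    and p: "p \<in> Hom C Z (gob P)" "p' \<in> Hom C Z (gob P)" and y: "y \<in> Hom C Z (verts Q)" "y' \<in> Hom C Z (verts Q)"
  shows "f \<cdot> pair C Z (gob P) (verts Q) p y = f \<cdot> pair C Z (gob P) (verts Q) p' y'"
proof -
  let ?P = "gob P" let ?B = "term_obj C"
  let ?WE = "Prod C ?P (edges Q)" and ?pE = "pr1 C ?P (edges Q)" and ?yE = "pr2 C ?P (edges Q)"
  let ?b = "pmap C ?P (verts Q) ?P ?B (Id C ?P) (bang C (verts Q))"
  have d: "d0 Q \<in> Hom C (edges Q) (verts Q)" "d1 Q \<in> Hom C (edges Q) (verts Q)" using dQ by auto
  have i: "Id C ?P \<in> Hom C ?P ?P" "bang C (verts Q) \<in> Hom C (verts Q) ?B" by auto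
  have c: "is_coequaliser C ?WE (Prod C ?P (verts Q)) (pmap C ?P (edges Q) ?P (verts Q) (Id C ?P) (d0 Q))
      (pmap C ?P (edges Q) ?P (verts Q) (Id C ?P) (d1 Q)) (Prod C ?P ?B) ?b"
    using E.Bass_Serre Q_connected E.objs(2) unfolding Bass_Serre_def products_preserve_coequalisers_def by blast
  have pr: "?pE \<in> Hom C ?WE ?P" "?yE \<in> Hom C ?WE (edges Q)" by auto
  have pm: "pmap C ?P (edges Q) ?P (verts Q) (Id C ?P) (d Q) = pair C ?WE ?P (verts Q) ?pE (d Q \<cdot> ?yE)" for d
    unfolding pmap_def using E.Id_comp[OF pr(1)] by simp
  have "f \<cdot> pmap C ?P (edges Q) ?P (verts Q) (Id C ?P) (d0 Q) = f \<cdot> pmap C ?P (edges Q) ?P (verts Q) (Id C ?P) (d1 Q)"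
    unfolding pm using edge[OF pr] .
  then obtain h where h: "h \<in> Hom C (Prod C ?P ?B) W" "h \<cdot> ?b = f" using E.is_coequaliser_factor[OF c f] by metis
  have b: "?b \<in> Hom C (Prod C ?P (verts Q)) (Prod C ?P ?B)" using i by auto
  have fp: "f \<cdot> pair C Z ?P (verts Q) p y = h \<cdot> pair C Z ?P ?B p (bang C Z)"
    if p: "p \<in> Hom C Z ?P" and y: "y \<in> Hom C Z (verts Q)" for Z p y
    using E.comp_reduce[OF h(2) b h(1) E.pair_in[OF p y]] E.pmap_pair[OF i p y] p y by simp
  \<comment> \<open>\<open>f\<close> as a function of \<open>p\<close>, through the identification
    of \<open>\<pi>\<close> with its product with the terminal object.\<close>
  let ?k = "h \<cdot> pair C ?P ?P ?B (Id C ?P) (bang C ?P)"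
  have bP: "bang C ?P \<in> Hom C ?P ?B" by simp
  have k: "?k \<in> Hom C ?P W" using E.comp_in[OF h(1) E.pair_in[OF i(1) bP]] .
  have kp: "?k \<cdot> p = h \<cdot> pair C Z ?P ?B p (bang C Z)" if p: "p \<in> Hom C Z ?P" for Z p
    using E.comp_assoc[OF h(1) p E.pair_in[OF i(1) bP]] E.pair_comp[OF p i(1) bP] p by simp
  have "?k \<cdot> p = ?k \<cdot> p'"
  proof (rule E.universal_vert_hom_generates[OF Q_Obj \<G> universal k _ p])
    fix Z p w assume p: "p \<in> Hom C Z ?P" and w: "w \<in> Hom C Z (verts \<Gamma>)"
    have i: "snd \<eta> \<cdot> w \<in> Hom C Z ?P" "snd \<gamma> \<cdot> w \<in> Hom C Z (verts Q)" using w V.arrs by auto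
    note g = E.gop_in[OF E.P p i(1)]
    show "?k \<cdot> gop C Z P p (snd \<eta> \<cdot> w) = ?k \<cdot> p"
      using kp[OF g] kp[OF p] fp[OF g i(2)] fp[OF p i(2)] stab[OF p w] by simp
  qed
  then show ?thesis using fp[OF p(1) y(1)] fp[OF p(2) y(2)] kp[OF p(1)] kp[OF p(2)] by simp
qed

text \<open>The local deviations glue to one map \<open>f\<close> on
  \<open>\<pi> \<times> VQ\<close>; \<open>stab\<close> and \<open>edge\<close> are what
  \<open>const_on_proj\<close> asks of it. Comparing its values at \<open>(n, y)\<close> and at
  \<open>(1, y)\<close> then gives \<open>f n = f\<close>, hence \<open>n = 1\<close>.\<close>

lemma kernel_trivial:
  assumes sec: "is_section (Graph C) T X \<Phi> \<sigma>" and n: "n \<in> Hom C Z (gob P)" "\<phi> \<cdot> n = E.gone Z G"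
  shows "n = E.gone Z P"
proof -
  have \<sigma>: "\<sigma> \<in> Hom (Graph C) X T" "\<Phi> \<cdot>\<^bsub>Graph C\<^esub> \<sigma> = Id (Graph C) X" using sec unfolding is_section_def by auto
  note \<sigma>' = Graph_HomD[OF \<sigma>(1)]
  have \<sigma>E: "fst \<Phi> \<cdot> fst \<sigma> = Id C (edges X)" and \<sigma>V: "snd \<Phi> \<cdot> snd \<sigma> = Id C (verts X)" using \<sigma>(2) by auto
  let ?dev = "V.deviation (snd \<sigma>)"
  \<comment> \<open>Equality of \<open>[n p, y]\<close> and \<open>[n' p, y]\<close> gives
    \<open>n p = n' p \<eta>(w)^(-1)\<close> on a cover. Under \<open>\<phi>\<close> both kernel
    elements disappear, leaving \<open>j(w) = 1\<close>, whence
    \<open>\<eta>(w) = 1\<close>.\<close>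
  have uniq: "n = n'" if dv: "?dev Z p y n" "?dev Z p y n'" and p: "p \<in> Hom C Z (gob P)" and y: "y \<in> Hom C Z (verts Q)" for Z p y n n'
  proof -
    have n: "n \<in> Hom C Z (gob P)" "n' \<in> Hom C Z (gob P)" "\<phi> \<cdot> n = E.gone Z G" "\<phi> \<cdot> n' = E.gone Z G"
      "V.proj Z (gop C Z P n p) y = V.proj Z (gop C Z P n' p) y"
      using dv unfolding V.deviation_def by simp_all
    note np = E.gop_in[OF E.P n(1) p] E.gop_in[OF E.P n(2) p]
    obtain Z' c w where c: "regular_epi C Z' Z c" "c \<in> Hom C Z' Z" "w \<in> Hom C Z' (verts \<Gamma>)" "snd \<gamma> \<cdot> w = y \<cdot> c"
      "gop C Z P n p \<cdot> c = gop C Z' P (gop C Z P n' p \<cdot> c) (ginv P \<cdot> (snd \<eta> \<cdot> w))"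
      using proj_effective[OF np y y n(5)] .
    have ew: "snd \<eta> \<cdot> w \<in> Hom C Z' (gob P)" "snd j \<cdot> w \<in> Hom C Z' (gob G)" using c(3) V.arrs by auto
    have fp: "\<phi> \<cdot> p \<in> Hom C Z (gob G)" using p E.phi_in by auto
    have fpc: "(\<phi> \<cdot> p) \<cdot> c \<in> Hom C Z' (gob G)" using fp c by auto
    have ph: "\<phi> \<cdot> (gop C Z P m p \<cdot> c) = (\<phi> \<cdot> p) \<cdot> c" if "m \<in> Hom C Z (gob P)" "\<phi> \<cdot> m = E.gone Z G" for m
      using E.comp_assoc[OF E.phi_in c(2) E.gop_in[OF E.P that(1) p]] E.Grp_hom_gop[OF E.\<phi> that(1) p] that(2)
        E.gop_one_left[OF E.G fp] by simp
    have npc: "gop C Z P n' p \<cdot> c \<in> Hom C Z' (gob P)" using np c by auto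
    have "gop C Z' G ((\<phi> \<cdot> p) \<cdot> c) (ginv G \<cdot> (snd j \<cdot> w)) = gop C Z' G ((\<phi> \<cdot> p) \<cdot> c) (E.gone Z' G)"
      using arg_cong[OF c(5), of "\<lambda>x. \<phi> \<cdot> x"] ph[OF n(1,3)] ph[OF n(2,4)] E.Grp_hom_gop[OF E.\<phi> npc E.ginv_in[OF E.P ew(1)]]
        E.Grp_hom_inv[OF E.\<phi> ew(1)] V.phi_eta[OF c(3)] E.gop_one_right[OF E.G fpc] by simp
    then have "ginv G \<cdot> (snd j \<cdot> w) = E.gone Z' G"
      using E.gop_cancel_left[OF E.G fpc E.ginv_in[OF E.G ew(2)] E.gone_in[OF E.G E.Hom_Obj(1)[OF ew(1)]]] by blast
    then have "snd j \<cdot> w = E.gone Z' G"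
      using E.ginv_ginv[OF E.G ew(2)] E.ginv_gone[OF E.G E.Hom_Obj(1)[OF ew(1)]] by simp
    then have "snd \<eta> \<cdot> w = E.gone Z' P" using eta_trivial[OF c(3)] by simp
    then have "gop C Z P n p \<cdot> c = gop C Z P n' p \<cdot> c"
      using c(5) E.ginv_gone[OF E.P E.Hom_Obj(1)[OF ew(1)]] E.gop_one_right[OF E.P npc] by simp
    then have "gop C Z P n p = gop C Z P n' p" using E.regular_epi_cancel[OF c(1) np] by blast
    then show ?thesis using E.gop_cancel_right[OF E.P p n(1,2)] by blast
  qed
  let ?W = "Prod C (gob P) (verts Q)" and ?p = "pr1 C (gob P) (verts Q)" and ?y = "pr2 C (gob P) (verts Q)"
  have pr: "?p \<in> Hom C ?W (gob P)" "?y \<in> Hom C ?W (verts Q)" by auto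
  \<comment> \<open>The deviation at the generic point \<open>(p, y)\<close> of
    \<open>\<pi> \<times> VQ\<close>, so far available only on a cover.\<close>
  obtain W c n0 where c: "regular_epi C W ?W c" "c \<in> Hom C W ?W" "?dev W (?p \<cdot> c) (?y \<cdot> c) n0"
    using V.deviation_exists[OF \<sigma>'(2) \<sigma>V pr] .
  have n0: "n0 \<in> Hom C W (gob P)" using c(3) unfolding V.deviation_def by blast
  have pc: "?p \<cdot> c \<in> Hom C W (gob P)" "?y \<cdot> c \<in> Hom C W (verts Q)" using pr c(2) by auto
  \<comment> \<open>Two restrictions of \<open>n0\<close> over the same point are both deviations
    there, so by uniqueness they agree and \<open>n0\<close> descends to \<open>f\<close>.\<close>
  have "n0 \<cdot> k = n0 \<cdot> l" if k: "k \<in> Hom C Y W" and l: "l \<in> Hom C Y W" and kl: "c \<cdot> k = c \<cdot> l" for Y k l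
  proof (rule uniq)
    show "?dev Y ((?p \<cdot> c) \<cdot> k) ((?y \<cdot> c) \<cdot> k) (n0 \<cdot> k)" using V.deviation_comp[OF c(3) \<sigma>'(2) pc k] .
    show "?dev Y ((?p \<cdot> c) \<cdot> k) ((?y \<cdot> c) \<cdot> k) (n0 \<cdot> l)"
      using V.deviation_comp[OF c(3) \<sigma>'(2) pc l] E.comp_assoc[OF pr(1) k c(2)] E.comp_assoc[OF pr(1) l c(2)]
        E.comp_assoc[OF pr(2) k c(2)] E.comp_assoc[OF pr(2) l c(2)] kl by simp
  qed (use pc k in auto)
  then obtain f where f: "f \<in> Hom C ?W (gob P)" "f \<cdot> c = n0" using E.regular_epi_descent[OF c(1) n0] by metis
  have fdev0: "?dev ?W ?p ?y f"
  proof -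
    have fp: "\<phi> \<cdot> ?p \<in> Hom C ?W (gob G)" "snd s \<cdot> ?y \<in> Hom C ?W (verts X)" using pr V.arrs by auto
    have d: "\<phi> \<cdot> n0 = E.gone W G" "V.proj W (gop C W P n0 (?p \<cdot> c)) (?y \<cdot> c) = snd \<sigma> \<cdot> V.act W (\<phi> \<cdot> (?p \<cdot> c)) (snd s \<cdot> (?y \<cdot> c))"
      using c(3) unfolding V.deviation_def by auto
    have oW: "?W \<in> Obj C" by simp
    have "(\<phi> \<cdot> f) \<cdot> c = E.gone ?W G \<cdot> c" using E.comp_assoc[OF E.phi_in c(2) f(1)] f(2) d(1) E.gone_comp[OF E.G c(2)] by simp
    then have 1: "\<phi> \<cdot> f = E.gone ?W G"
      using E.regular_epi_cancel[OF c(1) E.comp_in[OF E.phi_in f(1)] E.gone_in[OF E.G oW]] by blast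
    note g = E.gop_in[OF E.P f(1) pr(1)]
    have "V.proj ?W (gop C ?W P f ?p) ?y \<cdot> c = (snd \<sigma> \<cdot> V.act ?W (\<phi> \<cdot> ?p) (snd s \<cdot> ?y)) \<cdot> c"
      using V.proj_comp[OF c(2) g pr(2)] E.gop_comp[OF E.P c(2) f(1) pr(1)] f(2) d(2) E.comp_assoc[OF \<sigma>'(2) c(2) V.act_in[OF fp]]
        V.act_comp[OF c(2) fp] E.comp_assoc[OF E.phi_in c(2) pr(1)] E.comp_assoc[OF V.s(1) c(2) pr(2)] by simp
    then have "V.proj ?W (gop C ?W P f ?p) ?y = snd \<sigma> \<cdot> V.act ?W (\<phi> \<cdot> ?p) (snd s \<cdot> ?y)"
      using E.regular_epi_cancel[OF c(1) V.proj_in[OF g pr(2)] E.comp_in[OF \<sigma>'(2) V.act_in[OF fp]]] by blast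
    then show ?thesis unfolding V.deviation_def using f 1 by simp
  qed
  have fdev: "?dev Z p y (f \<cdot> pair C Z (gob P) (verts Q) p y)" if p: "p \<in> Hom C Z (gob P)" and y: "y \<in> Hom C Z (verts Q)" for Z p y
    using V.deviation_comp[OF fdev0 \<sigma>'(2) pr E.pair_in[OF p y]] E.pr_pair[OF p y] by simp
  \<comment> \<open>Passing from \<open>p\<close> to \<open>p \<eta>(u)\<close> changes neither
    \<open>\<phi>(p) s(y)\<close> nor the class \<open>[n p, y]\<close>, where
    \<open>y = \<gamma>(u)\<close>. So the old deviation also serves at the new point.\<close>
  have stab: "f \<cdot> pair C Z (gob P) (verts Q) (gop C Z P p (snd \<eta> \<cdot> u)) (snd \<gamma> \<cdot> u) = f \<cdot> pair C Z (gob P) (verts Q) p (snd \<gamma> \<cdot> u)"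
    if p: "p \<in> Hom C Z (gob P)" and u: "u \<in> Hom C Z (verts \<Gamma>)" for Z p u
  proof -
    have i: "snd \<eta> \<cdot> u \<in> Hom C Z (gob P)" "snd \<gamma> \<cdot> u \<in> Hom C Z (verts Q)" "snd j \<cdot> u \<in> Hom C Z (gob G)"
      "\<phi> \<cdot> p \<in> Hom C Z (gob G)" using u p V.arrs by auto
    have sy: "snd s \<cdot> (snd \<gamma> \<cdot> u) \<in> Hom C Z (verts X)" using i V.arrs by auto
    let ?m = "f \<cdot> pair C Z (gob P) (verts Q) p (snd \<gamma> \<cdot> u)"
    have m: "?m \<in> Hom C Z (gob P)" "\<phi> \<cdot> ?m = E.gone Z G" "V.proj Z (gop C Z P ?m p) (snd \<gamma> \<cdot> u) = snd \<sigma> \<cdot> V.act Z (\<phi> \<cdot> p) (snd s \<cdot> (snd \<gamma> \<cdot> u))"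
      using fdev[OF p i(2)] unfolding V.deviation_def by auto
    note pu = E.gop_in[OF E.P p i(1)]
    have "V.act Z (\<phi> \<cdot> gop C Z P p (snd \<eta> \<cdot> u)) (snd s \<cdot> (snd \<gamma> \<cdot> u)) = V.act Z (\<phi> \<cdot> p) (snd s \<cdot> (snd \<gamma> \<cdot> u))"
      using E.Grp_hom_gop[OF E.\<phi> p i(1)] V.phi_eta[OF u] V.act_gop[OF i(4,3) sy] V.act_stab[OF u] by simp
    then have "?dev Z (gop C Z P p (snd \<eta> \<cdot> u)) (snd \<gamma> \<cdot> u) ?m"
      unfolding V.deviation_def using m E.gop_assoc[OF E.P m(1) p i(1)] V.proj_stab[OF u E.gop_in[OF E.P m(1) p]] by simp
    from uniq[OF fdev[OF pu i(2)] this pu i(2)] show ?thesis .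
  qed
  \<comment> \<open>A deviation \<open>m\<close> at an edge is, by compatibility of the edge and
    vertex components of the section with \<open>d0\<close> and \<open>d1\<close>, a deviation at
    both ends. Uniqueness on vertices then identifies it with the two values of
    \<open>f\<close>.\<close>
  have edge: "f \<cdot> pair C Z (gob P) (verts Q) p (d0 Q \<cdot> e) = f \<cdot> pair C Z (gob P) (verts Q) p (d1 Q \<cdot> e)"
    if p: "p \<in> Hom C Z (gob P)" and e: "e \<in> Hom C Z (edges Q)" for Z p e
  proof -
    obtain Z' c m where c: "regular_epi C Z' Z c" "c \<in> Hom C Z' Z" "E.deviation (fst \<sigma>) Z' (p \<cdot> c) (e \<cdot> c) m"
      using E.deviation_exists[OF \<sigma>'(1) \<sigma>E p e] .
    have m: "m \<in> Hom C Z' (gob P)" "\<phi> \<cdot> m = E.gone Z' G"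
      "E.proj Z' (gop C Z' P m (p \<cdot> c)) (e \<cdot> c) = fst \<sigma> \<cdot> E.act Z' (\<phi> \<cdot> (p \<cdot> c)) (fst s \<cdot> (e \<cdot> c))"
      using c(3) unfolding E.deviation_def by auto
    have pc: "p \<cdot> c \<in> Hom C Z' (gob P)" "e \<cdot> c \<in> Hom C Z' (edges Q)" using p e c by auto
    have fs: "\<phi> \<cdot> (p \<cdot> c) \<in> Hom C Z' (gob G)" "fst s \<cdot> (e \<cdot> c) \<in> Hom C Z' (edges X)" using pc E.arrs by auto
    have fm: "(f \<cdot> pair C Z (gob P) (verts Q) p (d Q \<cdot> e)) \<cdot> c = m" if d: "d \<in> {d0, d1}" for d
    proof -
      have de: "d Q \<cdot> e \<in> Hom C Z (verts Q)" "d Q \<cdot> (e \<cdot> c) \<in> Hom C Z' (verts Q)" using dQ[OF d] e pc by auto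
      have ds: "d T \<cdot> fst \<sigma> = snd \<sigma> \<cdot> d X" using d \<sigma>' by auto
      have "V.proj Z' (gop C Z' P m (p \<cdot> c)) (d Q \<cdot> (e \<cdot> c)) = snd \<sigma> \<cdot> V.act Z' (\<phi> \<cdot> (p \<cdot> c)) (snd s \<cdot> (d Q \<cdot> (e \<cdot> c)))"
        using d_proj[OF d E.gop_in[OF E.P m(1) pc(1)] pc(2)] m(3) E.comp_reduce[OF ds \<sigma>'(1) dT[OF d] E.act_in[OF fs]]
          E.comp_assoc[OF \<sigma>'(2) E.act_in[OF fs] dX[OF d]] d_act[OF d fs] d_s[OF d pc(2)] by simp
      then have "?dev Z' (p \<cdot> c) (d Q \<cdot> (e \<cdot> c)) m" unfolding V.deviation_def using m by simp
      moreover have "?dev Z' (p \<cdot> c) (d Q \<cdot> (e \<cdot> c)) ((f \<cdot> pair C Z (gob P) (verts Q) p (d Q \<cdot> e)) \<cdot> c)"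
        using V.deviation_comp[OF fdev[OF p de(1)] \<sigma>'(2) p de(1) c(2)] E.comp_assoc[OF dQ[OF d] c(2) e] by simp
      ultimately show ?thesis using uniq pc(1) de(2) by blast
    qed
    have de: "d0 Q \<cdot> e \<in> Hom C Z (verts Q)" "d1 Q \<cdot> e \<in> Hom C Z (verts Q)" using dQ[of d0] dQ[of d1] e by auto
    show ?thesis
      using E.regular_epi_cancel[OF c(1) E.comp_in[OF f(1) E.pair_in[OF p de(1)]] E.comp_in[OF f(1) E.pair_in[OF p de(2)]]]
        fm[of d0] fm[of d1] by simp
  qed
  have Z: "Z \<in> Obj C" using E.Hom_Obj(1)[OF n(1)] .
  obtain Z' c y where c: "regular_epi C Z' Z c" "c \<in> Hom C Z' Z" "y \<in> Hom C Z' (verts Q)" using vertex_cover[OF Z] .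
  have Z': "Z' \<in> Obj C" using E.Hom_Obj(1)[OF c(2)] .
  note o = E.gone_in[OF E.P Z']
  have nc: "n \<cdot> c \<in> Hom C Z' (gob P)" "\<phi> \<cdot> (n \<cdot> c) = E.gone Z' G"
    using n c(2) E.comp_assoc[OF E.phi_in c(2) n(1)] E.gone_comp[OF E.G c(2)] by auto
  let ?m = "f \<cdot> pair C Z' (gob P) (verts Q) (n \<cdot> c) y"
  have m: "?m \<in> Hom C Z' (gob P)" "\<phi> \<cdot> ?m = E.gone Z' G" "V.proj Z' (gop C Z' P ?m (n \<cdot> c)) y = snd \<sigma> \<cdot> V.act Z' (\<phi> \<cdot> (n \<cdot> c)) (snd s \<cdot> y)"
    using fdev[OF nc(1) c(3)] unfolding V.deviation_def by auto
  note mn = E.gop_in[OF E.P m(1) nc(1)]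
  \<comment> \<open>Since \<open>\<phi>(n) = 1\<close>, the section takes the same value for
    \<open>p = n\<close> and for \<open>p = 1\<close>; hence \<open>f(n, y) n\<close> is a deviation
    at \<open>(1, y)\<close>.\<close>
  have "?dev Z' (E.gone Z' P) y (gop C Z' P ?m (n \<cdot> c))"
    unfolding V.deviation_def
    using mn m nc E.Grp_hom_gop[OF E.\<phi> m(1) nc(1)] E.gop_one_left[OF E.G E.gone_in[OF E.G Z']] E.gop_one_right[OF E.P mn]
      E.Grp_hom_one[OF E.\<phi> Z'] by simp
  from uniq[OF this fdev[OF o c(3)] o c(3)] have "gop C Z' P ?m (n \<cdot> c) = gop C Z' P ?m (E.gone Z' P)"
    using const_on_proj[OF f(1) stab edge nc(1) o c(3,3)] E.gop_one_right[OF E.P m(1)] by simp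
  then have "n \<cdot> c = E.gone Z P \<cdot> c"
    using E.gop_cancel_left[OF E.P m(1) nc(1) o] E.gone_comp[OF E.P c(2)] by simp
  then show ?thesis using E.regular_epi_cancel[OF c(1) n(1) E.gone_in[OF E.P Z]] by blast
qed

text \<open>A trivial kernel makes \<open>\<phi>\<close> injective on elements. The local preimages
  of the generic element of \<open>G\<close>, which exist by local surjectivity, are then unique on
  overlaps and descend to an inverse.\<close>

lemma iso_phi:
  assumes sec: "is_section (Graph C) T X \<Phi> \<sigma>"
  shows "is_iso C (gob P) (gob G) \<phi>"
proof -
  have inj: "x = y" if x: "x \<in> Hom C Z (gob P)" and y: "y \<in> Hom C Z (gob P)" and e: "\<phi> \<cdot> x = \<phi> \<cdot> y" for Z x y
  proof -
    have fx: "\<phi> \<cdot> y \<in> Hom C Z (gob G)" using y E.phi_in by auto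
    note i = E.ginv_in[OF E.P y]
    have "\<phi> \<cdot> gop C Z P x (ginv P \<cdot> y) = E.gone Z G"
      using E.Grp_hom_gop[OF E.\<phi> x i] E.Grp_hom_inv[OF E.\<phi> y] e E.gop_inv_right[OF E.G fx] by simp
    then have "gop C Z P x (ginv P \<cdot> y) = gop C Z P y (ginv P \<cdot> y)"
      using kernel_trivial[OF sec E.gop_in[OF E.P x i]] E.gop_inv_right[OF E.P y] by simp
    then show ?thesis using E.gop_cancel_right[OF E.P i x y] by blast
  qed
  have idG: "Id C (gob G) \<in> Hom C (gob G) (gob G)" by simp
  obtain Z c p where c: "regular_epi C Z (gob G) c" "c \<in> Hom C Z (gob G)" "p \<in> Hom C Z (gob P)" "\<phi> \<cdot> p = Id C (gob G) \<cdot> c"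
    using E.locally_surjectiveE[OF phi_locally_surjective idG] .
  have "p \<cdot> k = p \<cdot> l" if k: "k \<in> Hom C Y Z" and l: "l \<in> Hom C Y Z" and "c \<cdot> k = c \<cdot> l" for Y k l
    by (rule inj[of _ Y]) (use that c E.comp_assoc[OF E.phi_in k c(3)] E.comp_assoc[OF E.phi_in l c(3)] in auto)
  then obtain \<psi> where \<psi>: "\<psi> \<in> Hom C (gob G) (gob P)" "\<psi> \<cdot> c = p" using E.regular_epi_descent[OF c(1,3)] by metis
  have "(\<phi> \<cdot> \<psi>) \<cdot> c = Id C (gob G) \<cdot> c" using E.comp_assoc[OF E.phi_in c(2) \<psi>(1)] \<psi>(2) c(4) by simp
  then have 1: "\<phi> \<cdot> \<psi> = Id C (gob G)"
    using E.regular_epi_cancel[OF c(1) E.comp_in[OF E.phi_in \<psi>(1)] idG] by blast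
  have "\<psi> \<cdot> \<phi> = Id C (gob P)"
    by (rule inj[of _ "gob P"]) (use \<psi> E.phi_in E.comp_reduce[OF 1 \<psi>(1) E.phi_in E.phi_in] in auto)
  then show ?thesis unfolding is_iso_def using 1 \<psi> E.phi_in by blast
qed

text \<open>The inverses on edges and on vertices form a map of graphs automatically, because
  commutation with \<open>d0\<close> and \<open>d1\<close> may be checked after composing with the
  invertible vertex component of \<open>\<Phi>\<close>.\<close>

lemma iso_Phi:
  assumes "is_iso C (gob P) (gob G) \<phi>"
  shows "is_iso (Graph C) T X \<Phi>"
proof -
  obtain k where k: "k \<in> Hom C (edges X) (edges T)" "k \<cdot> fst \<Phi> = Id C (edges T)" "fst \<Phi> \<cdot> k = Id C (edges X)"
    using E.iso_Phi[OF assms] unfolding is_iso_def by blast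
  obtain l where l: "l \<in> Hom C (verts X) (verts T)" "l \<cdot> snd \<Phi> = Id C (verts T)" "snd \<Phi> \<cdot> l = Id C (verts X)"
    using V.iso_Phi[OF assms] unfolding is_iso_def by blast
  note \<Phi>' = Graph_HomD[OF \<Phi>_graph]
  have d: "d T \<cdot> k = l \<cdot> d X" if d: "d \<in> {d0, d1}" for d
  proof -
    have dt: "d T \<cdot> k \<in> Hom C (edges X) (verts T)" using dT[OF d] k by auto
    have e: "d X \<cdot> fst \<Phi> = snd \<Phi> \<cdot> d T" using d \<Phi>' by auto
    have "d T \<cdot> k = l \<cdot> (snd \<Phi> \<cdot> (d T \<cdot> k))" using E.comp_reduce[OF l(2) \<Phi>'(2) l(1) dt] dt by simp
    also have "snd \<Phi> \<cdot> (d T \<cdot> k) = d X \<cdot> (fst \<Phi> \<cdot> k)"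
      using E.comp_reduce[OF e \<Phi>'(1) dX[OF d] k(1)] E.comp_assoc[OF \<Phi>'(2) k(1) dT[OF d]] by simp
    finally show ?thesis using k(3) dX[OF d] by simp
  qed
  have "(k, l) \<in> Hom (Graph C) X T"
    using d[of d0] d[of d1] dX[of d0] dX[of d1] dT[of d0] dT[of d1] k l by (simp add: Graph_Hom)
  then show ?thesis unfolding is_iso_def using \<Phi>_graph k l by (intro conjI bexI[of _ "(k, l)"]) auto
qed

end

section \<open>The graph of groups of an action\<close>

declare Graph_sel [simp del]

lemma (in Fin_Lim) Delta_group:
  assumes K: "group_object C K" and Q: "Q \<in> Obj (Graph C)"
  shows Delta_group_object: "group_object (slice (Graph C) Q) (Delta C Q K)"
    and gob_Delta: "gob (Delta C Q K) = (times_graph C (gob K) Q, times_pr2 C (gob K) Q)"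
    and Delta_gop: "\<And>Z z x y. x \<in> Hom (Graph C) Z (times_graph C (gob K) Q) \<Longrightarrow>
      y \<in> Hom (Graph C) Z (times_graph C (gob K) Q) \<Longrightarrow>
      times_pr2 C (gob K) Q \<cdot>\<^bsub>Graph C\<^esub> x = z \<Longrightarrow> times_pr2 C (gob K) Q \<cdot>\<^bsub>Graph C\<^esub> y = z \<Longrightarrow>
      times_pr1 C (gob K) Q \<cdot>\<^bsub>Graph C\<^esub> gop (slice (Graph C) Q) (Z, z) (Delta C Q K) x y =
      gop (Graph C) Z (const_group C K) (times_pr1 C (gob K) Q \<cdot>\<^bsub>Graph C\<^esub> x) (times_pr1 C (gob K) Q \<cdot>\<^bsub>Graph C\<^esub> y)"
    and Delta_inv: "\<And>Z x. x \<in> Hom (Graph C) Z (times_graph C (gob K) Q) \<Longrightarrow>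
      times_pr1 C (gob K) Q \<cdot>\<^bsub>Graph C\<^esub> (ginv (Delta C Q K) \<cdot>\<^bsub>Graph C\<^esub> x) =
      (ginv K, ginv K) \<cdot>\<^bsub>Graph C\<^esub> (times_pr1 C (gob K) Q \<cdot>\<^bsub>Graph C\<^esub> x)"
    and Delta_unit: "times_pr1 C (gob K) Q \<cdot>\<^bsub>Graph C\<^esub> gunit (Delta C Q K) =
      (gone (edges (fst (term_obj (slice (Graph C) Q)))) K, gone (verts (fst (term_obj (slice (Graph C) Q)))) K)"
proof -
  interpret G: Fin_Lim "Graph C" by (rule Fin_Lim_Graph)
  interpret S: Fin_Lim "slice (Graph C) Q" by (rule G.Fin_Lim_slice[OF Q])
  have P: "is_product (Graph C) (gob (const_group C K)) Q (times_graph C (gob K) Q) (times_pr1 C (gob K) Q) (times_pr2 C (gob K) Q)"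
    unfolding gob_const_group[OF K] using times_graph_product[OF group_object_hom(1)[OF K] Q] .
  note F = G.family_group[OF const_group_object[OF K] P Q, folded Delta_def]
  show "group_object (slice (Graph C) Q) (Delta C Q K)"
    "gob (Delta C Q K) = (times_graph C (gob K) Q, times_pr2 C (gob K) Q)" using F(1,2) by auto
  show "\<And>Z z x y. x \<in> Hom (Graph C) Z (times_graph C (gob K) Q) \<Longrightarrow>
      y \<in> Hom (Graph C) Z (times_graph C (gob K) Q) \<Longrightarrow>
      times_pr2 C (gob K) Q \<cdot>\<^bsub>Graph C\<^esub> x = z \<Longrightarrow> times_pr2 C (gob K) Q \<cdot>\<^bsub>Graph C\<^esub> y = z \<Longrightarrow>
      times_pr1 C (gob K) Q \<cdot>\<^bsub>Graph C\<^esub> gop (slice (Graph C) Q) (Z, z) (Delta C Q K) x y =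
      gop (Graph C) Z (const_group C K) (times_pr1 C (gob K) Q \<cdot>\<^bsub>Graph C\<^esub> x) (times_pr1 C (gob K) Q \<cdot>\<^bsub>Graph C\<^esub> y)"
    using F(3) by blast
  have "ginv (const_group C K) = (ginv K, ginv K)" by (simp add: const_group_def Let_def)
  then show "\<And>Z x. x \<in> Hom (Graph C) Z (times_graph C (gob K) Q) \<Longrightarrow>
      times_pr1 C (gob K) Q \<cdot>\<^bsub>Graph C\<^esub> (ginv (Delta C Q K) \<cdot>\<^bsub>Graph C\<^esub> x) =
      (ginv K, ginv K) \<cdot>\<^bsub>Graph C\<^esub> (times_pr1 C (gob K) Q \<cdot>\<^bsub>Graph C\<^esub> x)" using F(4) by simp
  let ?U = "fst (term_obj (slice (Graph C) Q))"
  have "?U \<in> Obj (Graph C)" using S.term_Obj G.Hom_Obj(1) by (metis prod.collapse slice_sel(1))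
  note b = Graph_HomD[OF G.bang_in[OF this]]
  have "gunit (const_group C K) = (gone (edges (term_obj (Graph C))) K, gone (verts (term_obj (Graph C))) K)"
    by (simp add: const_group_def Let_def)
  then show "times_pr1 C (gob K) Q \<cdot>\<^bsub>Graph C\<^esub> gunit (Delta C Q K) = (gone (edges ?U) K, gone (verts ?U) K)"
    using F(5) gone_comp[OF K b(1)] gone_comp[OF K b(2)] by (simp add: Graph_sel)
qed

text \<open>The two components of the data of a graph are treated uniformly.\<close>

definition component :: "(('o, 'a) graph \<Rightarrow> 'o) \<Rightarrow> ('a \<times> 'a \<Rightarrow> 'a) \<Rightarrow> bool" where
  "component ob ar \<longleftrightarrow> ob = edges \<and> ar = fst \<or> ob = verts \<and> ar = snd"

lemma component_simps:
  assumes "component ob ar"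
  shows "ar (g \<cdot>\<^bsub>Graph C\<^esub> f) = ar g \<cdot>\<^bsub>C\<^esub> ar f" "ar (Id (Graph C) X) = Id C (ob X)"
    "ar (times_pr1 C A X) = pr1 C A (ob X)" "ar (times_pr2 C A X) = pr2 C A (ob X)"
    "ob (times_graph C A X) = Prod C A (ob X)" "ob (const_graph C A) = A" "ar (x, x) = x"
    "ar (times_map C A X B Y k h) = pmap C A (ob X) B (ob Y) k (ar h)"
  using assms unfolding component_def
  by (auto simp: Graph_sel times_pr1_def times_pr2_def times_graph_def const_graph_def times_map_def)

lemma component_hom: "component ob ar \<Longrightarrow> f \<in> Hom (Graph C) X Y \<Longrightarrow> ar f \<in> Hom C (ob X) (ob Y)"
  unfolding component_def by (auto dest: Graph_HomD(1,2))

lemma component_eqI: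
  assumes "\<And>ob ar. component ob ar \<Longrightarrow> ar f = ar g"
  shows "f = g"
  using assms[of edges fst] assms[of verts snd] by (auto simp: component_def prod_eq_iff)

lemma (in Fin_Lim) component_const_gop:
  assumes "component ob ar" "group_object C K"
    "x \<in> Hom (Graph C) Z (const_graph C (gob K))" "y \<in> Hom (Graph C) Z (const_graph C (gob K))"
  shows "ar (gop (Graph C) Z (const_group C K) x y) = gop C (ob Z) K (ar x) (ar y)"
  using const_group_gop[OF assms(2-4)] assms(1) unfolding component_def by auto

text \<open>The situation of the theorem with its chosen constructions. The aim is to show, in
  \<open>graph_level\<close>, that these satisfy the abstract assumptions under which the argument
  was carried out.\<close>

locale action_setup = Bass_Serre_Cat C for C :: "('o, 'a) cat" (structure) +
  fixes G :: "('o, 'a) grp" and X :: "('o, 'a) graph" and a s :: "'a \<times> 'a"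
  assumes G: "group_object C G" and action: "graph_action C G X a" and connected: "connected C X"
    and sec: "is_section (Graph C) X (quotient_graph C G X a) (quotient_map C G X a) s"
begin

abbreviation "Q \<equiv> quotient_graph C G X a"
abbreviation "q \<equiv> quotient_map C G X a"
abbreviation "GX \<equiv> times_graph C (gob G) X"
abbreviation "S \<equiv> fst (stabiliser_eq C G X a)"
abbreviation "e \<equiv> snd (stabiliser_eq C G X a)"
abbreviation "\<epsilon> \<equiv> times_pr2 C (gob G) X \<cdot>\<^bsub>Graph C\<^esub> e"
abbreviation "K \<equiv> stabiliser C G X a"
abbreviation "\<G> \<equiv> action_gog C G X a s"
abbreviation "\<Gamma> \<equiv> fst (pullback_cone (Graph C) Q X s K)"
abbreviation "t \<equiv> fst (snd (pullback_cone (Graph C) Q X s K))"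
abbreviation "\<gamma> \<equiv> snd (snd (pullback_cone (Graph C) Q X s K))"
text \<open>The element of \<open>G\<close> underlying an element of
  \<open>s\<^sup>*G\<^sub>X\<close>.\<close>

abbreviation "j \<equiv> times_pr1 C (gob G) X \<cdot>\<^bsub>Graph C\<^esub> (e \<cdot>\<^bsub>Graph C\<^esub> t)"
abbreviation "\<pi> \<equiv> pi1 C Q \<G>"
abbreviation "unit \<equiv> pi1_unit C Q \<G>"
abbreviation "\<eta> \<equiv> times_pr1 C (gob \<pi>) Q \<cdot>\<^bsub>Graph C\<^esub> unit"
abbreviation "\<phi> \<equiv> canonical_hom C G X a s"
abbreviation "T \<equiv> standard_graph C Q \<G>"
abbreviation "\<tau> \<equiv> standard_proj C Q \<G>"
abbreviation "\<Phi> \<equiv> canonical_map C G X a s"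

section \<open>The stabiliser and the graph of groups as group objects\<close>

lemma X_Obj: "X \<in> Obj (Graph C)"
  using action unfolding graph_action_def by blast

lemma action_component: "component ob ar \<Longrightarrow> left_action C G (ob X) (ar a)"
  using action unfolding graph_action_def component_def by auto

lemma a_graph: "a \<in> Hom (Graph C) GX X"
  using action times_graph_Obj[OF group_object_hom(1)[OF G] X_Obj] X_Obj left_action_hom(2)
  unfolding graph_action_def Graph_Hom by auto

lemma GX_product: "is_product (Graph C) (const_graph C (gob G)) X GX (times_pr1 C (gob G) X) (times_pr2 C (gob G) X)"
  using times_graph_product[OF group_object_hom(1)[OF G] X_Obj] .

lemma times_pr_graph:
  "times_pr1 C (gob G) X \<in> Hom (Graph C) GX (const_graph C (gob G))" "times_pr2 C (gob G) X \<in> Hom (Graph C) GX X"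
proof -
  interpret GF: Fin_Lim "Graph C" by (rule Fin_Lim_Graph)
  show "times_pr1 C (gob G) X \<in> Hom (Graph C) GX (const_graph C (gob G))" "times_pr2 C (gob G) X \<in> Hom (Graph C) GX X"
    using GF.is_product_hom[OF GX_product] by auto
qed

lemma quotient_coequaliser: "is_coequaliser (Graph C) GX X a (times_pr2 C (gob G) X) Q q"
proof -
  interpret GF: Fin_Lim "Graph C" by (rule Fin_Lim_Graph)
  obtain Q' q' where "is_coequaliser (Graph C) GX X a (times_pr2 C (gob G) X) Q' q'"
    using has_coequalisers_Graph[OF coequalisers] a_graph times_pr_graph(2) unfolding has_coequalisers_def by blast
  from GF.coequaliser_exists[OF this] show ?thesis unfolding quotient_graph_def quotient_map_def quotient_def .
qed

lemma s_graph: "s \<in> Hom (Graph C) Q X" "q \<cdot>\<^bsub>Graph C\<^esub> s = Id (Graph C) Q" and q_graph: "q \<in> Hom (Graph C) X Q"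
  using sec unfolding is_section_def by auto

lemma Q_Obj: "Q \<in> Obj (Graph C)"
  using q_graph by (simp add: Graph_Hom)

lemma stabiliser_equaliser: "is_equaliser (Graph C) GX X a (times_pr2 C (gob G) X) S e"
proof -
  interpret GF: Fin_Lim "Graph C" by (rule Fin_Lim_Graph)
  obtain E e' where "is_equaliser (Graph C) GX X a (times_pr2 C (gob G) X) E e'"
    using GF.ex_equaliser[OF a_graph times_pr_graph(2)] .
  from GF.equaliser_exists[OF this] show ?thesis unfolding stabiliser_eq_def .
qed

text \<open>Equality of graph maps is tested on components, and a component of \<open>x\<close> is
  the pair of the components of its two projections.\<close>

lemma fixes_iff:
  assumes x: "x \<in> Hom (Graph C) Z GX" and p: "times_pr1 C (gob G) X \<cdot>\<^bsub>Graph C\<^esub> x = g" "times_pr2 C (gob G) X \<cdot>\<^bsub>Graph C\<^esub> x = y"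
  shows "a \<cdot>\<^bsub>Graph C\<^esub> x = times_pr2 C (gob G) X \<cdot>\<^bsub>Graph C\<^esub> x \<longleftrightarrow>
    (\<forall>ob ar. component ob ar \<longrightarrow> ar a \<cdot> pair C (ob Z) (gob G) (ob X) (ar g) (ar y) = ar y)"
proof -
  have "ar a \<cdot> pair C (ob Z) (gob G) (ob X) (ar g) (ar y) = ar (a \<cdot>\<^bsub>Graph C\<^esub> x)" if c: "component ob ar" for ob ar
  proof -
    have o: "gob G \<in> Obj C" "ob X \<in> Obj C" using group_object_hom(1)[OF G] left_action_hom(1)[OF action_component[OF c]] by auto
    have "ar x \<in> Hom C (ob Z) (Prod C (gob G) (ob X))" using component_hom[OF c x] component_simps(5)[OF c] by simp
    from pair_eta[OF this o] show ?thesis unfolding p[symmetric] component_simps(1,3,4)[OF c] by simp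
  qed
  then show ?thesis unfolding p(2) using component_eqI[of "a \<cdot>\<^bsub>Graph C\<^esub> x" y] by metis
qed

text \<open>An element of the stabiliser over \<open>z\<close> is an element \<open>g\<close> of
  \<open>G\<close> with \<open>g z = z\<close>. Closure under the operations follows from the action
  laws, applied on edges and on vertices, so \<open>subgroup_object\<close> applies inside
  \<open>\<Delta>(G)\<close> over \<open>X\<close>.\<close>

lemma stabiliser_group:
  "group_object (slice (Graph C) X) K" "gob K = (S, \<epsilon>)" "e \<in> Hom (Grp (slice (Graph C) X)) K (Delta C X G)"
proof -
  interpret GF: Fin_Lim "Graph C" by (rule Fin_Lim_Graph)
  interpret SX: Fin_Lim "slice (Graph C) X" by (rule GF.Fin_Lim_slice[OF X_Obj])
  note D = Delta_group[OF G X_Obj] and E = GF.is_equaliser_hom[OF stabiliser_equaliser]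
  let ?p1 = "times_pr1 C (gob G) X" and ?p2 = "times_pr2 C (gob G) X"
  let ?D = "Delta C X G"
  note p = times_pr_graph
  have eps: "\<epsilon> \<in> Hom (Graph C) S X" using GF.comp_in[OF p(2) E(3)] .
  have eS: "e \<in> Hom (slice (Graph C) X) (S, \<epsilon>) (gob ?D)" unfolding D(2) using E(3) eps p(2) by simp
  have mono: "is_mono (slice (Graph C) X) (S, \<epsilon>) (gob ?D) e"
    unfolding is_mono_def
  proof (intro conjI allI ballI impI eS)
    fix Zz :: "('o, 'a) graph \<times> 'a \<times> 'a" and x y
    obtain Z z where Z: "Zz = (Z, z)" by (cases Zz)
    assume "x \<in> Hom (slice (Graph C) X) Zz (S, \<epsilon>)" "y \<in> Hom (slice (Graph C) X) Zz (S, \<epsilon>)"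
      "e \<cdot>\<^bsub>slice (Graph C) X\<^esub> x = e \<cdot>\<^bsub>slice (Graph C) X\<^esub> y"
    then show "x = y" using GF.is_equaliser_ext[OF stabiliser_equaliser, of x Z y] unfolding Z by simp
  qed
  have fac: "\<exists>w \<in> Hom (slice (Graph C) X) (Z, z) (S, \<epsilon>). e \<cdot>\<^bsub>slice (Graph C) X\<^esub> w = x"
    if x: "x \<in> Hom (Graph C) Z GX" "?p1 \<cdot>\<^bsub>Graph C\<^esub> x = g" "?p2 \<cdot>\<^bsub>Graph C\<^esub> x = z"
      and f: "\<And>ob ar. component ob ar \<Longrightarrow> ar a \<cdot> pair C (ob Z) (gob G) (ob X) (ar g) (ar z) = ar z" for Z z x g
  proof -
    have "a \<cdot>\<^bsub>Graph C\<^esub> x = ?p2 \<cdot>\<^bsub>Graph C\<^esub> x" by (rule iffD2[OF fixes_iff[OF x]]) (intro allI impI f)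
    note w = GF.factor_is_equaliser[OF stabiliser_equaliser x(1) this]
    have "\<epsilon> \<cdot>\<^bsub>Graph C\<^esub> factor (Graph C) Z S e x = z" using GF.comp_assoc[OF p(2) w(1) E(3)] w(2) x(3) by simp
    moreover have "z \<in> Hom (Graph C) Z X" using GF.comp_in[OF p(2) x(1)] x(3) by simp
    ultimately show ?thesis using w eps by (intro bexI[of _ "factor (Graph C) Z S e x"]) simp_all
  qed
  have el: "e \<cdot>\<^bsub>Graph C\<^esub> x \<in> Hom (Graph C) Z GX" "?p2 \<cdot>\<^bsub>Graph C\<^esub> (e \<cdot>\<^bsub>Graph C\<^esub> x) = z"
    "?p1 \<cdot>\<^bsub>Graph C\<^esub> (e \<cdot>\<^bsub>Graph C\<^esub> x) \<in> Hom (Graph C) Z (const_graph C (gob G))"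
    "e \<cdot>\<^bsub>Graph C\<^esub> x \<in> Hom (slice (Graph C) X) (Z, z) (gob ?D)" "z \<in> Hom (Graph C) Z X"
    "\<And>ob ar. component ob ar \<Longrightarrow>
       ar a \<cdot> pair C (ob Z) (gob G) (ob X) (ar (?p1 \<cdot>\<^bsub>Graph C\<^esub> (e \<cdot>\<^bsub>Graph C\<^esub> x))) (ar z) = ar z"
    if "x \<in> Hom (slice (Graph C) X) (Z, z) (S, \<epsilon>)" for Z z x
  proof -
    have x: "x \<in> Hom (Graph C) Z S" "\<epsilon> \<cdot>\<^bsub>Graph C\<^esub> x = z" "z \<in> Hom (Graph C) Z X" using that by simp_all
    show ex: "e \<cdot>\<^bsub>Graph C\<^esub> x \<in> Hom (Graph C) Z GX" using GF.comp_in[OF E(3) x(1)] .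
    show 2: "?p2 \<cdot>\<^bsub>Graph C\<^esub> (e \<cdot>\<^bsub>Graph C\<^esub> x) = z" using GF.comp_assoc[OF p(2) x(1) E(3)] x(2) by simp
    show "?p1 \<cdot>\<^bsub>Graph C\<^esub> (e \<cdot>\<^bsub>Graph C\<^esub> x) \<in> Hom (Graph C) Z (const_graph C (gob G))" using GF.comp_in[OF p(1) ex] .
    show "e \<cdot>\<^bsub>Graph C\<^esub> x \<in> Hom (slice (Graph C) X) (Z, z) (gob ?D)" unfolding D(2) using ex 2 x(3) p(2) by simp
    show "z \<in> Hom (Graph C) Z X" using x(3) .
    have "a \<cdot>\<^bsub>Graph C\<^esub> (e \<cdot>\<^bsub>Graph C\<^esub> x) = ?p2 \<cdot>\<^bsub>Graph C\<^esub> (e \<cdot>\<^bsub>Graph C\<^esub> x)"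
      using GF.comp_assoc[OF E(1) x(1) E(3)] GF.comp_assoc[OF E(2) x(1) E(3)] E(4) by simp
    then show "\<And>ob ar. component ob ar \<Longrightarrow>
       ar a \<cdot> pair C (ob Z) (gob G) (ob X) (ar (?p1 \<cdot>\<^bsub>Graph C\<^esub> (e \<cdot>\<^bsub>Graph C\<^esub> x))) (ar z) = ar z"
      using fixes_iff[OF ex refl 2, THEN iffD1] by blast
  qed
  have mul: "\<exists>w \<in> Hom (slice (Graph C) X) Zz (S, \<epsilon>). e \<cdot>\<^bsub>slice (Graph C) X\<^esub> w =
      gop (slice (Graph C) X) Zz ?D (e \<cdot>\<^bsub>slice (Graph C) X\<^esub> x) (e \<cdot>\<^bsub>slice (Graph C) X\<^esub> y)"
    if xy: "x \<in> Hom (slice (Graph C) X) Zz (S, \<epsilon>)" "y \<in> Hom (slice (Graph C) X) Zz (S, \<epsilon>)" for Zz x y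
  proof -
    obtain Z z where Z: "Zz = (Z, z)" by (cases Zz)
    note x = el[OF xy(1)[unfolded Z]] and y = el[OF xy(2)[unfolded Z]]
    let ?g = "?p1 \<cdot>\<^bsub>Graph C\<^esub> (e \<cdot>\<^bsub>Graph C\<^esub> x)" and ?h = "?p1 \<cdot>\<^bsub>Graph C\<^esub> (e \<cdot>\<^bsub>Graph C\<^esub> y)"
    let ?w = "gop (slice (Graph C) X) (Z, z) ?D (e \<cdot>\<^bsub>Graph C\<^esub> x) (e \<cdot>\<^bsub>Graph C\<^esub> y)"
    have w: "?w \<in> Hom (Graph C) Z GX" "?p2 \<cdot>\<^bsub>Graph C\<^esub> ?w = z" using SX.gop_in[OF D(1) x(4) y(4)] unfolding D(2) by simp_all
    have "\<exists>w \<in> Hom (slice (Graph C) X) (Z, z) (S, \<epsilon>). e \<cdot>\<^bsub>slice (Graph C) X\<^esub> w = ?w"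
    proof (rule fac[OF w(1) D(3)[OF x(1) y(1) x(2) y(2)] w(2)])
      fix ob :: "('o, 'a) graph \<Rightarrow> 'o" and ar :: "'a \<times> 'a \<Rightarrow> 'a" assume c: "component ob ar"
      have gh: "ar ?g \<in> Hom C (ob Z) (gob G)" "ar ?h \<in> Hom C (ob Z) (gob G)" "ar z \<in> Hom C (ob Z) (ob X)"
        using component_hom[OF c x(3)] component_hom[OF c y(3)] component_hom[OF c x(5)] component_simps(6)[OF c] by simp_all
      show "ar a \<cdot> pair C (ob Z) (gob G) (ob X) (ar (gop (Graph C) Z (const_group C G) ?g ?h)) (ar z) = ar z"
        unfolding component_const_gop[OF c G x(3) y(3)]
        using left_action_gop[OF action_component[OF c] G gh] x(6)[OF c] y(6)[OF c] by simp
    qed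
    then show ?thesis unfolding Z by simp
  qed
  have inv: "\<exists>w \<in> Hom (slice (Graph C) X) Zz (S, \<epsilon>). e \<cdot>\<^bsub>slice (Graph C) X\<^esub> w =
      ginv ?D \<cdot>\<^bsub>slice (Graph C) X\<^esub> (e \<cdot>\<^bsub>slice (Graph C) X\<^esub> x)"
    if xx: "x \<in> Hom (slice (Graph C) X) Zz (S, \<epsilon>)" for Zz x
  proof -
    obtain Z z where Z: "Zz = (Z, z)" by (cases Zz)
    note x = el[OF xx[unfolded Z]]
    let ?g = "?p1 \<cdot>\<^bsub>Graph C\<^esub> (e \<cdot>\<^bsub>Graph C\<^esub> x)" let ?w = "ginv ?D \<cdot>\<^bsub>Graph C\<^esub> (e \<cdot>\<^bsub>Graph C\<^esub> x)"
    have w: "?w \<in> Hom (Graph C) Z GX" "?p2 \<cdot>\<^bsub>Graph C\<^esub> ?w = z" using SX.ginv_in[OF D(1) x(4)] unfolding D(2) by simp_all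
    have "\<exists>w \<in> Hom (slice (Graph C) X) (Z, z) (S, \<epsilon>). e \<cdot>\<^bsub>slice (Graph C) X\<^esub> w = ?w"
    proof (rule fac[OF w(1) D(4)[OF x(1)] w(2)])
      fix ob :: "('o, 'a) graph \<Rightarrow> 'o" and ar :: "'a \<times> 'a \<Rightarrow> 'a" assume c: "component ob ar"
      have gh: "ar ?g \<in> Hom C (ob Z) (gob G)" "ar z \<in> Hom C (ob Z) (ob X)"
        using component_hom[OF c x(3)] component_hom[OF c x(5)] component_simps(6)[OF c] by simp_all
      note A = action_component[OF c]
      \<comment> \<open>\<open>g^(-1) z = g^(-1) (g z)\<close>, because \<open>g\<close> fixes
        \<open>z\<close>.\<close>
      have "ar a \<cdot> pair C (ob Z) (gob G) (ob X) (ginv G \<cdot> ar ?g) (ar z) =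
          ar a \<cdot> pair C (ob Z) (gob G) (ob X) (gop C (ob Z) G (ginv G \<cdot> ar ?g) (ar ?g)) (ar z)"
        using left_action_gop[OF A G ginv_in[OF G gh(1)] gh] x(6)[OF c] by simp
      then show "ar a \<cdot> pair C (ob Z) (gob G) (ob X) (ar ((ginv G, ginv G) \<cdot>\<^bsub>Graph C\<^esub> ?g)) (ar z) = ar z"
        unfolding component_simps(1)[OF c, where g = "(ginv G, ginv G)"] component_simps(7)[OF c]
        using gop_inv_left[OF G gh(1)] left_action_one[OF A G gh(2)] by simp
    qed
    then show ?thesis unfolding Z by simp
  qed
  have one: "\<exists>w \<in> Hom (slice (Graph C) X) (term_obj (slice (Graph C) X)) (S, \<epsilon>). e \<cdot>\<^bsub>slice (Graph C) X\<^esub> w = gunit ?D"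
  proof -
    obtain U u where U: "term_obj (slice (Graph C) X) = (U, u)" by (meson surj_pair)
    have u: "u \<in> Hom (Graph C) U X" using SX.term_Obj U by simp
    have w: "gunit ?D \<in> Hom (Graph C) U GX" "?p2 \<cdot>\<^bsub>Graph C\<^esub> gunit ?D = u" using SX.group_object_hom(4)[OF D(1)] D(2) U by simp_all
    show ?thesis unfolding U
    proof (rule fac[OF w(1) D(5)[unfolded U fst_conv] w(2)])
      fix ob :: "('o, 'a) graph \<Rightarrow> 'o" and ar :: "'a \<times> 'a \<Rightarrow> 'a" assume c: "component ob ar"
      have "ar (gone (edges U) G, gone (verts U) G) = gone (ob U) G" using c unfolding component_def by auto
      then show "ar a \<cdot> pair C (ob U) (gob G) (ob X) (ar (gone (edges U) G, gone (verts U) G)) (ar u) = ar u"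
        using left_action_one[OF action_component[OF c] G component_hom[OF c u]] by simp
    qed
  qed
  have K: "K = subgroup_object (slice (Graph C) X) ?D (S, \<epsilon>) e" unfolding stabiliser_def by (simp add: case_prod_unfold Let_def)
  show "group_object (slice (Graph C) X) K" "gob K = (S, \<epsilon>)" "e \<in> Hom (Grp (slice (Graph C) X)) K (Delta C X G)"
    using SX.subgroup_object[OF D(1) mono mul inv one] unfolding K by blast+
qed

lemma gog_pullback:
  "is_pullback (Graph C) S Q X \<epsilon> s \<Gamma> t \<gamma>" "group_object (slice (Graph C) Q) \<G>" "gob \<G> = (\<Gamma>, \<gamma>)"
  "\<And>Z z x y. x \<in> Hom (Graph C) Z \<Gamma> \<Longrightarrow> y \<in> Hom (Graph C) Z \<Gamma> \<Longrightarrow> \<gamma> \<cdot>\<^bsub>Graph C\<^esub> x = z \<Longrightarrow> \<gamma> \<cdot>\<^bsub>Graph C\<^esub> y = z \<Longrightarrow>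
     t \<cdot>\<^bsub>Graph C\<^esub> gop (slice (Graph C) Q) (Z, z) \<G> x y =
     gop (slice (Graph C) X) (Z, s \<cdot>\<^bsub>Graph C\<^esub> z) K (t \<cdot>\<^bsub>Graph C\<^esub> x) (t \<cdot>\<^bsub>Graph C\<^esub> y)"
proof -
  interpret GF: Fin_Lim "Graph C" by (rule Fin_Lim_Graph)
  have cone: "pullback_cone (Graph C) Q X s K = (\<Gamma>, t, \<gamma>)" by simp
  note F = GF.pullback_group[OF s_graph(1) stabiliser_group(1,2) cone, folded action_gog_def]
  show "is_pullback (Graph C) S Q X \<epsilon> s \<Gamma> t \<gamma>" "group_object (slice (Graph C) Q) \<G>" "gob \<G> = (\<Gamma>, \<gamma>)"
    "\<And>Z z x y. x \<in> Hom (Graph C) Z \<Gamma> \<Longrightarrow> y \<in> Hom (Graph C) Z \<Gamma> \<Longrightarrow> \<gamma> \<cdot>\<^bsub>Graph C\<^esub> x = z \<Longrightarrow> \<gamma> \<cdot>\<^bsub>Graph C\<^esub> y = z \<Longrightarrow>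
     t \<cdot>\<^bsub>Graph C\<^esub> gop (slice (Graph C) Q) (Z, z) \<G> x y =
     gop (slice (Graph C) X) (Z, s \<cdot>\<^bsub>Graph C\<^esub> z) K (t \<cdot>\<^bsub>Graph C\<^esub> x) (t \<cdot>\<^bsub>Graph C\<^esub> y)"
    using F by blast+
qed

lemma gog_arrows:
  "e \<in> Hom (Graph C) S GX" "t \<in> Hom (Graph C) \<Gamma> S" "\<gamma> \<in> Hom (Graph C) \<Gamma> Q" "\<epsilon> \<in> Hom (Graph C) S X"
  "e \<cdot>\<^bsub>Graph C\<^esub> t \<in> Hom (Graph C) \<Gamma> GX" "j \<in> Hom (Graph C) \<Gamma> (const_graph C (gob G))"
  "times_pr2 C (gob G) X \<cdot>\<^bsub>Graph C\<^esub> (e \<cdot>\<^bsub>Graph C\<^esub> t) = s \<cdot>\<^bsub>Graph C\<^esub> \<gamma>"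
proof -
  interpret GF: Fin_Lim "Graph C" by (rule Fin_Lim_Graph)
  note P = GF.is_pullback_hom[OF gog_pullback(1)] and E = GF.is_equaliser_hom[OF stabiliser_equaliser]
  show "e \<in> Hom (Graph C) S GX" "t \<in> Hom (Graph C) \<Gamma> S" "\<gamma> \<in> Hom (Graph C) \<Gamma> Q" "\<epsilon> \<in> Hom (Graph C) S X"
    "e \<cdot>\<^bsub>Graph C\<^esub> t \<in> Hom (Graph C) \<Gamma> GX" "j \<in> Hom (Graph C) \<Gamma> (const_graph C (gob G))"
    using E P GF.comp_in[OF E(3) P(3)] GF.comp_in[OF times_pr_graph(1) GF.comp_in[OF E(3) P(3)]] by auto
  show "times_pr2 C (gob G) X \<cdot>\<^bsub>Graph C\<^esub> (e \<cdot>\<^bsub>Graph C\<^esub> t) = s \<cdot>\<^bsub>Graph C\<^esub> \<gamma>"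
    using GF.comp_assoc[OF times_pr_graph(2) P(3) E(3)] P(5) by simp
qed

text \<open>\<open>j\<close> is the composite of \<open>t\<close>, \<open>e\<close> and the first
  projection; each respects products, at the stages over \<open>Q\<close>, over \<open>X\<close>,
  and in the constant group.\<close>

lemma j_fibre_hom: "fibre_hom (Graph C) Q \<G> (const_group C G) j"
  unfolding fibre_hom_def
proof (intro conjI allI ballI)
  interpret GF: Fin_Lim "Graph C" by (rule Fin_Lim_Graph)
  interpret SX: Fin_Lim "slice (Graph C) X" by (rule GF.Fin_Lim_slice[OF X_Obj])
  interpret SQ: Fin_Lim "slice (Graph C) Q" by (rule GF.Fin_Lim_slice[OF Q_Obj])
  note arr = gog_arrows and D = Delta_group[OF G X_Obj]
  let ?p1 = "times_pr1 C (gob G) X" and ?p2 = "times_pr2 C (gob G) X"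
  show "j \<in> Hom (Graph C) (fst (gob \<G>)) (gob (const_group C G))"
    unfolding gog_pullback(3) gob_const_group[OF G] using arr(6) by simp
  fix Z z x y assume xy: "x \<in> Hom (slice (Graph C) Q) (Z, z) (gob \<G>)" "y \<in> Hom (slice (Graph C) Q) (Z, z) (gob \<G>)"
  then have x: "x \<in> Hom (Graph C) Z \<Gamma>" "y \<in> Hom (Graph C) Z \<Gamma>" "\<gamma> \<cdot>\<^bsub>Graph C\<^esub> x = z" "\<gamma> \<cdot>\<^bsub>Graph C\<^esub> y = z" "z \<in> Hom (Graph C) Z Q"
    unfolding gog_pullback(3) by simp_all
  let ?g = "gop (slice (Graph C) Q) (Z, z) \<G> x y" and ?z = "s \<cdot>\<^bsub>Graph C\<^esub> z"
  have g: "?g \<in> Hom (Graph C) Z \<Gamma>" using SQ.gop_in[OF gog_pullback(2) xy] unfolding gog_pullback(3) by simp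
  have z: "?z \<in> Hom (Graph C) Z X" using GF.comp_in[OF s_graph(1) x(5)] .
  have T: "t \<cdot>\<^bsub>Graph C\<^esub> w \<in> Hom (slice (Graph C) X) (Z, ?z) (gob K)" if "w \<in> Hom (Graph C) Z \<Gamma>" "\<gamma> \<cdot>\<^bsub>Graph C\<^esub> w = z" for w
  proof -
    have "\<epsilon> \<cdot>\<^bsub>Graph C\<^esub> (t \<cdot>\<^bsub>Graph C\<^esub> w) = ?z"
      using GF.comp_reduce[OF GF.is_pullback_hom(5)[OF gog_pullback(1)] arr(2,4) that(1)] GF.comp_assoc[OF s_graph(1) that(1) arr(3)] that(2)
      by simp
    then show ?thesis unfolding stabiliser_group(2) using GF.comp_in[OF arr(2) that(1)] z arr(4) by simp
  qed
  note tx = T[OF x(1,3)] and ty = T[OF x(2,4)]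
  have tC: "t \<cdot>\<^bsub>Graph C\<^esub> x \<in> Hom (Graph C) Z S" "t \<cdot>\<^bsub>Graph C\<^esub> y \<in> Hom (Graph C) Z S" using GF.comp_in[OF arr(2)] x by auto
  have eC: "e \<cdot>\<^bsub>Graph C\<^esub> (t \<cdot>\<^bsub>Graph C\<^esub> x) \<in> Hom (Graph C) Z GX" "e \<cdot>\<^bsub>Graph C\<^esub> (t \<cdot>\<^bsub>Graph C\<^esub> y) \<in> Hom (Graph C) Z GX"
    using GF.comp_in[OF arr(1)] tC by auto
  have eb: "?p2 \<cdot>\<^bsub>Graph C\<^esub> (e \<cdot>\<^bsub>Graph C\<^esub> (t \<cdot>\<^bsub>Graph C\<^esub> x)) = ?z" "?p2 \<cdot>\<^bsub>Graph C\<^esub> (e \<cdot>\<^bsub>Graph C\<^esub> (t \<cdot>\<^bsub>Graph C\<^esub> y)) = ?z"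
    using tx ty unfolding stabiliser_group(2) using GF.comp_assoc[OF times_pr_graph(2) tC(1) arr(1)]
      GF.comp_assoc[OF times_pr_graph(2) tC(2) arr(1)] by simp_all
  have J: "j \<cdot>\<^bsub>Graph C\<^esub> w = ?p1 \<cdot>\<^bsub>Graph C\<^esub> (e \<cdot>\<^bsub>Graph C\<^esub> (t \<cdot>\<^bsub>Graph C\<^esub> w))" if "w \<in> Hom (Graph C) Z \<Gamma>" for w
    using GF.comp_assoc[OF times_pr_graph(1) that arr(5)] GF.comp_assoc[OF arr(1) that arr(2)] by simp
  have "j \<cdot>\<^bsub>Graph C\<^esub> ?g = ?p1 \<cdot>\<^bsub>Graph C\<^esub> (e \<cdot>\<^bsub>Graph C\<^esub> gop (slice (Graph C) X) (Z, ?z) K (t \<cdot>\<^bsub>Graph C\<^esub> x) (t \<cdot>\<^bsub>Graph C\<^esub> y))"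
    using J[OF g] gog_pullback(4)[OF x(1-4)] by simp
  also have "\<dots> = ?p1 \<cdot>\<^bsub>Graph C\<^esub> gop (slice (Graph C) X) (Z, ?z) (Delta C X G) (e \<cdot>\<^bsub>Graph C\<^esub> (t \<cdot>\<^bsub>Graph C\<^esub> x)) (e \<cdot>\<^bsub>Graph C\<^esub> (t \<cdot>\<^bsub>Graph C\<^esub> y))"
    using SX.Grp_hom_gop[OF stabiliser_group(3) tx ty] by simp
  also have "\<dots> = gop (Graph C) Z (const_group C G) (j \<cdot>\<^bsub>Graph C\<^esub> x) (j \<cdot>\<^bsub>Graph C\<^esub> y)"
    using D(3)[OF eC eb] J x by simp
  finally show "j \<cdot>\<^bsub>Graph C\<^esub> ?g = gop (Graph C) Z (const_group C G) (j \<cdot>\<^bsub>Graph C\<^esub> x) (j \<cdot>\<^bsub>Graph C\<^esub> y)" .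
qed

lemmas pi1_props = pi1_universal[OF Q_Obj gog_pullback(2,3)]

text \<open>\<open>gog_map\<close> has components \<open>j\<close> and \<open>\<gamma>\<close>,
  hence is a homomorphism into \<open>\<Delta>(G)\<close> over \<open>Q\<close>. The universal
  property of \<open>\<pi>\<close> then makes the description defining \<open>\<phi>\<close>
  meaningful, and its first component gives \<open>\<phi> \<eta> = j\<close>.\<close>

lemma phi_hom: "\<phi> \<in> Hom (Grp C) \<pi> G" and phi_eta: "\<And>ob :: ('o, 'a) graph \<Rightarrow> 'o. \<And>ar. component ob ar \<Longrightarrow> \<phi> \<cdot> ar \<eta> = ar j"
proof -
  interpret GF: Fin_Lim "Graph C" by (rule Fin_Lim_Graph)
  let ?m = "times_map C (gob G) X (gob G) Q (Id C (gob G)) q" and ?f = "gog_map C G X a s"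
  let ?p1 = "times_pr1 C (gob G) Q" and ?p2 = "times_pr2 C (gob G) Q"
  have oG: "gob G \<in> Obj C" using group_object_hom(1)[OF G] .
  note arr = gog_arrows
  have P: "is_product (Graph C) (const_graph C (gob G)) Q (times_graph C (gob G) Q) ?p1 ?p2"
    using times_graph_product[OF oG Q_Obj] .
  note p = GF.is_product_hom[OF P]
  have m: "?m \<in> Hom (Graph C) GX (times_graph C (gob G) Q)" using times_map_in[OF Id_in[OF oG] q_graph] .
  have f: "?f = ?m \<cdot>\<^bsub>Graph C\<^esub> (e \<cdot>\<^bsub>Graph C\<^esub> t)" unfolding gog_map_def by (simp add: case_prod_unfold Let_def)
  have f_in: "?f \<in> Hom (Graph C) \<Gamma> (times_graph C (gob G) Q)" unfolding f using GF.comp_in[OF m arr(5)] .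
  have p1f: "?p1 \<cdot>\<^bsub>Graph C\<^esub> ?f = j"
  proof (rule component_eqI)
    fix ob :: "('o, 'a) graph \<Rightarrow> 'o" and ar :: "'a \<times> 'a \<Rightarrow> 'a" assume c: "component ob ar"
    note cs = component_simps[OF c]
    have i: "ar (e \<cdot>\<^bsub>Graph C\<^esub> t) \<in> Hom C (ob \<Gamma>) (Prod C (gob G) (ob X))" "ar q \<in> Hom C (ob X) (ob Q)"
      using component_hom[OF c arr(5)] component_hom[OF c q_graph] cs by simp_all
    have pm: "pmap C (gob G) (ob X) (gob G) (ob Q) (Id C (gob G)) (ar q) \<in> Hom C (Prod C (gob G) (ob X)) (Prod C (gob G) (ob Q))"
      using pmap_in[OF Id_in[OF oG] i(2)] .
    have o: "ob X \<in> Obj C" "ob Q \<in> Obj C" using Hom_Obj i(2) by auto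
    show "ar (?p1 \<cdot>\<^bsub>Graph C\<^esub> ?f) = ar j"
      unfolding f using comp_reduce[OF pr_pmap(1)[OF Id_in[OF oG] i(2)] pm pr_in(1)[OF oG o(2)] i(1)]
        Id_comp[OF pr_in(1)[OF oG o(1)]] by (simp add: cs)
  qed
  \<comment> \<open>The point of \<open>Q\<close> is \<open>q(s(\<gamma>))\<close>, which is
    \<open>\<gamma>\<close> since \<open>s\<close> is a section of \<open>q\<close>.\<close>
  have p2f: "?p2 \<cdot>\<^bsub>Graph C\<^esub> ?f = \<gamma>"
    unfolding f using GF.comp_reduce[OF times_map_pr(2)[OF Id_in[OF oG] q_graph] m p(2) arr(5)]
      GF.comp_assoc[OF q_graph arr(5) times_pr_graph(2)] arr(7) GF.comp_reduce[OF s_graph(2,1) q_graph arr(3)] GF.Id_comp[OF arr(3)]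
    by simp
  have "?f \<in> Hom (GoG C Q) \<G> (Delta C Q G)"
    unfolding GoG_def Delta_def
    using GF.Hom_family_group[OF gog_pullback(2,3) const_group_object[OF G] P[folded gob_const_group[OF G]]]
      f_in p2f j_fibre_hom p1f by simp
  from theI'[OF pi1_props(3)[OF G this]]
  have h: "\<phi> \<in> Hom (Grp C) \<pi> G" "Delta_map C Q \<pi> G \<phi> \<cdot>\<^bsub>GoG C Q\<^esub> unit = ?f"
    unfolding canonical_hom_def Let_def by auto
  then show "\<phi> \<in> Hom (Grp C) \<pi> G" by blast
  interpret SQ: Fin_Lim "slice (Graph C) Q" by (rule GF.Fin_Lim_slice[OF Q_Obj])
  have D: "Delta_map C Q \<pi> G \<phi> \<cdot>\<^bsub>Graph C\<^esub> unit = ?f" using h(2) unfolding GoG_def by simp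
  note dm = Delta_map_pr[OF Q_Obj Grp_homD(3)[OF h(1)]]
  have op: "gob \<pi> \<in> Obj C" using group_object_hom(1)[OF pi1_props(1)] .
  have pp: "times_pr1 C (gob \<pi>) Q \<in> Hom (Graph C) (times_graph C (gob \<pi>) Q) (const_graph C (gob \<pi>))"
    using GF.is_product_hom(1)[OF times_graph_product[OF op Q_Obj]] .
  have "const_graph C (gob \<pi>) \<in> Obj (Graph C)" using GF.Hom_Obj(2)[OF pp] .
  then have ff: "(\<phi>, \<phi>) \<in> Hom (Graph C) (const_graph C (gob \<pi>)) (const_graph C (gob G))"
    unfolding const_graph_Hom using Grp_homD(3)[OF h(1)] oG by (simp add: const_graph_def)
  have eq: "(\<phi>, \<phi>) \<cdot>\<^bsub>Graph C\<^esub> \<eta> = j"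
    using GF.comp_reduce[OF dm(3,1) p(1) pi1_props(4)] D p1f GF.comp_assoc[OF ff pi1_props(4) pp] by simp
  show "\<phi> \<cdot> ar \<eta> = ar j" if c: "component ob ar" for ob :: "('o, 'a) graph \<Rightarrow> 'o" and ar
    using arg_cong[OF eq, of ar]
    unfolding component_simps(1)[OF c, where g = "(\<phi>, \<phi>)" and f = \<eta>] component_simps(7)[OF c] .
qed

end

lemma component_coequaliser:
  assumes "component ob ar" "Cat C" "has_coequalisers C" "is_coequaliser (Graph C) A B f g Q q"
  shows "is_coequaliser C (ob A) (ob B) (ar f) (ar g) (ob Q) (ar q)"
  using Cat.graph_coequaliser_components[OF assms(2-4)] assms(1) unfolding component_def by auto

lemma (in Fin_Lim) component_equaliser:
  assumes "component ob ar" "is_equaliser (Graph C) A B f g E e"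
  shows "is_equaliser C (ob A) (ob B) (ar f) (ar g) (ob E) (ar e)"
  using graph_equaliser_components[OF assms(2)] assms(1) unfolding component_def by auto

lemma (in Fin_Lim) component_pullback:
  assumes "component ob ar" "is_pullback (Graph C) A B D f g P p q"
  shows "is_pullback C (ob A) (ob B) (ob D) (ar f) (ar g) (ob P) (ar p) (ar q)"
  using graph_pullback_components[OF assms(2)] assms(1) unfolding component_def by auto

text \<open>Evaluates \<open>(p, b) \<mapsto> (p u_1(b), u_2(b))\<close>, where \<open>u_1\<close>
  and \<open>u_2\<close> are the components of \<open>u\<close>. With the unit of
  \<open>\<pi>\<close> for \<open>u\<close>, this is the second map defining the standard
  graph.\<close>

lemma (in Fin_Lim) mul_id_pmap:
  assumes K: "group_object C K" and u: "u \<in> Hom C B (Prod C (gob K) A)" and A: "A \<in> Obj C"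
  shows "mul_id C K A \<cdot> pmap C (gob K) B (gob K) (Prod C (gob K) A) (Id C (gob K)) u =
    pair C (Prod C (gob K) B) (gob K) A
      (gop C (Prod C (gob K) B) K (pr1 C (gob K) B) ((pr1 C (gob K) A \<cdot> u) \<cdot> pr2 C (gob K) B))
      ((pr2 C (gob K) A \<cdot> u) \<cdot> pr2 C (gob K) B)"
proof -
  let ?G = "gob K" let ?KA = "Prod C ?G A" let ?W = "Prod C ?G ?KA" let ?V = "Prod C ?G B"
  let ?m = "pmap C ?G B ?G ?KA (Id C ?G) u"
  have o: "?G \<in> Obj C" "B \<in> Obj C" "?KA \<in> Obj C" using group_object_hom(1)[OF K] Hom_Obj[OF u] by auto
  note i = Id_in[OF o(1)]
  have m: "?m \<in> Hom C ?V ?W" using pmap_in[OF i u] .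
  have r: "pr1 C ?G ?KA \<in> Hom C ?W ?G" "pr2 C ?G ?KA \<in> Hom C ?W ?KA" "pr1 C ?G A \<in> Hom C ?KA ?G" "pr2 C ?G A \<in> Hom C ?KA A"
    using o A by auto
  have b: "pr1 C ?G B \<in> Hom C ?V ?G" "pr2 C ?G B \<in> Hom C ?V B" using o by auto
  note pm = pr_pmap[OF i u]
  have c: "pr1 C ?G A \<cdot> pr2 C ?G ?KA \<in> Hom C ?W ?G" "pr2 C ?G A \<cdot> pr2 C ?G ?KA \<in> Hom C ?W A" using r by auto
  note g = gop_in[OF K r(1) c(1)]
  show ?thesis
    unfolding mul_id_def Let_def
    using pair_comp[OF m g c(2)] gop_comp[OF K m r(1) c(1)] comp_assoc[OF r(3) m r(2)] comp_assoc[OF r(4) m r(2)]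
      comp_assoc[OF r(3) b(2) u] comp_assoc[OF r(4) b(2) u] pm Id_comp[OF b(1)] by simp
qed

section \<open>The standard graph and the canonical map in components\<close>

context action_setup
begin

lemma Cat_C: "Cat C" ..

lemma pi_group: "group_object C \<pi>"
  using pi1_props(1) .

lemma eta_graph: "\<eta> \<in> Hom (Graph C) \<Gamma> (const_graph C (gob \<pi>))"
proof -
  interpret GF: Fin_Lim "Graph C" by (rule Fin_Lim_Graph)
  show ?thesis
    using GF.comp_in[OF GF.is_product_hom(1)[OF times_graph_product[OF group_object_hom(1)[OF pi_group] Q_Obj]] pi1_props(4)] .
qed

text \<open>The second of the two maps \<open>\<pi> \<times> \<G> \<rightarrow> \<pi> \<times> Q\<close> defining the standard graph, \<open>(p, u) \<mapsto> p \<eta>(u)\<close>.\<close>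

abbreviation "translate \<equiv> (mul_id C \<pi> (edges Q), mul_id C \<pi> (verts Q)) \<cdot>\<^bsub>Graph C\<^esub>
  times_map C (gob \<pi>) \<Gamma> (gob \<pi>) (times_graph C (gob \<pi>) Q) (Id C (gob \<pi>)) unit"

context
  fixes ob :: "('o, 'a) graph \<Rightarrow> 'o" and ar :: "'a \<times> 'a \<Rightarrow> 'a"
  assumes c: "component ob ar"
begin

lemma objs: "ob Q \<in> Obj C" "ob \<Gamma> \<in> Obj C" "ob X \<in> Obj C" "gob \<pi> \<in> Obj C" "gob G \<in> Obj C"
  using Hom_Obj[OF component_hom[OF c gog_arrows(3)]] Hom_Obj(1)[OF component_hom[OF c q_graph]]
    group_object_hom(1)[OF pi_group] group_object_hom(1)[OF G] by auto

lemma ar_arrows: "ar s \<in> Hom C (ob Q) (ob X)" "ar \<gamma> \<in> Hom C (ob \<Gamma>) (ob Q)" "ar j \<in> Hom C (ob \<Gamma>) (gob G)"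
  "ar \<eta> \<in> Hom C (ob \<Gamma>) (gob \<pi>)" "ar a \<in> Hom C (Prod C (gob G) (ob X)) (ob X)"
  "ar unit \<in> Hom C (ob \<Gamma>) (Prod C (gob \<pi>) (ob Q))" "\<phi> \<in> Hom C (gob \<pi>) (gob G)"
  using component_hom[OF c s_graph(1)] component_hom[OF c gog_arrows(3)] component_hom[OF c gog_arrows(6)]
    component_hom[OF c eta_graph] left_action_hom(2)[OF action_component[OF c]] component_hom[OF c pi1_props(4)]
    component_simps(5,6)[OF c] Grp_homD(3)[OF phi_hom] by simp_all

lemma ar_translate: "ar translate = pair C (Prod C (gob \<pi>) (ob \<Gamma>)) (gob \<pi>) (ob Q)
    (gop C (Prod C (gob \<pi>) (ob \<Gamma>)) \<pi> (pr1 C (gob \<pi>) (ob \<Gamma>)) (ar \<eta> \<cdot> pr2 C (gob \<pi>) (ob \<Gamma>)))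
    (ar \<gamma> \<cdot> pr2 C (gob \<pi>) (ob \<Gamma>))"
proof -
  note cs = component_simps[OF c]
  have m: "ar (mul_id C \<pi> (edges Q), mul_id C \<pi> (verts Q)) = mul_id C \<pi> (ob Q)"
    using c unfolding component_def by auto
  have "ar \<eta> = pr1 C (gob \<pi>) (ob Q) \<cdot> ar unit" "ar \<gamma> = pr2 C (gob \<pi>) (ob Q) \<cdot> ar unit"
    using arg_cong[OF pi1_props(5), of ar] by (simp_all add: cs)
  then show ?thesis
    using mul_id_pmap[OF pi_group ar_arrows(6) objs(1)] m by (simp add: cs)
qed

lemma ar_projection: "ar (times_map C (gob \<pi>) \<Gamma> (gob \<pi>) Q (Id C (gob \<pi>)) \<gamma>) =
    pair C (Prod C (gob \<pi>) (ob \<Gamma>)) (gob \<pi>) (ob Q) (pr1 C (gob \<pi>) (ob \<Gamma>)) (ar \<gamma> \<cdot> pr2 C (gob \<pi>) (ob \<Gamma>))"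
  unfolding component_simps(8)[OF c] pmap_def using Id_comp[OF pr_in(1)[OF objs(4,2)]] by simp

lemma stab_component:
  "ar a \<cdot> pair C (ob \<Gamma>) (gob G) (ob X) (ar j) (ar s \<cdot> ar \<gamma>) = ar s \<cdot> ar \<gamma>"
proof -
  interpret GF: Fin_Lim "Graph C" by (rule Fin_Lim_Graph)
  note E = GF.is_equaliser_hom[OF stabiliser_equaliser]
  have "a \<cdot>\<^bsub>Graph C\<^esub> (e \<cdot>\<^bsub>Graph C\<^esub> t) = times_pr2 C (gob G) X \<cdot>\<^bsub>Graph C\<^esub> (e \<cdot>\<^bsub>Graph C\<^esub> t)"
    using GF.comp_assoc[OF E(1) gog_arrows(2) E(3)] GF.comp_assoc[OF E(2) gog_arrows(2) E(3)] E(4) by simp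
  from fixes_iff[OF gog_arrows(5) refl gog_arrows(7), THEN iffD1, OF this] c
  show ?thesis unfolding component_simps(1)[OF c, where g = s and f = \<gamma>, symmetric] by blast
qed

text \<open>The pair \<open>(g, s(y))\<close> factors first through the equaliser that defines the
  stabiliser and then, together with \<open>y\<close>, through the pullback along \<open>s\<close>;
  both are computed componentwise.\<close>

lemma stab_component_ex:
  assumes g: "g \<in> Hom C Z (gob G)" and y: "y \<in> Hom C Z (ob Q)"
    and fx: "ar a \<cdot> pair C Z (gob G) (ob X) g (ar s \<cdot> y) = ar s \<cdot> y"
  shows "\<exists>u \<in> Hom C Z (ob \<Gamma>). ar j \<cdot> u = g \<and> ar \<gamma> \<cdot> u = y"
proof -
  note cs = component_simps[OF c]
  note E = component_equaliser[OF c stabiliser_equaliser] and P = component_pullback[OF c gog_pullback(1)]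
  note E' = is_equaliser_hom[OF E] and P' = is_pullback_hom[OF P]
  have sy: "ar s \<cdot> y \<in> Hom C Z (ob X)" using ar_arrows y by auto
  note pp = pair_in[OF g sy]
  have x: "pair C Z (gob G) (ob X) g (ar s \<cdot> y) \<in> Hom C Z (ob GX)" using pp cs(5) by simp
  have "ar a \<cdot> pair C Z (gob G) (ob X) g (ar s \<cdot> y) = ar (times_pr2 C (gob G) X) \<cdot> pair C Z (gob G) (ob X) g (ar s \<cdot> y)"
    using fx pr_pair[OF g sy] by (simp add: cs)
  note w = factor_is_equaliser[OF E x this]
  let ?w = "factor C Z (ob S) (ar e) (pair C Z (gob G) (ob X) g (ar s \<cdot> y))"
  have pr: "pr1 C (gob G) (ob X) \<in> Hom C (Prod C (gob G) (ob X)) (gob G)" "pr2 C (gob G) (ob X) \<in> Hom C (Prod C (gob G) (ob X)) (ob X)"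
    using objs by auto
  have e: "ar e \<in> Hom C (ob S) (Prod C (gob G) (ob X))" using E'(3) cs(5) by simp
  have "ar \<epsilon> \<cdot> ?w = ar s \<cdot> y" using comp_assoc[OF pr(2) w(1) e] w(2) pr_pair[OF g sy] by (simp add: cs)
  note u = tuple_is_pullback[OF P w(1) y this]
  let ?u = "tuple C Z (ob \<Gamma>) (ar t) (ar \<gamma>) ?w y"
  have et: "ar e \<cdot> ar t \<in> Hom C (ob \<Gamma>) (Prod C (gob G) (ob X))" using e P'(3) by auto
  have "ar j \<cdot> ?u = g"
    using comp_assoc[OF pr(1) u(1) et] comp_assoc[OF e u(1) P'(3)] u(2) w(2) pr_pair[OF g sy] by (simp add: cs)
  then show ?thesis using u by blast
qed

text \<open>\<open>j\<close> and \<open>s \<cdot> \<gamma>\<close> are the two coordinates of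
  \<open>e \<cdot> t\<close>, and \<open>e\<close> is monic; so \<open>t\<close>, and with it the
  element of the pullback, is determined.\<close>

lemma stab_component_ext:
  assumes u: "u \<in> Hom C Z (ob \<Gamma>)" and v: "v \<in> Hom C Z (ob \<Gamma>)" and eq: "ar j \<cdot> u = ar j \<cdot> v" "ar \<gamma> \<cdot> u = ar \<gamma> \<cdot> v"
  shows "u = v"
proof -
  note cs = component_simps[OF c]
  note E = component_equaliser[OF c stabiliser_equaliser] and P = component_pullback[OF c gog_pullback(1)]
  note E' = is_equaliser_hom[OF E] and P' = is_pullback_hom[OF P]
  have pr: "pr1 C (gob G) (ob X) \<in> Hom C (Prod C (gob G) (ob X)) (gob G)" "pr2 C (gob G) (ob X) \<in> Hom C (Prod C (gob G) (ob X)) (ob X)"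
    using objs by auto
  have e: "ar e \<in> Hom C (ob S) (Prod C (gob G) (ob X))" using E'(3) cs(5) by simp
  have et: "ar e \<cdot> ar t \<in> Hom C (ob \<Gamma>) (Prod C (gob G) (ob X))" using e P'(3) by auto
  have t: "ar t \<cdot> u \<in> Hom C Z (ob S)" "ar t \<cdot> v \<in> Hom C Z (ob S)" using P'(3) u v by auto
  have sg: "pr2 C (gob G) (ob X) \<cdot> (ar e \<cdot> ar t) = ar s \<cdot> ar \<gamma>"
    using arg_cong[OF gog_arrows(7), of ar] by (simp add: cs)
  have "ar e \<cdot> (ar t \<cdot> u) = ar e \<cdot> (ar t \<cdot> v)"
  proof (rule pair_ext[of _ Z "gob G" "ob X"])
    show "ar e \<cdot> (ar t \<cdot> u) \<in> Hom C Z (Prod C (gob G) (ob X))" "ar e \<cdot> (ar t \<cdot> v) \<in> Hom C Z (Prod C (gob G) (ob X))"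
      using e t by auto
    show "pr1 C (gob G) (ob X) \<cdot> (ar e \<cdot> (ar t \<cdot> u)) = pr1 C (gob G) (ob X) \<cdot> (ar e \<cdot> (ar t \<cdot> v))"
      using comp_assoc[OF pr(1) u et] comp_assoc[OF e u P'(3)] comp_assoc[OF pr(1) v et] comp_assoc[OF e v P'(3)] eq(1)
      by (simp add: cs)
    show "pr2 C (gob G) (ob X) \<cdot> (ar e \<cdot> (ar t \<cdot> u)) = pr2 C (gob G) (ob X) \<cdot> (ar e \<cdot> (ar t \<cdot> v))"
      using comp_reduce[OF sg et pr(2) u] comp_assoc[OF e u P'(3)] comp_reduce[OF sg et pr(2) v] comp_assoc[OF e v P'(3)]
        comp_assoc[OF ar_arrows(1) u ar_arrows(2)] comp_assoc[OF ar_arrows(1) v ar_arrows(2)] eq(2)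
      by simp
  qed (use objs in auto)
  then have "ar t \<cdot> u = ar t \<cdot> v" using is_equaliser_ext[OF E t] by blast
  then show ?thesis using is_pullback_ext[OF P u v] eq(2) by blast
qed

lemma ar_orbit_map:
  "ar (a \<cdot>\<^bsub>Graph C\<^esub> (times_map C (gob G) Q (gob G) X (Id C (gob G)) s \<cdot>\<^bsub>Graph C\<^esub>
      times_map C (gob \<pi>) Q (gob G) Q \<phi> (Id (Graph C) Q))) =
    ar a \<cdot> pair C (Prod C (gob \<pi>) (ob Q)) (gob G) (ob X) (\<phi> \<cdot> pr1 C (gob \<pi>) (ob Q)) (ar s \<cdot> pr2 C (gob \<pi>) (ob Q))"
proof -
  note cs = component_simps[OF c] and i = Id_in[OF objs(1)]
  have pr: "pr1 C (gob \<pi>) (ob Q) \<in> Hom C (Prod C (gob \<pi>) (ob Q)) (gob \<pi>)" "pr2 C (gob \<pi>) (ob Q) \<in> Hom C (Prod C (gob \<pi>) (ob Q)) (ob Q)"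
    using objs by auto
  show ?thesis
    using pmap_eq[OF Id_in[OF objs(5)] ar_arrows(1) pmap_in[OF ar_arrows(7) i]] pr_pmap[OF ar_arrows(7) i]
      Id_comp[OF comp_in[OF ar_arrows(7) pr(1)]] Id_comp[OF pr(2)] by (simp add: cs)
qed

text \<open>\<open>\<phi>(p \<eta>(u)) s(\<gamma>(u)) = \<phi>(p) j(u) s(\<gamma>(u)) = \<phi>(p)
  s(\<gamma>(u))\<close>, as \<open>j(u)\<close> fixes \<open>s(\<gamma>(u))\<close>.\<close>

lemma orbit_map_coequalises:
  defines "k \<equiv> ar a \<cdot> pair C (Prod C (gob \<pi>) (ob Q)) (gob G) (ob X) (\<phi> \<cdot> pr1 C (gob \<pi>) (ob Q)) (ar s \<cdot> pr2 C (gob \<pi>) (ob Q))"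
  shows "k \<cdot> ar (times_map C (gob \<pi>) \<Gamma> (gob \<pi>) Q (Id C (gob \<pi>)) \<gamma>) = k \<cdot> ar translate"
proof -
  let ?W = "Prod C (gob \<pi>) (ob \<Gamma>)" and ?p = "pr1 C (gob \<pi>) (ob \<Gamma>)" and ?u = "pr2 C (gob \<pi>) (ob \<Gamma>)"
  let ?V = "Prod C (gob \<pi>) (ob Q)" and ?P = "pr1 C (gob \<pi>) (ob Q)" and ?Y = "pr2 C (gob \<pi>) (ob Q)"
  have pr: "?p \<in> Hom C ?W (gob \<pi>)" "?u \<in> Hom C ?W (ob \<Gamma>)" "?P \<in> Hom C ?V (gob \<pi>)" "?Y \<in> Hom C ?V (ob Q)" using objs by auto
  note A = action_component[OF c]
  have V: "\<phi> \<cdot> ?P \<in> Hom C ?V (gob G)" "ar s \<cdot> ?Y \<in> Hom C ?V (ob X)" using pr ar_arrows by auto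
  have k: "k \<cdot> pair C ?W (gob \<pi>) (ob Q) p y = ar a \<cdot> pair C ?W (gob G) (ob X) (\<phi> \<cdot> p) (ar s \<cdot> y)"
    if p: "p \<in> Hom C ?W (gob \<pi>)" and y: "y \<in> Hom C ?W (ob Q)" for p y
    unfolding k_def
    using comp_assoc[OF ar_arrows(5) pair_in[OF p y] pair_in[OF V]] pair_comp[OF pair_in[OF p y] V]
      comp_assoc[OF ar_arrows(7) pair_in[OF p y] pr(3)] comp_assoc[OF ar_arrows(1) pair_in[OF p y] pr(4)] pr_pair[OF p y] by simp
  have i: "ar \<gamma> \<cdot> ?u \<in> Hom C ?W (ob Q)" "ar \<eta> \<cdot> ?u \<in> Hom C ?W (gob \<pi>)" "ar j \<cdot> ?u \<in> Hom C ?W (gob G)" "\<phi> \<cdot> ?p \<in> Hom C ?W (gob G)"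
    using pr ar_arrows by auto
  have sx: "ar s \<cdot> (ar \<gamma> \<cdot> ?u) \<in> Hom C ?W (ob X)" using i ar_arrows by auto
  have sg: "ar s \<cdot> ar \<gamma> \<in> Hom C (ob \<Gamma>) (ob X)" using ar_arrows by auto
  have "\<phi> \<cdot> (ar \<eta> \<cdot> ?u) = ar j \<cdot> ?u" using comp_reduce[OF phi_eta[OF c] ar_arrows(4,7) pr(2)] .
  moreover have "ar a \<cdot> pair C ?W (gob G) (ob X) (ar j \<cdot> ?u) (ar s \<cdot> (ar \<gamma> \<cdot> ?u)) = ar s \<cdot> (ar \<gamma> \<cdot> ?u)"
    using comp_reduce[OF stab_component pair_in[OF ar_arrows(3) sg] ar_arrows(5) pr(2)] pair_comp[OF pr(2) ar_arrows(3) sg]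
      comp_assoc[OF ar_arrows(1) pr(2) ar_arrows(2)] by simp
  ultimately show ?thesis
    unfolding ar_translate ar_projection
    using k[OF pr(1) i(1)] k[OF gop_in[OF pi_group pr(1) i(2)] i(1)] Grp_hom_gop[OF phi_hom pr(1) i(2)]
      left_action_gop[OF A G i(4,3) sx] by simp
qed

end

text \<open>Required before the coequaliser can be formed in graphs. It commutes with
  \<open>d0\<close> and \<open>d1\<close> because \<open>\<eta>\<close> maps to a constant graph: an
  edge element and its two ends have the same image in \<open>\<pi>\<close>.\<close>

lemma translate_graph:
  "translate \<in> Hom (Graph C) (times_graph C (gob \<pi>) \<Gamma>) (times_graph C (gob \<pi>) Q)"
proof -
  interpret GF: Fin_Lim "Graph C" by (rule Fin_Lim_Graph)
  have cE: "component edges fst" and cV: "component verts snd" unfolding component_def by auto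
  note arr = ar_arrows[OF cE] ar_arrows[OF cV] and ob = objs[OF cE] objs[OF cV]
  have \<Gamma>: "\<Gamma> \<in> Obj (Graph C)" using GF.Hom_Obj(1)[OF gog_arrows(3)] .
  note TG = times_graph_Obj[OF ob(4) \<Gamma>] times_graph_Obj[OF ob(4) Q_Obj]
  let ?P = "gob \<pi>"
  have tr: "pair C (Prod C ?P (edges \<Gamma>)) ?P (edges Q) (gop C (Prod C ?P (edges \<Gamma>)) \<pi> (pr1 C ?P (edges \<Gamma>)) (fst \<eta> \<cdot> pr2 C ?P (edges \<Gamma>)))
      (fst \<gamma> \<cdot> pr2 C ?P (edges \<Gamma>)) \<in> Hom C (Prod C ?P (edges \<Gamma>)) (Prod C ?P (edges Q))" (is "?E \<in> _")
    and tr': "pair C (Prod C ?P (verts \<Gamma>)) ?P (verts Q) (gop C (Prod C ?P (verts \<Gamma>)) \<pi> (pr1 C ?P (verts \<Gamma>)) (snd \<eta> \<cdot> pr2 C ?P (verts \<Gamma>)))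
      (snd \<gamma> \<cdot> pr2 C ?P (verts \<Gamma>)) \<in> Hom C (Prod C ?P (verts \<Gamma>)) (Prod C ?P (verts Q))" (is "?V \<in> _")
    using pi_group arr ob by (auto intro!: pair_in gop_in comp_in[OF arr(4)] comp_in[OF arr(2)] comp_in[OF arr(11)] comp_in[OF arr(9)])
  note eta = eta_graph[unfolded const_graph_Hom] and gam = Graph_HomD[OF gog_arrows(3)]
  have d: "pmap C ?P (edges Q) ?P (verts Q) (Id C ?P) (d Q) \<cdot> ?E = ?V \<cdot> pmap C ?P (edges \<Gamma>) ?P (verts \<Gamma>) (Id C ?P) (d \<Gamma>)"
    if d: "d \<in> {d0, d1}" for d
  proof -
    let ?W = "Prod C ?P (edges \<Gamma>)" let ?p = "pr1 C ?P (edges \<Gamma>)" and ?u = "pr2 C ?P (edges \<Gamma>)"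
    have dd: "d Q \<in> Hom C (edges Q) (verts Q)" "d \<Gamma> \<in> Hom C (edges \<Gamma>) (verts \<Gamma>)" "d Q \<cdot> fst \<gamma> = snd \<gamma> \<cdot> d \<Gamma>"
      "fst \<eta> = snd \<eta> \<cdot> d \<Gamma>" using d gam eta by auto
    have pr: "?p \<in> Hom C ?W ?P" "?u \<in> Hom C ?W (edges \<Gamma>)" using ob by auto
    have i: "fst \<eta> \<cdot> ?u \<in> Hom C ?W ?P" "fst \<gamma> \<cdot> ?u \<in> Hom C ?W (edges Q)" "d \<Gamma> \<cdot> ?u \<in> Hom C ?W (verts \<Gamma>)"
      using pr arr dd by auto
    note g = gop_in[OF pi_group pr(1) i(1)]
    have prV: "pr1 C ?P (verts \<Gamma>) \<in> Hom C (Prod C ?P (verts \<Gamma>)) ?P" "pr2 C ?P (verts \<Gamma>) \<in> Hom C (Prod C ?P (verts \<Gamma>)) (verts \<Gamma>)"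
      using ob by auto
    have iV: "snd \<eta> \<cdot> pr2 C ?P (verts \<Gamma>) \<in> Hom C (Prod C ?P (verts \<Gamma>)) ?P" "snd \<gamma> \<cdot> pr2 C ?P (verts \<Gamma>) \<in> Hom C (Prod C ?P (verts \<Gamma>)) (verts Q)"
      using prV arr by auto
    have pm: "pmap C ?P (edges \<Gamma>) ?P (verts \<Gamma>) (Id C ?P) (d \<Gamma>) = pair C ?W ?P (verts \<Gamma>) ?p (d \<Gamma> \<cdot> ?u)"
      unfolding pmap_def using Id_comp[OF pr(1)] by simp
    note m = pair_in[OF pr(1) i(3)]
    show ?thesis
      unfolding pm
      using pmap_pair[OF Id_in[OF ob(4)] dd(1) g i(2)] Id_comp[OF g] comp_reduce[OF dd(3) arr(2) dd(1) pr(2)]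
        comp_assoc[OF arr(9) pr(2) dd(2)] pair_comp[OF m gop_in[OF pi_group prV(1) iV(1)] iV(2)]
        gop_comp[OF pi_group m prV(1) iV(1)] comp_assoc[OF arr(11) m prV(2)] comp_assoc[OF arr(9) m prV(2)]
        pr_pair[OF pr(1) i(3)] comp_assoc[OF arr(11) pr(2) dd(2)] dd(4) by simp
  qed
  show ?thesis
    unfolding Graph_Hom ar_translate[OF cE] ar_translate[OF cV]
    using TG tr tr' d[of d0] d[of d1] by simp
qed

lemma standard_coequaliser:
  "is_coequaliser (Graph C) (times_graph C (gob \<pi>) \<Gamma>) (times_graph C (gob \<pi>) Q)
     (times_map C (gob \<pi>) \<Gamma> (gob \<pi>) Q (Id C (gob \<pi>)) \<gamma>) translate T \<tau>"
proof -
  interpret GF: Fin_Lim "Graph C" by (rule Fin_Lim_Graph)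
  have m: "times_map C (gob \<pi>) \<Gamma> (gob \<pi>) Q (Id C (gob \<pi>)) \<gamma> \<in> Hom (Graph C) (times_graph C (gob \<pi>) \<Gamma>) (times_graph C (gob \<pi>) Q)"
    using times_map_in[OF Id_in[OF group_object_hom(1)[OF pi_group]] gog_arrows(3)] .
  obtain T' \<tau>' where "is_coequaliser (Graph C) (times_graph C (gob \<pi>) \<Gamma>) (times_graph C (gob \<pi>) Q)
     (times_map C (gob \<pi>) \<Gamma> (gob \<pi>) Q (Id C (gob \<pi>)) \<gamma>) translate T' \<tau>'"
    using has_coequalisers_Graph[OF coequalisers] m translate_graph unfolding has_coequalisers_def by blast
  from GF.coequaliser_exists[OF this] show ?thesis
    unfolding standard_graph_def standard_proj_def standard_def gog_pullback(3) by (simp add: Let_def)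
qed

text \<open>The map \<open>(p, y) \<mapsto> \<phi>(p) s(y)\<close> coequalises the pair that defines
  \<open>T\<close>, which makes the \<open>cofactor\<close> in the definition of
  \<open>\<Phi>\<close> meaningful.\<close>

lemma canonical_map_props: "\<Phi> \<in> Hom (Graph C) T X"
  "\<Phi> \<cdot>\<^bsub>Graph C\<^esub> \<tau> = a \<cdot>\<^bsub>Graph C\<^esub> (times_map C (gob G) Q (gob G) X (Id C (gob G)) s \<cdot>\<^bsub>Graph C\<^esub>
      times_map C (gob \<pi>) Q (gob G) Q \<phi> (Id (Graph C) Q))" (is "_ = ?k")
proof -
  interpret GF: Fin_Lim "Graph C" by (rule Fin_Lim_Graph)
  have k: "?k \<in> Hom (Graph C) (times_graph C (gob \<pi>) Q) X"
    using GF.comp_in[OF a_graph GF.comp_in[OF times_map_in[OF Id_in[OF group_object_hom(1)[OF G]] s_graph(1)]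
        times_map_in[OF Grp_homD(3)[OF phi_hom] GF.Id_in[OF Q_Obj]]]] .
  have "?k \<cdot>\<^bsub>Graph C\<^esub> times_map C (gob \<pi>) \<Gamma> (gob \<pi>) Q (Id C (gob \<pi>)) \<gamma> = ?k \<cdot>\<^bsub>Graph C\<^esub> translate"
  proof (rule component_eqI)
    fix ob :: "('o, 'a) graph \<Rightarrow> 'o" and ar :: "'a \<times> 'a \<Rightarrow> 'a" assume c: "component ob ar"
    show "ar (?k \<cdot>\<^bsub>Graph C\<^esub> times_map C (gob \<pi>) \<Gamma> (gob \<pi>) Q (Id C (gob \<pi>)) \<gamma>) = ar (?k \<cdot>\<^bsub>Graph C\<^esub> translate)"
      unfolding component_simps(1)[OF c, where g = ?k] ar_orbit_map[OF c] using orbit_map_coequalises[OF c] .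
  qed
  from GF.cofactor_is_coequaliser[OF standard_coequaliser k this]
  show "\<Phi> \<in> Hom (Graph C) T X" "\<Phi> \<cdot>\<^bsub>Graph C\<^esub> \<tau> = ?k"
    unfolding canonical_map_def Let_def by auto
qed

text \<open>Quotients, coequalisers and stabilisers of graphs are componentwise, so edges and
  vertices each satisfy the assumptions for a single object.\<close>

lemma level:
  assumes c: "component ob ar"
  shows "level C G \<pi> \<phi> (ob X) (ob Q) (ob \<Gamma>) (ob T) (ar a) (ar q) (ar s) (ar j) (ar \<gamma>) (ar \<eta>) (ar \<tau>) (ar \<Phi>)"
proof (intro level.intro level_axioms.intro)
  show "Bass_Serre_Cat C" ..
  note cs = component_simps[OF c] and arr = ar_arrows[OF c]
  show "group_object C G" "group_object C \<pi>" "\<phi> \<in> Hom (Grp C) \<pi> G" "left_action C G (ob X) (ar a)"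
    using G pi_group phi_hom action_component[OF c] by auto
  show "is_coequaliser C (Prod C (gob G) (ob X)) (ob X) (ar a) (pr2 C (gob G) (ob X)) (ob Q) (ar q)"
    using component_coequaliser[OF c Cat_C coequalisers quotient_coequaliser] by (simp add: cs)
  show "ar s \<in> Hom C (ob Q) (ob X)" "ar \<gamma> \<in> Hom C (ob \<Gamma>) (ob Q)" "ar j \<in> Hom C (ob \<Gamma>) (gob G)"
    "ar \<eta> \<in> Hom C (ob \<Gamma>) (gob \<pi>)" using arr by auto
  show "ar q \<cdot> ar s = Id C (ob Q)" using arg_cong[OF s_graph(2), of ar] by (simp only: cs)
  show "ar a \<cdot> pair C (ob \<Gamma>) (gob G) (ob X) (ar j) (ar s \<cdot> ar \<gamma>) = ar s \<cdot> ar \<gamma>" using stab_component[OF c] .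
  show "\<phi> \<cdot> ar \<eta> = ar j" using phi_eta[OF c] .
  show "ar \<Phi> \<in> Hom C (ob T) (ob X)" using component_hom[OF c canonical_map_props(1)] .
  show "ar \<Phi> \<cdot> ar \<tau> = ar a \<cdot> pair C (Prod C (gob \<pi>) (ob Q)) (gob G) (ob X) (\<phi> \<cdot> pr1 C (gob \<pi>) (ob Q)) (ar s \<cdot> pr2 C (gob \<pi>) (ob Q))"
    using arg_cong[OF canonical_map_props(2), of ar] unfolding ar_orbit_map[OF c] component_simps(1)[OF c, where g = \<Phi>] .
  show "is_coequaliser C (Prod C (gob \<pi>) (ob \<Gamma>)) (Prod C (gob \<pi>) (ob Q))
      (pair C (Prod C (gob \<pi>) (ob \<Gamma>)) (gob \<pi>) (ob Q) (pr1 C (gob \<pi>) (ob \<Gamma>)) (ar \<gamma> \<cdot> pr2 C (gob \<pi>) (ob \<Gamma>)))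
      (pair C (Prod C (gob \<pi>) (ob \<Gamma>)) (gob \<pi>) (ob Q)
        (gop C (Prod C (gob \<pi>) (ob \<Gamma>)) \<pi> (pr1 C (gob \<pi>) (ob \<Gamma>)) (ar \<eta> \<cdot> pr2 C (gob \<pi>) (ob \<Gamma>)))
        (ar \<gamma> \<cdot> pr2 C (gob \<pi>) (ob \<Gamma>))) (ob T) (ar \<tau>)"
    using component_coequaliser[OF c Cat_C coequalisers standard_coequaliser]
    unfolding ar_translate[OF c] ar_projection[OF c] component_simps(5)[OF c] .
  fix Z
  show "\<exists>u\<in>Hom C Z (ob \<Gamma>). ar j \<cdot> u = g \<and> ar \<gamma> \<cdot> u = y"
    if "g \<in> Hom C Z (gob G)" "y \<in> Hom C Z (ob Q)" "ar a \<cdot> pair C Z (gob G) (ob X) g (ar s \<cdot> y) = ar s \<cdot> y" for g y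
    using stab_component_ex[OF c that] .
  show "u = v" if "u \<in> Hom C Z (ob \<Gamma>)" "v \<in> Hom C Z (ob \<Gamma>)" "ar j \<cdot> u = ar j \<cdot> v" "ar \<gamma> \<cdot> u = ar \<gamma> \<cdot> v" for u v
    using stab_component_ext[OF c that] .
qed

lemma graph_level: "graph_level C G \<pi> \<phi> X Q \<Gamma> T a q s j \<gamma> \<eta> \<tau> \<Phi> \<G>"
proof (intro graph_level.intro graph_level_axioms.intro)
  interpret GF: Fin_Lim "Graph C" by (rule Fin_Lim_Graph)
  show "level C G \<pi> \<phi> (edges X) (edges Q) (edges \<Gamma>) (edges T) (fst a) (fst q) (fst s) (fst j) (fst \<gamma>) (fst \<eta>) (fst \<tau>) (fst \<Phi>)"
    "level C G \<pi> \<phi> (verts X) (verts Q) (verts \<Gamma>) (verts T) (snd a) (snd q) (snd s) (snd j) (snd \<gamma>) (snd \<eta>) (snd \<tau>) (snd \<Phi>)"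
    by (rule level; simp add: component_def)+
  show "\<tau> \<in> Hom (Graph C) (times_graph C (gob \<pi>) Q) T" using is_coequaliser_hom(3)[OF standard_coequaliser] .
  show "universal_vert_hom C Q \<G> \<pi> (snd \<eta>)" using pi1_props(7) .
qed (use action q_graph s_graph canonical_map_props gog_pullback connected in auto)

end

lemma (in Fin_Lim) is_iso_Grp:
  assumes f: "f \<in> Hom (Grp C) K L" and iso: "is_iso C (gob K) (gob L) f"
  shows "is_iso (Grp C) K L f"
proof -
  obtain g where g: "g \<in> Hom C (gob L) (gob K)" "g \<cdot> f = Id C (gob K)" "f \<cdot> g = Id C (gob L)"
    using iso unfolding is_iso_def by blast
  note h = Grp_homD[OF f]
  have "g \<in> Hom (Grp C) L K"
  proof (rule Grp_homI[OF h(2,1) g(1)])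
    fix Z x y assume x: "x \<in> Hom C Z (gob L)" "y \<in> Hom C Z (gob L)"
    have gx: "g \<cdot> x \<in> Hom C Z (gob K)" "g \<cdot> y \<in> Hom C Z (gob K)" using g x by auto
    have "f \<cdot> (g \<cdot> x) = x" "f \<cdot> (g \<cdot> y) = y"
      using comp_reduce[OF g(3,1) h(3) x(1)] comp_reduce[OF g(3,1) h(3) x(2)] x by simp_all
    then have "gop C Z L x y = f \<cdot> gop C Z K (g \<cdot> x) (g \<cdot> y)" using Grp_hom_gop[OF f gx] by simp
    then show "g \<cdot> gop C Z L x y = gop C Z K (g \<cdot> x) (g \<cdot> y)"
      using comp_reduce[OF g(2) h(3) g(1) gop_in[OF h(1) gx]] gop_in[OF h(1) gx] by simp
  qed
  then show ?thesis unfolding is_iso_def using f g by auto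
qed

theorem theorem5p2:
  fixes C :: "('o, 'a) cat" and G :: "('o, 'a) grp" and X :: "('o, 'a) graph"
    and a s :: "'a \<times> 'a"
  assumes "Bass_Serre C"
    and "G \<in> Obj (Grp C)"
    and "X \<in> Obj (Graph C)"
    and "graph_action C G X a"
    and "connected C X"
    and "is_section (Graph C) X (quotient_graph C G X a) (quotient_map C G X a) s"
  shows "let Q = quotient_graph C G X a;
             \<G> = action_gog C G X a s;
             \<pi> = pi1 C Q \<G>;
             T = standard_graph C Q \<G>;
             \<phi> = canonical_hom C G X a s;
             \<Phi> = canonical_map C G X a s
         in ((\<exists>\<sigma>. is_section (Graph C) T X \<Phi> \<sigma>) \<longleftrightarrow> is_iso (Graph C) T X \<Phi>) \<and>
            (is_iso (Graph C) T X \<Phi> \<longleftrightarrow> is_iso C (gob \<pi>) (gob G) \<phi>) \<and>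
            (is_iso C (gob \<pi>) (gob G) \<phi> \<longrightarrow> is_iso (Grp C) \<pi> G \<phi>)"
proof -
  interpret Bass_Serre_Cat C by unfold_locales (rule assms(1))
  interpret A: action_setup C G X a s by unfold_locales (use assms in auto)
  interpret L: graph_level C G A.\<pi> A.\<phi> X A.Q A.\<Gamma> A.T a A.q s A.j A.\<gamma> A.\<eta> A.\<tau> A.\<Phi> A.\<G>
    by (rule A.graph_level)
  \<comment> \<open>The implications run in a cycle, from (ii) to (i), from (i) to (iii) and from
    (iii) to (ii); invertibility in \<open>Grp C\<close> comes last.\<close>
  have "\<exists>\<sigma>. is_section (Graph C) A.T X A.\<Phi> \<sigma>" if "is_iso (Graph C) A.T X A.\<Phi>"
    using that unfolding is_iso_def is_section_def by blast
  moreover have "is_iso C (gob A.\<pi>) (gob G) A.\<phi>" if "\<exists>\<sigma>. is_section (Graph C) A.T X A.\<Phi> \<sigma>"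
    using that L.iso_phi by blast
  moreover have "is_iso (Graph C) A.T X A.\<Phi>" if "is_iso C (gob A.\<pi>) (gob G) A.\<phi>"
    using that by (rule L.iso_Phi)
  moreover have "is_iso (Grp C) A.\<pi> G A.\<phi>" if "is_iso C (gob A.\<pi>) (gob G) A.\<phi>"
    using that by (rule is_iso_Grp[OF A.phi_hom])
  ultimately show ?thesis unfolding Let_def by blast
qed

end
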